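(* Let $\Omega^\epsilon$ ($0<\epsilon<\epsilon_0$) be the oscillating domains built from $\alpha>1$, $b$ and $G$ as described in the context. Assume that $f^\epsilon\in L^2(\Omega^\epsilon)$ satisfies $\|f^\epsilon\|_{L^2(\Omega^\epsilon)}\le C$ for some constant $C>0$ independent of $\epsilon$, and that the function $\hat f^\epsilon(x)=\int_{-b(x)}^{G_\epsilon(x)} f^\epsilon(x,y)\,dy$, $x\in(0,1)$, satisfies $\hat f^\epsilon\rightharpoonup \hat f$ weakly in $L^2(0,1)$ as $\epsilon\to0$, for some $\hat f\in L^2(0,1)$. Let $u^\epsilon\in H^1(\Omega^\epsilon)$ be the unique (weak) solution of $$ \begin{cases} -\dfrac{\partial^2 u^\epsilon}{\partial x_1^2}-\dfrac1{\epsilon^2}\dfrac{\partial^2 u^\epsilon}{\partial x_2^2}+u^\epsilon=f^\epsilon & \text{in }\Omega^\epsilon,\\[2mm] \dfrac{\partial u^\epsilon}{\partial x_1}\nu_1^\epsilon+\dfrac1{\epsilon^2}\dfrac{\partial u^\epsilon}{\partial x_2}\nu_2^\epsilon=0 & \text{on }\partial\Omega^\epsilon, \end{cases} $$ and let $G_0(x)=\min_{y\in\mathbb R}G(x,y)\ge 0$. Let $$ p(x)=\frac1{l(x)}\int_0^{l(x)}\big(b(x)+G(x,y)\big)\,dy=b(x)+\frac1{l(x)}\int_0^{l(x)}G(x,y)\,dy,\qquad x\in(0,1). $$ If $u_0=u_0(x_1)\in H^1(0,1)$ is the unique weak solution of the Neumann problem $$ \int_0^1\Big\{\big(b(x)+G_0(x)\big)\,u_x(x)\,\varphi_x(x)+p(x)\,u(x)\,\varphi(x)\Big\}\,dx=\int_0^1\hat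 f(x)\,\varphi(x)\,dx\qquad\forall\varphi\in H^1(0,1), $$ then $$ \|u^\epsilon-u_0\|_{L^2(\Omega^\epsilon)}\to0\quad\text{as }\epsilon\to0 . $$ Moreover, if $\Omega_0=\{(x_1,x_2)\in\mathbb R^2 : x_1\in(0,1),\ -b(x_1)<x_2<G_0(x_1)\}\subset\Omega^\epsilon$, then $u^\epsilon\to u_0$ strongly in $H^1(\Omega_0)$ as $\epsilon\to0$.
   Context: Setting. Fix $\alpha>1$ and $\epsilon_0>0$. Hypothesis on $b$: $b:(0,1)\to(0,\infty)$ is piecewise $C^1$ and there are constants $b_0,b_1$ with $0<b_0\le b(x)\le b_1$ for all $x\in(0,1)$. Hypothesis on $G$: $G:[0,1]\times\mathbb R\to[0,+\infty)$ is continuous in $x$, uniformly in the second variable $y$ (for each $\eta>0$ there is $\delta>0$ such that $|G(x,y)-G(x',y)|\le\eta$ for all $x,x'\in[0,1]$ with $|x-x'|<\delta$ and all $y\in\mathbb R$). Moreover $G$ is periodic in $y$ with a period $l(x)$ that may depend on $x$: $G(x,y+l(x))=G(x,y)$, where $l$ is continuous on $[0,1]$ and $0<L'\le l(x)\le L$ for all $x\in[0,1]$, with $L',L$ constants. For $\epsilon\in(0,\epsilon_0)$ put $G_\epsilon(x)=G(x,x/\epsilon^\alpha)$, and $$\Omega^\epsilon=\{(x_1,x_2)\in\mathbb R^2 : x_1\in(0,1),\ -b(x_1)<x_2<G_\epsilon(x_1)\}.$$ It is part of the setting that $\Omega^\epsilon$ is a domain (in particular an open set) and that the minimum defining $G_0$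 exists. $\nu^\epsilon=(\nu_1^\epsilon,\nu_2^\epsilon)$ is the outward unit normal to $\partial\Omega^\epsilon$. The boundary value problem is understood in the weak sense: $u^\epsilon\in H^1(\Omega^\epsilon)$ and $$\int_{\Omega^\epsilon}\Big\{\frac{\partial u^\epsilon}{\partial x_1}\frac{\partial\varphi}{\partial x_1}+\frac1{\epsilon^2}\frac{\partial u^\epsilon}{\partial x_2}\frac{\partial\varphi}{\partial x_2}+u^\epsilon\varphi\Big\}dx_1dx_2=\int_{\Omega^\epsilon}f^\epsilon\varphi\,dx_1dx_2\quad\forall\varphi\in H^1(\Omega^\epsilon).$$ A function of $x_1$ alone, such as $u_0$, is regarded as a function on $\Omega^\epsilon$ or $\Omega_0$ that is constant in $x_2$.
   Formalization: The function G is additionally assumed to be bounded on [0,1] × ℝ; without this the claim fails, for example for G(x,y)=g(y) periodic with thin spikes of unbounded height and finite mean. *)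

theory Defs
  imports "HOL-Analysis.Analysis"
begin

section \<open>Sobolev spaces on subsets of a Euclidean space\<close>

text \<open>
  Functions on \<open>S\<close> are total functions whose values outside \<open>S\<close> are irrelevant; elements of
  \<open>L\<^sup>2(S)\<close> are represented by arbitrary Lebesgue measurable representatives.
\<close>

definition Lsq :: "'a::euclidean_space set \<Rightarrow> ('a \<Rightarrow> real) set" where
  "Lsq S = {f. f \<in> borel_measurable (lebesgue_on S) \<and> integrable (lebesgue_on S) (\<lambda>x. (f x)\<^sup>2)}"

definition Lsq_norm :: "'a::euclidean_space set \<Rightarrow> ('a \<Rightarrow> real) \<Rightarrow> real" where
  "Lsq_norm S f = sqrt (\<integral>x. (f x)\<^sup>2 \<partial>(lebesgue_on S))"

definition Lsq_weak_tendsto ::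
  "'a::euclidean_space set \<Rightarrow> ('i \<Rightarrow> 'a \<Rightarrow> real) \<Rightarrow> ('a \<Rightarrow> real) \<Rightarrow> 'i filter \<Rightarrow> bool" where
  "Lsq_weak_tendsto S f g F \<longleftrightarrow>
     (\<forall>\<^sub>F i in F. f i \<in> Lsq S) \<and> g \<in> Lsq S \<and>
     (\<forall>\<psi>\<in>Lsq S. ((\<lambda>i. \<integral>x. f i x * \<psi> x \<partial>(lebesgue_on S)) \<longlongrightarrow> (\<integral>x. g x * \<psi> x \<partial>(lebesgue_on S))) F)"

primrec Ck :: "nat \<Rightarrow> ('a::euclidean_space \<Rightarrow> real) \<Rightarrow> bool" where
  "Ck 0 f \<longleftrightarrow> continuous_on UNIV f"
| "Ck (Suc k) f \<longleftrightarrow> f differentiable_on UNIV \<and>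
     (\<forall>i\<in>Basis. Ck k (\<lambda>x. frechet_derivative f (at x) i))"

definition test_functions :: "'a::euclidean_space set \<Rightarrow> ('a \<Rightarrow> real) set" where
  "test_functions S = {\<phi>. (\<forall>k. Ck k \<phi>) \<and> compact (closure {x. \<phi> x \<noteq> 0}) \<and> closure {x. \<phi> x \<noteq> 0} \<subseteq> S}"

definition has_weak_partial ::
  "'a::euclidean_space set \<Rightarrow> 'a \<Rightarrow> ('a \<Rightarrow> real) \<Rightarrow> ('a \<Rightarrow> real) \<Rightarrow> bool" where
  "has_weak_partial S i u g \<longleftrightarrow>
     (\<forall>\<phi>\<in>test_functions S.
        (\<integral>x. u x * frechet_derivative \<phi> (at x) i \<partial>(lebesgue_on S)) = - (\<integral>x. g x * \<phi> x \<partial>(lebesgue_on S)))"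

definition H1 :: "'a::euclidean_space set \<Rightarrow> ('a \<Rightarrow> real) set" where
  "H1 S = {u. u \<in> Lsq S \<and> (\<forall>i\<in>Basis. \<exists>g\<in>Lsq S. has_weak_partial S i u g)}"

text \<open>
  For open \<open>S\<close> and \<open>u\<close> in \<open>H\<^sup>1(S)\<close> the weak derivative is unique only almost everywhere; the choice
  below fixes one representative. For \<open>u\<close> outside \<open>H\<^sup>1(S)\<close> the value is meaningless.
\<close>

definition weak_partial :: "'a::euclidean_space set \<Rightarrow> 'a \<Rightarrow> ('a \<Rightarrow> real) \<Rightarrow> 'a \<Rightarrow> real" where
  "weak_partial S i u = (SOME g. g \<in> Lsq S \<and> has_weak_partial S i u g)"

definition H1_norm :: "'a::euclidean_space set \<Rightarrow> ('a \<Rightarrow> real) \<Rightarrow> real" where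
  "H1_norm S u = sqrt ((Lsq_norm S u)\<^sup>2 + (\<Sum>i\<in>Basis. (Lsq_norm S (weak_partial S i u))\<^sup>2))"

definition H1_tendsto ::
  "'a::euclidean_space set \<Rightarrow> ('i \<Rightarrow> 'a \<Rightarrow> real) \<Rightarrow> ('a \<Rightarrow> real) \<Rightarrow> 'i filter \<Rightarrow> bool" where
  "H1_tendsto S u v F \<longleftrightarrow>
     (\<forall>\<^sub>F i in F. u i \<in> H1 S) \<and> v \<in> H1 S \<and> ((\<lambda>i. H1_norm S (\<lambda>x. u i x - v x)) \<longlongrightarrow> 0) F"


section \<open>The oscillating domains and the boundary value problems\<close>

text \<open>
  Piecewise \<open>C\<^sup>1\<close> on \<open>(0,1)\<close> is understood in the weakest sense: jumps are allowed at the finitely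
  many break points, unlike in the library's \<open>piecewise_C1_differentiable_on\<close>.
\<close>

definition pw_C1 :: "(real \<Rightarrow> real) \<Rightarrow> bool" where
  "pw_C1 b \<longleftrightarrow> (\<exists>S. finite S \<and> b C1_differentiable_on ({0<..<1} - S))"

definition G_eps :: "(real \<Rightarrow> real \<Rightarrow> real) \<Rightarrow> real \<Rightarrow> real \<Rightarrow> real \<Rightarrow> real" where
  "G_eps G \<alpha> \<epsilon> x = G x (x / \<epsilon> powr \<alpha>)"

definition G_min :: "(real \<Rightarrow> real \<Rightarrow> real) \<Rightarrow> real \<Rightarrow> real" where
  "G_min G x = (LEAST m. m \<in> range (G x))"

definition region :: "(real \<Rightarrow> real) \<Rightarrow> (real \<Rightarrow> real) \<Rightarrow> (real \<times> real) set" where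
  "region b g = {(x1, x2). 0 < x1 \<and> x1 < 1 \<and> - b x1 < x2 \<and> x2 < g x1}"

definition vertical_integral ::
  "(real \<Rightarrow> real) \<Rightarrow> (real \<Rightarrow> real) \<Rightarrow> (real \<times> real \<Rightarrow> real) \<Rightarrow> real \<Rightarrow> real" where
  "vertical_integral b g f x = (\<integral>y. f (x, y) \<partial>(lebesgue_on {- b x..g x}))"

definition mean_height ::
  "(real \<Rightarrow> real) \<Rightarrow> (real \<Rightarrow> real \<Rightarrow> real) \<Rightarrow> (real \<Rightarrow> real) \<Rightarrow> real \<Rightarrow> real" where
  "mean_height b G l x = 1 / l x * (\<integral>y. b x + G x y \<partial>(lebesgue_on {0..l x}))"

definition weak_solution_eps ::
  "real \<Rightarrow> (real \<times> real) set \<Rightarrow> (real \<times> real \<Rightarrow> real) \<Rightarrow> (real \<times> real \<Rightarrow> real) \<Rightarrow> bool" where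
  "weak_solution_eps \<epsilon> S f u \<longleftrightarrow> u \<in> H1 S \<and>
     (\<forall>\<phi>\<in>H1 S.
        (\<integral>z. weak_partial S (1, 0) u z * weak_partial S (1, 0) \<phi> z
            + 1 / \<epsilon>\<^sup>2 * (weak_partial S (0, 1) u z * weak_partial S (0, 1) \<phi> z)
            + u z * \<phi> z \<partial>(lebesgue_on S))
        = (\<integral>z. f z * \<phi> z \<partial>(lebesgue_on S)))"

definition weak_solution_limit ::
  "(real \<Rightarrow> real) \<Rightarrow> (real \<Rightarrow> real) \<Rightarrow> (real \<Rightarrow> real) \<Rightarrow> (real \<Rightarrow> real) \<Rightarrow> bool" where
  "weak_solution_limit a p h u \<longleftrightarrow> u \<in> H1 {0<..<1} \<and>
     (\<forall>\<phi>\<in>H1 {0<..<1}.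
        (\<integral>x. a x * weak_partial {0<..<1} 1 u x * weak_partial {0<..<1} 1 \<phi> x
            + p x * u x * \<phi> x \<partial>(lebesgue_on {0<..<1}))
        = (\<integral>x. h x * \<phi> x \<partial>(lebesgue_on {0<..<1})))"

end

theory Submission
  imports Defs
begin

text \<open>The solutions \<open>u\<^sup>\<epsilon>\<close> are compared with recovery functions \<open>w\<^sup>\<epsilon>\<close> that agree with a smooth
  approximation of \<open>u\<^sub>0\<close> below the graph of \<open>G\<^sub>0\<close> and with a step function, constant in each finger of the
  oscillating boundary, above it. Since the fingers have width \<open>O(\<epsilon>\<^sup>\<alpha>)\<close> with \<open>\<alpha> > 1\<close>, the transition is
  cheap in spite of the factor \<open>1/\<epsilon>\<^sup>2\<close> in the energy. The equation is tested with \<open>v = u\<^sup>\<epsilon> - w\<^sup>\<epsilon>\<close>. As the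
  vertical derivative of \<open>v\<close> is \<open>O(\<epsilon>)\<close>, a Poincare inequality replaces \<open>v\<close>, up to \<open>O(\<epsilon>)\<close>, by its average
  \<open>V(x\<^sub>1)\<close> over vertical segments in a strip common to all domains, and \<open>V\<close> stays bounded in \<open>H\<^sup>1(0,1)\<close>.
  The weak convergence of the vertical integrals of \<open>f\<^sup>\<epsilon>\<close> and of \<open>G\<^sub>\<epsilon>\<close> is uniform on bounded subsets of
  \<open>H\<^sup>1(0,1)\<close>, so the limit problem tested with \<open>V\<close> shows that the energy of \<open>v\<close> tends to \<open>0\<close>.\<close>

section \<open>Square-integrable functions\<close>

text \<open>The obstacle is the lack of uniform regularity: the lower and the upper boundary may
  jump, so extension operators, traces and a compact embedding on the oscillating domains are not at
  hand. What is uniform is the strip of depth \<open>b\<^sub>0\<close> below the axis, the bound on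
  the height, and the fact that vertical slices are intervals. Pointwise bounds are therefore drawn
  from test integrals by duality, and the measurability of the boundary functions is drawn from the
  openness of the domains. The delicate term is the horizontal derivative. Replacing v by V is
  harmless in L2, but the derivative of v need not be close to that of V in norm. On the limit
  domain the derivative of the limit is therefore approximated by a test function, and the
  derivative is moved from v - V onto it; the resulting constant depends on the approximation but
  not on \<epsilon>. In the fingers the recovery function has no horizontal derivative, so they
  contribute nothing to the diffusion. This is why the limit diffusion sees the height up to
  \<open>G0\<close> only, whereas the zero order term sees the mean height.\<close>

lemma LsqD:
  assumes "f \<in> Lsq S"
  shows "f \<in> borel_measurable (lebesgue_on S)" "integrable (lebesgue_on S) (\<lambda>x. (f x)\<^sup>2)"
  using assms by (auto simp: Lsq_def)

lemma Lsq_integrable_mult: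
  assumes "f \<in> Lsq S" "g \<in> Lsq S"
  shows "integrable (lebesgue_on S) (\<lambda>x. f x * g x)"
proof (rule Bochner_Integration.integrable_bound)
  show "integrable (lebesgue_on S) (\<lambda>x. (f x)\<^sup>2 + (g x)\<^sup>2)"
    using assms by (intro Bochner_Integration.integrable_add LsqD(2))
  show "(\<lambda>x. f x * g x) \<in> borel_measurable (lebesgue_on S)"
    using assms by (intro borel_measurable_times LsqD(1))
  have "\<bar>a * b\<bar> \<le> a\<^sup>2 + b\<^sup>2" for a b :: real
  proof -
    have "0 \<le> (\<bar>a\<bar> - \<bar>b\<bar>)\<^sup>2" by simp
    then have "2 * (\<bar>a\<bar> * \<bar>b\<bar>) \<le> a\<^sup>2 + b\<^sup>2" by (simp add: power2_eq_square algebra_simps)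
    moreover have "0 \<le> \<bar>a\<bar> * \<bar>b\<bar>" by simp
    ultimately show ?thesis by (simp only: abs_mult)
  qed
  from order_trans[OF this abs_ge_self]
  show "AE x in lebesgue_on S. norm (f x * g x) \<le> norm ((f x)\<^sup>2 + (g x)\<^sup>2)"
    by (intro AE_I2) (simp only: real_norm_def)
qed

lemma Lsq_cmult [intro]: "f \<in> Lsq S \<Longrightarrow> (\<lambda>x. c * f x) \<in> Lsq S"
  by (auto simp: Lsq_def power_mult_distrib)

lemma Lsq_add [intro]:
  assumes "f \<in> Lsq S" "g \<in> Lsq S"
  shows "(\<lambda>x. f x + g x) \<in> Lsq S"
proof -
  have "integrable (lebesgue_on S) (\<lambda>x. (f x)\<^sup>2 + 2 * (f x * g x) + (g x)\<^sup>2)"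
    using assms Lsq_integrable_mult[OF assms]
    by (intro Bochner_Integration.integrable_add integrable_mult_right LsqD(2))
  then show ?thesis
    using assms by (auto simp: Lsq_def power2_eq_square algebra_simps)
qed

lemma Lsq_minus [intro]: "f \<in> Lsq S \<Longrightarrow> (\<lambda>x. - f x) \<in> Lsq S"
  by (auto simp: Lsq_def)

lemma Lsq_diff [intro]: "f \<in> Lsq S \<Longrightarrow> g \<in> Lsq S \<Longrightarrow> (\<lambda>x. f x - g x) \<in> Lsq S"
  using Lsq_add[of f S "\<lambda>x. - g x"] by auto

lemma Lsq_abs [intro]: "f \<in> Lsq S \<Longrightarrow> (\<lambda>x. \<bar>f x\<bar>) \<in> Lsq S"
  by (auto simp: Lsq_def)

lemma Lsq_norm_nonneg [simp]: "0 \<le> Lsq_norm S f"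
  by (simp add: Lsq_norm_def)

lemma Lsq_norm_power2: "(Lsq_norm S f)\<^sup>2 = (\<integral>x. (f x)\<^sup>2 \<partial>lebesgue_on S)"
  by (simp add: Lsq_norm_def)

lemma Lsq_norm_abs [simp]: "Lsq_norm S (\<lambda>x. \<bar>f x\<bar>) = Lsq_norm S f"
  by (simp add: Lsq_norm_def)

lemma Lsq_norm_minus [simp]: "Lsq_norm S (\<lambda>x. - f x) = Lsq_norm S f"
  by (simp add: Lsq_norm_def)

lemma Lsq_norm_cmult: "Lsq_norm S (\<lambda>x. c * f x) = \<bar>c\<bar> * Lsq_norm S f"
  by (simp add: Lsq_norm_def power_mult_distrib real_sqrt_mult)

lemma Lsq_Cauchy_Schwarz:
  assumes f: "f \<in> Lsq S" and g: "g \<in> Lsq S"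
  shows "\<bar>\<integral>x. f x * g x \<partial>lebesgue_on S\<bar> \<le> Lsq_norm S f * Lsq_norm S g"
proof -
  define a b c where "a = (\<integral>x. (f x)\<^sup>2 \<partial>lebesgue_on S)" and "b = (\<integral>x. f x * g x \<partial>lebesgue_on S)"
    and "c = (\<integral>x. (g x)\<^sup>2 \<partial>lebesgue_on S)"
  have *: "0 \<le> s\<^sup>2 * a + 2 * (s * t) * b + t\<^sup>2 * c" for s t
  proof -
    have "(\<integral>x. (s * f x + t * g x)\<^sup>2 \<partial>lebesgue_on S)
        = (\<integral>x. s\<^sup>2 * (f x)\<^sup>2 + 2 * (s * t) * (f x * g x) + t\<^sup>2 * (g x)\<^sup>2 \<partial>lebesgue_on S)"
      by (simp add: power2_eq_square algebra_simps)
    also have "\<dots> = s\<^sup>2 * a + 2 * (s * t) * b + t\<^sup>2 * c"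
      using LsqD(2)[OF f] LsqD(2)[OF g] Lsq_integrable_mult[OF f g]
      by (simp add: a_def b_def c_def)
    finally have "(\<integral>x. (s * f x + t * g x)\<^sup>2 \<partial>lebesgue_on S) = s\<^sup>2 * a + 2 * (s * t) * b + t\<^sup>2 * c" .
    moreover have "0 \<le> (\<integral>x. (s * f x + t * g x)\<^sup>2 \<partial>lebesgue_on S)"
      by (intro integral_nonneg_AE AE_I2) simp
    ultimately show ?thesis by simp
  qed
  have nn: "0 \<le> a" "0 \<le> c" by (auto simp: a_def c_def)
  have "b\<^sup>2 \<le> a * c"
  proof (cases "c = 0")
    case True
    have "b = 0"
    proof (rule ccontr)
      assume "b \<noteq> 0"
      \<comment> \<open>With c = 0 the form is affine in t, and this t gives it the value
        -1.\<close>
      then have "0 \<le> a + 2 * (- (a + 1) / (2 * b)) * b"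
        using *[of 1 "- (a + 1) / (2 * b)"] True by simp
      also have "a + 2 * (- (a + 1) / (2 * b)) * b = -1"
        using \<open>b \<noteq> 0\<close> by (simp add: field_simps)
      finally show False by simp
    qed
    then show ?thesis using True by simp
  next
    case False
    have "0 \<le> c * (a * c - b\<^sup>2)"
      using *[of c "- b"] by (simp add: power2_eq_square algebra_simps)
    then show ?thesis using False nn by (simp add: zero_le_mult_iff)
  qed
  then have "sqrt (b\<^sup>2) \<le> sqrt (a * c)" by (rule real_sqrt_le_mono)
  then show ?thesis by (simp add: Lsq_norm_def real_sqrt_mult a_def b_def c_def)
qed

lemma Lsq_norm_triangle:
  assumes f: "f \<in> Lsq S" and g: "g \<in> Lsq S"
  shows "Lsq_norm S (\<lambda>x. f x + g x) \<le> Lsq_norm S f + Lsq_norm S g"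
proof (rule power2_le_imp_le)
  have "(Lsq_norm S (\<lambda>x. f x + g x))\<^sup>2 = (\<integral>x. (f x)\<^sup>2 + 2 * (f x * g x) + (g x)\<^sup>2 \<partial>lebesgue_on S)"
    unfolding Lsq_norm_power2 by (simp add: power2_eq_square algebra_simps)
  also have "\<dots> = (Lsq_norm S f)\<^sup>2 + 2 * (\<integral>x. f x * g x \<partial>lebesgue_on S) + (Lsq_norm S g)\<^sup>2"
    using LsqD(2)[OF f] LsqD(2)[OF g] Lsq_integrable_mult[OF f g]
    by (simp add: Lsq_norm_power2)
  also have "\<dots> \<le> (Lsq_norm S f)\<^sup>2 + 2 * (Lsq_norm S f * Lsq_norm S g) + (Lsq_norm S g)\<^sup>2"
    using Lsq_Cauchy_Schwarz[OF f g] by linarith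
  also have "\<dots> = (Lsq_norm S f + Lsq_norm S g)\<^sup>2"
    by (simp add: power2_eq_square algebra_simps)
  finally show "(Lsq_norm S (\<lambda>x. f x + g x))\<^sup>2 \<le> (Lsq_norm S f + Lsq_norm S g)\<^sup>2" .
qed simp

lemma Lsq_norm_triangle_diff:
  assumes "f \<in> Lsq S" "g \<in> Lsq S"
  shows "Lsq_norm S (\<lambda>x. f x - g x) \<le> Lsq_norm S f + Lsq_norm S g"
  using Lsq_norm_triangle[of f S "\<lambda>x. - g x"] assms by auto

lemma Lsq_AE_bound:
  assumes g: "g \<in> Lsq S" and f: "f \<in> borel_measurable (lebesgue_on S)"
    and le: "AE x in lebesgue_on S. \<bar>f x\<bar> \<le> \<bar>g x\<bar>"
  shows "f \<in> Lsq S" "Lsq_norm S f \<le> Lsq_norm S g"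
proof -
  have le2: "AE x in lebesgue_on S. (f x)\<^sup>2 \<le> (g x)\<^sup>2"
    using le by eventually_elim (simp only: abs_le_square_iff)
  have int: "integrable (lebesgue_on S) (\<lambda>x. (f x)\<^sup>2)"
    by (rule Bochner_Integration.integrable_bound[OF LsqD(2)[OF g]]) (use f le2 in auto)
  then show "f \<in> Lsq S" using f by (simp add: Lsq_def)
  show "Lsq_norm S f \<le> Lsq_norm S g"
    unfolding Lsq_norm_def using int LsqD(2)[OF g] le2
    by (intro real_sqrt_le_mono integral_mono_AE) auto
qed

lemma Lsq_norm_cong_AE:
  assumes "f \<in> Lsq S" "g \<in> Lsq S" "AE x in lebesgue_on S. f x = g x"
  shows "Lsq_norm S f = Lsq_norm S g"
  using assms by (intro antisym Lsq_AE_bound(2)) (auto simp: Lsq_def)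

text \<open>No sign is required of \<open>B\<close>, which can be negative when \<open>S\<close> is
  empty; hence \<open>\<bar>B\<bar>\<close> in the bound.\<close>

lemma Lsq_bounded:
  assumes S: "S \<in> lmeasurable" and f: "f \<in> borel_measurable (lebesgue_on S)"
    and B: "\<And>x. x \<in> S \<Longrightarrow> \<bar>f x\<bar> \<le> B"
  shows "f \<in> Lsq S" "Lsq_norm S f \<le> \<bar>B\<bar> * sqrt (measure lebesgue S)"
proof -
  interpret finite_measure "lebesgue_on S" by (rule finite_measure_lebesgue_on[OF S])
  have c: "(\<lambda>x. B) \<in> Lsq S" by (simp add: Lsq_def)
  have le: "AE x in lebesgue_on S. \<bar>f x\<bar> \<le> \<bar>B\<bar>"
    by (intro AE_I2) (use order_trans[OF B abs_ge_self] in simp)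
  show "f \<in> Lsq S" by (rule Lsq_AE_bound(1)[OF c f le])
  have "Lsq_norm S f \<le> Lsq_norm S (\<lambda>x. B)" by (rule Lsq_AE_bound(2)[OF c f le])
  also have "\<dots> = \<bar>B\<bar> * sqrt (measure lebesgue S)"
    using S by (simp add: Lsq_norm_def real_sqrt_mult measure_restrict_space fmeasurableD)
  finally show "Lsq_norm S f \<le> \<bar>B\<bar> * sqrt (measure lebesgue S)" .
qed

lemma Lsq_mult_bounded:
  assumes f: "f \<in> Lsq S" and k: "k \<in> borel_measurable (lebesgue_on S)"
    and B: "\<And>x. x \<in> S \<Longrightarrow> \<bar>k x\<bar> \<le> B"
  shows "(\<lambda>x. k x * f x) \<in> Lsq S" "Lsq_norm S (\<lambda>x. k x * f x) \<le> \<bar>B\<bar> * Lsq_norm S f"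
proof -
  have "\<bar>k x * f x\<bar> \<le> \<bar>\<bar>B\<bar> * f x\<bar>" if "x \<in> S" for x
    unfolding abs_mult abs_abs
    by (rule mult_right_mono[OF order_trans[OF B[OF that] abs_ge_self]]) simp
  then have le: "AE x in lebesgue_on S. \<bar>k x * f x\<bar> \<le> \<bar>\<bar>B\<bar> * f x\<bar>"
    by (intro AE_I2) simp
  have m: "(\<lambda>x. k x * f x) \<in> borel_measurable (lebesgue_on S)"
    using LsqD(1)[OF f] k by (rule borel_measurable_times[rotated])
  show "(\<lambda>x. k x * f x) \<in> Lsq S" by (rule Lsq_AE_bound(1)[OF Lsq_cmult[OF f] m le])
  show "Lsq_norm S (\<lambda>x. k x * f x) \<le> \<bar>B\<bar> * Lsq_norm S f"
    using Lsq_AE_bound(2)[OF Lsq_cmult[OF f] m le] by (simp add: Lsq_norm_cmult)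
qed

lemma Lsq_integrable:
  assumes S: "S \<in> lmeasurable" and f: "f \<in> Lsq S"
  shows "integrable (lebesgue_on S) f" "(\<integral>x. \<bar>f x\<bar> \<partial>lebesgue_on S) \<le> sqrt (measure lebesgue S) * Lsq_norm S f"
proof -
  have c: "(\<lambda>x. 1) \<in> Lsq S" "Lsq_norm S (\<lambda>x. 1) \<le> sqrt (measure lebesgue S)"
    using Lsq_bounded[OF S, of "\<lambda>x. 1" 1] by auto
  show "integrable (lebesgue_on S) f"
    using Lsq_integrable_mult[OF c(1) f] by simp
  have "(\<integral>x. \<bar>f x\<bar> \<partial>lebesgue_on S) \<le> Lsq_norm S (\<lambda>x. 1) * Lsq_norm S f"
    using Lsq_Cauchy_Schwarz[OF c(1) Lsq_abs[OF f]] by simp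
  also have "\<dots> \<le> sqrt (measure lebesgue S) * Lsq_norm S f"
    using c by (intro mult_right_mono) auto
  finally show "(\<integral>x. \<bar>f x\<bar> \<partial>lebesgue_on S) \<le> sqrt (measure lebesgue S) * Lsq_norm S f" .
qed

lemma integrable_lebesgue_on_subset:
  fixes f :: "'a::euclidean_space \<Rightarrow> real"
  assumes f: "integrable (lebesgue_on S) f" and "T \<subseteq> S" "T \<in> sets lebesgue" "S \<in> sets lebesgue"
  shows "integrable (lebesgue_on T) f"
proof -
  have "(\<lambda>x. if x \<in> S then f x else 0) absolutely_integrable_on UNIV"
    using f assms by (simp add: set_integrable_def Lebesgue_Measure.integrable_restrict_UNIV)
  then have "set_integrable lebesgue S f"
    by (simp add: absolutely_integrable_restrict_UNIV)
  then have "set_integrable lebesgue T f"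
    by (rule set_integrable_subset) (use assms in auto)
  then show ?thesis
    by (rule absolutely_integrable_imp_integrable) (use assms in auto)
qed

lemma Lsq_subset:
  assumes f: "f \<in> Lsq S" and T: "T \<subseteq> S" "T \<in> sets lebesgue" "S \<in> sets lebesgue"
  shows "f \<in> Lsq T" "Lsq_norm T f \<le> Lsq_norm S f"
proof -
  show "f \<in> Lsq T"
    using f T integrable_lebesgue_on_subset[OF LsqD(2)[OF f] T]
    by (auto simp: Lsq_def intro: measurable_restrict_mono)
  show "Lsq_norm T f \<le> Lsq_norm S f"
    unfolding Lsq_norm_def
    by (intro real_sqrt_le_mono integral_mono_lebesgue_on_AE LsqD(2)[OF f]) (use T in auto)
qed

lemma continuous_on_imp_measurable_lebesgue_on:
  assumes "continuous_on UNIV (f :: 'a::euclidean_space \<Rightarrow> real)"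
  shows "f \<in> borel_measurable (lebesgue_on S)"
  using borel_measurable_continuous_onI[OF assms]
  by (simp add: measurable_completion measurable_restrict_space1)

lemma borel_imp_measurable_lebesgue_on:
  assumes "(f :: 'a::euclidean_space \<Rightarrow> real) \<in> borel_measurable borel"
  shows "f \<in> borel_measurable (lebesgue_on S)"
  using assms by (simp add: measurable_completion measurable_restrict_space1)

section \<open>Test functions\<close>

lemma has_frechet_derivative_on_UNIV:
  "f differentiable_on UNIV \<Longrightarrow> (f has_derivative frechet_derivative f (at x)) (at x)"
  by (simp add: differentiable_on_def frechet_derivative_works)

lemma Ck_Suc_imp: "Ck (Suc k) f \<Longrightarrow> Ck k f"
proof (induction k arbitrary: f)
  case 0
  then show ?case by (auto intro: differentiable_imp_continuous_on)
next
  case (Suc k)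
  then have "f differentiable_on UNIV" "\<And>i. i \<in> Basis \<Longrightarrow> Ck (Suc k) (\<lambda>x. frechet_derivative f (at x) i)"
    by (subst (asm) Ck.simps(2), blast)+
  then show ?case using Suc.IH by (subst Ck.simps(2)) blast
qed

lemma Ck_SucI:
  assumes "\<And>x. (f has_derivative f' x) (at x)" "\<And>i. i \<in> Basis \<Longrightarrow> Ck k (\<lambda>x. f' x i)"
  shows "Ck (Suc k) f"
proof -
  have "f differentiable_on UNIV" using assms(1) by (auto simp: differentiable_on_def differentiable_def)
  moreover have "frechet_derivative f (at x) = f' x" for x
    using frechet_derivative_at[OF assms(1)] by simp
  ultimately show ?thesis using assms(2) by simp
qed

lemma Ck_SucD:
  assumes "Ck (Suc k) f"
  shows "(f has_derivative frechet_derivative f (at x)) (at x)"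
    "i \<in> Basis \<Longrightarrow> Ck k (\<lambda>x. frechet_derivative f (at x) i)"
  using assms has_frechet_derivative_on_UNIV by auto

lemma Ck_const: "Ck k (\<lambda>x. c)"
proof (induction k arbitrary: c)
  case (Suc k)
  show ?case by (rule Ck_SucI[where f'="\<lambda>x i. 0"]) (auto intro: Suc)
qed simp

lemma Ck_add: "Ck k f \<Longrightarrow> Ck k g \<Longrightarrow> Ck k (\<lambda>x. f x + g x)"
proof (induction k arbitrary: f g)
  case 0 then show ?case by (auto intro: continuous_on_add)
next
  case (Suc k)
  show ?case
    by (rule Ck_SucI[OF has_derivative_add[OF Ck_SucD(1)[OF Suc.prems(1)] Ck_SucD(1)[OF Suc.prems(2)]]])
      (intro Suc.IH Ck_SucD(2)[OF Suc.prems(1)] Ck_SucD(2)[OF Suc.prems(2)])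
qed

lemma Ck_mult: "Ck k f \<Longrightarrow> Ck k g \<Longrightarrow> Ck k (\<lambda>x. f x * g x)"
proof (induction k arbitrary: f g)
  case 0 then show ?case by (auto intro: continuous_on_mult)
next
  case (Suc k)
  show ?case
    by (rule Ck_SucI[OF has_derivative_mult[OF Ck_SucD(1)[OF Suc.prems(1)] Ck_SucD(1)[OF Suc.prems(2)]]])
      (intro Ck_add Suc.IH Ck_SucD(2)[OF Suc.prems(1)] Ck_SucD(2)[OF Suc.prems(2)]
        Ck_Suc_imp[OF Suc.prems(1)] Ck_Suc_imp[OF Suc.prems(2)])
qed

lemma Ck_cmult: "Ck k f \<Longrightarrow> Ck k (\<lambda>x. c * f x)"
  by (intro Ck_mult Ck_const)

lemma Ck_diff: "Ck k f \<Longrightarrow> Ck k g \<Longrightarrow> Ck k (\<lambda>x. f x - g x)"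
  using Ck_add[of k f "\<lambda>x. (-1) * g x"] Ck_cmult[of k g "-1"] by simp

lemma Ck_power: "Ck k f \<Longrightarrow> Ck k (\<lambda>x. f x ^ n)"
  by (induction n) (auto intro: Ck_const Ck_mult)

lemma Ck_prod: "(\<And>i. i \<in> I \<Longrightarrow> Ck k (f i)) \<Longrightarrow> Ck k (\<lambda>x. \<Prod>i\<in>I. f i x)"
  by (induction I rule: infinite_finite_induct) (auto intro: Ck_const Ck_mult)

lemma Ck_real_SucI:
  fixes f :: "real \<Rightarrow> real"
  assumes "\<And>x. (f has_real_derivative f' x) (at x)" "Ck k f'"
  shows "Ck (Suc k) f"
  by (rule Ck_SucI[where f'="\<lambda>x. (*) (f' x)"]) (use assms in \<open>auto simp: has_field_derivative_def\<close>)

lemma Ck_real_SucD: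
  fixes f :: "real \<Rightarrow> real"
  assumes "Ck (Suc k) f"
  shows "(f has_real_derivative frechet_derivative f (at x) 1) (at x)" "Ck k (\<lambda>x. frechet_derivative f (at x) 1)"
proof -
  note d = Ck_SucD(1)[OF assms]
  have "frechet_derivative f (at x) t = frechet_derivative f (at x) 1 * t" for t
    using linear_cmul[OF has_derivative_linear[OF d], of x t 1] by simp
  then have "frechet_derivative f (at x) = (*) (frechet_derivative f (at x) 1)" by (rule ext)
  then show "(f has_real_derivative frechet_derivative f (at x) 1) (at x)"
    using d unfolding has_field_derivative_def by metis
  show "Ck k (\<lambda>x. frechet_derivative f (at x) 1)" using Ck_SucD(2)[OF assms] by simp
qed

lemma Ck_compose_linear:
  fixes g :: "real \<Rightarrow> real"
  assumes "bounded_linear l"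
  shows "Ck k g \<Longrightarrow> Ck k (\<lambda>x. g (l x))"
proof (induction k arbitrary: g)
  case 0
  then show ?case
    using continuous_on_compose2[of UNIV g UNIV l] linear_continuous_on[OF assms] by simp
next
  case (Suc k)
  have "((\<lambda>x. g (l x)) has_derivative (\<lambda>i. frechet_derivative g (at (l x)) 1 * l i)) (at x)" for x
    using has_derivative_compose[OF bounded_linear_imp_has_derivative[OF assms]
        Ck_real_SucD(1)[OF Suc.prems, unfolded has_field_derivative_def]] .
  then show ?case
  proof (rule Ck_SucI)
    fix i
    have "Ck k (\<lambda>x. l i * frechet_derivative g (at (l x)) 1)"
      by (intro Ck_cmult Suc.IH Ck_real_SucD(2)[OF Suc.prems])
    then show "Ck k (\<lambda>x. frechet_derivative g (at (l x)) 1 * l i)" by (simp add: mult.commute)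
  qed
qed

lemma Ck_ident: "Ck k (\<lambda>x::real. x)"
proof (cases k)
  case (Suc j)
  show ?thesis unfolding Suc
    by (rule Ck_real_SucI[where f'="\<lambda>x. 1"]) (auto intro: Ck_const)
qed auto

lemma Ck_real_polynomial_function: "real_polynomial_function p \<Longrightarrow> Ck k p"
  by (induction rule: real_polynomial_function.induct)
    (auto intro: Ck_const Ck_add Ck_mult Ck_compose_linear[OF _ Ck_ident])

text \<open>The flat function exp(-1/t) carries a polynomial factor in 1/t, so that the family is
  closed under differentiation and smoothness is an induction over the order for all polynomials at
  once.\<close>

definition exp_cutoff :: "real poly \<Rightarrow> real \<Rightarrow> real" where
  "exp_cutoff p t = (if t \<le> 0 then 0 else poly p (1 / t) * exp (- (1 / t)))"

lemma poly_over_exp_tendsto_0: "((\<lambda>s::real. poly p s * exp (- s)) \<longlongrightarrow> 0) at_top"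
proof -
  have "((\<lambda>s. \<Sum>i\<le>degree p. coeff p i * (s ^ i / exp s)) \<longlongrightarrow> (\<Sum>i\<le>degree p. coeff p i * 0)) at_top"
    by (intro tendsto_intros tendsto_power_div_exp_0)
  then show ?thesis by (simp add: poly_altdef exp_minus sum_distrib_right divide_inverse mult.assoc)
qed

text \<open>In s = 1/t one has ds/dt = -s^2, so p(s) exp(-s) has the t-derivative s^2 (p(s) - p'(s))
  exp(-s).\<close>

lemma exp_cutoff_deriv:
  "(exp_cutoff p has_real_derivative exp_cutoff ([:0, 0, 1:] * (p - pderiv p)) t) (at t)"
proof -
  consider "t < 0" | "t = 0" | "t > 0" by linarith
  then show ?thesis
  proof cases
    case 1
    have "eventually (\<lambda>s. exp_cutoff p s = 0) (nhds t)"
      using eventually_nhds_in_open[of "{..<0}" t] 1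
      by (auto simp: exp_cutoff_def elim!: eventually_mono)
    then show ?thesis using 1
      by (subst DERIV_cong_ev[OF refl _ refl]) (auto simp: exp_cutoff_def)
  next
    case 3
    have "((\<lambda>t. poly p (1 / t) * exp (- (1 / t))) has_real_derivative
        exp_cutoff ([:0, 0, 1:] * (p - pderiv p)) t) (at t)"
      using 3 by (auto intro!: derivative_eq_intros DERIV_chain'[OF _ poly_DERIV]
          simp: exp_cutoff_def power2_eq_square field_simps)
    moreover have "eventually (\<lambda>s. poly p (1 / s) * exp (- (1 / s)) = exp_cutoff p s) (nhds t)"
      using eventually_nhds_in_open[of "{0<..}" t] 3
      by (auto simp: exp_cutoff_def elim!: eventually_mono)
    ultimately show ?thesis by (subst DERIV_cong_ev[OF refl _ refl]) (auto simp: eq_commute)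
  next
    case 2
    \<comment> \<open>The right difference quotient at 0 is again a polynomial in 1/s times
      exp(-1/s), and 1/s tends to infinity.\<close>
    have "((\<lambda>s. exp_cutoff p s / s) \<longlongrightarrow> 0) (at_right 0)"
    proof (rule Lim_transform_eventually)
      show "((\<lambda>s. poly ([:0, 1:] * p) (inverse s) * exp (- inverse s)) \<longlongrightarrow> 0) (at_right 0)"
        by (rule filterlim_compose[OF poly_over_exp_tendsto_0 filterlim_inverse_at_top_right])
      show "\<forall>\<^sub>F s in at_right 0. poly ([:0, 1:] * p) (inverse s) * exp (- inverse s) = exp_cutoff p s / s"
        by (auto simp: eventually_at_filter exp_cutoff_def field_simps)
    qed
    moreover have "((\<lambda>s. exp_cutoff p s / s) \<longlongrightarrow> 0) (at_left 0)"
      by (rule Lim_transform_eventually[OF tendsto_const]) (auto simp: eventually_at_filter exp_cutoff_def)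
    ultimately show ?thesis
      unfolding has_field_derivative_iff 2 by (simp add: filterlim_split_at exp_cutoff_def)
  qed
qed

lemma Ck_exp_cutoff: "Ck k (exp_cutoff p)"
proof (induction k arbitrary: p)
  case 0
  show ?case using exp_cutoff_deriv[of p]
    by (auto intro!: DERIV_isCont continuous_at_imp_continuous_on)
next
  case (Suc k)
  show ?case by (rule Ck_real_SucI[OF exp_cutoff_deriv Suc])
qed

section \<open>Bumps and exhaustion of open sets\<close>

definition bump :: "'a::euclidean_space \<Rightarrow> 'a \<Rightarrow> 'a \<Rightarrow> real" where
  "bump a b x = (\<Prod>i\<in>Basis. exp_cutoff 1 (x \<bullet> i - a \<bullet> i) * exp_cutoff 1 (b \<bullet> i - x \<bullet> i))"

lemma exp_cutoff_1: "0 \<le> exp_cutoff 1 t" "exp_cutoff 1 t \<le> 1" "exp_cutoff 1 t \<noteq> 0 \<longleftrightarrow> t > 0"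
  by (auto simp: exp_cutoff_def)

lemma Ck_shift:
  fixes g :: "real \<Rightarrow> real"
  shows "Ck k g \<Longrightarrow> Ck k (\<lambda>t. g (t - c))"
proof (induction k arbitrary: g)
  case 0
  then have "continuous_on UNIV g" by simp
  then have "continuous_on UNIV (\<lambda>t. g (t - c))"
    by (rule continuous_on_compose2) (auto intro!: continuous_intros)
  then show ?case by simp
next
  case (Suc k)
  show ?case
  proof (rule Ck_real_SucI)
    show "((\<lambda>t. g (t - c)) has_real_derivative frechet_derivative g (at (x - c)) 1) (at x)" for x
      by (rule DERIV_cong[OF DERIV_chain'[OF _ Ck_real_SucD(1)[OF Suc.prems]]])
        (auto intro!: derivative_eq_intros)
    show "Ck k (\<lambda>x. frechet_derivative g (at (x - c)) 1)"
      by (rule Suc.IH[OF Ck_real_SucD(2)[OF Suc.prems]])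
  qed
qed

lemma Ck_bump: "Ck k (bump a b)"
proof -
  have "Ck k (\<lambda>t. exp_cutoff 1 (- t - - c))" for c :: real
    using Ck_compose_linear[OF _ Ck_shift[OF Ck_exp_cutoff], of "\<lambda>t. - t"]
      bounded_linear_minus[OF bounded_linear_ident] by blast
  then have 2: "Ck k (\<lambda>t. exp_cutoff 1 (c - t))" for c :: real by simp
  have bl: "bounded_linear (\<lambda>x::'a. x \<bullet> i)" for i by (rule bounded_linear_inner_left)
  show ?thesis unfolding bump_def[abs_def]
    by (intro Ck_prod Ck_mult Ck_compose_linear[OF bl Ck_shift[OF Ck_exp_cutoff]] Ck_compose_linear[OF bl 2])
qed

lemma bump_bounds: "0 \<le> bump a b x" "bump a b x \<le> 1"
  by (auto simp: bump_def intro!: prod_nonneg prod_le_1 mult_nonneg_nonneg mult_le_one exp_cutoff_1)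

lemma bump_pos_iff: "bump a b x \<noteq> 0 \<longleftrightarrow> x \<in> box a b"
  using exp_cutoff_1(3) by (auto simp: bump_def mem_box)

lemma test_functionI:
  assumes "\<And>k. Ck k \<phi>" "\<And>x. \<phi> x \<noteq> 0 \<Longrightarrow> x \<in> K" "compact K" "K \<subseteq> S"
  shows "\<phi> \<in> test_functions S"
proof -
  have "closure {x. \<phi> x \<noteq> 0} \<subseteq> K"
    using assms by (intro closure_minimal) (auto intro: compact_imp_closed)
  moreover from this have "compact (closure {x. \<phi> x \<noteq> 0})"
    using \<open>compact K\<close> by (metis closed_closure compact_Int_closed inf.absorb_iff2)
  ultimately show ?thesis using assms by (auto simp: test_functions_def)
qed

lemma test_functionE:
  assumes "\<phi> \<in> test_functions S"
  obtains K where "compact K" "K \<subseteq> S" "\<And>x. x \<notin> K \<Longrightarrow> \<phi> x = 0" "\<And>k. Ck k \<phi>"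
proof (rule that)
  show "\<phi> x = 0" if "x \<notin> closure {x. \<phi> x \<noteq> 0}" for x
  proof (rule ccontr)
    assume "\<phi> x \<noteq> 0"
    then have "x \<in> {x. \<phi> x \<noteq> 0}" by simp
    then show False using subsetD[OF closure_subset] that by metis
  qed
  show "compact (closure {x. \<phi> x \<noteq> 0})" "closure {x. \<phi> x \<noteq> 0} \<subseteq> S" "\<And>k. Ck k \<phi>"
    using assms unfolding test_functions_def by simp_all
qed

lemma test_functions_mono: "\<phi> \<in> test_functions S \<Longrightarrow> S \<subseteq> T \<Longrightarrow> \<phi> \<in> test_functions T"
  by (auto simp: test_functions_def)

text \<open>Countably many boxes with closures inside \<open>S\<close> cover \<open>S\<close>. With
  bumps \<beta> k on these boxes, take 1 minus the product over k < n of (1 - \<beta> k)^n: the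
  finite product keeps the support compact, and the growing exponent sends to 0 every factor whose
  bump is positive at the point.\<close>

lemma open_exhaustion_by_test_functions:
  fixes S :: "'a::euclidean_space set"
  assumes "open S"
  obtains \<psi> :: "nat \<Rightarrow> 'a \<Rightarrow> real" where
    "\<And>n. \<psi> n \<in> test_functions S" "\<And>n x. 0 \<le> \<psi> n x" "\<And>n x. \<psi> n x \<le> 1"
    "\<And>x. x \<in> S \<Longrightarrow> (\<lambda>n. \<psi> n x) \<longlonglongrightarrow> 1"
proof -
  define \<F> where "\<F> = {box a b | a b. cbox a b \<subseteq> S}"
  obtain \<F>' where F': "\<F>' \<subseteq> \<F>" "countable \<F>'" "\<Union>\<F>' = \<Union>\<F>"
    by (rule Lindelof[of \<F>]) (auto simp: \<F>_def open_box)
  have cov: "S \<subseteq> \<Union>\<F>"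
  proof
    fix x assume "x \<in> S"
    obtain a b where "cbox a b \<subseteq> S" "x \<in> box a b"
      using open_contains_cbox[OF assms \<open>x \<in> S\<close>] by metis
    then show "x \<in> \<Union>\<F>" unfolding \<F>_def by blast
  qed
  show thesis
  proof (cases "S = {}")
    case True
    then show ?thesis
      by (intro that[of "\<lambda>n x. 0"] test_functionI[where K="{}"] Ck_const) auto
  next
    case False
  define \<D> where "\<D> = \<F>'"
  have D: "countable \<D>" "\<D> \<noteq> {}" "\<Union>\<D> = \<Union>\<F>"
    using F'(2,3) cov False unfolding \<D>_def by blast+
  have "\<exists>p. X = box (fst p) (snd p) \<and> cbox (fst p) (snd p) \<subseteq> S" if "X \<in> \<D>" for X
    using that F'(1) by (force simp: \<D>_def \<F>_def)
  then have "\<exists>p. \<forall>X\<in>\<D>. X = box (fst (p X)) (snd (p X)) \<and> cbox (fst (p X)) (snd (p X)) \<subseteq> S"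
    by (intro bchoice) blast
  then obtain p where p: "\<forall>X\<in>\<D>. X = box (fst (p X)) (snd (p X)) \<and> cbox (fst (p X)) (snd (p X)) \<subseteq> S"
    by blast
  define a b where "a X = fst (p X)" and "b X = snd (p X)" for X
  have ab: "X = box (a X) (b X)" "cbox (a X) (b X) \<subseteq> S" if "X \<in> \<D>" for X
    using p that unfolding a_def b_def by blast+
  define X where "X = from_nat_into \<D>"
  have X: "X k \<in> \<D>" for k using D by (simp add: X_def from_nat_into)
  define \<beta> where "\<beta> k = bump (a (X k)) (b (X k))" for k
  define \<psi> where "\<psi> n x = 1 - (\<Prod>k<n. (1 - \<beta> k x) ^ n)" for n x
  have bb: "0 \<le> 1 - \<beta> k x" "1 - \<beta> k x \<le> 1" for k x
    using bump_bounds[of "a (X k)" "b (X k)" x] by (auto simp: \<beta>_def)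
  show ?thesis
  proof
    show "\<psi> n \<in> test_functions S" for n
    proof (rule test_functionI)
      show "Ck k (\<psi> n)" for k unfolding \<psi>_def[abs_def] \<beta>_def
        by (intro Ck_diff Ck_prod Ck_power Ck_const Ck_bump)
      show "compact (\<Union>k<n. cbox (a (X k)) (b (X k)))" by (intro compact_UN) auto
      show "(\<Union>k<n. cbox (a (X k)) (b (X k))) \<subseteq> S" using ab(2)[OF X] by blast
      fix x assume "\<psi> n x \<noteq> 0"
      have "\<exists>k<n. \<beta> k x \<noteq> 0"
      proof (rule ccontr)
        assume "\<not> ?thesis"
        then have "(\<Prod>k<n. (1 - \<beta> k x) ^ n) = 1" by (intro prod.neutral) simp
        then show False using \<open>\<psi> n x \<noteq> 0\<close> by (simp add: \<psi>_def)
      qed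
      then obtain k where k: "k < n" "\<beta> k x \<noteq> 0" by blast
      have "x \<in> cbox (a (X k)) (b (X k))"
        using k(2) unfolding \<beta>_def bump_pos_iff by (rule subsetD[OF box_subset_cbox])
      then show "x \<in> (\<Union>k<n. cbox (a (X k)) (b (X k)))" using k(1) by (intro UN_I) auto
    qed
    show "0 \<le> \<psi> n x" for n x unfolding \<psi>_def using bb
      by (simp add: prod_le_1 power_le_one)
    show "\<psi> n x \<le> 1" for n x unfolding \<psi>_def using bb
      by (simp add: prod_nonneg)
    fix x assume "x \<in> S"
    then obtain Y where "Y \<in> \<D>" "x \<in> Y" using cov D by blast
    obtain m where m: "X m = Y"
      using from_nat_into_surj[OF D(1) \<open>Y \<in> \<D>\<close>] unfolding X_def by metis
    have "\<beta> m x \<noteq> 0" unfolding \<beta>_def bump_pos_iff m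
      using ab(1)[OF \<open>Y \<in> \<D>\<close>] \<open>x \<in> Y\<close> by blast
    then have lt: "1 - \<beta> m x < 1" using bump_bounds(1)[of "a (X m)" "b (X m)" x] by (auto simp: \<beta>_def)
    \<comment> \<open>All factors lie in [0, 1], so the product is squeezed by the single factor of
      index \<open>m\<close>, which decays geometrically.\<close>
    have "(\<lambda>n. \<Prod>k<n. (1 - \<beta> k x) ^ n) \<longlonglongrightarrow> 0"
    proof (rule tendsto_sandwich[OF _ _ tendsto_const])
      show "(\<lambda>n. (1 - \<beta> m x) ^ n) \<longlonglongrightarrow> 0" using bb lt by (intro LIMSEQ_realpow_zero) auto
      show "\<forall>\<^sub>F n in sequentially. 0 \<le> (\<Prod>k<n. (1 - \<beta> k x) ^ n)"
        using bb by (auto intro!: always_eventually prod_nonneg)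
      show "\<forall>\<^sub>F n in sequentially. (\<Prod>k<n. (1 - \<beta> k x) ^ n) \<le> (1 - \<beta> m x) ^ n"
        using eventually_gt_at_top[of m]
      proof eventually_elim
        case (elim n)
        have "(\<Prod>k<n. (1 - \<beta> k x) ^ n) = (1 - \<beta> m x) ^ n * (\<Prod>k\<in>{..<n} - {m}. (1 - \<beta> k x) ^ n)"
          using elim by (subst prod.remove[of _ m]) auto
        also have "\<dots> \<le> (1 - \<beta> m x) ^ n * 1"
          using bb by (intro mult_left_mono prod_le_1) (auto simp: power_le_one)
        finally show ?case by simp
      qed
    qed
    from tendsto_diff[OF tendsto_const[of 1] this] show "(\<lambda>n. \<psi> n x) \<longlonglongrightarrow> 1"
      unfolding \<psi>_def by simp
  qed
  qed
qed

section \<open>Density of test functions and uniqueness of weak derivatives\<close>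

lemma Lsq_norm_eq_0_imp_AE:
  assumes "f \<in> Lsq S" "Lsq_norm S f = 0"
  shows "AE x in lebesgue_on S. f x = 0"
proof -
  have "(\<integral>x. (f x)\<^sup>2 \<partial>lebesgue_on S) = 0" using assms(2) by (simp add: Lsq_norm_def)
  then have "AE x in lebesgue_on S. (f x)\<^sup>2 = 0"
    using integral_nonneg_eq_0_iff_AE[OF LsqD(2)[OF assms(1)]] by simp
  then show ?thesis by simp
qed

lemma Lsq_dominated_convergence:
  fixes h :: "nat \<Rightarrow> 'a::euclidean_space \<Rightarrow> real"
  assumes w: "w \<in> Lsq S" and h: "\<And>n. h n \<in> borel_measurable (lebesgue_on S)"
    and le: "\<And>n. AE x in lebesgue_on S. \<bar>h n x\<bar> \<le> \<bar>w x\<bar>"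
    and lim: "AE x in lebesgue_on S. (\<lambda>n. h n x) \<longlonglongrightarrow> 0"
  shows "(\<lambda>n. Lsq_norm S (h n)) \<longlonglongrightarrow> 0"
proof -
  have "(\<lambda>n. \<integral>x. (h n x)\<^sup>2 \<partial>lebesgue_on S) \<longlonglongrightarrow> (\<integral>x. 0 \<partial>lebesgue_on S)"
  proof (rule integral_dominated_convergence)
    show "integrable (lebesgue_on S) (\<lambda>x. (w x)\<^sup>2)" by (rule LsqD(2)[OF w])
    show "AE x in lebesgue_on S. (\<lambda>n. (h n x)\<^sup>2) \<longlonglongrightarrow> 0"
      using lim
    proof eventually_elim
      case (elim x)
      from tendsto_power[OF this, of 2] show ?case by simp
    qed
    show "AE x in lebesgue_on S. norm ((h n x)\<^sup>2) \<le> (w x)\<^sup>2" for n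
      using le[of n] by eventually_elim (simp add: abs_le_square_iff)
  qed (use h in auto)
  from tendsto_real_sqrt[OF this] show ?thesis by (simp add: Lsq_norm_def)
qed

lemma test_function_continuous: "\<phi> \<in> test_functions S \<Longrightarrow> continuous_on UNIV \<phi>"
  by (metis Ck.simps(1) test_functionE)

lemma test_function_bounded:
  assumes "\<phi> \<in> test_functions S"
  obtains B where "0 < B" "\<And>x. \<bar>\<phi> x\<bar> \<le> B"
proof -
  obtain K where K: "compact K" "\<And>x. x \<notin> K \<Longrightarrow> \<phi> x = 0"
    using assms by (rule test_functionE) blast
  have "compact (\<phi> ` K)"
    by (intro compact_continuous_image K continuous_on_subset[OF test_function_continuous[OF assms]]) simp
  then obtain B where B: "\<And>y. y \<in> \<phi> ` K \<Longrightarrow> norm y \<le> B" by (meson compact_imp_bounded bounded_iff)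
  show thesis
  proof (rule that[of "\<bar>B\<bar> + 1"])
    show "\<bar>\<phi> x\<bar> \<le> \<bar>B\<bar> + 1" for x
    proof (cases "x \<in> K")
      case True
      then have "norm (\<phi> x) \<le> B" by (intro B) simp
      then show ?thesis by simp
    qed (use K in auto)
  qed simp
qed

lemma test_function_partial:
  assumes "\<phi> \<in> test_functions S" "i \<in> Basis"
  shows "(\<lambda>x. frechet_derivative \<phi> (at x) i) \<in> test_functions S"
proof -
  obtain K where K: "compact K" "K \<subseteq> S" "\<And>x. x \<notin> K \<Longrightarrow> \<phi> x = 0" "\<And>k. Ck k \<phi>"
    using assms(1) by (rule test_functionE) blast
  show ?thesis
  proof (rule test_functionI)
    show "Ck k (\<lambda>x. frechet_derivative \<phi> (at x) i)" for k
      using Ck_SucD(2)[OF K(4) assms(2)] .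
    show "x \<in> K" if "frechet_derivative \<phi> (at x) i \<noteq> 0" for x
    proof (rule ccontr)
      assume x: "x \<notin> K"
      have "open (- K)" using K(1) by (simp add: compact_imp_closed open_Compl)
      then have "(\<phi> has_derivative (\<lambda>t. 0)) (at x)"
        by (rule has_derivative_transform_within_open[OF has_derivative_const]) (use x K in auto)
      then have "frechet_derivative \<phi> (at x) = (\<lambda>t. 0)" by (metis frechet_derivative_at)
      then show False using that by simp
    qed
  qed (use K in auto)
qed

lemma test_function_in_Lsq:
  assumes "\<phi> \<in> test_functions S" "T \<in> lmeasurable"
  shows "\<phi> \<in> Lsq T"
proof -
  obtain B where "\<And>x. \<bar>\<phi> x\<bar> \<le> B" using assms(1) by (rule test_function_bounded) blast
  then show ?thesis
    by (intro Lsq_bounded(1)[OF assms(2)] continuous_on_imp_measurable_lebesgue_on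
        test_function_continuous[OF assms(1)])
qed

lemma test_functions_mult_smooth:
  assumes "\<phi> \<in> test_functions S" "\<And>k. Ck k p"
  shows "(\<lambda>x. p x * \<phi> x) \<in> test_functions S"
proof -
  obtain K where K: "compact K" "K \<subseteq> S" "\<And>x. x \<notin> K \<Longrightarrow> \<phi> x = 0" "\<And>k. Ck k \<phi>"
    using assms(1) by (rule test_functionE) blast
  show ?thesis
    by (rule test_functionI[OF Ck_mult[OF assms(2) K(4)] _ K(1,2)]) (use K(3) in auto)
qed

text \<open>Four approximations, each within e / 4: truncation of the values, continuous functions,
  a polynomial by Stone-Weierstrass on the closure, and multiplication by an exhausting sequence.
  Smoothness comes from the polynomial and compact support from the exhaustion, so no convolution is
  involved.\<close>

proposition test_functions_dense:
  fixes f :: "'a::euclidean_space \<Rightarrow> real"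
  assumes S: "open S" "bounded S" and f: "f \<in> Lsq S" and "e > 0"
  obtains \<phi> where "\<phi> \<in> test_functions S" "Lsq_norm S (\<lambda>x. f x - \<phi> x) < e"
proof -
  have Sm: "S \<in> lmeasurable" "S \<in> sets lebesgue"
    using S by (auto intro: lmeasurable_open)
  define c where "c K t = max (- K) (min K t)" for K t :: real
  have c_cont: "continuous_on UNIV (c K)" for K unfolding c_def by (intro continuous_intros)
  have [measurable]: "c K \<in> borel_measurable borel" for K
    by (rule borel_measurable_continuous_onI[OF c_cont])
  have c_bd: "\<bar>c (real n) t\<bar> \<le> real n" for n t by (auto simp: c_def)
  define f1 where "f1 n x = c (real n) (f x)" for n :: nat and x
  have f1_m: "f1 n \<in> borel_measurable (lebesgue_on S)" for n
    unfolding f1_def using LsqD(1)[OF f] by measurable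
  have f1_L: "f1 n \<in> Lsq S" for n
    by (rule Lsq_bounded(1)[OF Sm(1) f1_m, where B="real n"]) (simp add: f1_def c_bd)
  have "(\<lambda>n. Lsq_norm S (\<lambda>x. f x - f1 n x)) \<longlonglongrightarrow> 0"
  proof (rule Lsq_dominated_convergence[OF f])
    show "(\<lambda>x. f x - f1 n x) \<in> borel_measurable (lebesgue_on S)" for n
      using f1_m LsqD(1)[OF f] by simp
    show "AE x in lebesgue_on S. \<bar>f x - f1 n x\<bar> \<le> \<bar>f x\<bar>" for n
      by (intro AE_I2) (auto simp: f1_def c_def)
    show "AE x in lebesgue_on S. (\<lambda>n. f x - f1 n x) \<longlonglongrightarrow> 0"
    proof (intro AE_I2 tendsto_eventually)
      fix x
      obtain N where "\<bar>f x\<bar> \<le> real N" using real_arch_simple by blast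
      then show "\<forall>\<^sub>F n in sequentially. f x - f1 n x = 0"
        by (intro eventually_sequentiallyI[of N]) (auto simp: f1_def c_def)
    qed
  qed
  then have "\<forall>\<^sub>F n in sequentially. Lsq_norm S (\<lambda>x. f x - f1 n x) < e / 4"
    using \<open>e > 0\<close> by (intro order_tendstoD) auto
  from eventually_happens[OF this] obtain m where m: "Lsq_norm S (\<lambda>x. f x - f1 m x) < e / 4" by auto
  \<comment> \<open>\<open>measurable_on\<close> provides continuous functions that converge to
    \<open>f1 m\<close> off a null set; clipping them at level m keeps them dominated.\<close>
  have "f1 m measurable_on S" using measurable_on_iff_borel_measurable[OF Sm(2)] f1_m by blast
  then obtain N g where N: "negligible N" and g: "\<And>n. continuous_on UNIV (g n)"
    and lim: "\<And>x. x \<notin> N \<Longrightarrow> (\<lambda>n. g n x) \<longlonglongrightarrow> (if x \<in> S then f1 m x else 0)"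
    unfolding measurable_on_def by blast
  define f2 where "f2 n x = c (real m) (g n x)" for n x
  have f2_c: "continuous_on UNIV (f2 n)" for n
    unfolding f2_def by (rule continuous_on_compose2[OF c_cont g]) simp
  have f2_bd: "\<bar>f2 n x\<bar> \<le> real m" for n x by (simp add: f2_def c_bd)
  have "(\<lambda>n. Lsq_norm S (\<lambda>x. f1 m x - f2 n x)) \<longlonglongrightarrow> 0"
  proof (rule Lsq_dominated_convergence)
    show "(\<lambda>x. 2 * real m) \<in> Lsq S" by (rule Lsq_bounded(1)[OF Sm(1)]) auto
    show "(\<lambda>x. f1 m x - f2 n x) \<in> borel_measurable (lebesgue_on S)" for n
      using f1_m continuous_on_imp_measurable_lebesgue_on[OF f2_c] by simp
    show "AE x in lebesgue_on S. \<bar>f1 m x - f2 n x\<bar> \<le> \<bar>2 * real m\<bar>" for n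
    proof (rule AE_I2)
      fix x
      have "\<bar>f1 m x\<bar> \<le> real m" by (simp add: f1_def c_bd)
      then show "\<bar>f1 m x - f2 n x\<bar> \<le> \<bar>2 * real m\<bar>" using f2_bd[of n x] by linarith
    qed
    have "AE x in lebesgue. x \<notin> N"
      using N by (simp add: AE_not_in negligible_iff_null_sets)
    then have "AE x in lebesgue. x \<in> S \<longrightarrow> x \<notin> N" by auto
    then have "AE x in lebesgue_on S. x \<in> S \<and> x \<notin> N"
      using Sm by (simp add: AE_restrict_space_iff)
    then show "AE x in lebesgue_on S. (\<lambda>n. f1 m x - f2 n x) \<longlonglongrightarrow> 0"
    proof eventually_elim
      case (elim x)
      then have "(\<lambda>n. g n x) \<longlonglongrightarrow> f1 m x" using lim[of x] by simp
      then have "(\<lambda>n. c (real m) (g n x)) \<longlonglongrightarrow> c (real m) (f1 m x)"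
        unfolding c_def by (intro tendsto_intros)
      moreover have "c (real m) (f1 m x) = f1 m x" by (auto simp: f1_def c_def)
      ultimately have "(\<lambda>n. f2 n x) \<longlonglongrightarrow> f1 m x" by (simp add: f2_def)
      from tendsto_diff[OF tendsto_const this, of "f1 m x"] show ?case by simp
    qed
  qed
  then have "\<forall>\<^sub>F n in sequentially. Lsq_norm S (\<lambda>x. f1 m x - f2 n x) < e / 4"
    using \<open>e > 0\<close> by (intro order_tendstoD) auto
  from eventually_happens[OF this] obtain k where k: "Lsq_norm S (\<lambda>x. f1 m x - f2 k x) < e / 4" by auto
  have f2_m: "f2 k \<in> borel_measurable (lebesgue_on S)"
    by (rule continuous_on_imp_measurable_lebesgue_on[OF f2_c])
  have f2_L: "f2 k \<in> Lsq S"
    by (rule Lsq_bounded(1)[OF Sm(1) f2_m, where B="real m"]) (simp add: f2_bd)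
  \<comment> \<open>The tolerance below is e / (4 (s + 1)); adding 1 keeps it positive when
    \<open>S\<close> has measure zero.\<close>
  define s where "s = sqrt (measure lebesgue S)"
  have "s \<ge> 0" by (simp add: s_def)
  have cc: "compact (closure S)" using S by (simp add: compact_closure)
  obtain p where p: "real_polynomial_function p" "\<And>x. x \<in> closure S \<Longrightarrow> \<bar>f2 k x - p x\<bar> < e / (4 * (s + 1))"
    by (rule Stone_Weierstrass_real_polynomial_function[OF cc continuous_on_subset[OF f2_c], of "e / (4 * (s + 1))"])
      (use \<open>e > 0\<close> \<open>s \<ge> 0\<close> in auto)
  have p_C: "Ck j p" for j by (rule Ck_real_polynomial_function[OF p(1)])
  have p_c: "continuous_on UNIV p" using p_C[of 0] by simp
  have p_m: "p \<in> borel_measurable (lebesgue_on S)"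
    by (rule continuous_on_imp_measurable_lebesgue_on[OF p_c])
  obtain B where B: "\<And>x. x \<in> S \<Longrightarrow> \<bar>p x\<bar> \<le> B"
  proof -
    have "compact (p ` closure S)"
      by (intro compact_continuous_image cc continuous_on_subset[OF p_c]) simp
    then obtain B where "\<And>y. y \<in> p ` closure S \<Longrightarrow> norm y \<le> B" by (meson compact_imp_bounded bounded_iff)
    then show ?thesis using closure_subset[of S] by (intro that[of B]) auto
  qed
  have p_L: "p \<in> Lsq S" by (rule Lsq_bounded(1)[OF Sm(1) p_m B])
  have 3: "Lsq_norm S (\<lambda>x. f2 k x - p x) \<le> e / 4"
  proof -
    have "Lsq_norm S (\<lambda>x. f2 k x - p x) \<le> \<bar>e / (4 * (s + 1))\<bar> * sqrt (measure lebesgue S)"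
    proof (rule Lsq_bounded(2)[OF Sm(1)])
      show "\<bar>f2 k x - p x\<bar> \<le> e / (4 * (s + 1))" if "x \<in> S" for x
        using p(2)[of x] that closure_subset[of S] by (meson less_imp_le subsetD)
    qed (use f2_m p_m in simp)
    also have "\<dots> = e / 4 * (s / (s + 1))" using \<open>e > 0\<close> \<open>s \<ge> 0\<close> by (simp add: s_def[symmetric])
    also have "\<dots> \<le> e / 4 * 1" using \<open>e > 0\<close> \<open>s \<ge> 0\<close> by (intro mult_left_mono) auto
    finally show ?thesis by simp
  qed
  obtain \<psi> :: "nat \<Rightarrow> 'a \<Rightarrow> real" where \<psi>: "\<And>n. \<psi> n \<in> test_functions S" "\<And>n x. 0 \<le> \<psi> n x"
    "\<And>n x. \<psi> n x \<le> 1" "\<And>x. x \<in> S \<Longrightarrow> (\<lambda>n. \<psi> n x) \<longlonglongrightarrow> 1"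
    using open_exhaustion_by_test_functions[OF S(1)] by blast
  have pt: "(\<lambda>x. p x * \<psi> n x) \<in> test_functions S" for n
    by (rule test_functions_mult_smooth[OF \<psi>(1) p_C])
  have "(\<lambda>n. Lsq_norm S (\<lambda>x. p x - p x * \<psi> n x)) \<longlonglongrightarrow> 0"
  proof (rule Lsq_dominated_convergence[OF p_L])
    show "(\<lambda>x. p x - p x * \<psi> n x) \<in> borel_measurable (lebesgue_on S)" for n
      using p_m continuous_on_imp_measurable_lebesgue_on[OF test_function_continuous[OF pt]] by simp
    show "AE x in lebesgue_on S. \<bar>p x - p x * \<psi> n x\<bar> \<le> \<bar>p x\<bar>" for n
    proof (rule AE_I2)
      fix x
      have "p x - p x * \<psi> n x = p x * (1 - \<psi> n x)" by (simp add: right_diff_distrib)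
      then have "\<bar>p x - p x * \<psi> n x\<bar> = \<bar>p x\<bar> * (1 - \<psi> n x)"
        using \<psi>(3)[of n x] by (simp only: abs_mult)
      also have "\<dots> \<le> \<bar>p x\<bar> * 1" using \<psi>(2)[of n x] by (intro mult_left_mono) auto
      finally show "\<bar>p x - p x * \<psi> n x\<bar> \<le> \<bar>p x\<bar>" by simp
    qed
    show "AE x in lebesgue_on S. (\<lambda>n. p x - p x * \<psi> n x) \<longlonglongrightarrow> 0"
    proof (rule AE_I2)
      fix x assume "x \<in> space (lebesgue_on S)"
      then have "(\<lambda>n. \<psi> n x) \<longlonglongrightarrow> 1" using \<psi>(4) by simp
      from tendsto_diff[OF tendsto_const tendsto_mult[OF tendsto_const this], of "p x" "p x"]
      show "(\<lambda>n. p x - p x * \<psi> n x) \<longlonglongrightarrow> 0" by simp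
    qed
  qed
  then have "\<forall>\<^sub>F n in sequentially. Lsq_norm S (\<lambda>x. p x - p x * \<psi> n x) < e / 4"
    using \<open>e > 0\<close> by (intro order_tendstoD) auto
  from eventually_happens[OF this] obtain n where n: "Lsq_norm S (\<lambda>x. p x - p x * \<psi> n x) < e / 4" by auto
  have pn: "(\<lambda>x. p x * \<psi> n x) \<in> Lsq S" by (rule test_function_in_Lsq[OF pt Sm(1)])
  have "Lsq_norm S (\<lambda>x. f x - p x * \<psi> n x)
      = Lsq_norm S (\<lambda>x. (f x - f1 m x) + ((f1 m x - f2 k x) + ((f2 k x - p x) + (p x - p x * \<psi> n x))))"
    by simp
  also have "\<dots> \<le> Lsq_norm S (\<lambda>x. f x - f1 m x) + (Lsq_norm S (\<lambda>x. f1 m x - f2 k x)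
      + (Lsq_norm S (\<lambda>x. f2 k x - p x) + Lsq_norm S (\<lambda>x. p x - p x * \<psi> n x)))"
    by (intro order_trans[OF Lsq_norm_triangle] add_left_mono Lsq_add Lsq_diff f f1_L f2_L p_L pn order_refl)
  also have "\<dots> < e" using m k 3 n by linarith
  finally show thesis using pt by (intro that[of "\<lambda>x. p x * \<psi> n x"])
qed

text \<open>If the norm of g were positive, a test function \<phi> closer to g than this norm would
  give norm(g)^2 = \<integral> g (g - \<phi>) < norm(g)^2.\<close>

lemma AE_zero_if_orthogonal_to_test_functions:
  fixes g :: "'a::euclidean_space \<Rightarrow> real"
  assumes S: "open S" "bounded S" and g: "g \<in> Lsq S"
    and 0: "\<And>\<phi>. \<phi> \<in> test_functions S \<Longrightarrow> (\<integral>x. g x * \<phi> x \<partial>lebesgue_on S) = 0"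
  shows "AE x in lebesgue_on S. g x = 0"
proof (rule Lsq_norm_eq_0_imp_AE[OF g], rule ccontr)
  assume "Lsq_norm S g \<noteq> 0"
  then have pos: "Lsq_norm S g > 0" using Lsq_norm_nonneg[of S g] by linarith
  have Sm: "S \<in> lmeasurable" using S by (auto intro: lmeasurable_open)
  obtain \<phi> where \<phi>: "\<phi> \<in> test_functions S" "Lsq_norm S (\<lambda>x. g x - \<phi> x) < Lsq_norm S g"
    using test_functions_dense[OF S g pos] by blast
  note \<phi>L = test_function_in_Lsq[OF \<phi>(1) Sm]
  have "(Lsq_norm S g)\<^sup>2 = (\<integral>x. g x * (g x - \<phi> x) + g x * \<phi> x \<partial>lebesgue_on S)"
    unfolding Lsq_norm_power2 by (simp add: power2_eq_square algebra_simps)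
  also have "\<dots> = (\<integral>x. g x * (g x - \<phi> x) \<partial>lebesgue_on S)"
    using Lsq_integrable_mult[OF g Lsq_diff[OF g \<phi>L]] Lsq_integrable_mult[OF g \<phi>L] 0[OF \<phi>(1)] by simp
  also have "\<dots> \<le> Lsq_norm S g * Lsq_norm S (\<lambda>x. g x - \<phi> x)"
    using Lsq_Cauchy_Schwarz[OF g Lsq_diff[OF g \<phi>L]] by linarith
  also have "\<dots> < Lsq_norm S g * Lsq_norm S g" using \<phi>(2) pos by (intro mult_strict_left_mono)
  finally show False by (simp add: power2_eq_square)
qed

section \<open>Uniqueness, differences and restriction of weak derivatives\<close>

lemma weak_partial_unique:
  assumes S: "open S" "bounded S" and "g \<in> Lsq S" "h \<in> Lsq S"
    and "has_weak_partial S i u g" "has_weak_partial S i u h"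
  shows "AE x in lebesgue_on S. g x = h x"
proof -
  have Sm: "S \<in> lmeasurable" using S by (auto intro: lmeasurable_open)
  have "AE x in lebesgue_on S. g x - h x = 0"
  proof (rule AE_zero_if_orthogonal_to_test_functions[OF S Lsq_diff[OF assms(3,4)]])
    fix \<phi> assume \<phi>: "\<phi> \<in> test_functions S"
    note L = test_function_in_Lsq[OF \<phi> Sm]
    have "(\<integral>x. g x * \<phi> x \<partial>lebesgue_on S) = (\<integral>x. h x * \<phi> x \<partial>lebesgue_on S)"
      using assms(5,6) \<phi> unfolding has_weak_partial_def by fastforce
    then show "(\<integral>x. (g x - h x) * \<phi> x \<partial>lebesgue_on S) = 0"
      using Lsq_integrable_mult[OF assms(3) L] Lsq_integrable_mult[OF assms(4) L]
      by (simp add: left_diff_distrib)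
  qed
  then show ?thesis by simp
qed

lemma weak_partial_H1:
  assumes "u \<in> H1 S" "i \<in> Basis"
  shows "weak_partial S i u \<in> Lsq S" "has_weak_partial S i u (weak_partial S i u)"
proof -
  have "\<exists>g. g \<in> Lsq S \<and> has_weak_partial S i u g" using assms by (auto simp: H1_def)
  from someI_ex[OF this] show "weak_partial S i u \<in> Lsq S" "has_weak_partial S i u (weak_partial S i u)"
    by (auto simp: weak_partial_def)
qed

text \<open>Links the representative chosen by \<open>weak_partial\<close> with any weak derivative
  found by construction.\<close>

lemma weak_partial_eq_AE:
  assumes S: "open S" "bounded S" and g: "g \<in> Lsq S" "has_weak_partial S i u g"
  shows "weak_partial S i u \<in> Lsq S" "AE x in lebesgue_on S. weak_partial S i u x = g x"
proof -
  have "\<exists>g. g \<in> Lsq S \<and> has_weak_partial S i u g" using g by auto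
  from someI_ex[OF this] have *: "weak_partial S i u \<in> Lsq S" "has_weak_partial S i u (weak_partial S i u)"
    by (auto simp: weak_partial_def)
  show "weak_partial S i u \<in> Lsq S" by fact
  show "AE x in lebesgue_on S. weak_partial S i u x = g x"
    by (rule weak_partial_unique[OF S *(1) g(1) *(2) g(2)])
qed

lemma has_weak_partial_diff:
  assumes S: "S \<in> lmeasurable" and "u \<in> Lsq S" "v \<in> Lsq S" "g \<in> Lsq S" "h \<in> Lsq S" "i \<in> Basis"
    and w: "has_weak_partial S i u g" "has_weak_partial S i v h"
  shows "has_weak_partial S i (\<lambda>x. u x - v x) (\<lambda>x. g x - h x)"
  unfolding has_weak_partial_def
proof
  fix \<phi> assume \<phi>: "\<phi> \<in> test_functions S"
  note L = test_function_in_Lsq[OF \<phi> S] and L' = test_function_in_Lsq[OF test_function_partial[OF \<phi> \<open>i \<in> Basis\<close>] S]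
  show "(\<integral>x. (u x - v x) * frechet_derivative \<phi> (at x) i \<partial>lebesgue_on S) = - (\<integral>x. (g x - h x) * \<phi> x \<partial>lebesgue_on S)"
    using w \<phi> Lsq_integrable_mult[OF \<open>u \<in> Lsq S\<close> L'] Lsq_integrable_mult[OF \<open>v \<in> Lsq S\<close> L']
      Lsq_integrable_mult[OF \<open>g \<in> Lsq S\<close> L] Lsq_integrable_mult[OF \<open>h \<in> Lsq S\<close> L]
    by (simp add: left_diff_distrib has_weak_partial_def)
qed

lemma integral_eq_on_subset:
  fixes f :: "'a::euclidean_space \<Rightarrow> real"
  assumes "T \<subseteq> S" "T \<in> sets lebesgue" "S \<in> sets lebesgue" "\<And>x. x \<in> S - T \<Longrightarrow> f x = 0"
  shows "(\<integral>x. f x \<partial>lebesgue_on S) = (\<integral>x. f x \<partial>lebesgue_on T)"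
proof -
  have "(\<integral>x. f x \<partial>lebesgue_on S) = (\<integral>x. (if x \<in> T then f x else 0) \<partial>lebesgue_on S)"
    by (rule Bochner_Integration.integral_cong) (use assms(4) in auto)
  also have "\<dots> = (\<integral>x. f x \<partial>lebesgue_on T)" by (rule Lebesgue_Measure.integral_restrict) (use assms in auto)
  finally show ?thesis .
qed

lemma has_weak_partial_subset:
  assumes "has_weak_partial S i u g" and T: "T \<subseteq> S" "T \<in> sets lebesgue" "S \<in> sets lebesgue" and "i \<in> Basis"
  shows "has_weak_partial T i u g"
  unfolding has_weak_partial_def
proof
  fix \<phi> assume \<phi>: "\<phi> \<in> test_functions T"
  note \<phi>S = test_functions_mono[OF \<phi> T(1)]
  have z: "\<psi> x = 0" if "\<psi> \<in> test_functions T" "x \<in> S - T" for \<psi> x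
    using that by (elim test_functionE) auto
  have "(\<integral>x. u x * frechet_derivative \<phi> (at x) i \<partial>lebesgue_on T) = (\<integral>x. u x * frechet_derivative \<phi> (at x) i \<partial>lebesgue_on S)"
    using z[OF test_function_partial[OF \<phi> \<open>i \<in> Basis\<close>]] by (intro integral_eq_on_subset[symmetric] T) auto
  also have "\<dots> = - (\<integral>x. g x * \<phi> x \<partial>lebesgue_on S)" using assms(1) \<phi>S by (auto simp: has_weak_partial_def)
  also have "(\<integral>x. g x * \<phi> x \<partial>lebesgue_on S) = (\<integral>x. g x * \<phi> x \<partial>lebesgue_on T)"
    using z[OF \<phi>] by (intro integral_eq_on_subset T) auto
  finally show "(\<integral>x. u x * frechet_derivative \<phi> (at x) i \<partial>lebesgue_on T) = - (\<integral>x. g x * \<phi> x \<partial>lebesgue_on T)" .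
qed

section \<open>Integration by parts\<close>

lemma lborel_integral_translation:
  fixes f :: "'a::euclidean_space \<Rightarrow> real"
  assumes [measurable]: "f \<in> borel_measurable borel"
  shows "(\<integral>x. f (c + x) \<partial>lborel) = (\<integral>x. f x \<partial>lborel)"
proof -
  have "(\<integral>x. f x \<partial>lborel) = (\<integral>x. f x \<partial>distr lborel borel ((+) c))"
    by (simp add: lborel_distr_plus)
  also have "\<dots> = (\<integral>x. f (c + x) \<partial>lborel)" by (rule integral_distr) auto
  finally show ?thesis by simp
qed

lemma lborel_integrable_translation:
  fixes f :: "'a::euclidean_space \<Rightarrow> real"
  assumes f: "integrable lborel f"
  shows "integrable lborel (\<lambda>x. f (c + x))"
proof -
  have "integrable (distr lborel borel ((+) c)) f" using f by (simp add: lborel_distr_plus)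
  then show ?thesis using f by (subst (asm) integrable_distr_eq) auto
qed

lemma lebesgue_on_integral_eq_lborel:
  fixes f :: "'a::euclidean_space \<Rightarrow> real"
  assumes [measurable]: "S \<in> sets borel" "f \<in> borel_measurable borel"
  shows "(\<integral>x. f x \<partial>lebesgue_on S) = (\<integral>x. indicator S x * f x \<partial>lborel)"
proof -
  have "(\<integral>x. f x \<partial>lebesgue_on S) = (\<integral>x. indicator S x *\<^sub>R f x \<partial>lebesgue)"
    by (rule integral_restrict_space) simp
  also have "\<dots> = (\<integral>x. indicator S x *\<^sub>R f x \<partial>lborel)"
    by (rule integral_completion) auto
  finally show ?thesis by simp
qed

lemma bounded_support_integrable_lborel:
  fixes f :: "'a::euclidean_space \<Rightarrow> real"
  assumes [measurable]: "f \<in> borel_measurable borel" and le: "\<And>x. \<bar>f x\<bar> \<le> B"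
    and z: "\<And>x. x \<notin> cball 0 R \<Longrightarrow> f x = 0"
  shows "integrable lborel f"
proof (rule Bochner_Integration.integrable_bound)
  show "integrable lborel (\<lambda>x. B * indicator (cball (0::'a) R) x)"
    using emeasure_bounded_finite[of "cball (0::'a) R"] by simp
  show "AE x in lborel. norm (f x) \<le> norm (B * indicator (cball (0::'a) R) x)"
  proof (rule AE_I2)
    fix x show "norm (f x) \<le> norm (B * indicator (cball (0::'a) R) x)"
      using le[of x] z[of x] by (cases "x \<in> cball 0 R") auto
  qed
qed simp

text \<open>Integration by parts without continuity of the derivative: the difference quotients of a
  compactly supported function have integral \<open>0\<close> by translation invariance, and they are dominated
  by the mean value theorem.\<close>

lemma integral_directional_derivative_eq_0:
  fixes k D :: "'a::euclidean_space \<Rightarrow> real"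
  assumes k[measurable]: "k \<in> borel_measurable borel" and D[measurable]: "D \<in> borel_measurable borel"
    and deriv: "\<And>x. ((\<lambda>t. k (x + t *\<^sub>R i)) has_real_derivative D x) (at 0)"
    and supp: "\<And>x. x \<notin> cball 0 R \<Longrightarrow> k x = 0"
    and bd: "\<And>x. \<bar>k x\<bar> \<le> B" "\<And>x. \<bar>D x\<bar> \<le> M" and i: "norm i = 1"
  shows "(\<integral>x. D x \<partial>lborel) = 0"
proof -
  have "0 \<le> M" using bd(2)[of 0] by linarith
  have deriv': "((\<lambda>t. k (x + t *\<^sub>R i)) has_real_derivative D (x + s *\<^sub>R i)) (at s)" for x s
  proof -
    have "((\<lambda>t. k ((x + s *\<^sub>R i) + t *\<^sub>R i)) has_real_derivative D (x + s *\<^sub>R i)) (at 0)" by (rule deriv)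
    then have "((\<lambda>t. k (x + (t + s) *\<^sub>R i)) has_real_derivative D (x + s *\<^sub>R i)) (at 0)"
      by (simp add: scaleR_add_left add_ac)
    then show ?thesis using DERIV_shift[of "\<lambda>t. k (x + t *\<^sub>R i)" "D (x + s *\<^sub>R i)" 0 s] by simp
  qed
  have lip: "\<bar>k (x + t *\<^sub>R i) - k x\<bar> \<le> M * \<bar>t\<bar>" for x t
    using field_differentiable_bound[of UNIV "\<lambda>t. k (x + t *\<^sub>R i)" "\<lambda>s. D (x + s *\<^sub>R i)" M t 0]
      deriv' bd(2) by (simp add: has_field_derivative_at_within)
  define h where "h n = inverse (real (Suc n))" for n
  have h: "h n > 0" "h n \<le> 1" for n by (auto simp: h_def inverse_le_1_iff)
  have h0: "h \<longlonglongrightarrow> 0" unfolding h_def by (rule LIMSEQ_inverse_real_of_nat)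
  define F where "F n x = (k (h n *\<^sub>R i + x) - k x) / h n" for n x
  have k_int: "integrable lborel k" by (rule bounded_support_integrable_lborel[OF k bd(1) supp])
  have F_m[measurable]: "F n \<in> borel_measurable borel" for n unfolding F_def by measurable
  have F0: "(\<integral>x. F n x \<partial>lborel) = 0" for n
    unfolding F_def using lborel_integral_translation[OF k] lborel_integrable_translation[OF k_int] k_int by simp
  have "(\<lambda>n. \<integral>x. F n x \<partial>lborel) \<longlonglongrightarrow> (\<integral>x. D x \<partial>lborel)"
  proof (rule integral_dominated_convergence)
    \<comment> \<open>The steps \<open>h n\<close> are at most 1, so all difference quotients vanish
      outside the ball of radius \<open>R + 1\<close>.\<close>
    show "integrable lborel (\<lambda>x. M * indicator (cball (0::'a) (R + 1)) x)"
      using emeasure_bounded_finite[of "cball (0::'a) (R + 1)"] by simp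
    show "AE x in lborel. (\<lambda>n. F n x) \<longlonglongrightarrow> D x"
    proof (rule AE_I2)
      fix x
      have "(\<lambda>t. (k (x + t *\<^sub>R i) - k x) / t) \<midarrow>0\<rightarrow> D x"
        using deriv[of x] by (simp add: has_field_derivative_iff)
      from tendsto_at_iff_sequentially[THEN iffD1, OF this, rule_format, of h]
      show "(\<lambda>n. F n x) \<longlonglongrightarrow> D x"
        using h h0 by (simp add: F_def comp_def add.commute less_imp_neq[symmetric])
    qed
    show "AE x in lborel. norm (F n x) \<le> M * indicator (cball 0 (R + 1)) x" for n
    proof (rule AE_I2)
      fix x
      show "norm (F n x) \<le> M * indicator (cball 0 (R + 1)) x"
      proof (cases "x \<in> cball 0 (R + 1)")
        case True
        have "\<bar>k (h n *\<^sub>R i + x) - k x\<bar> \<le> M * h n" using lip[of x "h n"] h[of n] by (simp add: add.commute)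
        then show ?thesis using True h[of n] by (simp add: F_def divide_le_eq)
      next
        case False
        have "norm (x + h n *\<^sub>R i) \<ge> norm x - h n"
          using norm_triangle_ineq4[of "x + h n *\<^sub>R i" "h n *\<^sub>R i"] h[of n] i by simp
        then have "h n *\<^sub>R i + x \<notin> cball 0 R" "x \<notin> cball 0 R" using False h[of n] by (auto simp: add.commute)
        then show ?thesis using supp False by (simp add: F_def)
      qed
    qed
  qed auto
  then show ?thesis by (simp add: F0 LIMSEQ_const_iff)
qed

text \<open>Source of the explicit weak derivatives below. The product of v with a test function
  \<phi>, extended by 0, is differentiable along \<open>i\<close> at every point of the space,
  because \<phi> vanishes near each point outside \<open>S\<close>; hence its derivative has
  integral 0.\<close>

proposition has_weak_partial_if_directional_derivative:
  fixes v g :: "'a::euclidean_space \<Rightarrow> real"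
  assumes S: "open S" "bounded S" and i: "i \<in> Basis"
    and [measurable]: "v \<in> borel_measurable borel" "g \<in> borel_measurable borel"
    and bd: "\<And>x. x \<in> S \<Longrightarrow> \<bar>v x\<bar> \<le> B" "\<And>x. x \<in> S \<Longrightarrow> \<bar>g x\<bar> \<le> B'"
    and deriv: "\<And>x. x \<in> S \<Longrightarrow> ((\<lambda>t. v (x + t *\<^sub>R i)) has_real_derivative g x) (at 0)"
  shows "has_weak_partial S i v g"
  unfolding has_weak_partial_def
proof
  fix \<phi> assume \<phi>: "\<phi> \<in> test_functions S"
  define \<phi>' where "\<phi>' x = frechet_derivative \<phi> (at x) i" for x
  have \<phi>': "\<phi>' \<in> test_functions S" unfolding \<phi>'_def by (rule test_function_partial[OF \<phi> i])
  obtain K where K: "compact K" "K \<subseteq> S" "\<And>x. x \<notin> K \<Longrightarrow> \<phi> x = 0" "\<And>k. Ck k \<phi>"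
    using \<phi> by (rule test_functionE) blast
  obtain K' where K': "compact K'" "K' \<subseteq> S" "\<And>x. x \<notin> K' \<Longrightarrow> \<phi>' x = 0" using \<phi>' by (rule test_functionE) blast
  obtain A where A: "0 < A" "\<And>x. \<bar>\<phi> x\<bar> \<le> A" using test_function_bounded[OF \<phi>] by blast
  obtain A' where A': "0 < A'" "\<And>x. \<bar>\<phi>' x\<bar> \<le> A'" using test_function_bounded[OF \<phi>'] by blast
  have [measurable]: "\<phi> \<in> borel_measurable borel" "\<phi>' \<in> borel_measurable borel"
    by (rule borel_measurable_continuous_onI test_function_continuous \<phi> \<phi>')+
  have [measurable]: "S \<in> sets borel" using S by simp
  obtain R where "\<And>x. x \<in> S \<Longrightarrow> norm x \<le> R" using S(2) by (auto simp: bounded_iff)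
  then have R: "S \<subseteq> cball 0 R" by auto
  define k where "k x = indicator S x * (v x * \<phi> x)" for x
  define D where "D x = indicator S x * (g x * \<phi> x + v x * \<phi>' x)" for x
  have "(\<integral>x. D x \<partial>lborel) = 0"
  proof (rule integral_directional_derivative_eq_0)
    show "k \<in> borel_measurable borel" "D \<in> borel_measurable borel" unfolding k_def D_def by measurable
    show "k x = 0" if "x \<notin> cball 0 R" for x using that R by (auto simp: k_def indicator_def)
    show "norm i = 1" using i by simp
    show "\<bar>k x\<bar> \<le> \<bar>B\<bar> * A" for x
    proof (cases "x \<in> S")
      case True
      have "\<bar>v x\<bar> * \<bar>\<phi> x\<bar> \<le> \<bar>B\<bar> * A"
        using bd(1)[OF True] A by (intro mult_mono) auto
      then show ?thesis using True by (simp add: k_def abs_mult)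
    qed (use A in \<open>simp add: k_def\<close>)
    show "\<bar>D x\<bar> \<le> \<bar>B'\<bar> * A + \<bar>B\<bar> * A'" for x
    proof (cases "x \<in> S")
      case True
      have "\<bar>v x\<bar> * \<bar>\<phi>' x\<bar> \<le> \<bar>B\<bar> * A'" "\<bar>g x\<bar> * \<bar>\<phi> x\<bar> \<le> \<bar>B'\<bar> * A"
        using bd(1)[OF True] bd(2)[OF True] A A' by (auto intro!: mult_mono)
      then show ?thesis using True abs_triangle_ineq[of "g x * \<phi> x" "v x * \<phi>' x"]
        by (simp add: D_def abs_mult)
    qed (use A A' in \<open>simp add: D_def\<close>)
    fix x
    have lim: "((\<lambda>t. x + t *\<^sub>R i) \<longlongrightarrow> x) (nhds 0)"
    proof -
      have "((\<lambda>t. x + t *\<^sub>R i) \<longlongrightarrow> x + 0 *\<^sub>R i) (nhds 0)"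
        by (intro tendsto_intros filterlim_ident)
      then show ?thesis by simp
    qed
    show "((\<lambda>t. k (x + t *\<^sub>R i)) has_real_derivative D x) (at 0)"
    proof (cases "x \<in> S")
      case True
      have ev: "\<forall>\<^sub>F t in nhds 0. k (x + t *\<^sub>R i) = v (x + t *\<^sub>R i) * \<phi> (x + t *\<^sub>R i)"
        using topological_tendstoD[OF lim S(1) True] by eventually_elim (simp add: k_def)
      have "((\<lambda>t. \<phi> (x + t *\<^sub>R i)) has_derivative (\<lambda>t. frechet_derivative \<phi> (at (x + 0 *\<^sub>R i)) (t *\<^sub>R i))) (at 0)"
      proof (rule has_derivative_compose[where f="\<lambda>t. x + t *\<^sub>R i"])
        show "((\<lambda>t. x + t *\<^sub>R i) has_derivative (\<lambda>t. t *\<^sub>R i)) (at 0)"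
          by (auto intro!: derivative_eq_intros)
        show "(\<phi> has_derivative frechet_derivative \<phi> (at (x + 0 *\<^sub>R i))) (at (x + 0 *\<^sub>R i))"
          by (rule Ck_SucD(1)[OF K(4)])
      qed
      moreover have "frechet_derivative \<phi> (at x) (t *\<^sub>R i) = \<phi>' x * t" for t
        using linear_scale[OF has_derivative_linear[OF Ck_SucD(1)[OF K(4)]]] by (simp add: \<phi>'_def)
      ultimately have "((\<lambda>t. \<phi> (x + t *\<^sub>R i)) has_real_derivative \<phi>' x) (at 0)"
        by (simp add: has_field_derivative_def)
      from DERIV_mult[OF deriv[OF True] this]
      have "((\<lambda>t. v (x + t *\<^sub>R i) * \<phi> (x + t *\<^sub>R i)) has_real_derivative D x) (at 0)"
        using True by (simp add: D_def mult.commute add.commute)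
      then show ?thesis by (subst DERIV_cong_ev[OF refl ev refl])
    next
      case False
      have "open (- K)" "x \<in> - K" using K(1,2) False by (auto simp: compact_imp_closed open_Compl)
      from topological_tendstoD[OF lim this]
      have ev: "\<forall>\<^sub>F t in nhds 0. k (x + t *\<^sub>R i) = 0" by eventually_elim (simp add: k_def K(3))
      have "D x = 0" using False by (simp add: D_def)
      then show ?thesis by (subst DERIV_cong_ev[OF refl ev refl]) simp
    qed
  qed
  moreover have "(\<integral>x. D x \<partial>lborel) = (\<integral>x. g x * \<phi> x + v x * \<phi>' x \<partial>lebesgue_on S)"
    unfolding D_def by (rule lebesgue_on_integral_eq_lborel[symmetric]) auto
  moreover have "(\<integral>x. g x * \<phi> x + v x * \<phi>' x \<partial>lebesgue_on S)
      = (\<integral>x. g x * \<phi> x \<partial>lebesgue_on S) + (\<integral>x. v x * \<phi>' x \<partial>lebesgue_on S)"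
  proof (rule Bochner_Integration.integral_add)
    have Sm: "S \<in> lmeasurable" using S by (auto intro: lmeasurable_open)
    show "integrable (lebesgue_on S) (\<lambda>x. g x * \<phi> x)"
      by (rule Lsq_integrable_mult[OF Lsq_bounded(1)[OF Sm borel_imp_measurable_lebesgue_on bd(2)] test_function_in_Lsq[OF \<phi> Sm]]) auto
    show "integrable (lebesgue_on S) (\<lambda>x. v x * \<phi>' x)"
      by (rule Lsq_integrable_mult[OF Lsq_bounded(1)[OF Sm borel_imp_measurable_lebesgue_on bd(1)] test_function_in_Lsq[OF \<phi>' Sm]]) auto
  qed
  ultimately show "(\<integral>x. v x * frechet_derivative \<phi> (at x) i \<partial>lebesgue_on S) = - (\<integral>x. g x * \<phi> x \<partial>lebesgue_on S)"
    by (simp add: \<phi>'_def)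
qed

section \<open>Almost everywhere inequalities from test integrals\<close>

lemma set_integral_lebesgue_on:
  fixes f :: "'a::euclidean_space \<Rightarrow> real"
  assumes "T \<in> sets lebesgue"
  shows "(LINT x:T|lebesgue. f x) = (\<integral>x. f x \<partial>lebesgue_on T)"
  using assms by (simp add: set_lebesgue_integral_def integral_restrict_space)

lemma set_integrable_lebesgue_on:
  fixes f :: "'a::euclidean_space \<Rightarrow> real"
  assumes "T \<in> sets lebesgue"
  shows "set_integrable lebesgue T f \<longleftrightarrow> integrable (lebesgue_on T) f"
  using assms by (simp add: set_integrable_def integrable_restrict_space)

text \<open>Up to a null set, an open set is a countable disjoint union of open boxes whose closures
  it contains.\<close>

lemma open_integral_nonneg_if_box_integrals_nonneg:
  fixes h :: "'a::euclidean_space \<Rightarrow> real"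
  assumes U: "open U" "bounded U" and int: "integrable (lebesgue_on U) h"
    and box: "\<And>a b. cbox a b \<subseteq> U \<Longrightarrow> 0 \<le> (\<integral>x. h x \<partial>lebesgue_on (box a b))"
  shows "0 \<le> (\<integral>x. h x \<partial>lebesgue_on U)"
proof (cases "U = {}")
  case False
  obtain a where a: "U \<subseteq> box (- a) a" using bounded_subset_box_symmetric[OF U(2)] by blast
  \<comment> \<open>This gauge confines to \<open>U\<close> every tile of the covering that has its
    tag in \<open>U\<close>.\<close>
  define g where "g x = (if x \<in> U then U else UNIV)" for x
  have g: "gauge g" using U(1) by (auto simp: gauge_def g_def)
  have a1: "U \<subseteq> cbox (- a) a" using a box_subset_cbox by blast
  have a2: "box (- a) a \<noteq> {}" using a False by blast
  obtain \<D> where D: "countable \<D>" "\<And>K. K \<in> \<D> \<Longrightarrow> interior K \<noteq> {} \<and> (\<exists>c d. K = cbox c d)"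
    "pairwise (\<lambda>A B. interior A \<inter> interior B = {}) \<D>" "\<And>K. K \<in> \<D> \<Longrightarrow> \<exists>x \<in> U \<inter> K. K \<subseteq> g x" "U \<subseteq> \<Union>\<D>"
    by (rule covering_lemma[OF a1 a2 g]) (rule that)
  have KU: "K \<subseteq> U" if "K \<in> \<D>" for K using D(4)[OF that] by (auto simp: g_def)
  define A where "A n = (if n \<in> to_nat_on \<D> ` \<D> then interior (from_nat_into \<D> n) else {})" for n
  have A_cases: "A n = {} \<or> (\<exists>c d. A n = box c d \<and> cbox c d \<subseteq> U)" for n
  proof (cases "n \<in> to_nat_on \<D> ` \<D>")
    case True
    then obtain K where K: "K \<in> \<D>" "n = to_nat_on \<D> K" by blast
    then have "A n = interior K" using D(1) by (simp add: A_def)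
    then show ?thesis using D(2)[OF K(1)] KU[OF K(1)] by (metis interior_cbox)
  qed (simp add: A_def)
  have A_open: "open (A n)" for n by (simp add: A_def)
  have A_sets: "A n \<in> sets lebesgue" for n using A_open by simp
  have A_sub: "A n \<subseteq> U" for n using A_cases[of n] box_subset_cbox by blast
  have disj: "disjoint_family A"
    unfolding disjoint_family_on_def
  proof (intro ballI impI)
    fix m n :: nat assume "m \<noteq> n"
    show "A m \<inter> A n = {}"
    proof (cases "m \<in> to_nat_on \<D> ` \<D> \<and> n \<in> to_nat_on \<D> ` \<D>")
      case True
      then obtain K L where KL: "K \<in> \<D>" "m = to_nat_on \<D> K" "L \<in> \<D>" "n = to_nat_on \<D> L" by blast
      then have "K \<noteq> L" using \<open>m \<noteq> n\<close> by blast
      then have "interior K \<inter> interior L = {}" using D(3) KL unfolding pairwise_def by blast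
      then show ?thesis using KL D(1) by (simp add: A_def)
    qed (auto simp: A_def)
  qed
  have U_sets: "U \<in> sets lebesgue" using U by simp
  have intT: "integrable (lebesgue_on T) h" if "T \<subseteq> U" "T \<in> sets lebesgue" for T
    by (rule integrable_lebesgue_on_subset[OF int that U_sets])
  define B where "B n = (\<Union>k<n. A k)" for n
  have B_sets: "B n \<in> sets lebesgue" for n unfolding B_def using A_sets by auto
  have "0 \<le> (LINT x:B n|lebesgue. h x)" for n
  proof -
    have "(LINT x:B n|lebesgue. h x) = (\<Sum>k<n. LINT x:A k|lebesgue. h x)"
      unfolding B_def
      by (rule set_integral_finite_Union)
        (use disj A_sets A_sub intT in \<open>auto simp: disjoint_family_on_def set_integrable_lebesgue_on\<close>)
    also have "\<dots> \<ge> 0"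
    proof (rule sum_nonneg)
      fix k
      show "0 \<le> (LINT x:A k|lebesgue. h x)"
        unfolding set_integral_lebesgue_on[OF A_sets] using A_cases[of k] box by auto
    qed
    finally show ?thesis .
  qed
  moreover have "(\<lambda>n. LINT x:B n|lebesgue. h x) \<longlonglongrightarrow> (LINT x:(\<Union>n. B n)|lebesgue. h x)"
  proof (rule set_integral_cont_up[OF B_sets])
    show "incseq B" unfolding B_def by (intro incseq_SucI UN_mono) auto
    show "set_integrable lebesgue (\<Union>n. B n) h"
      using B_sets A_sub by (subst set_integrable_lebesgue_on) (auto intro!: intT simp: B_def)
  qed
  ultimately have "0 \<le> (LINT x:(\<Union>n. B n)|lebesgue. h x)" by (intro LIMSEQ_le_const) auto
  also have "(LINT x:(\<Union>n. B n)|lebesgue. h x) = (LINT x:U|lebesgue. h x)"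
  proof (rule set_integral_cong_set)
    have "set_integrable lebesgue U h" "set_integrable lebesgue (\<Union>n. B n) h"
      using B_sets A_sub U_sets int by (auto simp: set_integrable_lebesgue_on B_def intro!: intT)
    then show "set_borel_measurable lebesgue U h" "set_borel_measurable lebesgue (\<Union>n. B n) h"
      unfolding set_integrable_def set_borel_measurable_def by (auto dest: borel_measurable_integrable)
    \<comment> \<open>The open tiles miss only the frontiers of the tiles, countably many null
      sets.\<close>
    define N where "N = (\<Union>K\<in>\<D>. frontier K)"
    have "negligible (frontier K)" if "K \<in> \<D>" for K
      using D(2)[OF that] by (auto intro!: negligible_convex_frontier)
    then have "negligible N" unfolding N_def by (intro negligible_countable_Union) (use D(1) in auto)
    then have "AE x in lebesgue. x \<notin> N" by (simp add: AE_not_in negligible_iff_null_sets)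
    then show "AE x in lebesgue. x \<in> U \<longleftrightarrow> x \<in> (\<Union>n. B n)"
    proof eventually_elim
      case (elim x)
      have "x \<in> (\<Union>n. B n)" if x: "x \<in> U"
      proof -
        obtain K where K: "K \<in> \<D>" "x \<in> K" using D(5) x by blast
        have "x \<in> interior K"
          using elim K closure_subset[of K] by (auto simp: N_def frontier_def)
        then have "x \<in> A (to_nat_on \<D> K)" using K D(1) by (simp add: A_def)
        then show ?thesis by (auto simp: B_def)
      qed
      moreover have "x \<in> U" if "x \<in> (\<Union>n. B n)" using that A_sub by (auto simp: B_def)
      ultimately show ?case by blast
    qed
  qed
  also have "\<dots> = (\<integral>x. h x \<partial>lebesgue_on U)" by (rule set_integral_lebesgue_on[OF U_sets])
  finally show ?thesis .
qed simp

text \<open>The set A where h < 0 is enclosed in open sets U such that U - A has measure at most e.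
  The integral over U is nonnegative, and the part over U - A is at most sqrt e times the norm of h.
  So the integral over A is nonnegative as well, which forces A to be null.\<close>

lemma AE_nonneg_if_box_integrals_nonneg:
  fixes h :: "'a::euclidean_space \<Rightarrow> real"
  assumes S: "open S" "bounded S" and h: "h \<in> Lsq S"
    and box: "\<And>a b. cbox a b \<subseteq> S \<Longrightarrow> 0 \<le> (\<integral>x. h x \<partial>lebesgue_on (box a b))"
  shows "AE x in lebesgue_on S. 0 \<le> h x"
proof -
  have Sm: "S \<in> lmeasurable" "S \<in> sets lebesgue" using S by (auto intro: lmeasurable_open)
  have int: "integrable (lebesgue_on S) h" by (rule Lsq_integrable(1)[OF Sm(1) h])
  define A where "A = {x \<in> S. h x < 0}"
  have "A \<in> sets (lebesgue_on S)"
    using borel_measurable_less[OF LsqD(1)[OF h] borel_measurable_const[of 0]]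
    by (simp add: A_def)
  then have A: "A \<in> sets lebesgue" "A \<subseteq> S" using Sm by (auto simp: sets_restrict_space_iff A_def)
  have lower: "- (sqrt e * Lsq_norm S h) \<le> (\<integral>x. h x \<partial>lebesgue_on A)" if "e > 0" for e
  proof -
    obtain T where T: "open T" "A \<subseteq> T" "T - A \<in> lmeasurable" "emeasure lebesgue (T - A) < ennreal e"
      using sets_lebesgue_outer_open[OF A(1) \<open>e > 0\<close>] by blast
    define U where "U = T \<inter> S"
    have U: "open U" "bounded U" "U \<subseteq> S" "A \<subseteq> U" "U \<in> sets lebesgue"
      using T S A by (auto simp: U_def bounded_Int)
    define D where "D = U - A"
    have D: "D \<in> sets lebesgue" "D \<subseteq> S" "D \<subseteq> T - A" using U A by (auto simp: D_def U_def)
    have Dm: "D \<in> lmeasurable" by (rule fmeasurableI2[OF T(3) D(3,1)])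
    have intT: "integrable (lebesgue_on X) h" if "X \<subseteq> S" "X \<in> sets lebesgue" for X
      by (rule integrable_lebesgue_on_subset[OF int that Sm(2)])
    have "measure lebesgue D \<le> measure lebesgue (T - A)"
      by (rule measure_mono_fmeasurable[OF D(3,1) T(3)])
    also have "\<dots> \<le> e" using T(4) \<open>e > 0\<close> T(3)
      by (simp add: emeasure_eq_measure2 ennreal_less_iff)
    finally have mD: "measure lebesgue D \<le> e" .
    have "0 \<le> (\<integral>x. h x \<partial>lebesgue_on U)"
      by (rule open_integral_nonneg_if_box_integrals_nonneg[OF U(1,2) intT[OF U(3,5)]]) (use U(3) box in blast)
    also have "\<dots> = (LINT x:A \<union> D|lebesgue. h x)"
      using U set_integral_lebesgue_on[OF U(5)] by (simp add: D_def Un_absorb1)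
    also have "\<dots> = (LINT x:A|lebesgue. h x) + (LINT x:D|lebesgue. h x)"
      by (rule set_integral_Un) (use A D intT in \<open>auto simp: set_integrable_lebesgue_on D_def\<close>)
    also have "\<dots> = (\<integral>x. h x \<partial>lebesgue_on A) + (\<integral>x. h x \<partial>lebesgue_on D)"
      by (simp add: set_integral_lebesgue_on A D)
    also have "(\<integral>x. h x \<partial>lebesgue_on D) \<le> sqrt e * Lsq_norm S h"
    proof -
      note hD = Lsq_subset[OF h D(2,1) Sm(2)]
      have "(\<integral>x. h x \<partial>lebesgue_on D) \<le> (\<integral>x. \<bar>h x\<bar> \<partial>lebesgue_on D)"
        using intT[OF D(2,1)] by (intro integral_mono) auto
      also have "\<dots> \<le> sqrt (measure lebesgue D) * Lsq_norm D h" by (rule Lsq_integrable(2)[OF Dm hD(1)])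
      also have "\<dots> \<le> sqrt e * Lsq_norm S h" using mD hD(2) \<open>e > 0\<close> by (intro mult_mono) auto
      finally show ?thesis .
    qed
    finally show ?thesis by simp
  qed
  have "0 \<le> (\<integral>x. h x \<partial>lebesgue_on A)"
  proof (rule tendsto_upperbound)
    have "((\<lambda>e. - (sqrt e * Lsq_norm S h)) \<longlongrightarrow> - (sqrt 0 * Lsq_norm S h)) (at_right 0)"
      by (intro tendsto_intros)
    then show "((\<lambda>e. - (sqrt e * Lsq_norm S h)) \<longlongrightarrow> 0) (at_right 0)" by simp
    show "\<forall>\<^sub>F e in at_right 0. - (sqrt e * Lsq_norm S h) \<le> (\<integral>x. h x \<partial>lebesgue_on A)"
      using lower by (auto simp: eventually_at_filter)
  qed simp
  moreover have intA: "integrable (lebesgue_on A) (\<lambda>x. - h x)"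
    using integrable_lebesgue_on_subset[OF int A(2,1) Sm(2)] by simp
  moreover have nn: "AE x in lebesgue_on A. 0 \<le> - h x" by (rule AE_I2) (simp add: A_def)
  ultimately have "(\<integral>x. - h x \<partial>lebesgue_on A) = 0"
    using integral_nonneg_AE[OF nn] by simp
  then have "AE x in lebesgue_on A. - h x = 0"
    using integral_nonneg_eq_0_iff_AE[OF intA nn] by simp
  then have "AE x in lebesgue. x \<in> A \<longrightarrow> - h x = 0" using A by (simp add: AE_restrict_space_iff)
  then have "AE x in lebesgue. x \<in> S \<longrightarrow> 0 \<le> h x" by eventually_elim (auto simp: A_def)
  then show ?thesis using Sm by (simp add: AE_restrict_space_iff)
qed

text \<open>Dominated convergence, for an abstract sequence \<psi> so that it serves both ordinary
  and tensor product test functions.\<close>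

lemma box_integral_nonneg_by_approximation:
  fixes h :: "'a::euclidean_space \<Rightarrow> real" and \<psi> :: "nat \<Rightarrow> 'a \<Rightarrow> real"
  assumes S: "open S" "bounded S" "T \<subseteq> S" "T \<in> sets lebesgue" and h: "h \<in> Lsq S"
    and \<psi>: "\<And>n. continuous_on UNIV (\<psi> n)" "\<And>n x. 0 \<le> \<psi> n x" "\<And>n x. \<psi> n x \<le> 1"
    "\<And>n x. x \<notin> T \<Longrightarrow> \<psi> n x = 0" "\<And>x. x \<in> T \<Longrightarrow> (\<lambda>n. \<psi> n x) \<longlonglongrightarrow> 1"
    and nn: "\<And>n. 0 \<le> (\<integral>x. h x * \<psi> n x \<partial>lebesgue_on S)"
  shows "0 \<le> (\<integral>x. h x \<partial>lebesgue_on T)"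
proof -
  have Sm: "S \<in> lmeasurable" "S \<in> sets lebesgue" using S by (auto intro: lmeasurable_open)
  have int: "integrable (lebesgue_on S) h" by (rule Lsq_integrable(1)[OF Sm(1) h])
  have [measurable]: "\<psi> n \<in> borel_measurable (lebesgue_on S)" for n
    by (rule continuous_on_imp_measurable_lebesgue_on[OF \<psi>(1)])
  have [measurable]: "h \<in> borel_measurable (lebesgue_on S)" by (rule LsqD(1)[OF h])
  have "(\<lambda>n. \<integral>x. h x * \<psi> n x \<partial>lebesgue_on S) \<longlonglongrightarrow> (\<integral>x. (if x \<in> T then h x else 0) \<partial>lebesgue_on S)"
  proof (rule integral_dominated_convergence)
    show "integrable (lebesgue_on S) (\<lambda>x. \<bar>h x\<bar>)" using int by simp
    show "(\<lambda>x. if x \<in> T then h x else 0) \<in> borel_measurable (lebesgue_on S)"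
      by (subst borel_measurable_if_lebesgue_on[OF S(4) Sm(2) S(3)])
        (rule measurable_restrict_mono[OF _ S(3)], measurable)
    show "AE x in lebesgue_on S. (\<lambda>n. h x * \<psi> n x) \<longlonglongrightarrow> (if x \<in> T then h x else 0)"
    proof (rule AE_I2)
      fix x
      show "(\<lambda>n. h x * \<psi> n x) \<longlonglongrightarrow> (if x \<in> T then h x else 0)"
        using tendsto_mult[OF tendsto_const \<psi>(5), of x "h x"] \<psi>(4)[of x] by (cases "x \<in> T") auto
    qed
    show "AE x in lebesgue_on S. norm (h x * \<psi> n x) \<le> \<bar>h x\<bar>" for n
    proof (rule AE_I2)
      fix x
      have "\<bar>h x\<bar> * \<bar>\<psi> n x\<bar> \<le> \<bar>h x\<bar> * 1" using \<psi>(2,3)[of n x] by (intro mult_left_mono) auto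
      then show "norm (h x * \<psi> n x) \<le> \<bar>h x\<bar>" by (simp add: abs_mult)
    qed
  qed measurable
  then have "0 \<le> (\<integral>x. (if x \<in> T then h x else 0) \<partial>lebesgue_on S)"
    by (rule LIMSEQ_le_const) (use nn in auto)
  then show ?thesis using Lebesgue_Measure.integral_restrict[OF S(3,4) Sm(2), of h] by simp
qed

lemma AE_nonneg_if_test_integrals_nonneg:
  fixes h :: "'a::euclidean_space \<Rightarrow> real"
  assumes S: "open S" "bounded S" and h: "h \<in> Lsq S"
    and nn: "\<And>a b \<phi>. cbox a b \<subseteq> S \<Longrightarrow> \<phi> \<in> test_functions (box a b) \<Longrightarrow> (\<And>x. 0 \<le> \<phi> x) \<Longrightarrow>
      0 \<le> (\<integral>x. h x * \<phi> x \<partial>lebesgue_on S)"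
  shows "AE x in lebesgue_on S. 0 \<le> h x"
proof (rule AE_nonneg_if_box_integrals_nonneg[OF S h])
  fix a b assume ab: "cbox a b \<subseteq> S"
  obtain \<psi> :: "nat \<Rightarrow> 'a \<Rightarrow> real" where \<psi>: "\<And>n. \<psi> n \<in> test_functions (box a b)" "\<And>n x. 0 \<le> \<psi> n x"
    "\<And>n x. \<psi> n x \<le> 1" "\<And>x. x \<in> box a b \<Longrightarrow> (\<lambda>n. \<psi> n x) \<longlonglongrightarrow> 1"
    using open_exhaustion_by_test_functions[OF open_box] by blast
  have "box a b \<subseteq> S" using ab box_subset_cbox by blast
  then show "0 \<le> (\<integral>x. h x \<partial>lebesgue_on (box a b))"
  proof (rule box_integral_nonneg_by_approximation[OF S _ _ h, of _ \<psi>])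
    show "\<psi> n x = 0" if "x \<notin> box a b" for n x
      using \<psi>(1)[of n] by (rule test_functionE) (use that in blast)
  qed (use \<psi>(2-4) nn[OF ab \<psi>(1,2)] test_function_continuous[OF \<psi>(1)] in auto)
qed

text \<open>Products A(x) B(y) suffice because they approximate the indicator of a box. They are the
  right test functions for \<open>strip_average_Poincare\<close>, where an antiderivative is taken
  in y alone.\<close>

lemma AE_nonneg_if_tensor_integrals_nonneg:
  fixes h :: "real \<times> real \<Rightarrow> real"
  assumes S: "open S" "bounded S" and h: "h \<in> Lsq S"
    and nn: "\<And>a b c d A B. {a..b} \<times> {c..d} \<subseteq> S \<Longrightarrow> A \<in> test_functions {a<..<b} \<Longrightarrow> B \<in> test_functions {c<..<d} \<Longrightarrow>
      (\<And>x. 0 \<le> A x) \<Longrightarrow> (\<And>x. 0 \<le> B x) \<Longrightarrow> 0 \<le> (\<integral>z. h z * (A (fst z) * B (snd z)) \<partial>lebesgue_on S)"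
  shows "AE z in lebesgue_on S. 0 \<le> h z"
proof (rule AE_nonneg_if_box_integrals_nonneg[OF S h])
  fix p q :: "real \<times> real" assume pq: "cbox p q \<subseteq> S"
  define a b c d where "a = fst p" and "b = fst q" and "c = snd p" and "d = snd q"
  have eq: "p = (a, c)" "q = (b, d)" by (auto simp: a_def b_def c_def d_def)
  have sub: "{a..b} \<times> {c..d} \<subseteq> S" using pq by (simp add: eq cbox_Pair_eq)
  have bx: "box p q = {a<..<b} \<times> {c<..<d}"
    by (auto simp: eq mem_box Basis_prod_def)
  obtain A :: "nat \<Rightarrow> real \<Rightarrow> real" where A: "\<And>n. A n \<in> test_functions {a<..<b}" "\<And>n x. 0 \<le> A n x"
    "\<And>n x. A n x \<le> 1" "\<And>x. x \<in> {a<..<b} \<Longrightarrow> (\<lambda>n. A n x) \<longlonglongrightarrow> 1"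
    using open_exhaustion_by_test_functions[OF open_greaterThanLessThan] by blast
  obtain B :: "nat \<Rightarrow> real \<Rightarrow> real" where B: "\<And>n. B n \<in> test_functions {c<..<d}" "\<And>n x. 0 \<le> B n x"
    "\<And>n x. B n x \<le> 1" "\<And>x. x \<in> {c<..<d} \<Longrightarrow> (\<lambda>n. B n x) \<longlonglongrightarrow> 1"
    using open_exhaustion_by_test_functions[OF open_greaterThanLessThan] by blast
  have zA: "A n x = 0" if "x \<notin> {a<..<b}" for n x
    using A(1)[of n] by (rule test_functionE) (use that in blast)
  have zB: "B n x = 0" if "x \<notin> {c<..<d}" for n x
    using B(1)[of n] by (rule test_functionE) (use that in blast)
  have "box p q \<subseteq> S" using pq box_subset_cbox by blast
  then show "0 \<le> (\<integral>x. h x \<partial>lebesgue_on (box p q))"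
  proof (rule box_integral_nonneg_by_approximation[OF S _ _ h, of _ "\<lambda>n z. A n (fst z) * B n (snd z)"])
    show "continuous_on UNIV (\<lambda>z. A n (fst z) * B n (snd z))" for n
      by (intro continuous_on_mult continuous_on_compose2[OF test_function_continuous[OF A(1)]]
          continuous_on_compose2[OF test_function_continuous[OF B(1)]] continuous_intros) auto
    show "0 \<le> A n (fst z) * B n (snd z)" for n z using A B by simp
    show "A n (fst z) * B n (snd z) \<le> 1" for n z using A B by (intro mult_le_one) auto
    show "A n (fst z) * B n (snd z) = 0" if "z \<notin> box p q" for n z
      using that zA[of "fst z" n] zB[of "snd z" n] unfolding bx by (cases z) auto
    show "(\<lambda>n. A n (fst z) * B n (snd z)) \<longlonglongrightarrow> 1" if "z \<in> box p q" for z
    proof -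
      have "fst z \<in> {a<..<b}" "snd z \<in> {c<..<d}" using that unfolding bx by auto
      from tendsto_mult[OF A(4)[OF this(1)] B(4)[OF this(2)]] show ?thesis by simp
    qed
    show "0 \<le> (\<integral>z. h z * (A n (fst z) * B n (snd z)) \<partial>lebesgue_on S)" for n
      by (rule nn[OF sub A(1) B(1) A(2) B(2)])
  qed simp
qed

section \<open>Regions between two graphs\<close>

lemma measurable_lebesgue_cong_AE:
  fixes f g :: "'a::euclidean_space \<Rightarrow> real"
  assumes f: "f \<in> borel_measurable lebesgue" and ae: "AE x in lebesgue. f x = g x"
  shows "g \<in> borel_measurable lebesgue"
proof -
  have neg: "negligible {x. f x \<noteq> g x}"
    using ae by (simp add: negligible_iff_null_sets completion.AE_iff_null_sets)
  have "f measurable_on UNIV"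
    using f by (simp add: measurable_on_iff_borel_measurable lebesgue_on_UNIV_eq)
  from measurable_on_spike[OF this neg, of g] have "g measurable_on UNIV" by auto
  then show ?thesis by (simp add: measurable_on_iff_borel_measurable lebesgue_on_UNIV_eq)
qed

text \<open>Lebesgue measurable functions on the plane need not be measurable for the product of the
  one-dimensional Borel structures, so Fubini is applied to a Borel representative extended by
  0.\<close>

definition borel_rep :: "'a::euclidean_space set \<Rightarrow> ('a \<Rightarrow> real) \<Rightarrow> ('a \<Rightarrow> real) \<Rightarrow> bool" where
  "borel_rep S f f' \<longleftrightarrow> f' \<in> borel_measurable borel \<and> (\<forall>x. x \<notin> S \<longrightarrow> f' x = 0) \<and>
     (AE x in lborel. x \<in> S \<longrightarrow> f x = f' x)"

lemma borel_rep_exists: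
  assumes S: "S \<in> sets borel" and f: "f \<in> borel_measurable (lebesgue_on S)"
  obtains f' where "borel_rep S f f'"
proof -
  have "(\<lambda>x. if x \<in> S then f x else 0) \<in> borel_measurable lebesgue"
    by (rule borel_measurable_if_I[OF f]) (use S in simp)
  then obtain h where h: "h \<in> borel_measurable lborel" "AE x in lborel. (if x \<in> S then f x else 0) = h x"
    using completion_ex_borel_measurable_real by blast
  have [measurable]: "h \<in> borel_measurable borel" "S \<in> sets borel" using h S by auto
  have "borel_rep S f (\<lambda>x. indicator S x * h x)"
    unfolding borel_rep_def
  proof (intro conjI)
    show "AE x in lborel. x \<in> S \<longrightarrow> f x = indicator S x * h x"
      using h(2) by eventually_elim auto
  qed auto
  then show thesis by (rule that)
qed

lemma borel_rep_integral:
  assumes S: "S \<in> sets borel" and r: "borel_rep S f f'"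
  shows "f \<in> borel_measurable (lebesgue_on S)"
    "integrable (lebesgue_on S) f \<longleftrightarrow> integrable lborel f'"
    "(\<integral>x. f x \<partial>lebesgue_on S) = (\<integral>x. f' x \<partial>lborel)"
proof -
  have Sl: "S \<in> sets lebesgue" using S by simp
  have f'[measurable]: "f' \<in> borel_measurable borel" using r by (simp add: borel_rep_def)
  have f'l: "f' \<in> borel_measurable lebesgue" by (simp add: measurable_completion)
  have ae: "AE x in lebesgue. x \<in> S \<longrightarrow> f x = f' x"
    using r by (auto simp: borel_rep_def intro: AE_completion)
  have ae': "AE x in lebesgue. f' x = (if x \<in> S then f x else 0)"
    using ae by eventually_elim (use r in \<open>auto simp: borel_rep_def\<close>)
  show m: "f \<in> borel_measurable (lebesgue_on S)"
    by (rule borel_measurable_if_D[OF measurable_lebesgue_cong_AE[OF f'l ae']])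
  note m' = borel_measurable_if_I[OF m Sl]
  have "integrable (lebesgue_on S) f \<longleftrightarrow> integrable lebesgue (\<lambda>x. if x \<in> S then f x else 0)"
    using Lebesgue_Measure.integrable_restrict_UNIV[OF Sl] by blast
  also have "\<dots> \<longleftrightarrow> integrable lebesgue f'"
    using ae' by (intro integrable_cong_AE m' f'l) (auto elim: eventually_mono)
  also have "\<dots> \<longleftrightarrow> integrable lborel f'" by (rule integrable_completion) simp
  finally show "integrable (lebesgue_on S) f \<longleftrightarrow> integrable lborel f'" .
  have "(\<integral>x. f x \<partial>lebesgue_on S) = (\<integral>x. (if x \<in> S then f x else 0) \<partial>lebesgue)"
    using Lebesgue_Measure.integral_restrict_UNIV[OF Sl] by metis
  also have "\<dots> = (\<integral>x. f' x \<partial>lebesgue)"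
    using ae' by (intro integral_cong_AE m' f'l) (auto elim: eventually_mono)
  also have "\<dots> = (\<integral>x. f' x \<partial>lborel)" by (rule integral_completion) simp
  finally show "(\<integral>x. f x \<partial>lebesgue_on S) = (\<integral>x. f' x \<partial>lborel)" .
qed

lemma borel_rep_mult: "borel_rep S f f' \<Longrightarrow> borel_rep S g g' \<Longrightarrow> borel_rep S (\<lambda>x. f x * g x) (\<lambda>x. f' x * g' x)"
  by (auto simp: borel_rep_def elim: eventually_elim2)

lemma borel_rep_power2: "borel_rep S f f' \<Longrightarrow> borel_rep S (\<lambda>x. (f x)\<^sup>2) (\<lambda>x. (f' x)\<^sup>2)"
  unfolding power2_eq_square by (rule borel_rep_mult)

lemma borel_measurable_fst_compose:
  fixes q :: "real \<Rightarrow> real"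
  assumes "q \<in> borel_measurable borel"
  shows "(\<lambda>z::real \<times> real. q (fst z)) \<in> borel_measurable borel"
  by (rule measurable_compose[OF borel_measurable_continuous_onI assms]) (intro continuous_intros)

text \<open>Serves the oscillating domains and the limit domain with the same
  \<open>b\<^sub>0\<close> and \<open>H\<close>, so that the constants obtained here are uniform in
  \<epsilon>.\<close>

locale height_region =
  fixes b g :: "real \<Rightarrow> real" and b\<^sub>0 H :: real
  assumes open_region: "open (region b g)"
    and b0_pos: "0 < b\<^sub>0"
    and b_ge: "\<And>x. x \<in> {0<..<1} \<Longrightarrow> b\<^sub>0 \<le> b x"
    and g_nonneg: "\<And>x. x \<in> {0<..<1} \<Longrightarrow> 0 \<le> g x"
    and height_le: "\<And>x. x \<in> {0<..<1} \<Longrightarrow> b x + g x \<le> H"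
begin

abbreviation \<Omega> :: "(real \<times> real) set" where "\<Omega> \<equiv> region b g"
abbreviation VI :: "(real \<times> real \<Rightarrow> real) \<Rightarrow> real \<Rightarrow> real" where "VI \<equiv> vertical_integral b g"

lemma H_pos: "0 < H"
  using b_ge[of "1/2"] b0_pos g_nonneg[of "1/2"] height_le[of "1/2"] by simp

lemma mem_region: "(x, y) \<in> \<Omega> \<longleftrightarrow> x \<in> {0<..<1} \<and> - b x < y \<and> y < g x"
  by (auto simp: region_def)

lemma region_subset: "\<Omega> \<subseteq> {0<..<1} \<times> {-H<..<H}"
proof
  fix z assume "z \<in> \<Omega>"
  then obtain x y where z: "z = (x, y)" "x \<in> {0<..<1}" "- b x < y" "y < g x"
    by (cases z) (auto simp: mem_region)
  then show "z \<in> {0<..<1} \<times> {-H<..<H}"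
    using b_ge[of x] g_nonneg[of x] height_le[of x] b0_pos by auto
qed

lemma bounded_region: "bounded \<Omega>"
  by (rule bounded_subset[OF _ region_subset]) (intro bounded_Times bounded_Ioo)

lemma region_borel [measurable]: "\<Omega> \<in> sets borel"
  using open_region by simp

lemma region_lmeasurable: "\<Omega> \<in> lmeasurable" "\<Omega> \<in> sets lebesgue"
  using open_region bounded_region by (auto intro: lmeasurable_open)

lemma fst_region: "z \<in> \<Omega> \<Longrightarrow> fst z \<in> {0<..<1}"
  by (auto simp: region_def)

text \<open>A null set of abscissas lifts to a null set of vertical lines, so equality a.e. survives
  composition with \<open>fst\<close>.\<close>

lemma fst_rep:
  assumes q: "borel_rep {0<..<1} q q'"
  shows "borel_rep \<Omega> (\<lambda>z. q (fst z)) (\<lambda>z. indicator \<Omega> z * q' (fst z))"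
  unfolding borel_rep_def
proof (intro conjI)
  have [measurable]: "q' \<in> borel_measurable borel" using q by (simp add: borel_rep_def)
  have [measurable]: "(\<lambda>z::real \<times> real. q' (fst z)) \<in> borel_measurable borel"
    by (rule borel_measurable_fst_compose) simp
  show "(\<lambda>z. indicator \<Omega> z * q' (fst z)) \<in> borel_measurable borel" by measurable
  have "AE x in lborel. x \<in> {0<..<1} \<longrightarrow> q x = q' x" using q by (simp add: borel_rep_def)
  then obtain N where N: "N \<in> null_sets lborel" "{x. \<not> (x \<in> {0<..<1} \<longrightarrow> q x = q' x)} \<subseteq> N"
    by (auto simp: eventually_ae_filter)
  have "AE z::real \<times> real in lborel \<Otimes>\<^sub>M lborel. fst z \<notin> N"
  proof (rule lborel_pair.AE_pair_measure)
    have [measurable]: "N \<in> sets borel" using N by auto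
    show "{z::real \<times> real \<in> space (lborel \<Otimes>\<^sub>M lborel). fst z \<notin> N} \<in> sets (lborel \<Otimes>\<^sub>M lborel)" by measurable
    show "AE x in lborel. AE y::real in lborel. fst (x, y) \<notin> N"
      using AE_not_in[OF N(1)] by eventually_elim simp
  qed
  then have "AE z::real \<times> real in lborel. fst z \<notin> N" unfolding lborel_prod .
  then show "AE z in lborel. z \<in> \<Omega> \<longrightarrow> q (fst z) = indicator \<Omega> z * q' (fst z)"
  proof eventually_elim
    case (elim z)
    then show ?case using N(2) fst_region[of z] by auto
  qed
qed simp

lemma slice_length: "emeasure lborel {y. (x, y) \<in> \<Omega>} \<le> ennreal H"
proof (cases "x \<in> {0<..<1}")
  case True
  then have "{y. (x, y) \<in> \<Omega>} = {- b x<..<g x}" by (auto simp: mem_region)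
  moreover have "- b x \<le> g x" using True b_ge[of x] g_nonneg[of x] b0_pos by simp
  ultimately show ?thesis using height_le[OF True] by (auto intro!: ennreal_leI)
next
  case False
  then have "{y. (x, y) \<in> \<Omega>} = {}" by (auto simp: mem_region)
  then show ?thesis by simp
qed

lemma Lsq_fst:
  assumes q: "q \<in> Lsq {0<..<1}"
  shows "(\<lambda>z. q (fst z)) \<in> Lsq \<Omega>" "Lsq_norm \<Omega> (\<lambda>z. q (fst z)) \<le> sqrt H * Lsq_norm {0<..<1} q"
proof -
  obtain q' where r: "borel_rep {0<..<1} q q'"
    using borel_rep_exists[OF _ LsqD(1)[OF q]] by auto
  have [measurable]: "q' \<in> borel_measurable borel" using r by (simp add: borel_rep_def)
  have qm[measurable]: "(\<lambda>z::real \<times> real. q' (fst z)) \<in> borel_measurable borel"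
    by (rule borel_measurable_fst_compose) simp
  have mp: "(\<lambda>z. ennreal ((indicator \<Omega> z * q' (fst z))\<^sup>2)) \<in> borel_measurable (lborel \<Otimes>\<^sub>M lborel)"
    unfolding lborel_prod by simp
  note r2 = borel_rep_power2[OF fst_rep[OF r]]
  note B = borel_rep_integral[OF _ borel_rep_power2[OF r]]
  have int1: "integrable lborel (\<lambda>x. (q' x)\<^sup>2)" using B(2) LsqD(2)[OF q] by simp
  have I: "(\<integral>\<^sup>+ z. (indicator \<Omega> z * q' (fst z))\<^sup>2 \<partial>lborel) \<le> ennreal H * ennreal (\<integral>x. (q' x)\<^sup>2 \<partial>lborel)"
  proof -
    have "(\<integral>\<^sup>+ z. ennreal ((indicator \<Omega> z * q' (fst z))\<^sup>2) \<partial>lborel) = (\<integral>\<^sup>+ z. ennreal ((indicator \<Omega> z * q' (fst z))\<^sup>2) \<partial>(lborel \<Otimes>\<^sub>M lborel))"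
      by (simp add: lborel_prod)
    also have "\<dots> = (\<integral>\<^sup>+ x. \<integral>\<^sup>+ y. ennreal ((indicator \<Omega> (x, y) * q' x)\<^sup>2) \<partial>lborel \<partial>lborel)"
      by (subst lborel.nn_integral_fst[OF mp, symmetric]) simp
    also have "\<dots> = (\<integral>\<^sup>+ x. \<integral>\<^sup>+ y. ennreal ((q' x)\<^sup>2) * indicator {y. (x, y) \<in> \<Omega>} y \<partial>lborel \<partial>lborel)"
      by (intro nn_integral_cong) (auto simp: indicator_def)
    also have "\<dots> = (\<integral>\<^sup>+ x. ennreal ((q' x)\<^sup>2) * emeasure lborel {y. (x, y) \<in> \<Omega>} \<partial>lborel)"
      by (intro nn_integral_cong nn_integral_cmult_indicator) measurable
    also have "\<dots> \<le> (\<integral>\<^sup>+ x. ennreal ((q' x)\<^sup>2) * ennreal H \<partial>lborel)"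
      by (intro nn_integral_mono mult_left_mono slice_length) simp
    also have "\<dots> = ennreal H * (\<integral>\<^sup>+ x. ennreal ((q' x)\<^sup>2) \<partial>lborel)"
      by (subst mult.commute, rule nn_integral_cmult) measurable
    also have "(\<integral>\<^sup>+ x. ennreal ((q' x)\<^sup>2) \<partial>lborel) = ennreal (\<integral>x. (q' x)\<^sup>2 \<partial>lborel)"
      by (rule nn_integral_eq_integral[OF int1]) simp
    finally show ?thesis .
  qed
  have int2: "integrable lborel (\<lambda>z. (indicator \<Omega> z * q' (fst z))\<^sup>2)"
  proof (rule integrableI_bounded)
    show "(\<integral>\<^sup>+ z. ennreal (norm ((indicator \<Omega> z * q' (fst z))\<^sup>2)) \<partial>lborel) < \<infinity>"
      using le_less_trans[OF I] by (simp add: ennreal_mult_less_top)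
  qed measurable
  then have "integrable (lebesgue_on \<Omega>) (\<lambda>z. (q (fst z))\<^sup>2)"
    using borel_rep_integral(2)[OF region_borel r2] by simp
  then show "(\<lambda>z. q (fst z)) \<in> Lsq \<Omega>"
    using borel_rep_integral(1)[OF region_borel fst_rep[OF r]] by (simp add: Lsq_def)
  have "(\<integral>z. (indicator \<Omega> z * q' (fst z))\<^sup>2 \<partial>lborel) \<le> H * (\<integral>x. (q' x)\<^sup>2 \<partial>lborel)"
  proof -
    have "ennreal (\<integral>z. (indicator \<Omega> z * q' (fst z))\<^sup>2 \<partial>lborel) \<le> ennreal H * ennreal (\<integral>x. (q' x)\<^sup>2 \<partial>lborel)"
      using I nn_integral_eq_integral[OF int2] by simp
    then show ?thesis using H_pos by (simp add: ennreal_mult'[symmetric] ennreal_le_iff)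
  qed
  then have "(Lsq_norm \<Omega> (\<lambda>z. q (fst z)))\<^sup>2 \<le> H * (Lsq_norm {0<..<1} q)\<^sup>2"
    unfolding Lsq_norm_power2 using borel_rep_integral(3)[OF region_borel r2] B(3) by simp
  then have "sqrt ((Lsq_norm \<Omega> (\<lambda>z. q (fst z)))\<^sup>2) \<le> sqrt (H * (Lsq_norm {0<..<1} q)\<^sup>2)"
    by (rule real_sqrt_le_mono)
  then show "Lsq_norm \<Omega> (\<lambda>z. q (fst z)) \<le> sqrt H * Lsq_norm {0<..<1} q"
    by (simp add: real_sqrt_mult)
qed

lemma VI_rep:
  assumes r: "borel_rep \<Omega> f f'"
  shows "borel_rep {0<..<1} (VI f) (\<lambda>x. \<integral>y. f' (x, y) \<partial>lborel)"
  unfolding borel_rep_def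
proof (intro conjI allI impI)
  have [measurable]: "f' \<in> borel_measurable borel" using r by (simp add: borel_rep_def)
  have [measurable]: "f' \<in> borel_measurable (lborel \<Otimes>\<^sub>M lborel)"
    using \<open>f' \<in> borel_measurable borel\<close> unfolding lborel_prod by simp
  show "(\<lambda>x. \<integral>y. f' (x, y) \<partial>lborel) \<in> borel_measurable borel" by measurable
  show "(\<integral>y. f' (x, y) \<partial>lborel) = 0" if "x \<notin> {0<..<1}" for x
  proof -
    have "f' (x, y) = 0" for y using r that by (auto simp: borel_rep_def mem_region)
    then show ?thesis by simp
  qed
  have "AE z in lborel \<Otimes>\<^sub>M lborel. z \<in> \<Omega> \<longrightarrow> f z = f' z"
    using r unfolding lborel_prod by (simp add: borel_rep_def)
  from lborel_pair.AE_pair[OF this]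
  have "AE x in lborel. AE y in lborel. (x, y) \<in> \<Omega> \<longrightarrow> f (x, y) = f' (x, y)" .
  then show "AE x in lborel. x \<in> {0<..<1} \<longrightarrow> VI f x = (\<integral>y. f' (x, y) \<partial>lborel)"
  proof eventually_elim
    case (elim x)
    show ?case
    proof
      assume x: "x \<in> {0<..<1}"
      \<comment> \<open>\<open>vertical_integral\<close> runs over a closed interval whereas slices
        of the region are open; the two end points form a null set.\<close>
      have "AE y in lborel. y \<notin> {- b x, g x}" by (intro AE_not_in finite_imp_null_set_lborel) simp
      with elim have "AE y in lborel. y \<in> {- b x..g x} \<longrightarrow> f (x, y) = f' (x, y)"
        by eventually_elim (use x in \<open>auto simp: mem_region\<close>)
      moreover have "f' (x, y) = 0" if "y \<notin> {- b x..g x}" for y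
        using r that by (auto simp: borel_rep_def mem_region)
      moreover have "(\<lambda>y. f' (x, y)) \<in> borel_measurable borel" by measurable
      ultimately have "borel_rep {- b x..g x} (\<lambda>y. f (x, y)) (\<lambda>y. f' (x, y))"
        by (simp add: borel_rep_def)
      from borel_rep_integral(3)[OF _ this] show "VI f x = (\<integral>y. f' (x, y) \<partial>lborel)"
        by (simp add: vertical_integral_def)
    qed
  qed
qed

text \<open>Cauchy-Schwarz on each slice, whose length is at most \<open>H\<close>, followed by
  integration over x.\<close>

lemma VI_Lsq:
  assumes f: "f \<in> Lsq \<Omega>"
  shows "VI f \<in> Lsq {0<..<1}" "Lsq_norm {0<..<1} (VI f) \<le> sqrt H * Lsq_norm \<Omega> f"
proof -
  obtain f' where r: "borel_rep \<Omega> f f'" using borel_rep_exists[OF region_borel LsqD(1)[OF f]] by auto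
  have f'b[measurable]: "f' \<in> borel_measurable borel" using r by (simp add: borel_rep_def)
  have [measurable]: "f' \<in> borel_measurable (lborel \<Otimes>\<^sub>M lborel)"
    using f'b unfolding lborel_prod by simp
  define F where "F x = (\<integral>y. f' (x, y) \<partial>lborel)" for x
  note rF = VI_rep[OF r, folded F_def]
  have [measurable]: "F \<in> borel_measurable borel" using rF by (simp add: borel_rep_def)
  have int: "integrable (lborel \<Otimes>\<^sub>M lborel) (\<lambda>z. (f' z)\<^sup>2)"
    using borel_rep_integral(2)[OF region_borel borel_rep_power2[OF r]] LsqD(2)[OF f] by (simp add: lborel_prod)
  define Q where "Q x = (\<integral>y. (f' (x, y))\<^sup>2 \<partial>lborel)" for x
  have Q: "integrable lborel Q" unfolding Q_def using lborel_pair.integrable_fst'[OF int] .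
  have ae: "AE x in lborel. (F x)\<^sup>2 \<le> H * Q x"
    using lborel_pair.AE_integrable_fst'[OF int]
  proof eventually_elim
    case (elim x)
    show ?case
    proof (cases "x \<in> {0<..<1}")
      case True
      let ?I = "{- b x<..<g x}"
      have rep: "borel_rep ?I (\<lambda>y. f' (x, y)) (\<lambda>y. f' (x, y))"
        using r by (auto simp: borel_rep_def mem_region)
      have L: "(\<lambda>y. f' (x, y)) \<in> Lsq ?I"
        using borel_rep_integral(1)[OF _ rep] borel_rep_integral(2)[OF _ borel_rep_power2[OF rep]] elim
        by (simp add: Lsq_def)
      have m: "?I \<in> lmeasurable" by simp
      have "- b x \<le> g x" using True b_ge[of x] g_nonneg[of x] b0_pos by simp
      then have mI: "measure lebesgue ?I \<le> H" using height_le[OF True] by simp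
      have "\<bar>F x\<bar> = \<bar>\<integral>y. f' (x, y) \<partial>lebesgue_on ?I\<bar>"
        unfolding F_def using borel_rep_integral(3)[OF _ rep] by simp
      also have "\<dots> \<le> (\<integral>y. \<bar>f' (x, y)\<bar> \<partial>lebesgue_on ?I)" by (rule integral_abs_bound)
      also have "\<dots> \<le> sqrt (measure lebesgue ?I) * Lsq_norm ?I (\<lambda>y. f' (x, y))"
        by (rule Lsq_integrable(2)[OF m L])
      also have "\<dots> \<le> sqrt H * Lsq_norm ?I (\<lambda>y. f' (x, y))" using mI by (intro mult_right_mono) auto
      finally have "\<bar>F x\<bar>\<^sup>2 \<le> (sqrt H * Lsq_norm ?I (\<lambda>y. f' (x, y)))\<^sup>2" by (intro power_mono) auto
      also have "\<dots> = H * Q x"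
        using H_pos borel_rep_integral(3)[OF _ borel_rep_power2[OF rep]]
        by (simp add: power_mult_distrib Lsq_norm_power2 Q_def)
      finally show ?thesis by simp
    next
      case False
      have "f' (x, y) = 0" for y using r False by (auto simp: borel_rep_def mem_region)
      then show ?thesis by (simp add: F_def Q_def)
    qed
  qed
  have intF: "integrable lborel (\<lambda>x. (F x)\<^sup>2)"
    by (rule Bochner_Integration.integrable_bound[OF integrable_mult_right[OF Q, of H]])
      (use ae in \<open>auto elim!: eventually_mono\<close>)
  show "VI f \<in> Lsq {0<..<1}"
    using borel_rep_integral(1)[OF _ rF] borel_rep_integral(2)[OF _ borel_rep_power2[OF rF]] intF
    by (simp add: Lsq_def)
  have "(Lsq_norm {0<..<1} (VI f))\<^sup>2 = (\<integral>x. (F x)\<^sup>2 \<partial>lborel)"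
    unfolding Lsq_norm_power2 using borel_rep_integral(3)[OF _ borel_rep_power2[OF rF]] by simp
  also have "\<dots> \<le> (\<integral>x. H * Q x \<partial>lborel)"
    by (rule integral_mono_AE[OF intF integrable_mult_right[OF Q] ae])
  also have "\<dots> = H * (\<integral>z. (f' z)\<^sup>2 \<partial>(lborel \<Otimes>\<^sub>M lborel))"
    using lborel_pair.integral_fst'[OF int] by (simp add: Q_def)
  also have "\<dots> = H * (Lsq_norm \<Omega> f)\<^sup>2"
    unfolding Lsq_norm_power2 using borel_rep_integral(3)[OF region_borel borel_rep_power2[OF r]] by (simp add: lborel_prod)
  finally have "sqrt ((Lsq_norm {0<..<1} (VI f))\<^sup>2) \<le> sqrt (H * (Lsq_norm \<Omega> f)\<^sup>2)" by (rule real_sqrt_le_mono)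
  then show "Lsq_norm {0<..<1} (VI f) \<le> sqrt H * Lsq_norm \<Omega> f" by (simp add: real_sqrt_mult)
qed

lemma VI_integral:
  assumes f: "f \<in> Lsq \<Omega>" and q: "q \<in> Lsq {0<..<1}"
  shows "(\<integral>z. f z * q (fst z) \<partial>lebesgue_on \<Omega>) = (\<integral>x. VI f x * q x \<partial>lebesgue_on {0<..<1})"
proof -
  obtain f' where r: "borel_rep \<Omega> f f'" using borel_rep_exists[OF region_borel LsqD(1)[OF f]] by auto
  obtain q' where rq: "borel_rep {0<..<1} q q'"
    using borel_rep_exists[OF _ LsqD(1)[OF q]] by auto
  note rm = borel_rep_mult[OF r fst_rep[OF rq]]
  have int: "integrable (lborel \<Otimes>\<^sub>M lborel) (\<lambda>z. f' z * (indicator \<Omega> z * q' (fst z)))"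
    using borel_rep_integral(2)[OF region_borel rm] Lsq_integrable_mult[OF f Lsq_fst(1)[OF q]]
    by (simp add: lborel_prod)
  have "(\<integral>z. f z * q (fst z) \<partial>lebesgue_on \<Omega>) = (\<integral>z. f' z * (indicator \<Omega> z * q' (fst z)) \<partial>(lborel \<Otimes>\<^sub>M lborel))"
    using borel_rep_integral(3)[OF region_borel rm] by (simp add: lborel_prod)
  also have "\<dots> = (\<integral>x. \<integral>y. f' (x, y) * (indicator \<Omega> (x, y) * q' x) \<partial>lborel \<partial>lborel)"
    using lborel_pair.integral_fst'[OF int] by simp
  also have "\<dots> = (\<integral>x. (\<integral>y. f' (x, y) \<partial>lborel) * q' x \<partial>lborel)"
  proof (rule Bochner_Integration.integral_cong[OF refl])
    fix x
    have "(\<integral>y. f' (x, y) * (indicator \<Omega> (x, y) * q' x) \<partial>lborel) = (\<integral>y. f' (x, y) * q' x \<partial>lborel)"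
      by (rule Bochner_Integration.integral_cong[OF refl]) (use r in \<open>auto simp: borel_rep_def indicator_def\<close>)
    then show "(\<integral>y. f' (x, y) * (indicator \<Omega> (x, y) * q' x) \<partial>lborel) = (\<integral>y. f' (x, y) \<partial>lborel) * q' x" by simp
  qed
  also have "\<dots> = (\<integral>x. VI f x * q x \<partial>lebesgue_on {0<..<1})"
    using borel_rep_integral(3)[OF _ borel_rep_mult[OF VI_rep[OF r] rq]] by simp
  finally show ?thesis .
qed

lemma VI_const_1: "x \<in> {0<..<1} \<Longrightarrow> VI (\<lambda>z. 1) x = b x + g x"
  using b_ge[of x] g_nonneg[of x] b0_pos
  by (simp add: vertical_integral_def measure_restrict_space)

end

section \<open>Poincare inequalities\<close>

lemma real_antiderivative:
  fixes f :: "real \<Rightarrow> real"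
  assumes "continuous_on UNIV f"
  obtains F where "\<And>x. (F has_real_derivative f x) (at x)"
proof
  fix x :: real
  have "((\<lambda>u. LBINT y=ereal 0..ereal u. f y) has_vector_derivative f x) (at x within {-\<bar>x\<bar> - 1..\<bar>x\<bar> + 1})"
    by (rule interval_integral_FTC2) (use assms in \<open>auto intro: continuous_on_subset\<close>)
  moreover have "at x within {-\<bar>x\<bar> - 1..\<bar>x\<bar> + 1} = at x" by (rule at_within_interior) auto
  ultimately show "((\<lambda>u. LBINT y=ereal 0..ereal u. f y) has_real_derivative f x) (at x)"
    by (simp only: has_real_derivative_iff_has_vector_derivative)
qed

text \<open>Meant for \<open>B\<close> supported in [c, d]: \<open>F\<close> is the antiderivative
  that starts at 0, and \<open>J\<close> is the integral of \<open>B\<close>.\<close>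

definition antideriv_from :: "(real \<Rightarrow> real) \<Rightarrow> real \<Rightarrow> real \<Rightarrow> (real \<Rightarrow> real) \<Rightarrow> real \<Rightarrow> bool" where
  "antideriv_from B c d F J \<longleftrightarrow> (\<forall>y. (F has_real_derivative B y) (at y)) \<and>
     (\<forall>y\<le>c. F y = 0) \<and> (\<forall>y\<ge>d. F y = J)"

lemma antideriv_from_exists:
  assumes "continuous_on UNIV B" and z: "\<And>y. y \<notin> {c..d} \<Longrightarrow> B y = 0"
  obtains F J where "antideriv_from B c d F J"
proof -
  obtain F0 where F0: "\<And>x. (F0 has_real_derivative B x) (at x)" using real_antiderivative[OF assms(1)] by blast
  have cont: "continuous_on UNIV F0" using F0 by (auto intro!: continuous_at_imp_continuous_on DERIV_isCont)
  have left: "F0 y = F0 c" if "y \<le> c" for y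
  proof (cases "y = c")
    case False
    show ?thesis
      by (rule DERIV_isconst_end[of y c F0, symmetric])
        (use False that cont in \<open>auto intro: continuous_on_subset intro!: DERIV_cong[OF F0] z\<close>)
  qed simp
  have right: "F0 y = F0 d" if "y \<ge> d" for y
  proof (cases "y = d")
    case False
    show ?thesis
      by (rule DERIV_isconst_end[of d y F0])
        (use False that cont in \<open>auto intro: continuous_on_subset intro!: DERIV_cong[OF F0] z\<close>)
  qed simp
  have "antideriv_from B c d (\<lambda>y. F0 y - F0 c) (F0 d - F0 c)"
    unfolding antideriv_from_def
  proof (intro conjI allI impI)
    show "((\<lambda>y. F0 y - F0 c) has_real_derivative B y) (at y)" for y
      using DERIV_diff[OF F0 DERIV_const[of "F0 c"]] by simp
    show "F0 y - F0 c = 0" if "y \<le> c" for y unfolding left[OF that] by simp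
    show "F0 y - F0 c = F0 d - F0 c" if "y \<ge> d" for y unfolding right[OF that] by simp
  qed
  then show thesis by (rule that)
qed

lemma antideriv_from_bounds:
  assumes F: "antideriv_from B c d F J" and nn: "\<And>y. 0 \<le> B y"
  shows "0 \<le> F y" "F y \<le> J"
proof -
  have mono: "F x \<le> F y" if "x \<le> y" for x y
    by (rule DERIV_nonneg_imp_nondecreasing[OF that]) (use F nn in \<open>auto simp: antideriv_from_def\<close>)
  have "F (min y c) = 0" "F (max y d) = J" using F by (auto simp: antideriv_from_def)
  then show "0 \<le> F y" "F y \<le> J" using mono[of "min y c" y] mono[of y "max y d"] by auto
qed

lemma antideriv_from_integral:
  assumes F: "antideriv_from B c d F J" and B: "continuous_on UNIV B" "\<And>y. y \<notin> {c..d} \<Longrightarrow> B y = 0"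
    and T: "{c..d} \<subseteq> T" "T \<in> sets lebesgue"
  shows "(\<integral>y. B y \<partial>lebesgue_on T) = J"
proof -
  have "(\<integral>y. B y \<partial>lebesgue_on T) = (\<integral>y. B y \<partial>lebesgue_on {c..d})"
    by (rule integral_eq_on_subset) (use T B(2) in auto)
  also have "\<dots> = J"
  proof (cases "c \<le> d")
    case True
    have m: "B \<in> borel_measurable borel" by (rule borel_measurable_continuous_onI[OF B(1)])
    have "(\<integral>y. B y \<partial>lebesgue_on {c..d}) = (\<integral>y. indicator {c..d} y *\<^sub>R B y \<partial>lborel)"
      using lebesgue_on_integral_eq_lborel[OF _ m, of "{c..d}"] by simp
    also have "\<dots> = F d - F c"
      by (rule integral_FTC_atLeastAtMost[OF True])
        (use F B(1) in \<open>auto simp: antideriv_from_def has_real_derivative_iff_has_vector_derivative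
          intro: has_vector_derivative_at_within continuous_on_subset\<close>)
    finally show ?thesis using F by (simp add: antideriv_from_def)
  next
    case False
    then have "F c = 0" "F c = J" using F by (auto simp: antideriv_from_def)
    then show ?thesis using False by simp
  qed
  finally show ?thesis .
qed

lemma test_function_zero:
  assumes "\<phi> \<in> test_functions S" "x \<notin> S" shows "\<phi> x = 0"
  using assms(1) by (rule test_functionE) (use assms(2) in blast)

text \<open>The clause about \<open>F\<close> says that \<rho> has integral 1, in the form in which
  it is used.\<close>

definition unit_bump :: "real \<Rightarrow> real \<Rightarrow> (real \<Rightarrow> real) \<Rightarrow> bool" where
  "unit_bump p q \<rho> \<longleftrightarrow> p < q \<and> (\<forall>k. Ck k \<rho>) \<and> (\<forall>y. 0 \<le> \<rho> y) \<and> (\<forall>y. y \<notin> {p..q} \<longrightarrow> \<rho> y = 0) \<and>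
     (\<exists>F. antideriv_from \<rho> p q F 1)"

lemma unit_bump_exists:
  assumes "p < q" obtains \<rho> where "unit_bump p q \<rho>"
proof -
  have z: "bump p q y = 0" if "y \<notin> {p..q}" for y
    using that bump_pos_iff[of p q y] by (auto simp: box_real)
  have c: "continuous_on UNIV (bump p q)" using Ck_bump[of 0 p q] by simp
  obtain F J where F: "antideriv_from (bump p q) p q F J"
    by (rule antideriv_from_exists[OF c z])
  note Fb = antideriv_from_bounds[OF F bump_bounds(1)]
  \<comment> \<open>If the integral were 0, \<open>F\<close> would be constant and the bump would
    vanish at the midpoint of its interval.\<close>
  have "J \<noteq> 0"
  proof
    assume "J = 0"
    then have "F = (\<lambda>y. 0)" using Fb by (intro ext antisym) auto
    then have "((\<lambda>y. 0) has_real_derivative bump p q ((p + q) / 2)) (at ((p + q) / 2))"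
      using F by (simp add: antideriv_from_def)
    then have "bump p q ((p + q) / 2) = 0" by (metis DERIV_const DERIV_unique)
    moreover have "(p + q) / 2 \<in> box p q" using assms by (simp add: box_real)
    ultimately show False using bump_pos_iff[of p q] by blast
  qed
  then have J: "J > 0" using Fb[of 0] by simp
  have "antideriv_from (\<lambda>y. (1 / J) * bump p q y) p q (\<lambda>y. (1 / J) * F y) 1"
    unfolding antideriv_from_def
  proof (intro conjI allI impI)
    show "((\<lambda>y. (1 / J) * F y) has_real_derivative (1 / J) * bump p q y) (at y)" for y
      by (rule DERIV_cmult) (use F in \<open>simp add: antideriv_from_def\<close>)
  qed (use F J in \<open>auto simp: antideriv_from_def\<close>)
  then have "unit_bump p q (\<lambda>y. (1 / J) * bump p q y)"
    unfolding unit_bump_def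
  proof (intro conjI allI impI exI)
    show "0 \<le> 1 / J * bump p q y" for y using J bump_bounds(1)[of p q y] by simp
    show "Ck k (\<lambda>y. 1 / J * bump p q y)" for k by (rule Ck_cmult[OF Ck_bump])
    show "1 / J * bump p q y = 0" if "y \<notin> {p..q}" for y using z[OF that] by simp
  qed (use assms in auto)
  then show thesis by (rule that)
qed

text \<open>B - J \<rho> has integral 0, so its antiderivative \<beta> has compact support. As
  \<beta> is a difference of two functions with values in [0, J], it is bounded by
  \<open>J\<close>.\<close>

lemma mean_zero_antiderivative:
  assumes \<rho>: "unit_bump p q \<rho>" and B: "\<And>k. Ck k B" "\<And>y. 0 \<le> B y" "\<And>y. y \<notin> {c..d} \<Longrightarrow> B y = 0"
  obtains \<beta> F J where "antideriv_from B c d F J" "\<And>k. Ck k \<beta>" "\<And>y. y \<notin> {min p c..max q d} \<Longrightarrow> \<beta> y = 0"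
    "\<And>y. (\<beta> has_real_derivative B y - J * \<rho> y) (at y)" "\<And>y. \<bar>\<beta> y\<bar> \<le> J"
proof -
  have cB: "continuous_on UNIV B" using B(1)[of 0] by simp
  obtain F J where F: "antideriv_from B c d F J" by (rule antideriv_from_exists[OF cB B(3)])
  obtain R where R: "antideriv_from \<rho> p q R 1" using \<rho> by (auto simp: unit_bump_def)
  have nn: "0 \<le> \<rho> y" for y using \<rho> by (simp add: unit_bump_def)
  note Fb = antideriv_from_bounds[OF F B(2)] and Rb = antideriv_from_bounds[OF R nn]
  define \<beta> where "\<beta> y = F y - J * R y" for y
  have d: "(\<beta> has_real_derivative B y - J * \<rho> y) (at y)" for y
    unfolding \<beta>_def using F R by (intro DERIV_diff DERIV_cmult) (auto simp: antideriv_from_def)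
  have J: "0 \<le> J" using Fb[of 0] by simp
  show thesis
  proof (rule that[OF F _ _ d])
    show "Ck k \<beta>" for k
    proof (rule Ck_Suc_imp, rule Ck_real_SucI[OF d])
      show "Ck k (\<lambda>y. B y - J * \<rho> y)"
        using B(1) \<rho> by (intro Ck_diff Ck_cmult) (auto simp: unit_bump_def)
    qed
    show "\<beta> y = 0" if "y \<notin> {min p c..max q d}" for y
    proof -
      have "y < min p c \<or> y > max q d" using that by auto
      then show ?thesis
      proof
        assume "y < min p c"
        then have "F y = 0" "R y = 0" using F R by (simp_all add: antideriv_from_def)
        then show ?thesis by (simp add: \<beta>_def)
      next
        assume "y > max q d"
        then have "F y = J" "R y = 1" using F R by (simp_all add: antideriv_from_def)
        then show ?thesis by (simp add: \<beta>_def)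
      qed
    qed
    show "\<bar>\<beta> y\<bar> \<le> J" for y
    proof -
      have "0 \<le> J * R y" "J * R y \<le> J * 1"
        using J Rb(1)[of y] mult_left_mono[OF Rb(2)[of y] J] by simp_all
      then show ?thesis using Fb[of y] unfolding \<beta>_def by linarith
    qed
  qed
qed

section \<open>Tensor products of test functions\<close>

lemma frechet_derivative_real:
  assumes "(f has_real_derivative D) (at x)"
  shows "frechet_derivative f (at x) t = D * t"
  using frechet_derivative_at[OF assms[unfolded has_field_derivative_def]] by metis

lemma tensor_test_function:
  fixes A B :: "real \<Rightarrow> real"
  assumes A: "\<And>k. Ck k A" "\<And>x. x \<notin> {a..b} \<Longrightarrow> A x = 0" and B: "\<And>k. Ck k B" "\<And>y. y \<notin> {c..d} \<Longrightarrow> B y = 0"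
    and S: "{a..b} \<times> {c..d} \<subseteq> S"
  shows "(\<lambda>z. A (fst z) * B (snd z)) \<in> test_functions S"
proof (rule test_functionI[where K="{a..b} \<times> {c..d}"])
  show "Ck k (\<lambda>z. A (fst z) * B (snd z))" for k
    by (intro Ck_mult Ck_compose_linear[OF bounded_linear_fst A(1)] Ck_compose_linear[OF bounded_linear_snd B(1)])
  show "z \<in> {a..b} \<times> {c..d}" if "A (fst z) * B (snd z) \<noteq> 0" for z
  proof -
    have "A (fst z) \<noteq> 0" "B (snd z) \<noteq> 0" using that by simp_all
    then have "fst z \<in> {a..b}" "snd z \<in> {c..d}" using A(2) B(2) by blast+
    then show ?thesis by (simp only: mem_Times_iff)
  qed
qed (use S in \<open>auto intro: compact_Times\<close>)

lemma tensor_partials: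
  fixes A B :: "real \<Rightarrow> real" and z :: "real \<times> real"
  assumes A: "(A has_real_derivative A' (fst z)) (at (fst z))" and B: "(B has_real_derivative B' (snd z)) (at (snd z))"
  shows "frechet_derivative (\<lambda>z. A (fst z) * B (snd z)) (at z) (1, 0) = A' (fst z) * B (snd z)"
    "frechet_derivative (\<lambda>z. A (fst z) * B (snd z)) (at z) (0, 1) = A (fst z) * B' (snd z)"
proof -
  have "((\<lambda>z. A (fst z)) has_derivative (\<lambda>t. A' (fst z) * fst t)) (at z)"
    by (rule has_derivative_compose[OF has_derivative_fst[OF has_derivative_ident]
          A[unfolded has_field_derivative_def]])
  moreover have "((\<lambda>z. B (snd z)) has_derivative (\<lambda>t. B' (snd z) * snd t)) (at z)"
    by (rule has_derivative_compose[OF has_derivative_snd[OF has_derivative_ident]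
          B[unfolded has_field_derivative_def]])
  ultimately have "((\<lambda>z. A (fst z) * B (snd z)) has_derivative
      (\<lambda>t. A (fst z) * (B' (snd z) * snd t) + A' (fst z) * fst t * B (snd z))) (at z)"
    by (rule has_derivative_mult)
  from frechet_derivative_at[OF this, symmetric]
  show "frechet_derivative (\<lambda>z. A (fst z) * B (snd z)) (at z) (1, 0) = A' (fst z) * B (snd z)"
    "frechet_derivative (\<lambda>z. A (fst z) * B (snd z)) (at z) (0, 1) = A (fst z) * B' (snd z)"
    by simp_all
qed

text \<open>The pointwise bound is obtained by duality: a test function minus the multiple of \<open>\<rho>\<close> with the same
  integral is the derivative of a test function bounded by that integral.\<close>

lemma Poincare_interval:
  fixes V V' :: "real \<Rightarrow> real"
  assumes V: "V \<in> Lsq {p<..<q}" "V' \<in> Lsq {p<..<q}" and w: "has_weak_partial {p<..<q} 1 V V'"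
    and \<rho>: "unit_bump p' q' \<rho>" "{p'..q'} \<subseteq> {p<..<q}"
  shows "AE x in lebesgue_on {p<..<q}. \<bar>V x - (\<integral>t. V t * \<rho> t \<partial>lebesgue_on {p<..<q})\<bar>
    \<le> (\<integral>t. \<bar>V' t\<bar> \<partial>lebesgue_on {p<..<q})"
proof -
  let ?I = "{p<..<q}"
  have I: "open ?I" "bounded ?I" "?I \<in> lmeasurable" "?I \<in> sets lebesgue" by auto
  define c where "c = (\<integral>t. V t * \<rho> t \<partial>lebesgue_on ?I)"
  define M where "M = (\<integral>t. \<bar>V' t\<bar> \<partial>lebesgue_on ?I)"
  have \<rho>t: "\<rho> \<in> test_functions ?I"
    by (rule test_functionI[where K="{p'..q'}"]) (use \<rho> in \<open>auto simp: unit_bump_def simp del: atLeastAtMost_iff\<close>)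
  note \<rho>L = test_function_in_Lsq[OF \<rho>t I(3)]
  have const: "(\<lambda>x. r) \<in> Lsq ?I" for r by (rule Lsq_bounded(1)[OF I(3)]) auto
  \<comment> \<open>The sign s covers the two one-sided bounds at once.\<close>
  have main: "AE x in lebesgue_on ?I. 0 \<le> M + s * (V x - c)" if s: "\<bar>s\<bar> = 1" for s
  proof (rule AE_nonneg_if_test_integrals_nonneg[OF I(1,2)])
    show "(\<lambda>x. M + s * (V x - c)) \<in> Lsq ?I" by (intro Lsq_add Lsq_cmult Lsq_diff const V)
    fix a b \<phi> assume ab: "cbox a b \<subseteq> ?I" and \<phi>: "\<phi> \<in> test_functions (box a b)" and nn: "\<And>x. 0 \<le> \<phi> x"
    have z: "\<phi> y = 0" if "y \<notin> {a..b}" for y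
      using test_function_zero[OF \<phi>, of y] that by (auto simp: box_real)
    have C: "Ck k \<phi>" for k using \<phi> by (rule test_functionE) blast
    have \<phi>c: "continuous_on UNIV \<phi>" using C[of 0] by simp
    have abI: "{a..b} \<subseteq> ?I" using ab by simp
    have \<phi>I: "\<phi> \<in> test_functions ?I"
      by (rule test_functions_mono[OF \<phi>]) (use abI in \<open>auto simp: box_real\<close>)
    note \<phi>L = test_function_in_Lsq[OF \<phi>I I(3)]
    obtain \<beta> F J where F: "antideriv_from \<phi> a b F J" and \<beta>: "\<And>k. Ck k \<beta>" "\<And>y. y \<notin> {min p' a..max q' b} \<Longrightarrow> \<beta> y = 0"
      "\<And>y. (\<beta> has_real_derivative \<phi> y - J * \<rho> y) (at y)" "\<And>y. \<bar>\<beta> y\<bar> \<le> J"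
      by (rule mean_zero_antiderivative[of p' q' \<rho> \<phi> a b, OF \<rho>(1) C nn]) (erule z, rule that)
    have J: "(\<integral>y. \<phi> y \<partial>lebesgue_on ?I) = J" by (rule antideriv_from_integral[OF F \<phi>c z abI I(4)])
    show "0 \<le> (\<integral>x. (M + s * (V x - c)) * \<phi> x \<partial>lebesgue_on ?I)"
    proof (cases "a \<le> b")
      case False
      then have "\<phi> y = 0" for y using z[of y] by simp
      then show ?thesis by simp
    next
      case True
      have pq': "p' < q'" using \<rho>(1) by (simp add: unit_bump_def)
      have "{min p' a..max q' b} \<subseteq> ?I"
        using subsetD[OF abI, of a] subsetD[OF abI, of b] subsetD[OF \<rho>(2), of p'] subsetD[OF \<rho>(2), of q'] True pq'
        by (auto simp: min_def max_def)
      then have \<beta>t: "\<beta> \<in> test_functions ?I"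
        by (intro test_functionI[OF \<beta>(1), where K="{min p' a..max q' b}"]) (use \<beta>(2) in blast, auto)
      note \<beta>L = test_function_in_Lsq[OF \<beta>t I(3)]
      note i1 = Lsq_integrable_mult[OF V(1) \<phi>L] and i2 = Lsq_integrable_mult[OF V(1) \<rho>L]
        and i3 = Lsq_integrable_mult[OF V(2) \<beta>L] and i4 = Lsq_integrable(1)[OF I(3) \<phi>L]
        and i5 = Lsq_integrable(1)[OF I(3) V(2)]
      have "(\<integral>x. V x * (\<phi> x - J * \<rho> x) \<partial>lebesgue_on ?I) = - (\<integral>x. V' x * \<beta> x \<partial>lebesgue_on ?I)"
        using bspec[OF w[unfolded has_weak_partial_def] \<beta>t] frechet_derivative_real[OF \<beta>(3), of _ 1] by simp
      moreover have "(\<integral>x. V x * (\<phi> x - J * \<rho> x) \<partial>lebesgue_on ?I) = (\<integral>x. V x * \<phi> x \<partial>lebesgue_on ?I) - J * c"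
        using i1 i2 by (simp add: right_diff_distrib c_def mult.left_commute[of _ J])
      ultimately have key: "(\<integral>x. V x * \<phi> x \<partial>lebesgue_on ?I) - J * c = - (\<integral>x. V' x * \<beta> x \<partial>lebesgue_on ?I)" by simp
      have "\<bar>\<integral>x. V' x * \<beta> x \<partial>lebesgue_on ?I\<bar> \<le> (\<integral>x. \<bar>V' x * \<beta> x\<bar> \<partial>lebesgue_on ?I)" by (rule integral_abs_bound)
      also have "\<dots> \<le> (\<integral>x. \<bar>V' x\<bar> * J \<partial>lebesgue_on ?I)"
      proof (rule integral_mono[OF integrable_abs[OF i3]])
        show "integrable (lebesgue_on ?I) (\<lambda>x. \<bar>V' x\<bar> * J)" using i5 by simp
        show "\<bar>V' x * \<beta> x\<bar> \<le> \<bar>V' x\<bar> * J" for x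
          unfolding abs_mult by (rule mult_left_mono[OF \<beta>(4)]) simp
      qed
      also have "\<dots> = M * J" by (simp add: M_def)
      finally have bd: "\<bar>\<integral>x. V' x * \<beta> x \<partial>lebesgue_on ?I\<bar> \<le> M * J" .
      have "(\<integral>x. (M + s * (V x - c)) * \<phi> x \<partial>lebesgue_on ?I)
          = (\<integral>x. M * \<phi> x + s * (V x * \<phi> x - c * \<phi> x) \<partial>lebesgue_on ?I)"
        by (simp add: algebra_simps)
      also have "\<dots> = M * J + s * ((\<integral>x. V x * \<phi> x \<partial>lebesgue_on ?I) - c * J)"
        using i1 i4 J by simp
      also have "\<dots> = M * J - s * (\<integral>x. V' x * \<beta> x \<partial>lebesgue_on ?I)"
        using key by (simp add: mult.commute)
      also have "\<dots> \<ge> 0"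
      proof -
        have "\<bar>s * (\<integral>x. V' x * \<beta> x \<partial>lebesgue_on ?I)\<bar> \<le> M * J" using bd s by (simp add: abs_mult)
        then show ?thesis by linarith
      qed
      finally show ?thesis .
    qed
  qed
  have "AE x in lebesgue_on ?I. 0 \<le> M + 1 * (V x - c)" "AE x in lebesgue_on ?I. 0 \<le> M + (- 1) * (V x - c)"
    by (rule main, simp)+
  then show ?thesis
    unfolding c_def[symmetric] M_def[symmetric] by eventually_elim (simp add: abs_le_iff)
qed

lemma unit_bump_test_function:
  "unit_bump p q \<rho> \<Longrightarrow> {p..q} \<subseteq> S \<Longrightarrow> \<rho> \<in> test_functions S"
  by (rule test_functionI[where K="{p..q}"]) (auto simp: unit_bump_def simp del: atLeastAtMost_iff)

lemma Lsq_mult_test_snd: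
  fixes f :: "real \<times> real \<Rightarrow> real"
  assumes f: "f \<in> Lsq S" and \<phi>: "\<phi> \<in> test_functions T"
  shows "(\<lambda>z. f z * \<phi> (snd z)) \<in> Lsq S"
    and "(\<And>x. \<bar>\<phi> x\<bar> \<le> B) \<Longrightarrow> Lsq_norm S (\<lambda>z. f z * \<phi> (snd z)) \<le> \<bar>B\<bar> * Lsq_norm S f"
proof -
  have m: "(\<lambda>z. \<phi> (snd z)) \<in> borel_measurable (lebesgue_on S)"
    by (intro continuous_on_imp_measurable_lebesgue_on continuous_on_compose2[OF test_function_continuous[OF \<phi>]] continuous_intros) auto
  obtain B' where B': "\<And>x. \<bar>\<phi> x\<bar> \<le> B'" using test_function_bounded[OF \<phi>] by blast
  show "(\<lambda>z. f z * \<phi> (snd z)) \<in> Lsq S"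
    using Lsq_mult_bounded(1)[OF f m, of B'] B' by (simp add: mult.commute)
  show "Lsq_norm S (\<lambda>z. f z * \<phi> (snd z)) \<le> \<bar>B\<bar> * Lsq_norm S f" if "\<And>x. \<bar>\<phi> x\<bar> \<le> B"
    using Lsq_mult_bounded(2)[OF f m, of B] that by (simp add: mult.commute)
qed

lemma Lsq_mult_test:
  fixes f :: "'a::euclidean_space \<Rightarrow> real"
  assumes f: "f \<in> Lsq S" and \<phi>: "\<phi> \<in> test_functions T"
  shows "(\<lambda>z. f z * \<phi> z) \<in> Lsq S"
proof -
  obtain B where B: "\<And>x. \<bar>\<phi> x\<bar> \<le> B" using test_function_bounded[OF \<phi>] by blast
  show ?thesis
    using Lsq_mult_bounded(1)[OF f continuous_on_imp_measurable_lebesgue_on[OF test_function_continuous[OF \<phi>]], of B] B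
    by (simp add: mult.commute)
qed

lemma test_function_subinterval:
  fixes \<phi> :: "real \<Rightarrow> real"
  assumes "\<phi> \<in> test_functions {r<..<s}"
  obtains a b where "{a..b} \<subseteq> {r<..<s}" "\<And>x. x \<notin> {a..b} \<Longrightarrow> \<phi> x = 0"
proof -
  obtain K where K: "compact K" "K \<subseteq> {r<..<s}" "\<And>x. x \<notin> K \<Longrightarrow> \<phi> x = 0"
    using assms by (rule test_functionE) blast
  show thesis
  proof (cases "K = {}")
    case True
    then show ?thesis using K by (intro that[of 1 0]) auto
  next
    case False
    obtain a where a: "a \<in> K" "\<And>t. t \<in> K \<Longrightarrow> a \<le> t" using compact_attains_inf[OF K(1) False] by blast
    obtain b where b: "b \<in> K" "\<And>t. t \<in> K \<Longrightarrow> t \<le> b" using compact_attains_sup[OF K(1) False] by blast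
    show ?thesis
    proof (rule that[of a b])
      show "{a..b} \<subseteq> {r<..<s}" using a(1) b(1) K(2) by fastforce
      show "\<phi> x = 0" if "x \<notin> {a..b}" for x using that a(2) b(2) by (intro K(3)) fastforce
    qed
  qed
qed

section \<open>Averages over the common strip\<close>

context height_region
begin

lemma strip_subset: "{0<..<1} \<times> {- b\<^sub>0<..<0} \<subseteq> \<Omega>"
proof
  fix z assume "z \<in> {0<..<1::real} \<times> {- b\<^sub>0<..<0}"
  then obtain x y where "z = (x, y)" "x \<in> {0<..<1}" "- b\<^sub>0 < y" "y < 0" by (cases z) auto
  then show "z \<in> \<Omega>" using b_ge[of x] g_nonneg[of x] by (simp add: mem_region)
qed

text \<open>In the test function \<phi>(x) \<rho>(y) the horizontal derivative falls on \<phi>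
  alone, and its support lies in the strip, hence in the region.\<close>

lemma strip_average_has_weak_derivative:
  assumes v: "v \<in> Lsq \<Omega>" "g1 \<in> Lsq \<Omega>" "has_weak_partial \<Omega> (1, 0) v g1"
    and \<rho>: "unit_bump p q \<rho>" "{p..q} \<subseteq> {- b\<^sub>0<..<0}"
  shows "has_weak_partial {0<..<1} 1 (VI (\<lambda>z. v z * \<rho> (snd z))) (VI (\<lambda>z. g1 z * \<rho> (snd z)))"
  unfolding has_weak_partial_def
proof
  fix \<phi> :: "real \<Rightarrow> real" assume \<phi>: "\<phi> \<in> test_functions {0<..<1}"
  note \<rho>t = unit_bump_test_function[OF \<rho>]
  have I: "{0<..<1::real} \<in> lmeasurable" by simp
  note \<phi>' = test_function_partial[OF \<phi>, of 1, simplified]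
  obtain a b' where ab: "{a..b'} \<subseteq> {0<..<1}" "\<And>x. x \<notin> {a..b'} \<Longrightarrow> \<phi> x = 0"
    using test_function_subinterval[OF \<phi>] by blast
  have C: "Ck k \<phi>" for k using \<phi> by (rule test_functionE) blast
  have C\<rho>: "Ck k \<rho>" for k using \<rho> by (simp add: unit_bump_def)
  have z\<rho>: "\<rho> y = 0" if "y \<notin> {p..q}" for y using \<rho>(1) that by (simp add: unit_bump_def)
  have "{a..b'} \<times> {p..q} \<subseteq> \<Omega>" using ab(1) \<rho>(2) strip_subset by blast
  then have t: "(\<lambda>z. \<phi> (fst z) * \<rho> (snd z)) \<in> test_functions \<Omega>"
    by (intro tensor_test_function[OF C _ C\<rho>]) (erule ab(2), erule z\<rho>)
  have p1: "frechet_derivative (\<lambda>z. \<phi> (fst z) * \<rho> (snd z)) (at z) (1, 0) = frechet_derivative \<phi> (at (fst z)) 1 * \<rho> (snd z)" for z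
    by (rule tensor_partials(1)[where A'="\<lambda>x. frechet_derivative \<phi> (at x) 1" and B'="\<lambda>y. frechet_derivative \<rho> (at y) 1"])
      (rule Ck_real_SucD(1)[OF C] Ck_real_SucD(1)[OF C\<rho>])+
  have "(\<integral>x. VI (\<lambda>z. v z * \<rho> (snd z)) x * frechet_derivative \<phi> (at x) 1 \<partial>lebesgue_on {0<..<1})
      = (\<integral>z. v z * \<rho> (snd z) * frechet_derivative \<phi> (at (fst z)) 1 \<partial>lebesgue_on \<Omega>)"
    by (rule VI_integral[symmetric, OF Lsq_mult_test_snd(1)[OF v(1) \<rho>t] test_function_in_Lsq[OF \<phi>' I]])
  also have "\<dots> = (\<integral>z. v z * frechet_derivative (\<lambda>z. \<phi> (fst z) * \<rho> (snd z)) (at z) (1, 0) \<partial>lebesgue_on \<Omega>)"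
    by (simp add: p1 mult_ac)
  also have "\<dots> = - (\<integral>z. g1 z * (\<phi> (fst z) * \<rho> (snd z)) \<partial>lebesgue_on \<Omega>)"
    by (rule bspec[OF v(3)[unfolded has_weak_partial_def] t])
  also have "(\<integral>z. g1 z * (\<phi> (fst z) * \<rho> (snd z)) \<partial>lebesgue_on \<Omega>) = (\<integral>z. g1 z * \<rho> (snd z) * \<phi> (fst z) \<partial>lebesgue_on \<Omega>)"
    by (simp add: mult_ac)
  also have "\<dots> = (\<integral>x. VI (\<lambda>z. g1 z * \<rho> (snd z)) x * \<phi> x \<partial>lebesgue_on {0<..<1})"
    by (rule VI_integral[OF Lsq_mult_test_snd(1)[OF v(2) \<rho>t] test_function_in_Lsq[OF \<phi> I]])
  finally show "(\<integral>x. VI (\<lambda>z. v z * \<rho> (snd z)) x * frechet_derivative \<phi> (at x) 1 \<partial>lebesgue_on {0<..<1})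
    = - (\<integral>x. VI (\<lambda>z. g1 z * \<rho> (snd z)) x * \<phi> x \<partial>lebesgue_on {0<..<1})" .
qed

text \<open>Over the support of \<open>A\<close> every slice contains [c, d], outside which
  \<open>B\<close> vanishes, so the vertical integral of \<open>B\<close> is \<open>J\<close>
  there.\<close>

lemma tensor_integral:
  assumes N: "N \<in> Lsq {0<..<1}" and A: "A \<in> test_functions {0<..<1}" "\<And>x. x \<notin> {a..b'} \<Longrightarrow> A x = 0"
    and B: "B \<in> test_functions T" "\<And>y. y \<notin> {c..d} \<Longrightarrow> B y = 0" "antideriv_from B c d F J"
    and sub: "{a..b'} \<times> {c..d} \<subseteq> \<Omega>"
  shows "(\<integral>z. N (fst z) * (A (fst z) * B (snd z)) \<partial>lebesgue_on \<Omega>) = J * (\<integral>x. N x * A x \<partial>lebesgue_on {0<..<1})"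
proof -
  have NA: "(\<lambda>x. N x * A x) \<in> Lsq {0<..<1}" by (rule Lsq_mult_test[OF N A(1)])
  have one: "(\<lambda>z. 1) \<in> Lsq \<Omega>" by (rule Lsq_bounded(1)[OF region_lmeasurable(1)]) auto
  have BL: "(\<lambda>z. B (snd z)) \<in> Lsq \<Omega>" using Lsq_mult_test_snd(1)[OF one B(1)] by simp
  have "(\<integral>z. N (fst z) * (A (fst z) * B (snd z)) \<partial>lebesgue_on \<Omega>) = (\<integral>z. B (snd z) * (N (fst z) * A (fst z)) \<partial>lebesgue_on \<Omega>)"
    by (simp add: mult_ac)
  also have "\<dots> = (\<integral>x. VI (\<lambda>z. B (snd z)) x * (N x * A x) \<partial>lebesgue_on {0<..<1})"
    by (rule VI_integral[OF BL NA])
  also have "\<dots> = (\<integral>x. J * (N x * A x) \<partial>lebesgue_on {0<..<1})"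
  proof (rule Bochner_Integration.integral_cong[OF refl])
    fix x
    show "VI (\<lambda>z. B (snd z)) x * (N x * A x) = J * (N x * A x)"
    proof (cases "A x = 0")
      case False
      then have x: "x \<in> {a..b'}" using A(2) by blast
      have "{c..d} \<subseteq> {- b x..g x}"
      proof
        fix y assume "y \<in> {c..d}"
        then have "(x, y) \<in> \<Omega>" using x sub by blast
        then show "y \<in> {- b x..g x}" by (simp add: mem_region)
      qed
      then have "(\<integral>y. B y \<partial>lebesgue_on {- b x..g x}) = J"
        by (intro antideriv_from_integral[OF B(3) test_function_continuous[OF B(1)]]) (erule B(2), auto)
      then show ?thesis by (simp add: vertical_integral_def)
    qed simp
  qed
  also have "\<dots> = J * (\<integral>x. N x * A x \<partial>lebesgue_on {0<..<1})" by simp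
  finally show ?thesis .
qed

text \<open>The duality of \<open>Poincare_interval\<close> on all vertical slices at once. Tested
  against A(x) B(y), the difference v - V becomes, up to sign, the integral of \<open>g2\<close>
  against A(x) \<beta>(y), where \<beta> is bounded by the integral \<open>J\<close> of
  \<open>B\<close>; the same factor \<open>J\<close> appears when the bound on the right is
  tested.\<close>

proposition strip_average_Poincare:
  assumes v: "v \<in> Lsq \<Omega>" "g2 \<in> Lsq \<Omega>" "has_weak_partial \<Omega> (0, 1) v g2"
    and \<rho>: "unit_bump p q \<rho>" "{p..q} \<subseteq> {- b\<^sub>0<..<0}"
  shows "AE z in lebesgue_on \<Omega>. \<bar>v z - VI (\<lambda>z. v z * \<rho> (snd z)) (fst z)\<bar> \<le> VI (\<lambda>z. \<bar>g2 z\<bar>) (fst z)"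
proof -
  note \<rho>t = unit_bump_test_function[OF \<rho>]
  define V where "V = VI (\<lambda>z. v z * \<rho> (snd z))"
  define N where "N = VI (\<lambda>z. \<bar>g2 z\<bar>)"
  have vL: "(\<lambda>z. v z * \<rho> (snd z)) \<in> Lsq \<Omega>" by (rule Lsq_mult_test_snd(1)[OF v(1) \<rho>t])
  have VL: "V \<in> Lsq {0<..<1}" unfolding V_def by (rule VI_Lsq(1)[OF vL])
  have NL: "N \<in> Lsq {0<..<1}" unfolding N_def by (rule VI_Lsq(1)[OF Lsq_abs[OF v(2)]])
  note Vf = Lsq_fst(1)[OF VL] and Nf = Lsq_fst(1)[OF NL]
  have main: "AE z in lebesgue_on \<Omega>. 0 \<le> N (fst z) + s * (v z - V (fst z))" if s: "\<bar>s\<bar> = 1" for s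
  proof (rule AE_nonneg_if_tensor_integrals_nonneg[OF open_region bounded_region])
    show "(\<lambda>z. N (fst z) + s * (v z - V (fst z))) \<in> Lsq \<Omega>"
      by (rule Lsq_add[OF Nf Lsq_cmult[OF Lsq_diff[OF v(1) Vf]]])
    fix a b' c d :: real and A B :: "real \<Rightarrow> real"
    assume sub: "{a..b'} \<times> {c..d} \<subseteq> \<Omega>" and A: "A \<in> test_functions {a<..<b'}" "\<And>x. 0 \<le> A x"
      and B: "B \<in> test_functions {c<..<d}" "\<And>x. 0 \<le> B x"
    have zA: "A x = 0" if "x \<notin> {a..b'}" for x using test_function_zero[OF A(1), of x] that by auto
    have zB: "B y = 0" if "y \<notin> {c..d}" for y using test_function_zero[OF B(1), of y] that by auto
    have CA: "Ck k A" for k using A(1) by (rule test_functionE) blast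
    have CB: "Ck k B" for k using B(1) by (rule test_functionE) blast
    have C\<rho>: "Ck k \<rho>" for k using \<rho> by (simp add: unit_bump_def)
    show "0 \<le> (\<integral>z. (N (fst z) + s * (v z - V (fst z))) * (A (fst z) * B (snd z)) \<partial>lebesgue_on \<Omega>)"
    proof (cases "a \<le> b' \<and> c \<le> d")
      case False
      then have "A (fst z) * B (snd z) = 0" for z :: "real \<times> real" using zA[of "fst z"] zB[of "snd z"] by auto
      then show ?thesis by (simp only: mult_zero_right) simp
    next
      case True
      have pq': "p < q" using \<rho>(1) by (simp add: unit_bump_def)
      have abI: "{a..b'} \<subseteq> {0<..<1}"
      proof
        fix x assume "x \<in> {a..b'}"
        then have "(x, c) \<in> \<Omega>" using sub True by auto
        then show "x \<in> {0<..<1}" by (simp add: mem_region)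
      qed
      have AI: "A \<in> test_functions {0<..<1}"
        by (rule test_functionI[OF CA, where K="{a..b'}"]) (use zA abI in blast, auto simp: abI)
      obtain \<beta> F J where F: "antideriv_from B c d F J" and \<beta>: "\<And>k. Ck k \<beta>" "\<And>y. y \<notin> {min p c..max q d} \<Longrightarrow> \<beta> y = 0"
        "\<And>y. (\<beta> has_real_derivative B y - J * \<rho> y) (at y)" "\<And>y. \<bar>\<beta> y\<bar> \<le> J"
        by (rule mean_zero_antiderivative[of p q \<rho> B c d, OF \<rho>(1) CB B(2)]) (erule zB, rule that)
      \<comment> \<open>Slices of the region are intervals, so the vertical hull of a piece of the
        strip and a side of the box stays inside.\<close>
      have sub\<beta>: "{a..b'} \<times> {min p c..max q d} \<subseteq> \<Omega>"
      proof
        fix z assume "z \<in> {a..b'} \<times> {min p c..max q d}"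
        then obtain x y where z: "z = (x, y)" "x \<in> {a..b'}" "min p c \<le> y" "y \<le> max q d" by (cases z) auto
        have "(x, c) \<in> \<Omega>" "(x, d) \<in> \<Omega>" using z(2) True sub by auto
        moreover have "(x, p) \<in> \<Omega>" "(x, q) \<in> \<Omega>"
          using z(2) abI \<rho>(2) pq' strip_subset by (auto intro!: subsetD[OF strip_subset])
        ultimately show "z \<in> \<Omega>" using z by (auto simp: mem_region min_le_iff_disj le_max_iff_disj)
      qed
      have t: "(\<lambda>z. A (fst z) * \<beta> (snd z)) \<in> test_functions \<Omega>"
        by (rule tensor_test_function[OF CA _ \<beta>(1) _ sub\<beta>]) (erule zA, erule \<beta>(2))
      have p2: "frechet_derivative (\<lambda>z. A (fst z) * \<beta> (snd z)) (at z) (0, 1) = A (fst z) * (B (snd z) - J * \<rho> (snd z))" for z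
        by (rule tensor_partials(2)[where A'="\<lambda>x. frechet_derivative A (at x) 1" and B'="\<lambda>y. B y - J * \<rho> y"])
          (rule Ck_real_SucD(1)[OF CA] \<beta>(3))+
      have tB: "(\<lambda>z. A (fst z) * B (snd z)) \<in> test_functions \<Omega>"
        by (rule tensor_test_function[OF CA _ CB _ sub]) (erule zA, erule zB)
      have I: "{0<..<1::real} \<in> lmeasurable" by simp
      note tL = test_function_in_Lsq[OF t region_lmeasurable(1)] and tBL = test_function_in_Lsq[OF tB region_lmeasurable(1)]
      note AL = test_function_in_Lsq[OF AI I]
      define X where "X = (\<integral>z. v z * (A (fst z) * B (snd z)) \<partial>lebesgue_on \<Omega>)"
      define Y where "Y = (\<integral>z. g2 z * (A (fst z) * \<beta> (snd z)) \<partial>lebesgue_on \<Omega>)"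
      have J0: "0 \<le> J" using \<beta>(4)[of 0] by linarith
      have XN: "(\<integral>z. N (fst z) * (A (fst z) * B (snd z)) \<partial>lebesgue_on \<Omega>) = J * (\<integral>z. \<bar>g2 z\<bar> * A (fst z) \<partial>lebesgue_on \<Omega>)"
        unfolding VI_integral[OF Lsq_abs[OF v(2)] AL] N_def[symmetric]
        by (rule tensor_integral[OF NL AI _ B(1) _ F sub]) (erule zA, erule zB)
      have XV: "(\<integral>z. V (fst z) * (A (fst z) * B (snd z)) \<partial>lebesgue_on \<Omega>) = J * (\<integral>z. v z * \<rho> (snd z) * A (fst z) \<partial>lebesgue_on \<Omega>)"
        unfolding VI_integral[OF vL AL] V_def[symmetric]
        by (rule tensor_integral[OF VL AI _ B(1) _ F sub]) (erule zA, erule zB)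
      have "(\<integral>z. v z * (A (fst z) * (B (snd z) - J * \<rho> (snd z))) \<partial>lebesgue_on \<Omega>) = - Y"
        using bspec[OF v(3)[unfolded has_weak_partial_def] t] unfolding p2 Y_def .
      moreover have "(\<integral>z. v z * (A (fst z) * (B (snd z) - J * \<rho> (snd z))) \<partial>lebesgue_on \<Omega>)
          = (\<integral>z. v z * (A (fst z) * B (snd z)) - J * (v z * \<rho> (snd z) * A (fst z)) \<partial>lebesgue_on \<Omega>)"
        by (simp add: algebra_simps)
      moreover have "\<dots> = X - J * (\<integral>z. v z * \<rho> (snd z) * A (fst z) \<partial>lebesgue_on \<Omega>)"
        using Lsq_integrable_mult[OF v(1) tBL] Lsq_integrable_mult[OF vL Lsq_fst(1)[OF AL]] by (simp add: X_def)
      ultimately have key: "X - (\<integral>z. V (fst z) * (A (fst z) * B (snd z)) \<partial>lebesgue_on \<Omega>) = - Y"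
        unfolding XV by linarith
      have "\<bar>Y\<bar> \<le> (\<integral>z. \<bar>g2 z * (A (fst z) * \<beta> (snd z))\<bar> \<partial>lebesgue_on \<Omega>)"
        unfolding Y_def by (rule integral_abs_bound)
      also have "\<dots> \<le> (\<integral>z. J * (\<bar>g2 z\<bar> * A (fst z)) \<partial>lebesgue_on \<Omega>)"
      proof (rule integral_mono)
        show "integrable (lebesgue_on \<Omega>) (\<lambda>z. \<bar>g2 z * (A (fst z) * \<beta> (snd z))\<bar>)"
          using Lsq_integrable_mult[OF v(2) tL] by (rule integrable_abs)
        show "integrable (lebesgue_on \<Omega>) (\<lambda>z. J * (\<bar>g2 z\<bar> * A (fst z)))"
          using Lsq_integrable_mult[OF Lsq_abs[OF v(2)] Lsq_fst(1)[OF AL]] by (rule integrable_mult_right)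
        fix z
        have "\<bar>g2 z * (A (fst z) * \<beta> (snd z))\<bar> = \<bar>g2 z\<bar> * A (fst z) * \<bar>\<beta> (snd z)\<bar>"
          using A(2) by (simp add: abs_mult)
        also have "\<dots> \<le> \<bar>g2 z\<bar> * A (fst z) * J" using A(2) \<beta>(4) by (intro mult_left_mono) auto
        finally show "\<bar>g2 z * (A (fst z) * \<beta> (snd z))\<bar> \<le> J * (\<bar>g2 z\<bar> * A (fst z))" by (simp add: mult_ac)
      qed
      also have "\<dots> = (\<integral>z. N (fst z) * (A (fst z) * B (snd z)) \<partial>lebesgue_on \<Omega>)" unfolding XN by simp
      finally have bd: "\<bar>Y\<bar> \<le> (\<integral>z. N (fst z) * (A (fst z) * B (snd z)) \<partial>lebesgue_on \<Omega>)" .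
      have "(\<integral>z. (N (fst z) + s * (v z - V (fst z))) * (A (fst z) * B (snd z)) \<partial>lebesgue_on \<Omega>)
          = (\<integral>z. N (fst z) * (A (fst z) * B (snd z)) + s * (v z * (A (fst z) * B (snd z)) - V (fst z) * (A (fst z) * B (snd z))) \<partial>lebesgue_on \<Omega>)"
        by (simp add: algebra_simps)
      also have "\<dots> = (\<integral>z. N (fst z) * (A (fst z) * B (snd z)) \<partial>lebesgue_on \<Omega>)
          + s * (X - (\<integral>z. V (fst z) * (A (fst z) * B (snd z)) \<partial>lebesgue_on \<Omega>))"
        using Lsq_integrable_mult[OF v(1) tBL] Lsq_integrable_mult[OF Vf tBL] Lsq_integrable_mult[OF Nf tBL]
        by (simp add: X_def)
      also have "\<dots> = (\<integral>z. N (fst z) * (A (fst z) * B (snd z)) \<partial>lebesgue_on \<Omega>) - s * Y" unfolding key by simp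
      also have "\<dots> \<ge> 0"
      proof -
        have "\<bar>s * Y\<bar> = \<bar>Y\<bar>" using s by (simp add: abs_mult)
        then show ?thesis using bd by linarith
      qed
      finally show ?thesis .
    qed
  qed
  have "AE z in lebesgue_on \<Omega>. 0 \<le> N (fst z) + 1 * (v z - V (fst z))"
    "AE z in lebesgue_on \<Omega>. 0 \<le> N (fst z) + (- 1) * (v z - V (fst z))"
    by (rule main, simp)+
  then show ?thesis
    unfolding V_def[symmetric] N_def[symmetric] by eventually_elim (simp add: abs_le_iff)
qed

text \<open>Taking the vertical integral and lifting the result back to the region cost a factor
  sqrt H each.\<close>

corollary strip_average_error:
  assumes v: "v \<in> Lsq \<Omega>" "g2 \<in> Lsq \<Omega>" "has_weak_partial \<Omega> (0, 1) v g2"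
    and \<rho>: "unit_bump p q \<rho>" "{p..q} \<subseteq> {- b\<^sub>0<..<0}"
  shows "Lsq_norm \<Omega> (\<lambda>z. v z - VI (\<lambda>z. v z * \<rho> (snd z)) (fst z)) \<le> H * Lsq_norm \<Omega> g2"
proof -
  have vL: "(\<lambda>z. v z * \<rho> (snd z)) \<in> Lsq \<Omega>"
    by (rule Lsq_mult_test_snd(1)[OF v(1) unit_bump_test_function[OF \<rho>]])
  have NL: "VI (\<lambda>z. \<bar>g2 z\<bar>) \<in> Lsq {0<..<1}" by (rule VI_Lsq(1)[OF Lsq_abs[OF v(2)]])
  have dL: "(\<lambda>z. v z - VI (\<lambda>z. v z * \<rho> (snd z)) (fst z)) \<in> Lsq \<Omega>"
    by (rule Lsq_diff[OF v(1) Lsq_fst(1)[OF VI_Lsq(1)[OF vL]]])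
  have "Lsq_norm \<Omega> (\<lambda>z. v z - VI (\<lambda>z. v z * \<rho> (snd z)) (fst z)) \<le> Lsq_norm \<Omega> (\<lambda>z. VI (\<lambda>z. \<bar>g2 z\<bar>) (fst z))"
    by (rule Lsq_AE_bound(2)[OF Lsq_fst(1)[OF NL] LsqD(1)[OF dL]])
      (use strip_average_Poincare[OF v \<rho>] in \<open>eventually_elim, linarith\<close>)
  also have "\<dots> \<le> sqrt H * Lsq_norm {0<..<1} (VI (\<lambda>z. \<bar>g2 z\<bar>))" by (rule Lsq_fst(2)[OF NL])
  also have "\<dots> \<le> sqrt H * (sqrt H * Lsq_norm \<Omega> (\<lambda>z. \<bar>g2 z\<bar>))"
    using H_pos by (intro mult_left_mono VI_Lsq(2)[OF Lsq_abs[OF v(2)]]) simp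
  also have "\<dots> = H * Lsq_norm \<Omega> g2" using H_pos by (simp add: mult.assoc[symmetric])
  finally show ?thesis .
qed

end

section \<open>Sobolev functions on the unit interval\<close>

text \<open>The derivative is approximated first, by a test function w with antiderivative F. The
  difference q - F then has a derivative that is small in L1, so by \<open>Poincare_interval\<close>
  it is uniformly close to its weighted average c, and U = F + c.\<close>

proposition H1_unit_interval_smooth_approximation:
  fixes q d :: "real \<Rightarrow> real"
  assumes q: "q \<in> Lsq {0<..<1}" "d \<in> Lsq {0<..<1}" "has_weak_partial {0<..<1} 1 q d" and "e > 0"
  obtains U w B where "\<And>x. (U has_real_derivative w x) (at x)" "continuous_on UNIV w" "\<And>x. \<bar>w x\<bar> \<le> B"
    "AE x in lebesgue_on {0<..<1}. \<bar>q x - U x\<bar> \<le> e" "Lsq_norm {0<..<1} (\<lambda>x. d x - w x) \<le> e"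
proof -
  let ?I = "{0<..<1::real}"
  have I: "open ?I" "bounded ?I" "?I \<in> lmeasurable" by auto
  obtain w where w: "w \<in> test_functions ?I" "Lsq_norm ?I (\<lambda>x. d x - w x) < e"
    using test_functions_dense[OF I(1,2) q(2) \<open>e > 0\<close>] by blast
  note wc = test_function_continuous[OF w(1)]
  obtain B where B: "\<And>x. \<bar>w x\<bar> \<le> B" using test_function_bounded[OF w(1)] by blast
  obtain F where F: "\<And>x. (F has_real_derivative w x) (at x)" using real_antiderivative[OF wc] by blast
  have Fc: "continuous_on UNIV F" using F by (auto intro!: continuous_at_imp_continuous_on DERIV_isCont)
  obtain BF where BF: "\<And>x. x \<in> ?I \<Longrightarrow> \<bar>F x\<bar> \<le> BF"
  proof -
    have "compact (F ` {0..1})"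
      by (intro compact_continuous_image continuous_on_subset[OF Fc]) auto
    then obtain B' where "\<And>y. y \<in> F ` {0..1} \<Longrightarrow> norm y \<le> B'" by (meson compact_imp_bounded bounded_iff)
    then show ?thesis by (intro that[of B']) auto
  qed
  have [measurable]: "F \<in> borel_measurable borel" "w \<in> borel_measurable borel"
    by (rule borel_measurable_continuous_onI Fc wc)+
  have Fw: "has_weak_partial ?I 1 F w"
  proof (rule has_weak_partial_if_directional_derivative[OF I(1,2)])
    show "((\<lambda>t. F (x + t *\<^sub>R 1)) has_real_derivative w x) (at 0)" for x
      using F[of x] DERIV_shift[of F "w x" 0 x] by (simp add: add.commute)
  qed (use BF B in auto)
  have FL: "F \<in> Lsq ?I" by (rule Lsq_bounded(1)[OF I(3) borel_imp_measurable_lebesgue_on BF]) simp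
  note wL = test_function_in_Lsq[OF w(1) I(3)]
  note dL = Lsq_diff[OF q(1) FL] and eL = Lsq_diff[OF q(2) wL]
  obtain \<rho> where \<rho>: "unit_bump (1/4) (3/4) \<rho>" using unit_bump_exists[of "1/4" "3/4"] by auto
  define c where "c = (\<integral>t. (q t - F t) * \<rho> t \<partial>lebesgue_on ?I)"
  have wd: "has_weak_partial ?I 1 (\<lambda>x. q x - F x) (\<lambda>x. d x - w x)"
    by (rule has_weak_partial_diff[OF I(3) q(1) FL q(2) wL _ q(3) Fw]) simp
  have AE1: "AE x in lebesgue_on ?I. \<bar>q x - F x - c\<bar> \<le> (\<integral>t. \<bar>d t - w t\<bar> \<partial>lebesgue_on ?I)"
    unfolding c_def by (rule Poincare_interval[OF dL eL wd \<rho>]) auto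
  have le: "(\<integral>t. \<bar>d t - w t\<bar> \<partial>lebesgue_on ?I) \<le> e"
    using Lsq_integrable(2)[OF I(3) eL] w(2) by simp
  show thesis
  proof (rule that)
    show "((\<lambda>x. F x + c) has_real_derivative w x) (at x)" for x
      using DERIV_add[OF F DERIV_const[of c]] by simp
    show "AE x in lebesgue_on ?I. \<bar>q x - (F x + c)\<bar> \<le> e"
      using AE1 by eventually_elim (use le in linarith)
  qed (use wc B w(2) in auto)
qed

text \<open>For the smooth approximants of q the composition with \<open>fst\<close> is classically
  differentiable. Passing to q leaves in the weak identity an error of order e, for every e >
  0.\<close>

lemma (in height_region) has_weak_partial_compose_fst:
  assumes q: "q \<in> Lsq {0<..<1}" "d \<in> Lsq {0<..<1}" "has_weak_partial {0<..<1} 1 q d"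
  shows "has_weak_partial \<Omega> (1, 0) (\<lambda>z. q (fst z)) (\<lambda>z. d (fst z))"
    "has_weak_partial \<Omega> (0, 1) (\<lambda>z. q (fst z)) (\<lambda>z. 0)"
proof -
  have I: "{0<..<1::real} \<in> lmeasurable" by simp
  \<comment> \<open>The pair (i, k) treats both axes together: k = 1 goes with the first, and k = 0
    with the second, along which the derivative is 0.\<close>
  have one: "\<bar>(\<integral>z. q (fst z) * frechet_derivative \<phi> (at z) i \<partial>lebesgue_on \<Omega>) + (\<integral>z. k * d (fst z) * \<phi> z \<partial>lebesgue_on \<Omega>)\<bar>
      \<le> e * (sqrt H * (Lsq_norm \<Omega> (\<lambda>z. frechet_derivative \<phi> (at z) i) + Lsq_norm \<Omega> \<phi>))"
    if \<phi>: "\<phi> \<in> test_functions \<Omega>" and ik: "(i, k) = ((1, 0), 1) \<or> (i, k) = ((0, 1), 0)" and "e > 0"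
    for \<phi> i e and k :: real
  proof -
    have i: "i \<in> Basis" using ik by (auto simp: Basis_prod_def)
    obtain U w B where U: "\<And>x. (U has_real_derivative w x) (at x)" "continuous_on UNIV w" "\<And>x. \<bar>w x\<bar> \<le> B"
      "AE x in lebesgue_on {0<..<1}. \<bar>q x - U x\<bar> \<le> e" "Lsq_norm {0<..<1} (\<lambda>x. d x - w x) \<le> e"
      using H1_unit_interval_smooth_approximation[OF q \<open>e > 0\<close>] by blast
    have Uc: "continuous_on UNIV U" using U(1) by (auto intro!: continuous_at_imp_continuous_on DERIV_isCont)
    obtain BU where BU: "\<And>x. x \<in> {0<..<1} \<Longrightarrow> \<bar>U x\<bar> \<le> BU"
    proof -
      have "compact (U ` {0..1})"
        by (intro compact_continuous_image continuous_on_subset[OF Uc]) auto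
      then obtain B' where "\<And>y. y \<in> U ` {0..1} \<Longrightarrow> norm y \<le> B'" by (meson compact_imp_bounded bounded_iff)
      then show ?thesis by (intro that[of B']) auto
    qed
    have [measurable]: "U \<in> borel_measurable borel" "w \<in> borel_measurable borel"
      by (rule borel_measurable_continuous_onI Uc U(2))+
    have mf: "(\<lambda>z::real \<times> real. U (fst z)) \<in> borel_measurable borel" "(\<lambda>z::real \<times> real. k * w (fst z)) \<in> borel_measurable borel"
      using borel_measurable_fst_compose[of U] borel_measurable_fst_compose[of w] by auto
    have "has_weak_partial \<Omega> i (\<lambda>z. U (fst z)) (\<lambda>z. k * w (fst z))"
    proof (rule has_weak_partial_if_directional_derivative[OF open_region bounded_region i mf])
      show "\<bar>U (fst z)\<bar> \<le> BU" if "z \<in> \<Omega>" for z using BU fst_region[OF that] .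
      show "\<bar>k * w (fst z)\<bar> \<le> B" if "z \<in> \<Omega>" for z using U(3)[of "fst z"] ik by auto
      show "((\<lambda>t. U (fst (z + t *\<^sub>R i))) has_real_derivative k * w (fst z)) (at 0)" for z
      proof -
        have "((\<lambda>t. U (t + fst z)) has_real_derivative w (fst z)) (at 0)"
          using U(1)[of "fst z"] DERIV_shift[of U "w (fst z)" 0 "fst z"] by simp
        then show ?thesis using ik by (auto simp: add.commute)
      qed
    qed
    then have wk: "(\<integral>z. U (fst z) * frechet_derivative \<phi> (at z) i \<partial>lebesgue_on \<Omega>) = - (\<integral>z. k * w (fst z) * \<phi> z \<partial>lebesgue_on \<Omega>)"
      using \<phi> by (simp add: has_weak_partial_def)
    have UL: "U \<in> Lsq {0<..<1}" by (rule Lsq_bounded(1)[OF I borel_imp_measurable_lebesgue_on BU]) simp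
    have wL: "w \<in> Lsq {0<..<1}" by (rule Lsq_bounded(1)[OF I borel_imp_measurable_lebesgue_on U(3)]) simp
    have qU: "Lsq_norm {0<..<1} (\<lambda>x. q x - U x) \<le> e"
    proof -
      have c: "(\<lambda>x. e) \<in> Lsq {0<..<1::real}" "Lsq_norm {0<..<1::real} (\<lambda>x. e) \<le> \<bar>e\<bar> * sqrt (measure lebesgue {0<..<1::real})"
        using Lsq_bounded[OF I, of "\<lambda>x. e" e] \<open>e > 0\<close> by auto
      have "Lsq_norm {0<..<1} (\<lambda>x. q x - U x) \<le> Lsq_norm {0<..<1::real} (\<lambda>x. e)"
        by (rule Lsq_AE_bound(2)[OF c(1) LsqD(1)[OF Lsq_diff[OF q(1) UL]]]) (use U(4) in \<open>eventually_elim, simp\<close>)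
      then show ?thesis using c(2) \<open>e > 0\<close> by simp
    qed
    note \<phi>L = test_function_in_Lsq[OF \<phi> region_lmeasurable(1)]
      and \<phi>L' = test_function_in_Lsq[OF test_function_partial[OF \<phi> i] region_lmeasurable(1)]
    note F = Lsq_fst(1)[OF q(1)] Lsq_fst(1)[OF q(2)] Lsq_fst(1)[OF UL] Lsq_fst(1)[OF wL]
    have "\<bar>\<integral>z. (q (fst z) - U (fst z)) * frechet_derivative \<phi> (at z) i \<partial>lebesgue_on \<Omega>\<bar>
        \<le> Lsq_norm \<Omega> (\<lambda>z. q (fst z) - U (fst z)) * Lsq_norm \<Omega> (\<lambda>z. frechet_derivative \<phi> (at z) i)"
      by (rule Lsq_Cauchy_Schwarz[OF Lsq_diff[OF F(1,3)] \<phi>L'])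
    also have "\<dots> \<le> (sqrt H * e) * Lsq_norm \<Omega> (\<lambda>z. frechet_derivative \<phi> (at z) i)"
      using order_trans[OF Lsq_fst(2)[OF Lsq_diff[OF q(1) UL]] mult_left_mono[OF qU]] H_pos
      by (intro mult_right_mono) auto
    finally have b1: "\<bar>\<integral>z. (q (fst z) - U (fst z)) * frechet_derivative \<phi> (at z) i \<partial>lebesgue_on \<Omega>\<bar>
        \<le> (sqrt H * e) * Lsq_norm \<Omega> (\<lambda>z. frechet_derivative \<phi> (at z) i)" .
    have "\<bar>\<integral>z. (d (fst z) - w (fst z)) * \<phi> z \<partial>lebesgue_on \<Omega>\<bar>
        \<le> Lsq_norm \<Omega> (\<lambda>z. d (fst z) - w (fst z)) * Lsq_norm \<Omega> \<phi>"
      by (rule Lsq_Cauchy_Schwarz[OF Lsq_diff[OF F(2,4)] \<phi>L])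
    also have "\<dots> \<le> (sqrt H * e) * Lsq_norm \<Omega> \<phi>"
      using order_trans[OF Lsq_fst(2)[OF Lsq_diff[OF q(2) wL]] mult_left_mono[OF U(5)]] H_pos
      by (intro mult_right_mono) auto
    finally have b2: "\<bar>\<integral>z. (d (fst z) - w (fst z)) * \<phi> z \<partial>lebesgue_on \<Omega>\<bar> \<le> (sqrt H * e) * Lsq_norm \<Omega> \<phi>" .
    have e1: "(\<integral>z. (q (fst z) - U (fst z)) * frechet_derivative \<phi> (at z) i \<partial>lebesgue_on \<Omega>)
      = (\<integral>z. q (fst z) * frechet_derivative \<phi> (at z) i \<partial>lebesgue_on \<Omega>) - (\<integral>z. U (fst z) * frechet_derivative \<phi> (at z) i \<partial>lebesgue_on \<Omega>)"
      using Lsq_integrable_mult[OF F(1) \<phi>L'] Lsq_integrable_mult[OF F(3) \<phi>L'] by (simp add: left_diff_distrib)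
    have e2: "k * (\<integral>z. (d (fst z) - w (fst z)) * \<phi> z \<partial>lebesgue_on \<Omega>)
      = (\<integral>z. k * d (fst z) * \<phi> z \<partial>lebesgue_on \<Omega>) - (\<integral>z. k * w (fst z) * \<phi> z \<partial>lebesgue_on \<Omega>)"
      using Lsq_integrable_mult[OF F(2) \<phi>L] Lsq_integrable_mult[OF F(4) \<phi>L] by (simp add: left_diff_distrib mult.assoc right_diff_distrib)
    have "\<bar>k * (\<integral>z. (d (fst z) - w (fst z)) * \<phi> z \<partial>lebesgue_on \<Omega>)\<bar> \<le> (sqrt H * e) * Lsq_norm \<Omega> \<phi>"
      using b2 ik H_pos \<open>e > 0\<close> by auto
    then have "\<bar>(\<integral>z. q (fst z) * frechet_derivative \<phi> (at z) i \<partial>lebesgue_on \<Omega>) + (\<integral>z. k * d (fst z) * \<phi> z \<partial>lebesgue_on \<Omega>)\<bar>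
      \<le> (sqrt H * e) * Lsq_norm \<Omega> (\<lambda>z. frechet_derivative \<phi> (at z) i) + (sqrt H * e) * Lsq_norm \<Omega> \<phi>"
      using b1 e1 e2 wk by linarith
    then show ?thesis by (simp add: algebra_simps)
  qed
  have zero: "x = 0" if "\<And>e. e > 0 \<Longrightarrow> \<bar>x\<bar> \<le> e * c" "0 \<le> c" for x c :: real
  proof (rule ccontr)
    assume "x \<noteq> 0"
    then have "\<bar>x\<bar> \<le> \<bar>x\<bar> / (2 * (c + 1)) * c" using that by (intro that(1)) auto
    also have "\<dots> = \<bar>x\<bar> * (c / (2 * (c + 1)))" by simp
    also have "\<dots> \<le> \<bar>x\<bar> * (1 / 2)" using that(2) by (intro mult_left_mono) (auto simp: field_simps)
    finally show False using \<open>x \<noteq> 0\<close> by simp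
  qed
  have two: "(\<integral>z. q (fst z) * frechet_derivative \<phi> (at z) i \<partial>lebesgue_on \<Omega>) + (\<integral>z. k * d (fst z) * \<phi> z \<partial>lebesgue_on \<Omega>) = 0"
    if "\<phi> \<in> test_functions \<Omega>" "(i, k) = ((1, 0), 1) \<or> (i, k) = ((0, 1), 0)" for \<phi> i and k :: real
    by (rule zero[OF one[OF that]]) (use H_pos in auto)
  show "has_weak_partial \<Omega> (1, 0) (\<lambda>z. q (fst z)) (\<lambda>z. d (fst z))"
    unfolding has_weak_partial_def using two[of _ "(1, 0)" 1] by (auto simp: add_eq_0_iff2)
  show "has_weak_partial \<Omega> (0, 1) (\<lambda>z. q (fst z)) (\<lambda>z. 0)"
    unfolding has_weak_partial_def using two[of _ "(0, 1)" 0] by auto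
qed

section \<open>Weak convergence, uniform on bounded sets of H1(0,1)\<close>

lemma integral_interval_split:
  fixes h :: "real \<Rightarrow> real"
  assumes "a \<le> b" "b \<le> c" and h: "integrable (lebesgue_on {a<..<c}) h"
  shows "(\<integral>x. h x \<partial>lebesgue_on {a<..<c}) = (\<integral>x. h x \<partial>lebesgue_on {a<..<b}) + (\<integral>x. h x \<partial>lebesgue_on {b<..<c})"
proof -
  have hk: "(\<integral>x. h x \<partial>lebesgue_on {r<..<s}) = integral {r..s} h" "h integrable_on {r..s}" if "a \<le> r" "s \<le> c" for r s
  proof -
    have i: "integrable (lebesgue_on {r<..<s}) h"
      by (rule integrable_lebesgue_on_subset[OF h]) (use that in auto)
    show "(\<integral>x. h x \<partial>lebesgue_on {r<..<s}) = integral {r..s} h"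
      using lebesgue_integral_eq_integral[OF i] integral_open_interval_real[of r s h] by simp
    show "h integrable_on {r..s}"
      using integrable_on_lebesgue_on[OF i] integrable_on_open_interval_real[of h r s] by simp
  qed
  show ?thesis using Henstock_Kurzweil_Integration.integral_combine[OF assms(1,2) hk(2)] hk(1) assms by simp
qed

lemma integral_unit_interval_cells:
  fixes h :: "real \<Rightarrow> real"
  assumes h: "integrable (lebesgue_on {0<..<1}) h" and "0 < N"
  shows "(\<integral>x. h x \<partial>lebesgue_on {0<..<1}) = (\<Sum>j<N. \<integral>x. h x \<partial>lebesgue_on {real j / real N<..<(real j + 1) / real N})"
proof -
  have "(\<integral>x. h x \<partial>lebesgue_on {0<..<real k / real N}) = (\<Sum>j<k. \<integral>x. h x \<partial>lebesgue_on {real j / real N<..<(real j + 1) / real N})"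
    if "k \<le> N" for k
    using that
  proof (induction k)
    case (Suc k)
    have "(real k + 1) / real N \<le> 1" using Suc.prems \<open>0 < N\<close> by (simp add: divide_le_eq)
    then have "integrable (lebesgue_on {0<..<(real k + 1) / real N}) h"
      by (intro integrable_lebesgue_on_subset[OF h]) auto
    from integral_interval_split[OF _ _ this, of "real k / real N"] Suc
    show ?case by (simp add: divide_right_mono add.commute)
  qed simp
  from this[of N] \<open>0 < N\<close> show ?thesis by simp
qed

text \<open>A quantitative form of the compactness of the embedding of \<open>H\<^sup>1(0,1)\<close> into \<open>L\<^sup>2(0,1)\<close>: on each cell of a
  fine grid every function of a bounded set is close to a constant.\<close>

proposition weak_null_uniform_on_bounded_H1:
  fixes D :: "'i \<Rightarrow> real \<Rightarrow> real"
  assumes D: "\<forall>\<^sub>F i in F. D i \<in> Lsq {0<..<1} \<and> Lsq_norm {0<..<1} (D i) \<le> K"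
    and lim: "\<And>a b. 0 \<le> a \<Longrightarrow> b \<le> 1 \<Longrightarrow> ((\<lambda>i. \<integral>x. D i x \<partial>lebesgue_on {a<..<b}) \<longlongrightarrow> 0) F"
    and "e > 0"
  shows "\<forall>\<^sub>F i in F. \<forall>V V'. V \<in> Lsq {0<..<1} \<longrightarrow> V' \<in> Lsq {0<..<1} \<longrightarrow> has_weak_partial {0<..<1} 1 V V' \<longrightarrow>
    Lsq_norm {0<..<1} V \<le> R \<longrightarrow> Lsq_norm {0<..<1} V' \<le> R \<longrightarrow> \<bar>\<integral>x. D i x * V x \<partial>lebesgue_on {0<..<1}\<bar> \<le> e"
proof -
  let ?I = "{0<..<1::real}"
  define c where "c = \<bar>R\<bar> * \<bar>K\<bar>"
  \<comment> \<open>When the derivative has norm at most R, a function deviates on a cell of length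
    1 / N from its weighted average by at most R / sqrt N. This \<open>N\<close> makes R / sqrt N
    times the bound \<open>K\<close> of the norms of \<open>D i\<close> at most e / 2.\<close>
  obtain N :: nat where N: "real N > (2 * c / e)\<^sup>2 + 1" using reals_Archimedean2 by blast
  have "real N > 0" using N zero_le_power2[of "2 * c / e"] by linarith
  then have N0: "0 < N" "real N > 0" by simp_all
  define J where "J j = {real j / real N<..<(real j + 1) / real N}" for j
  have Jlm: "J j \<in> lmeasurable" "J j \<in> sets lebesgue" for j by (auto simp: J_def)
  have Jsub: "J j \<subseteq> ?I" if "j < N" for j
  proof -
    have "(real j + 1) / real N \<le> 1" "0 \<le> real j / real N" using that N0 by (simp_all add: divide_le_eq)
    note le = this
    show ?thesis
    proof
      fix x assume "x \<in> J j"
      then have "real j / real N < x" "x < (real j + 1) / real N" by (simp_all add: J_def)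
      then have "0 < x" "x < 1" using le by linarith+
      then show "x \<in> ?I" by simp
    qed
  qed
  have Jm: "measure lebesgue (J j) = 1 / real N" for j
    using N0 by (simp add: J_def diff_divide_distrib[symmetric] divide_right_mono)
  have "\<exists>\<rho> p q. unit_bump p q \<rho> \<and> {p..q} \<subseteq> J j" for j
  proof -
    define p q where "p = (real j + 1/4) / real N" and "q = (real j + 3/4) / real N"
    have "p < q" "{p..q} \<subseteq> J j" using N0 by (auto simp: p_def q_def J_def field_simps)
    moreover obtain \<rho> where "unit_bump p q \<rho>" using unit_bump_exists[OF \<open>p < q\<close>] by blast
    ultimately show ?thesis by blast
  qed
  then obtain \<rho> p q where \<rho>: "\<And>j. unit_bump (p j) (q j) (\<rho> j)" "\<And>j. {p j..q j} \<subseteq> J j" by metis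
  have \<rho>L: "\<rho> j \<in> Lsq (J j)" for j
    by (rule test_function_in_Lsq[OF unit_bump_test_function[OF \<rho>] Jlm(1)])
  define P where "P j = Lsq_norm (J j) (\<rho> j)" for j
  \<comment> \<open>Cells and weights depend neither on i nor on V, so finitely many scalar limits
    yield uniformity in V.\<close>
  have "((\<lambda>i. \<Sum>j<N. \<bar>R\<bar> * P j * \<bar>\<integral>x. D i x \<partial>lebesgue_on (J j)\<bar>) \<longlongrightarrow> (\<Sum>j<N. \<bar>R\<bar> * P j * \<bar>0\<bar>)) F"
  proof (intro tendsto_intros)
    fix j assume "j \<in> {..<N}"
    then show "((\<lambda>i. \<integral>x. D i x \<partial>lebesgue_on (J j)) \<longlongrightarrow> 0) F"
      unfolding J_def using N0 by (intro lim) (auto simp: field_simps)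
  qed
  then have "\<forall>\<^sub>F i in F. (\<Sum>j<N. \<bar>R\<bar> * P j * \<bar>\<integral>x. D i x \<partial>lebesgue_on (J j)\<bar>) < e / 2"
    using \<open>e > 0\<close> by (intro order_tendstoD(2)) auto
  with D show ?thesis
  proof eventually_elim
    case (elim i)
    then have DL: "D i \<in> Lsq ?I" "Lsq_norm ?I (D i) \<le> K" by auto
    have Dint: "integrable (lebesgue_on ?I) (D i)" by (rule Lsq_integrable(1)[OF _ DL(1)]) simp
    have D1: "(\<integral>x. \<bar>D i x\<bar> \<partial>lebesgue_on ?I) \<le> \<bar>K\<bar>"
    proof -
      have "(\<integral>x. \<bar>D i x\<bar> \<partial>lebesgue_on ?I) \<le> sqrt (measure lebesgue ?I) * Lsq_norm ?I (D i)"
        by (rule Lsq_integrable(2)[OF _ DL(1)]) simp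
      then show ?thesis using DL(2) by simp
    qed
    show ?case
    proof (intro allI impI)
      fix V V' assume V: "V \<in> Lsq ?I" "V' \<in> Lsq ?I" "has_weak_partial ?I 1 V V'" "Lsq_norm ?I V \<le> R" "Lsq_norm ?I V' \<le> R"
      have R0: "0 \<le> R" using V(4) Lsq_norm_nonneg[of ?I V] by linarith
      note DV = Lsq_integrable_mult[OF DL(1) V(1)]
      have cell: "\<bar>\<integral>x. D i x * V x \<partial>lebesgue_on (J j)\<bar> \<le> \<bar>R\<bar> / sqrt (real N) * (\<integral>x. \<bar>D i x\<bar> \<partial>lebesgue_on (J j))
          + \<bar>R\<bar> * P j * \<bar>\<integral>x. D i x \<partial>lebesgue_on (J j)\<bar>" if j: "j < N" for j
      proof -
        note S = Jsub[OF j] Jlm(2)[of j]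
        have Is: "?I \<in> sets lebesgue" by simp
        note VJ = Lsq_subset[OF V(1) S Is] and V'J = Lsq_subset[OF V(2) S Is] and DJ = Lsq_subset[OF DL(1) S Is]
        have wJ: "has_weak_partial (J j) 1 V V'" by (rule has_weak_partial_subset[OF V(3) S Is]) simp
        \<comment> \<open>The comparison constant on the cell is a weighted average, which
          Cauchy-Schwarz bounds uniformly in V.\<close>
        define v where "v = (\<integral>t. V t * \<rho> j t \<partial>lebesgue_on (J j))"
        have "\<bar>v\<bar> \<le> Lsq_norm (J j) V * P j" unfolding v_def P_def by (rule Lsq_Cauchy_Schwarz[OF VJ(1) \<rho>L])
        also have "\<dots> \<le> \<bar>R\<bar> * P j" using VJ(2) V(4) by (intro mult_right_mono) (auto simp: P_def)
        finally have v: "\<bar>v\<bar> \<le> \<bar>R\<bar> * P j" .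
        have close0: "AE x in lebesgue_on (J j). \<bar>V x - v\<bar> \<le> (\<integral>t. \<bar>V' t\<bar> \<partial>lebesgue_on (J j))"
          using Poincare_interval[of V "real j / real N" "(real j + 1) / real N" V', folded J_def, OF VJ(1) V'J(1) wJ \<rho>(1)[of j] \<rho>(2)[of j]]
          by (simp add: v_def)
        have osc: "(\<integral>t. \<bar>V' t\<bar> \<partial>lebesgue_on (J j)) \<le> \<bar>R\<bar> / sqrt (real N)"
        proof -
          have "(\<integral>t. \<bar>V' t\<bar> \<partial>lebesgue_on (J j)) \<le> sqrt (measure lebesgue (J j)) * Lsq_norm (J j) V'"
            by (rule Lsq_integrable(2)[OF Jlm(1) V'J(1)])
          also have "\<dots> \<le> sqrt (1 / real N) * \<bar>R\<bar>"
            unfolding Jm using V'J(2) V(5) by (intro mult_left_mono) auto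
          finally show ?thesis by (simp add: real_sqrt_divide)
        qed
        have close: "AE x in lebesgue_on (J j). \<bar>V x - v\<bar> \<le> \<bar>R\<bar> / sqrt (real N)"
          using close0 by eventually_elim (use osc in linarith)
        have cL: "(\<lambda>x. v) \<in> Lsq (J j)" by (rule Lsq_bounded(1)[OF Jlm(1)]) auto
        note i1 = Lsq_integrable_mult[OF DJ(1) Lsq_diff[OF VJ(1) cL]] and i2 = Lsq_integrable(1)[OF Jlm(1) DJ(1)]
        have "(\<integral>x. D i x * V x \<partial>lebesgue_on (J j)) = (\<integral>x. D i x * (V x - v) + v * D i x \<partial>lebesgue_on (J j))"
          by (simp add: algebra_simps)
        also have "\<dots> = (\<integral>x. D i x * (V x - v) \<partial>lebesgue_on (J j)) + v * (\<integral>x. D i x \<partial>lebesgue_on (J j))"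
          using i1 i2 by simp
        finally have eq: "(\<integral>x. D i x * V x \<partial>lebesgue_on (J j)) = (\<integral>x. D i x * (V x - v) \<partial>lebesgue_on (J j)) + v * (\<integral>x. D i x \<partial>lebesgue_on (J j))" .
        have "\<bar>\<integral>x. D i x * (V x - v) \<partial>lebesgue_on (J j)\<bar> \<le> (\<integral>x. \<bar>D i x * (V x - v)\<bar> \<partial>lebesgue_on (J j))"
          by (rule integral_abs_bound)
        also have "\<dots> \<le> (\<integral>x. \<bar>R\<bar> / sqrt (real N) * \<bar>D i x\<bar> \<partial>lebesgue_on (J j))"
        proof (rule integral_mono_AE[OF integrable_abs[OF i1]])
          show "integrable (lebesgue_on (J j)) (\<lambda>x. \<bar>R\<bar> / sqrt (real N) * \<bar>D i x\<bar>)"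
            using i2 by (intro integrable_mult_right integrable_abs)
          show "AE x in lebesgue_on (J j). \<bar>D i x * (V x - v)\<bar> \<le> \<bar>R\<bar> / sqrt (real N) * \<bar>D i x\<bar>"
            using close
          proof eventually_elim
            case (elim x)
            then show ?case unfolding abs_mult mult.commute[of "\<bar>D i x\<bar>"] by (rule mult_right_mono) simp
          qed
        qed
        also have "\<dots> = \<bar>R\<bar> / sqrt (real N) * (\<integral>x. \<bar>D i x\<bar> \<partial>lebesgue_on (J j))" by simp
        finally have b1: "\<bar>\<integral>x. D i x * (V x - v) \<partial>lebesgue_on (J j)\<bar> \<le> \<bar>R\<bar> / sqrt (real N) * (\<integral>x. \<bar>D i x\<bar> \<partial>lebesgue_on (J j))" .
        have b2: "\<bar>v * (\<integral>x. D i x \<partial>lebesgue_on (J j))\<bar> \<le> \<bar>R\<bar> * P j * \<bar>\<integral>x. D i x \<partial>lebesgue_on (J j)\<bar>"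
          unfolding abs_mult by (rule mult_right_mono[OF v]) simp
        show ?thesis unfolding eq using b1 b2 by linarith
      qed
      have "\<bar>\<integral>x. D i x * V x \<partial>lebesgue_on ?I\<bar> = \<bar>\<Sum>j<N. \<integral>x. D i x * V x \<partial>lebesgue_on (J j)\<bar>"
        unfolding J_def using integral_unit_interval_cells[OF DV N0(1)] by simp
      also have "\<dots> \<le> (\<Sum>j<N. \<bar>\<integral>x. D i x * V x \<partial>lebesgue_on (J j)\<bar>)" by (rule sum_abs)
      also have "\<dots> \<le> (\<Sum>j<N. \<bar>R\<bar> / sqrt (real N) * (\<integral>x. \<bar>D i x\<bar> \<partial>lebesgue_on (J j))
          + \<bar>R\<bar> * P j * \<bar>\<integral>x. D i x \<partial>lebesgue_on (J j)\<bar>)" by (rule sum_mono) (use cell in auto)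
      also have "\<dots> = \<bar>R\<bar> / sqrt (real N) * (\<integral>x. \<bar>D i x\<bar> \<partial>lebesgue_on ?I)
          + (\<Sum>j<N. \<bar>R\<bar> * P j * \<bar>\<integral>x. D i x \<partial>lebesgue_on (J j)\<bar>)"
        unfolding J_def integral_unit_interval_cells[OF integrable_abs[OF Dint] N0(1)]
        by (simp add: sum.distrib sum_distrib_left)
      also have "\<dots> \<le> \<bar>R\<bar> / sqrt (real N) * \<bar>K\<bar> + e / 2"
        using D1 elim by (intro add_mono mult_left_mono) auto
      also have "\<bar>R\<bar> / sqrt (real N) * \<bar>K\<bar> \<le> e / 2"
      proof -
        have "2 * c / e = sqrt ((2 * c / e)\<^sup>2)" using \<open>e > 0\<close> by (simp add: c_def)
        also have "\<dots> \<le> sqrt (real N)" using N by (intro real_sqrt_le_mono) linarith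
        finally have "2 * c \<le> sqrt (real N) * e" using \<open>e > 0\<close> by (simp add: field_simps)
        then show ?thesis using N0 by (simp add: c_def field_simps)
      qed
      finally show "\<bar>\<integral>x. D i x * V x \<partial>lebesgue_on ?I\<bar> \<le> e" by simp
    qed
  qed
qed

section \<open>The oscillating domains\<close>

text \<open>As \<open>m\<close> is the mean, the antiderivative P of g - m is periodic for positive
  arguments, hence bounded by l M, its bound on one period. The integral from s to t is a difference
  of two values of P, however long the interval is.\<close>

lemma periodic_integral_bound:
  fixes g :: "real \<Rightarrow> real"
  assumes g[measurable]: "g \<in> borel_measurable borel" and bd: "\<And>y. 0 \<le> g y" "\<And>y. g y \<le> M"
    and per: "\<And>y. g (y + l) = g y" and "0 < l" and m: "m = 1 / l * (\<integral>y. g y \<partial>lebesgue_on {0..l})"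
    and st: "0 \<le> s" "s \<le> t"
  shows "\<bar>(\<integral>y. g y - m \<partial>lebesgue_on {s<..<t})\<bar> \<le> 2 * (l * M)"
proof -
  have int: "integrable (lebesgue_on {a..c}) (\<lambda>y. g y - r)" for a c r
  proof -
    have "(\<lambda>y. g y - r) \<in> Lsq {a..c}"
    proof (rule Lsq_bounded(1))
      show "\<bar>g y - r\<bar> \<le> \<bar>M\<bar> + \<bar>r\<bar>" for y using bd[of y] by linarith
    qed (auto intro!: borel_imp_measurable_lebesgue_on)
    then show ?thesis by (intro Lsq_integrable(1)) auto
  qed
  have hk: "(\<integral>y. g y - r \<partial>lebesgue_on {a..c}) = integral {a..c} (\<lambda>y. g y - r)"
    "(\<lambda>y. g y - r) integrable_on {a..c}" for a c r
    using lebesgue_integral_eq_integral[OF int] integrable_on_lebesgue_on[OF int] by auto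
  have "0 \<le> M" using bd[of 0] by linarith
  have ml: "integral {0..l} (\<lambda>y. g y - m) = 0"
  proof -
    have "integrable (lebesgue_on {0..l}) g" using int[of 0 l 0] by simp
    then have "(\<integral>y. g y - m \<partial>lebesgue_on {0..l}) = (\<integral>y. g y \<partial>lebesgue_on {0..l}) - l * m"
      using \<open>0 < l\<close> finite_measure.integrable_const[OF finite_measure_lebesgue_on[of "{0..l}"]]
      by (simp add: measure_restrict_space)
    also have "\<dots> = 0" using \<open>0 < l\<close> by (simp add: m)
    finally show ?thesis using hk(1)[of 0 l m] by simp
  qed
  have "0 \<le> (\<integral>y. g y \<partial>lebesgue_on {0..l})" using bd by (intro integral_nonneg_AE AE_I2) auto
  then have m0: "0 \<le> m" using \<open>0 < l\<close> by (simp add: m)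
  have mM: "m \<le> M"
  proof -
    have "(\<integral>y. g y \<partial>lebesgue_on {0..l}) \<le> (\<integral>y. M \<partial>lebesgue_on {0..l})"
      using int[of 0 l 0] bd finite_measure.integrable_const[OF finite_measure_lebesgue_on[of "{0..l}"]]
      by (intro integral_mono) auto
    then show ?thesis using \<open>0 < l\<close> by (simp add: m measure_restrict_space field_simps)
  qed
  define P where "P t = integral {0..t} (\<lambda>y. g y - m)" for t
  have P_shift: "P (t + l) = P t" if "0 \<le> t" for t
  proof -
    have "P (t + l) = integral {0..l} (\<lambda>y. g y - m) + integral {l..t + l} (\<lambda>y. g y - m)"
      unfolding P_def using that \<open>0 < l\<close> hk(2)
      by (intro Henstock_Kurzweil_Integration.integral_combine[symmetric]) auto
    also have "integral {l..t + l} (\<lambda>y. g y - m) = integral {0..t} (\<lambda>y. g (y + l) - m)"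
      using integral_shift_real_ivl[of l l "t + l" "\<lambda>y. g y - m"] by simp
    finally show ?thesis using ml by (simp add: per P_def)
  qed
  have P_small: "\<bar>P t\<bar> \<le> l * M" if "0 \<le> t" "t \<le> l" for t
  proof -
    have "\<bar>g y - m\<bar> \<le> M" for y using bd[of y] m0 mM by linarith
    then have "norm (integral (cbox 0 t) (\<lambda>y. g y - m)) \<le> M * measure lborel (cbox 0 t)"
      using hk(2) \<open>0 \<le> M\<close> by (intro Henstock_Kurzweil_Integration.integrable_bound) auto
    then have "\<bar>P t\<bar> \<le> M * t" using that by (simp add: P_def)
    also have "\<dots> \<le> M * l" using that \<open>0 \<le> M\<close> by (intro mult_left_mono)
    finally show ?thesis by (simp add: mult.commute)
  qed
  have P_bound: "\<bar>P t\<bar> \<le> l * M" if "0 \<le> t" for t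
  proof -
    have P_n: "P (r + real n * l) = P r" if "0 \<le> r" for n r
    proof (induction n)
      case (Suc n)
      have "P (r + real (Suc n) * l) = P (r + real n * l + l)" by (simp add: algebra_simps)
      also have "\<dots> = P (r + real n * l)" using that \<open>0 < l\<close> by (intro P_shift) simp
      finally show ?case using Suc by simp
    qed simp
    define n where "n = nat \<lfloor>t / l\<rfloor>"
    have fl: "of_int \<lfloor>t / l\<rfloor> = real n" using that \<open>0 < l\<close> by (simp add: n_def)
    have "real n \<le> t / l" "t / l < real n + 1" unfolding fl[symmetric] by linarith+
    then have "0 \<le> t - real n * l" "t - real n * l \<le> l" using \<open>0 < l\<close> by (auto simp: field_simps)
    from P_small[OF this] P_n[OF this(1), of n] show ?thesis by simp
  qed
  have "(\<integral>y. g y - m \<partial>lebesgue_on {s<..<t}) = integral {s..t} (\<lambda>y. g y - m)"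
  proof -
    have "integrable (lebesgue_on {s<..<t}) (\<lambda>y. g y - m)"
      by (rule integrable_lebesgue_on_subset[OF int[of s t]]) auto
    from lebesgue_integral_eq_integral[OF this] show ?thesis
      using integral_open_interval_real[of s t "\<lambda>y. g y - m"] by simp
  qed
  also have "\<dots> = P t - P s"
    using Henstock_Kurzweil_Integration.integral_combine[OF st hk(2)[of m 0 t]] by (simp add: P_def)
  finally show ?thesis using P_bound[of s] P_bound[of t] st by linarith
qed

lemma integral_rescale:
  fixes g :: "real \<Rightarrow> real"
  assumes [measurable]: "g \<in> borel_measurable borel" and "0 < s"
  shows "(\<integral>x. g (x / s) \<partial>lebesgue_on {c<..<d}) = s * (\<integral>y. g y \<partial>lebesgue_on {c / s<..<d / s})"
proof -
  have "(\<integral>x. g (x / s) \<partial>lebesgue_on {c<..<d}) = (\<integral>x. indicator {c<..<d} x * g (x / s) \<partial>lborel)"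
    by (rule lebesgue_on_integral_eq_lborel) auto
  also have "\<dots> = \<bar>s\<bar> *\<^sub>R (\<integral>y. indicator {c<..<d} (0 + s * y) * g ((0 + s * y) / s) \<partial>lborel)"
    using \<open>0 < s\<close> by (intro lborel_integral_real_affine) simp
  also have "(\<integral>y. indicator {c<..<d} (0 + s * y) * g ((0 + s * y) / s) \<partial>lborel) = (\<integral>y. indicator {c / s<..<d / s} y * g y \<partial>lborel)"
    using \<open>0 < s\<close> by (intro Bochner_Integration.integral_cong) (auto simp: indicator_def field_simps)
  also have "\<dots> = (\<integral>y. g y \<partial>lebesgue_on {c / s<..<d / s})"
    by (rule lebesgue_on_integral_eq_lborel[symmetric]) auto
  finally show ?thesis using \<open>0 < s\<close> by simp
qed

locale thin_domain =
  fixes \<alpha> \<epsilon>\<^sub>0 b\<^sub>0 b\<^sub>1 L' L M :: real and b l :: "real \<Rightarrow> real" and G :: "real \<Rightarrow> real \<Rightarrow> real"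
  assumes alpha: "\<alpha> > 1" and eps0: "\<epsilon>\<^sub>0 > 0"
    and b0: "0 < b\<^sub>0" and b_bounds: "\<And>x. x \<in> {0<..<1} \<Longrightarrow> b\<^sub>0 \<le> b x \<and> b x \<le> b\<^sub>1"
    and G_nonneg: "\<And>x y. x \<in> {0..1} \<Longrightarrow> 0 \<le> G x y"
    and G_cont: "\<And>\<eta>. \<eta> > 0 \<Longrightarrow> \<exists>\<delta>>0. \<forall>x\<in>{0..1}. \<forall>x'\<in>{0..1}. \<bar>x - x'\<bar> < \<delta> \<longrightarrow> (\<forall>y. \<bar>G x y - G x' y\<bar> \<le> \<eta>)"
    and G_le: "\<And>x y. x \<in> {0..1} \<Longrightarrow> G x y \<le> M"
    and G_periodic: "\<And>x y. x \<in> {0..1} \<Longrightarrow> G x (y + l x) = G x y"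
    and l_bounds: "0 < L'" "\<And>x. x \<in> {0..1} \<Longrightarrow> L' \<le> l x \<and> l x \<le> L"
    and open_domain: "\<And>\<epsilon>. \<epsilon> \<in> {0<..<\<epsilon>\<^sub>0} \<Longrightarrow> open (region b (G_eps G \<alpha> \<epsilon>))"
    and min_exists: "\<And>x. x \<in> {0..1} \<Longrightarrow> \<exists>y. \<forall>z. G x y \<le> G x z"
begin

abbreviation Ge :: "real \<Rightarrow> real \<Rightarrow> real" where "Ge \<equiv> G_eps G \<alpha>"
abbreviation G0 :: "real \<Rightarrow> real" where "G0 \<equiv> G_min G"

definition H :: real where "H = b\<^sub>1 + M"
text \<open>The weak limit of the oscillating heights \<open>Ge \<epsilon>\<close>; adding
  \<open>b\<close> gives \<open>mean_height\<close>.\<close>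

definition G_mean :: "real \<Rightarrow> real" where "G_mean x = 1 / l x * (\<integral>y. G x y \<partial>lebesgue_on {0..l x})"

lemma l_pos: "x \<in> {0..1} \<Longrightarrow> 0 < l x"
  using l_bounds by force

lemma M_nonneg: "0 \<le> M" using G_nonneg[of 0 0] G_le[of 0 0] by simp

lemma L_pos: "0 < L" using l_bounds(1) l_bounds(2)[of 0] by simp

lemma G0_attained:
  assumes "x \<in> {0..1}" obtains y where "G x y = G0 x"
proof -
  obtain y where y: "\<And>z. G x y \<le> G x z" using min_exists[OF assms] by blast
  have "G0 x = G x y" unfolding G_min_def by (rule Least_equality) (use y in auto)
  then show thesis using that by metis
qed

lemma G0_le: "x \<in> {0..1} \<Longrightarrow> G0 x \<le> G x z"
proof -
  assume x: "x \<in> {0..1}"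
  obtain y where y: "\<And>z. G x y \<le> G x z" using min_exists[OF x] by blast
  have "G0 x = G x y" unfolding G_min_def by (rule Least_equality) (use y in auto)
  then show "G0 x \<le> G x z" using y by simp
qed

lemma G0_nonneg: "x \<in> {0..1} \<Longrightarrow> 0 \<le> G0 x"
  by (metis G0_attained G_nonneg)

lemma G0_close:
  assumes "x \<in> {0..1}" "x' \<in> {0..1}" "\<And>y. \<bar>G x y - G x' y\<bar> \<le> \<eta>"
  shows "\<bar>G0 x - G0 x'\<bar> \<le> \<eta>"
proof -
  obtain y where y: "G x y = G0 x" using G0_attained[OF assms(1)] by blast
  obtain y' where y': "G x' y' = G0 x'" using G0_attained[OF assms(2)] by blast
  have "G0 x' \<le> G x' y" "G0 x \<le> G x y'" using G0_le assms by auto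
  then show ?thesis using assms(3)[of y] assms(3)[of y'] y y' by linarith
qed

text \<open>A quantity attached to the slice \<open>G x\<close> that is 1-Lipschitz for the sup norm
  is continuous in x. This serves both \<open>G0\<close> and \<open>G_mean\<close>.\<close>

lemma continuous_on_if_close:
  fixes f :: "real \<Rightarrow> real"
  assumes "\<And>x x' \<eta>. x \<in> S \<Longrightarrow> x' \<in> S \<Longrightarrow> (\<And>y. \<bar>G x y - G x' y\<bar> \<le> \<eta>) \<Longrightarrow> \<bar>f x - f x'\<bar> \<le> \<eta>" and S: "S \<subseteq> {0..1}"
  shows "continuous_on S f"
  unfolding continuous_on_iff
proof (intro ballI allI impI)
  fix x e :: real assume x: "x \<in> S" and e: "0 < e"
  obtain \<delta> where \<delta>: "\<delta> > 0" "\<forall>x\<in>{0..1}. \<forall>x'\<in>{0..1}. \<bar>x - x'\<bar> < \<delta> \<longrightarrow> (\<forall>y. \<bar>G x y - G x' y\<bar> \<le> e / 2)"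
    using G_cont[of "e / 2"] e by auto
  show "\<exists>d>0. \<forall>x'\<in>S. dist x' x < d \<longrightarrow> dist (f x') (f x) < e"
  proof (intro exI conjI ballI impI)
    fix x' assume x': "x' \<in> S" "dist x' x < \<delta>"
    have "\<bar>f x' - f x\<bar> \<le> e / 2"
      by (rule assms(1)[OF x'(1) x]) (use \<delta>(2) x x' S in \<open>auto simp: dist_real_def\<close>)
    then show "dist (f x') (f x) < e" using e by (simp add: dist_real_def)
  qed (rule \<delta>(1))
qed

lemma G0_continuous: "continuous_on {0..1} G0"
  by (rule continuous_on_if_close) (auto intro: G0_close)

lemma height_region_eps:
  assumes "\<epsilon> \<in> {0<..<\<epsilon>\<^sub>0}" shows "height_region b (Ge \<epsilon>) b\<^sub>0 H"
proof
  fix x :: real assume x: "x \<in> {0<..<1}"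
  show "b\<^sub>0 \<le> b x" using b_bounds[OF x] by simp
  show "0 \<le> Ge \<epsilon> x" unfolding G_eps_def by (rule G_nonneg) (use x in simp)
  have "Ge \<epsilon> x \<le> M" unfolding G_eps_def by (rule G_le) (use x in simp)
  then show "b x + Ge \<epsilon> x \<le> H" using b_bounds[OF x] by (simp add: H_def)
qed (use open_domain[OF assms] b0 in auto)

lemma eps_half: "\<epsilon>\<^sub>0 / 2 \<in> {0<..<\<epsilon>\<^sub>0}" using eps0 by simp

lemma G0_le_Ge: "x \<in> {0<..<1} \<Longrightarrow> G0 x \<le> Ge \<epsilon> x"
  unfolding G_eps_def by (rule G0_le) simp

lemma region_G0_subset: "region b G0 \<subseteq> region b (Ge \<epsilon>)"
  unfolding region_def using G0_le_Ge[of _ \<epsilon>] by force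

text \<open>The function \<open>b\<close> may jump, so openness near the lower boundary is borrowed
  from one of the oscillating domains; near the upper boundary it comes from the continuity of
  \<open>G0\<close>.\<close>

lemma open_region_G0: "open (region b G0)"
proof -
  have "region b G0 = {z. fst z \<in> {0<..<1} \<and> snd z < G0 (fst z)} \<inter> region b (Ge (\<epsilon>\<^sub>0 / 2))"
    using G0_le_Ge[of _ "\<epsilon>\<^sub>0 / 2"] by (auto simp: region_def intro: less_le_trans)
  moreover have "open {z :: real \<times> real. fst z \<in> {0<..<1} \<and> snd z < G0 (fst z)}"
  proof -
    have "continuous_on ({0<..<1} \<times> UNIV) (\<lambda>z :: real \<times> real. G0 (fst z) - snd z)"
      by (intro continuous_intros continuous_on_compose2[OF G0_continuous]) auto
    then have "open ({0<..<1} \<times> UNIV \<inter> (\<lambda>z :: real \<times> real. G0 (fst z) - snd z) -` {0<..})"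
      by (rule continuous_open_preimage) (auto intro: open_Times)
    also have "{0<..<1} \<times> UNIV \<inter> (\<lambda>z :: real \<times> real. G0 (fst z) - snd z) -` {0<..}
      = {z :: real \<times> real. fst z \<in> {0<..<1} \<and> snd z < G0 (fst z)}" by auto
    finally show ?thesis .
  qed
  ultimately show ?thesis using open_domain[OF eps_half] by (simp add: open_Int)
qed

lemma height_region_G0: "height_region b G0 b\<^sub>0 H"
proof
  fix x :: real assume x: "x \<in> {0<..<1}"
  show "b\<^sub>0 \<le> b x" using b_bounds[OF x] by simp
  show "0 \<le> G0 x" by (rule G0_nonneg) (use x in simp)
  have "G0 x \<le> M" by (rule order_trans[OF G0_le G_le]) (use x in auto)
  then show "b x + G0 x \<le> H" using b_bounds[OF x] by (simp add: H_def)
qed (use open_region_G0 b0 in auto)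

text \<open>Measurability is read off from the open region: b + g is the vertical integral of the
  constant 1. Differences then give \<open>b\<close> and \<open>Ge \<epsilon>\<close>
  separately.\<close>

lemma Lsq_height:
  assumes "height_region b g b\<^sub>0 H" shows "(\<lambda>x. b x + g x) \<in> Lsq {0<..<1}"
proof -
  interpret height_region b g b\<^sub>0 H by fact
  have "VI (\<lambda>z. 1) \<in> Lsq {0<..<1}"
    by (rule VI_Lsq(1)[OF Lsq_bounded(1)[OF region_lmeasurable(1)]]) auto
  note VL = this
  have m: "(\<lambda>x. b x + g x) \<in> borel_measurable (lebesgue_on {0<..<1})"
    using LsqD(1)[OF VL] by (subst measurable_lebesgue_cong[where g="VI (\<lambda>z. 1)"]) (simp_all add: VI_const_1)
  show ?thesis
  proof (rule Lsq_AE_bound(1)[OF VL m], rule AE_I2)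
    fix x :: real assume "x \<in> space (lebesgue_on {0<..<1})"
    then show "\<bar>b x + g x\<bar> \<le> \<bar>VI (\<lambda>z. 1) x\<bar>" by (simp add: VI_const_1)
  qed
qed

lemma Lsq_G0: "G0 \<in> Lsq {0<..<1}"
proof (rule Lsq_bounded(1))
  show "G0 \<in> borel_measurable (lebesgue_on {0<..<1})"
    by (intro continuous_imp_measurable_on_sets_lebesgue continuous_on_subset[OF G0_continuous]) auto
  show "\<bar>G0 x\<bar> \<le> M" if "x \<in> {0<..<1}" for x
    using that G0_nonneg[of x] order_trans[OF G0_le G_le, of x] by auto
qed simp

lemma Lsq_b: "b \<in> Lsq {0<..<1}"
  using Lsq_diff[OF Lsq_height[OF height_region_G0] Lsq_G0] by simp

lemma Lsq_Ge: "\<epsilon> \<in> {0<..<\<epsilon>\<^sub>0} \<Longrightarrow> Ge \<epsilon> \<in> Lsq {0<..<1}"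
  using Lsq_diff[OF Lsq_height[OF height_region_eps] Lsq_b] by simp

lemma G_periodic_nat: "x \<in> {0..1} \<Longrightarrow> G x (y + real n * l x) = G x y"
proof (induction n)
  case (Suc n)
  have "G x (y + real (Suc n) * l x) = G x ((y + real n * l x) + l x)" by (simp add: algebra_simps)
  then show ?case using Suc G_periodic[of x "y + real n * l x"] by simp
qed simp

text \<open>Openness of the domains, at all scales \<open>\<epsilon>\<close>, makes \<open>G\<close> lower semicontinuous in its second variable.\<close>

lemma G_slice_measurable:
  assumes x: "x \<in> {0<..<1}" shows "G x \<in> borel_measurable borel"
proof (rule borel_measurableI_greater)
  fix t :: real
  show "{y \<in> space borel. t < G x y} \<in> sets borel"
  proof (cases "t < 0")
    case True
    then have "{y \<in> space borel. t < G x y} = UNIV" using G_nonneg[of x] x by (auto intro: less_le_trans)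
    then show ?thesis by simp
  next
    case False
    have "open {y. t < G x y}"
    proof (subst open_subopen, intro ballI)
      fix y0 assume "y0 \<in> {y. t < G x y}"
      then have y0: "t < G x y0" by simp
      define \<eta> where "\<eta> = (G x y0 - t) / 3"
      have \<eta>: "\<eta> > 0" using y0 by (simp add: \<eta>_def)
      obtain \<delta> where \<delta>: "\<delta> > 0" "\<forall>x\<in>{0..1}. \<forall>x'\<in>{0..1}. \<bar>x - x'\<bar> < \<delta> \<longrightarrow> (\<forall>y. \<bar>G x y - G x' y\<bar> \<le> \<eta>)"
        using G_cont[OF \<eta>] by auto
      define s where "s = (\<epsilon>\<^sub>0 / 2) powr \<alpha>"
      have s: "s > 0" using eps0 by (simp add: s_def)
      have lx: "l x > 0" using l_pos x by simp
      \<comment> \<open>Shifting \<open>y0\<close> by n periods makes \<open>y1\<close> so large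
        that the \<epsilon> with x / \<epsilon>^\<alpha> = y1 lies below the admissible
        bound.\<close>
      obtain n :: nat where n: "real n > (x / s + \<bar>y0\<bar>) / l x" using reals_Archimedean2 by blast
      define y1 where "y1 = y0 + real n * l x"
      have y1: "y1 > x / s" "y1 > 0"
      proof -
        have "real n * l x > x / s + \<bar>y0\<bar>" using n lx by (simp add: field_simps)
        then show "y1 > x / s" unfolding y1_def by linarith
        moreover have "x / s > 0" using x s by simp
        ultimately show "y1 > 0" by linarith
      qed
      define \<epsilon> where "\<epsilon> = (x / y1) powr (1 / \<alpha>)"
      have e\<alpha>: "\<epsilon> powr \<alpha> = x / y1" using alpha x y1 by (simp add: \<epsilon>_def powr_powr)
      have e0: "\<epsilon> > 0" using x y1 by (simp add: \<epsilon>_def)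
      have "\<epsilon> < \<epsilon>\<^sub>0"
      proof (rule ccontr)
        assume "\<not> \<epsilon> < \<epsilon>\<^sub>0"
        then have "s \<le> \<epsilon> powr \<alpha>" unfolding s_def using eps0 alpha by (intro powr_mono2) auto
        then have "s \<le> x / y1" by (simp add: e\<alpha>)
        then show False using y1 s by (simp add: field_simps)
      qed
      with e0 interpret R: height_region b "Ge \<epsilon>" b\<^sub>0 H by (intro height_region_eps) simp
      define A where "A = {x'. (x', t + \<eta>) \<in> region b (Ge \<epsilon>)}"
      have A: "open A"
      proof -
        have "open ((\<lambda>x'. (x', t + \<eta>)) -` region b (Ge \<epsilon>))"
          by (rule open_vimage[OF R.open_region]) (intro continuous_intros)
        then show ?thesis by (simp add: A_def vimage_def)
      qed
      have Gx: "Ge \<epsilon> x = G x y0"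
      proof -
        have "x / \<epsilon> powr \<alpha> = y1" using x y1 by (simp add: e\<alpha>)
        then show ?thesis using G_periodic_nat[of x y0 n] x by (simp add: G_eps_def y1_def)
      qed
      have "t + \<eta> < G x y0" using y0 by (simp add: \<eta>_def field_simps)
      then have "x \<in> A" using x b_bounds[OF x] b0 False \<eta> by (simp add: A_def R.mem_region Gx)
      define c where "c = x / y1"
      have c: "c > 0" using x y1 by (simp add: c_def)
      \<comment> \<open>\<open>T\<close> pulls \<open>A\<close> back along the map from y to the
        abscissa x' at which \<open>Ge \<epsilon>\<close> evaluates \<open>G x'\<close> at y + n l
        x. Returning from x' to x costs \<eta>, which the height t + \<eta> in \<open>A\<close>
        holds in reserve.\<close>
      define T where "T = (\<lambda>y. c * (y + real n * l x)) -` (A \<inter> {x - \<delta><..<x + \<delta>})"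
      have "open T" unfolding T_def
        by (rule open_vimage) (auto intro!: A continuous_intros open_Int)
      moreover have "y0 \<in> T"
      proof -
        have "c * (y0 + real n * l x) = x" using y1(2) unfolding c_def y1_def by simp
        then show ?thesis using \<open>x \<in> A\<close> \<delta>(1) by (simp add: T_def)
      qed
      moreover have "T \<subseteq> {y. t < G x y}"
      proof
        fix y assume "y \<in> T"
        define x' where "x' = c * (y + real n * l x)"
        have x': "x' \<in> A" "\<bar>x' - x\<bar> < \<delta>" using \<open>y \<in> T\<close> by (auto simp: T_def x'_def)
        then have x'1: "x' \<in> {0<..<1}" "t + \<eta> < Ge \<epsilon> x'" by (auto simp: A_def R.mem_region)
        have "x' / \<epsilon> powr \<alpha> = y + real n * l x" unfolding e\<alpha> c_def[symmetric] x'_def using c by simp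
        then have "Ge \<epsilon> x' = G x' (y + real n * l x)" by (simp add: G_eps_def)
        moreover have "\<bar>G x' (y + real n * l x) - G x (y + real n * l x)\<bar> \<le> \<eta>"
          using \<delta>(2) x' x'1 x by auto
        ultimately have "t < G x (y + real n * l x)" using x'1(2) by linarith
        then show "y \<in> {y. t < G x y}" using G_periodic_nat[of x y n] x by simp
      qed
      ultimately show "\<exists>T. open T \<and> y0 \<in> T \<and> T \<subseteq> {y. t < G x y}" by blast
    qed
    then show ?thesis by simp
  qed
qed

section \<open>Means over a period and averages of the oscillating height\<close>

lemma G_slice_periodic_bound:
  assumes x: "x \<in> {0<..<1}" and "0 \<le> s" "s \<le> t"
  shows "\<bar>\<integral>y. G x y - G_mean x \<partial>lebesgue_on {s<..<t}\<bar> \<le> 2 * (L * M)"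
proof -
  have x1: "x \<in> {0..1}" using x by simp
  have "\<bar>\<integral>y. G x y - G_mean x \<partial>lebesgue_on {s<..<t}\<bar> \<le> 2 * (l x * M)"
    by (rule periodic_integral_bound[OF G_slice_measurable[OF x]])
      (use x1 G_nonneg G_le G_periodic l_pos assms in \<open>auto simp: G_mean_def\<close>)
  also have "\<dots> \<le> 2 * (L * M)" using l_bounds(2)[OF x1] M_nonneg by (intro mult_left_mono mult_right_mono) auto
  finally show ?thesis .
qed

lemma G_slice_integrable:
  assumes x: "x \<in> {0<..<1}" shows "integrable (lebesgue_on {s<..<t}) (G x)"
proof -
  have "G x \<in> Lsq {s<..<t}"
  proof (rule Lsq_bounded(1))
    show "\<bar>G x y\<bar> \<le> M" for y using G_nonneg[of x y] G_le[of x y] x by simp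
  qed (auto intro: borel_imp_measurable_lebesgue_on G_slice_measurable[OF x])
  then show ?thesis by (intro Lsq_integrable(1)) auto
qed

lemma integral_const_interval: "s \<le> t \<Longrightarrow> (\<integral>x. c \<partial>lebesgue_on {s<..<t}) = (t - s) * (c::real)"
  and integrable_const_interval: "integrable (lebesgue_on {s<..<t}) (\<lambda>x. c::real)"
  using finite_measure.integrable_const[OF finite_measure_lebesgue_on[of "{s<..<t}"]]
  by (auto simp: measure_restrict_space)

text \<open>The slices have different periods, so their period integrals cannot be compared
  directly. On a long interval (0, T) both integrals equal T times the mean up to 2 L M, whatever
  the period is; dividing by T and letting T grow removes this error.\<close>

lemma G_mean_close:
  assumes x: "x \<in> {0<..<1}" "x' \<in> {0<..<1}" and cl: "\<And>y. \<bar>G x y - G x' y\<bar> \<le> \<eta>"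
  shows "\<bar>G_mean x - G_mean x'\<bar> \<le> \<eta>"
proof -
  define K where "K = 4 * (L * M)"
  have K: "0 \<le> K" using L_pos M_nonneg by (simp add: K_def)
  have *: "T * \<bar>G_mean x - G_mean x'\<bar> \<le> T * \<eta> + K" if "T > 0" for T
  proof -
    let ?I = "lebesgue_on {0<..<T}"
    note i = G_slice_integrable[OF x(1), of 0 T] G_slice_integrable[OF x(2), of 0 T] integrable_const_interval[of 0 T]
    have e: "(\<integral>y. G x y - G_mean x \<partial>?I) = (\<integral>y. G x y \<partial>?I) - T * G_mean x"
      "(\<integral>y. G x' y - G_mean x' \<partial>?I) = (\<integral>y. G x' y \<partial>?I) - T * G_mean x'"
      using i that integral_const_interval[of 0 T] by simp_all
    have "\<bar>(\<integral>y. G x y \<partial>?I) - (\<integral>y. G x' y \<partial>?I)\<bar> = \<bar>\<integral>y. G x y - G x' y \<partial>?I\<bar>" using i by simp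
    also have "\<dots> \<le> (\<integral>y. \<bar>G x y - G x' y\<bar> \<partial>?I)" by (rule integral_abs_bound)
    also have "\<dots> \<le> (\<integral>y. \<eta> \<partial>?I)" using i cl by (intro integral_mono) auto
    also have "\<dots> = T * \<eta>" using that integral_const_interval[of 0 T] by simp
    finally have "\<bar>T * G_mean x - T * G_mean x'\<bar> \<le> T * \<eta> + K"
      using G_slice_periodic_bound[OF x(1), of 0 T] G_slice_periodic_bound[OF x(2), of 0 T] that e K_def by linarith
    then show ?thesis using that by (simp add: right_diff_distrib[symmetric] abs_mult)
  qed
  show ?thesis
  proof (rule field_le_epsilon)
    fix e :: real assume "e > 0"
    \<comment> \<open>This gives K <= T e, and \<open>K + 1\<close> keeps \<open>T\<close> positive
      when K = 0.\<close>
    define T where "T = (K + 1) / e"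
    have T: "T > 0" using K \<open>e > 0\<close> by (simp add: T_def)
    have "K \<le> T * e" using \<open>e > 0\<close> by (simp add: T_def)
    then have "T * \<bar>G_mean x - G_mean x'\<bar> \<le> T * (\<eta> + e)" using *[OF T] by (simp add: distrib_left)
    then show "\<bar>G_mean x - G_mean x'\<bar> \<le> \<eta> + e" using T by simp
  qed
qed

lemma G_mean_bounds: "x \<in> {0<..<1} \<Longrightarrow> 0 \<le> G_mean x" "x \<in> {0<..<1} \<Longrightarrow> G_mean x \<le> M"
proof -
  assume x: "x \<in> {0<..<1}"
  have lx: "0 < l x" using l_pos x by simp
  show "0 \<le> G_mean x" unfolding G_mean_def
    using lx x G_nonneg[of x] by (intro mult_nonneg_nonneg integral_nonneg_AE AE_I2) auto
  have "(\<integral>y. G x y \<partial>lebesgue_on {0..l x}) \<le> (\<integral>y. M \<partial>lebesgue_on {0..l x})"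
  proof (rule integral_mono)
    have "G x \<in> Lsq {0..l x}"
    proof (rule Lsq_bounded(1))
      show "\<bar>G x y\<bar> \<le> M" for y using G_nonneg[of x y] G_le[of x y] x by simp
    qed (auto intro: borel_imp_measurable_lebesgue_on G_slice_measurable[OF x])
    then show "integrable (lebesgue_on {0..l x}) (G x)" by (intro Lsq_integrable(1)) auto
    show "integrable (lebesgue_on {0..l x}) (\<lambda>y. M)"
      by (rule finite_measure.integrable_const[OF finite_measure_lebesgue_on]) simp
  qed (use x G_le in auto)
  then show "G_mean x \<le> M" using lx by (simp add: G_mean_def measure_restrict_space field_simps)
qed

lemma Lsq_G_mean: "G_mean \<in> Lsq {0<..<1}"
proof (rule Lsq_bounded(1))
  have "continuous_on {0<..<1} G_mean" by (rule continuous_on_if_close) (auto intro: G_mean_close)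
  then show "G_mean \<in> borel_measurable (lebesgue_on {0<..<1})"
    by (rule continuous_imp_measurable_on_sets_lebesgue) auto
  show "\<bar>G_mean x\<bar> \<le> M" if "x \<in> {0<..<1}" for x using G_mean_bounds[OF that] by simp
qed simp

lemma mean_height_eq: "x \<in> {0<..<1} \<Longrightarrow> mean_height b G l x = b x + G_mean x"
proof -
  assume x: "x \<in> {0<..<1}"
  have lx: "0 < l x" using l_pos x by simp
  have "G x \<in> Lsq {0..l x}"
  proof (rule Lsq_bounded(1))
    show "\<bar>G x y\<bar> \<le> M" for y using G_nonneg[of x y] G_le[of x y] x by simp
  qed (auto intro: borel_imp_measurable_lebesgue_on G_slice_measurable[OF x])
  then have "integrable (lebesgue_on {0..l x}) (G x)" by (intro Lsq_integrable(1)) auto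
  moreover have "integrable (lebesgue_on {0..l x}) (\<lambda>y. b x)"
    by (rule finite_measure.integrable_const[OF finite_measure_lebesgue_on]) simp
  ultimately have "(\<integral>y. b x + G x y \<partial>lebesgue_on {0..l x}) = l x * b x + (\<integral>y. G x y \<partial>lebesgue_on {0..l x})"
    using lx by (simp add: measure_restrict_space)
  then show "mean_height b G l x = b x + G_mean x"
    using lx by (simp add: mean_height_def G_mean_def field_simps)
qed

lemma oscillation_cell:
  assumes e: "\<epsilon> \<in> {0<..<\<epsilon>\<^sub>0}" and cd: "0 \<le> c" "c \<le> d" "d \<le> 1" and x0: "x0 \<in> {0<..<1}"
    and cl: "\<And>x y. x \<in> {c<..<d} \<Longrightarrow> \<bar>G x y - G x0 y\<bar> \<le> \<eta>"
  shows "\<bar>\<integral>x. Ge \<epsilon> x - G_mean x \<partial>lebesgue_on {c<..<d}\<bar> \<le> 2 * \<eta> * (d - c) + 2 * (L * M) * \<epsilon> powr \<alpha>"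
proof -
  let ?I = "lebesgue_on {c<..<d}"
  define s where "s = \<epsilon> powr \<alpha>"
  have s: "s > 0" using e by (simp add: s_def)
  have sub: "{c<..<d} \<subseteq> {0<..<1}" using cd by auto
  have Lc: "(\<lambda>x. Ge \<epsilon> x - G_mean x) \<in> Lsq {c<..<d}"
    by (rule Lsq_subset(1)[OF Lsq_diff[OF Lsq_Ge[OF e] Lsq_G_mean] sub]) auto
  have i1: "integrable ?I (\<lambda>x. Ge \<epsilon> x - G_mean x)" by (rule Lsq_integrable(1)[OF _ Lc]) simp
  have gm: "(\<lambda>x. G x0 (x / s) - G_mean x0) \<in> borel_measurable borel"
    using measurable_compose[OF _ G_slice_measurable[OF x0], of "\<lambda>x. x / s" borel] by simp
  have bd0: "\<bar>G x0 (x / s) - G_mean x0\<bar> \<le> 2 * M" for x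
    using G_nonneg[of x0 "x / s"] G_le[of x0 "x / s"] G_mean_bounds[OF x0] x0 by auto
  have "(\<lambda>x. G x0 (x / s) - G_mean x0) \<in> Lsq {c<..<d}"
    by (rule Lsq_bounded(1)[OF _ borel_imp_measurable_lebesgue_on[OF gm] bd0]) simp
  then have i2: "integrable ?I (\<lambda>x. G x0 (x / s) - G_mean x0)" by (intro Lsq_integrable(1)) auto
  have "(\<integral>x. G x0 (x / s) - G_mean x0 \<partial>?I) = s * (\<integral>y. G x0 y - G_mean x0 \<partial>lebesgue_on {c / s<..<d / s})"
    by (rule integral_rescale[OF _ s]) (use G_slice_measurable[OF x0] in simp)
  moreover have "\<bar>\<integral>y. G x0 y - G_mean x0 \<partial>lebesgue_on {c / s<..<d / s}\<bar> \<le> 2 * (L * M)"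
    using cd s by (intro G_slice_periodic_bound[OF x0]) (auto intro: divide_right_mono)
  ultimately have a: "\<bar>\<integral>x. G x0 (x / s) - G_mean x0 \<partial>?I\<bar> \<le> s * (2 * (L * M))"
    using s by (simp add: abs_mult)
  have "\<bar>(\<integral>x. Ge \<epsilon> x - G_mean x \<partial>?I) - (\<integral>x. G x0 (x / s) - G_mean x0 \<partial>?I)\<bar>
      = \<bar>\<integral>x. (Ge \<epsilon> x - G_mean x) - (G x0 (x / s) - G_mean x0) \<partial>?I\<bar>"
    using Bochner_Integration.integral_diff[OF i1 i2] by simp
  also have "\<dots> \<le> (\<integral>x. \<bar>(Ge \<epsilon> x - G_mean x) - (G x0 (x / s) - G_mean x0)\<bar> \<partial>?I)" by (rule integral_abs_bound)
  also have "\<dots> \<le> (\<integral>x. 2 * \<eta> \<partial>?I)"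
  proof (rule integral_mono)
    show "integrable ?I (\<lambda>x. \<bar>(Ge \<epsilon> x - G_mean x) - (G x0 (x / s) - G_mean x0)\<bar>)"
      by (intro integrable_abs Bochner_Integration.integrable_diff i1 i2)
    show "integrable ?I (\<lambda>x. 2 * \<eta>)" by (rule integrable_const_interval)
    fix x assume "x \<in> space ?I"
    then have x: "x \<in> {c<..<d}" by simp
    have "\<bar>G_mean x - G_mean x0\<bar> \<le> \<eta>" by (rule G_mean_close[OF _ x0 cl[OF x]]) (use x sub in blast)
    moreover have "\<bar>Ge \<epsilon> x - G x0 (x / s)\<bar> \<le> \<eta>" unfolding G_eps_def s_def by (rule cl[OF x])
    ultimately show "\<bar>(Ge \<epsilon> x - G_mean x) - (G x0 (x / s) - G_mean x0)\<bar> \<le> 2 * \<eta>" by linarith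
  qed
  also have "\<dots> = (d - c) * (2 * \<eta>)" by (rule integral_const_interval[OF cd(2)])
  finally show ?thesis using a unfolding s_def[symmetric] by (simp add: algebra_simps)
qed

text \<open>On a fixed grid of N cells the freezing errors add up to at most 2 \<eta> = e / 4. The
  periodic errors add up to N times O(\<epsilon>^\<alpha>), which is below e / 4 for small
  \<epsilon>.\<close>

proposition G_eps_averages:
  assumes "0 \<le> a" "c \<le> 1"
  shows "((\<lambda>\<epsilon>. \<integral>x. Ge \<epsilon> x - G_mean x \<partial>lebesgue_on {a<..<c}) \<longlongrightarrow> 0) (at_right 0)"
proof (rule tendstoI)
  fix e :: real assume "e > 0"
  define \<eta> where "\<eta> = e / 8"
  have \<eta>: "\<eta> > 0" using \<open>e > 0\<close> by (simp add: \<eta>_def)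
  obtain \<delta> where \<delta>: "\<delta> > 0" "\<forall>x\<in>{0..1}. \<forall>x'\<in>{0..1}. \<bar>x - x'\<bar> < \<delta> \<longrightarrow> (\<forall>y. \<bar>G x y - G x' y\<bar> \<le> \<eta>)"
    using G_cont[OF \<eta>] by auto
  obtain N :: nat where N: "real N > 1 / \<delta> + 1" using reals_Archimedean2 by blast
  have "real N > 0" using N \<delta>(1) by (smt (verit) divide_pos_pos)
  then have N0: "0 < N" "real N > 0" by simp_all
  have N\<delta>: "1 / real N < \<delta>" using N N0 \<delta>(1) by (simp add: field_simps)
  have "((\<lambda>\<epsilon>. real N * (2 * (L * M) * \<epsilon> powr \<alpha>)) \<longlongrightarrow> real N * (2 * (L * M) * 0)) (at_right 0)"
  proof (intro tendsto_intros)
    have "((\<lambda>\<epsilon>. \<epsilon> powr \<alpha>) \<longlongrightarrow> 0 powr \<alpha>) (at_right 0)"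
      by (rule tendsto_powr2) (use alpha in \<open>auto simp: eventually_at_filter\<close>)
    then show "((\<lambda>\<epsilon>. \<epsilon> powr \<alpha>) \<longlongrightarrow> 0) (at_right 0)" by simp
  qed
  then have "\<forall>\<^sub>F \<epsilon> in at_right 0. real N * (2 * (L * M) * \<epsilon> powr \<alpha>) < e / 4"
    using \<open>e > 0\<close> by (intro order_tendstoD(2)) auto
  moreover have "\<forall>\<^sub>F \<epsilon> in at_right 0. \<epsilon> \<in> {0<..<\<epsilon>\<^sub>0}"
    using eps0 by (rule eventually_at_rightI[rotated]) simp
  ultimately show "\<forall>\<^sub>F \<epsilon> in at_right 0. dist (\<integral>x. Ge \<epsilon> x - G_mean x \<partial>lebesgue_on {a<..<c}) 0 < e"
  proof eventually_elim
    case (elim \<epsilon>)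
    let ?h = "\<lambda>x. Ge \<epsilon> x - G_mean x"
    have hL: "?h \<in> Lsq {0<..<1}" by (rule Lsq_diff[OF Lsq_Ge[OF elim(2)] Lsq_G_mean])
    have hi: "integrable (lebesgue_on {0<..<1}) ?h" by (rule Lsq_integrable(1)[OF _ hL]) simp
    have sub: "{a<..<c} \<subseteq> {0<..<1}" using assms by auto
    \<comment> \<open>The cutoff lets the interval be summed over grid cells although
      \<open>a\<close> and \<open>c\<close> need not be grid points.\<close>
    define k where "k x = (if x \<in> {a<..<c} then ?h x else 0)" for x
    have ki: "integrable (lebesgue_on {0<..<1}) k"
    proof -
      have "integrable (lebesgue_on {a<..<c}) ?h" by (rule integrable_lebesgue_on_subset[OF hi sub]) auto
      then have "integrable lebesgue k" unfolding k_def
        using Lebesgue_Measure.integrable_restrict_UNIV[of "{a<..<c}" ?h] by simp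
      then have "integrable (lebesgue_on UNIV) k" by (simp add: lebesgue_on_UNIV_eq)
      then show ?thesis by (rule integrable_lebesgue_on_subset) auto
    qed
    have cell: "\<bar>\<integral>x. k x \<partial>lebesgue_on {real j / real N<..<(real j + 1) / real N}\<bar> \<le> 2 * \<eta> / real N + 2 * (L * M) * \<epsilon> powr \<alpha>"
      if "j < N" for j
    proof -
      define r s where "r = max a (real j / real N)" and "s = min c ((real j + 1) / real N)"
      have rs: "{a<..<c} \<inter> {real j / real N<..<(real j + 1) / real N} = {r<..<s}" by (auto simp: r_def s_def)
      have eq: "(\<integral>x. k x \<partial>lebesgue_on {real j / real N<..<(real j + 1) / real N}) = (\<integral>x. ?h x \<partial>lebesgue_on {r<..<s})"
        unfolding k_def rs[symmetric] by (rule Lebesgue_Measure.integral_restrict_Int) auto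
      have nn: "0 \<le> 2 * (L * M) * \<epsilon> powr \<alpha>" using L_pos M_nonneg by simp
      show ?thesis
      proof (cases "r < s")
        case False
        then have "{r<..<s} = {}" by simp
        then show ?thesis unfolding eq using nn \<eta> N0 by simp
      next
        case True
        have r0: "0 \<le> r" using assms by (simp add: r_def)
        have s1: "s \<le> 1" using assms by (simp add: s_def)
        have len: "s - r \<le> 1 / real N"
        proof -
          have "s \<le> (real j + 1) / real N" "real j / real N \<le> r" by (auto simp: r_def s_def)
          then show ?thesis by (simp add: add_divide_distrib)
        qed
        have x0: "(r + s) / 2 \<in> {0<..<1}" using True r0 s1 by auto
        have "\<bar>\<integral>x. ?h x \<partial>lebesgue_on {r<..<s}\<bar> \<le> 2 * \<eta> * (s - r) + 2 * (L * M) * \<epsilon> powr \<alpha>"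
        proof (rule oscillation_cell[OF elim(2) r0 _ s1 x0])
          fix x y assume x: "x \<in> {r<..<s}"
          have "r < x" "x < s" using x by simp_all
          moreover have "s - r < \<delta>" by (rule le_less_trans[OF len N\<delta>])
          ultimately have "2 * x - (r + s) < 2 * \<delta>" "(r + s) - 2 * x < 2 * \<delta>" by linarith+
          then have "\<bar>x - (r + s) / 2\<bar> < \<delta>" by (simp add: abs_less_iff field_simps)
          then show "\<bar>G x y - G ((r + s) / 2) y\<bar> \<le> \<eta>" using \<delta>(2) x x0 r0 s1 by auto
        qed (use True in simp)
        also have "2 * \<eta> * (s - r) \<le> 2 * \<eta> * (1 / real N)" using len \<eta> by (intro mult_left_mono) auto
        finally show ?thesis unfolding eq by simp
      qed
    qed
    have "(\<integral>x. ?h x \<partial>lebesgue_on {a<..<c}) = (\<integral>x. k x \<partial>lebesgue_on {0<..<1})"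
      unfolding k_def by (rule Lebesgue_Measure.integral_restrict[symmetric, OF sub]) auto
    also have "\<dots> = (\<Sum>j<N. \<integral>x. k x \<partial>lebesgue_on {real j / real N<..<(real j + 1) / real N})"
      by (rule integral_unit_interval_cells[OF ki N0(1)])
    finally have eq: "(\<integral>x. ?h x \<partial>lebesgue_on {a<..<c}) = (\<Sum>j<N. \<integral>x. k x \<partial>lebesgue_on {real j / real N<..<(real j + 1) / real N})" .
    have "\<bar>\<integral>x. ?h x \<partial>lebesgue_on {a<..<c}\<bar> \<le> (\<Sum>j<N. \<bar>\<integral>x. k x \<partial>lebesgue_on {real j / real N<..<(real j + 1) / real N}\<bar>)"
      unfolding eq by (rule sum_abs)
    also have "\<dots> \<le> (\<Sum>j<N. 2 * \<eta> / real N + 2 * (L * M) * \<epsilon> powr \<alpha>)" by (rule sum_mono) (use cell in auto)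
    also have "\<dots> = 2 * \<eta> + real N * (2 * (L * M) * \<epsilon> powr \<alpha>)" using N0 by (simp add: algebra_simps)
    also have "\<dots> < e" using elim(1) \<open>e > 0\<close> by (simp add: \<eta>_def)
    finally show ?case by (simp add: dist_real_def)
  qed
qed

section \<open>Recovery functions\<close>

lemma eventually_eps: "\<forall>\<^sub>F \<epsilon> in at_right 0. \<epsilon> \<in> {0<..<\<epsilon>\<^sub>0}"
  using eps0 by (rule eventually_at_rightI[rotated]) simp

lemma G_periodic_int:
  assumes "x \<in> {0..1}" shows "G x (y + of_int k * l x) = G x y"
proof (cases "0 \<le> k")
  case True
  then show ?thesis using G_periodic_nat[OF assms, of y "nat k"] by simp
next
  case False
  then show ?thesis using G_periodic_nat[OF assms, of "y + of_int k * l x" "nat (- k)"] by simp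
qed

text \<open>As t runs through [z, z + h], t / \<epsilon>^\<alpha> runs through an interval of length
  L, hence through at least one period of \<open>G z\<close>, and meets a minimum point. Moving from
  z to t costs \<delta> / 2 in \<open>G\<close> and \<delta> / 2 in \<open>G0\<close>.\<close>

lemma near_minimum_exists:
  assumes e: "\<epsilon> \<in> {0<..<\<epsilon>\<^sub>0}" and \<delta>: "\<forall>x\<in>{0..1}. \<forall>x'\<in>{0..1}. \<bar>x - x'\<bar> < \<delta>' \<longrightarrow> (\<forall>y. \<bar>G x y - G x' y\<bar> \<le> \<delta> / 2)"
    and h: "h = L * \<epsilon> powr \<alpha>" "h < \<delta>'" and z: "0 \<le> z" "z + h \<le> 1"
  shows "\<exists>t\<in>{z..z + h}. Ge \<epsilon> t \<le> G0 t + \<delta>"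
proof -
  define s where "s = \<epsilon> powr \<alpha>"
  have s: "0 < s" using e by (simp add: s_def)
  have h0: "0 < h" using s L_pos by (simp add: h s_def)
  have z1: "z \<in> {0..1}" using z h0 by simp
  obtain y0 where y0: "G z y0 = G0 z" using G0_attained[OF z1] by blast
  have lz: "0 < l z" "l z \<le> L" using l_pos[OF z1] l_bounds(2)[OF z1] by auto
  \<comment> \<open>Selects the first translate of the minimum point \<open>y0\<close> by whole
    periods that is not below z / s.\<close>
  define k where "k = \<lceil>(z / s - y0) / l z\<rceil>"
  define y where "y = y0 + of_int k * l z"
  have "(z / s - y0) / l z \<le> of_int k" "of_int k < (z / s - y0) / l z + 1" unfolding k_def by linarith+
  then have "z / s \<le> y" "y < z / s + l z" using lz(1) by (auto simp: y_def field_simps)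
  then have yb: "z / s \<le> y" "y \<le> z / s + L" using lz by auto
  define t where "t = s * y"
  have "s * (z / s) \<le> t" "t \<le> s * (z / s + L)"
    unfolding t_def using mult_left_mono[OF yb(1), of s] mult_left_mono[OF yb(2), of s] s by simp_all
  then have t: "t \<in> {z..z + h}" using s by (simp add: h s_def[symmetric] distrib_left mult.commute)
  then have t1: "t \<in> {0..1}" using z by simp
  have "\<bar>t - z\<bar> < \<delta>'" using t h(2) by (simp add: abs_less_iff)
  then have cl: "\<bar>G t y' - G z y'\<bar> \<le> \<delta> / 2" for y' using \<delta> t1 z1 by blast
  have "Ge \<epsilon> t = G t y" using s by (simp add: G_eps_def s_def[symmetric] t_def)
  moreover have "G z y = G0 z" using G_periodic_int[OF z1, of y0 k] y0 by (simp add: y_def)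
  moreover have "\<bar>G0 t - G0 z\<bar> \<le> \<delta> / 2" by (rule G0_close[OF t1 z1 cl])
  ultimately have "Ge \<epsilon> t \<le> G0 t + \<delta>" using cl[of y] by linarith
  then show ?thesis using t by blast
qed

text \<open>A step function close to the identity all of whose jumps sit at points where the upper boundary
  is nearly as low as \<open>G0\<close>; consecutive such points are at distance \<open>O(\<epsilon>\<^sup>\<alpha>)\<close>.\<close>

lemma step_function_exists:
  assumes e: "\<epsilon> \<in> {0<..<\<epsilon>\<^sub>0}" and \<delta>: "\<forall>x\<in>{0..1}. \<forall>x'\<in>{0..1}. \<bar>x - x'\<bar> < \<delta>' \<longrightarrow> (\<forall>y. \<bar>G x y - G x' y\<bar> \<le> \<delta> / 2)"
    and h: "h = L * \<epsilon> powr \<alpha>" "h < \<delta>'"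
  obtains q :: "real \<Rightarrow> real" where "q \<in> borel_measurable borel" "\<And>x. q x \<in> {0..1}"
    "\<And>x. x \<in> {0<..<1} \<Longrightarrow> \<bar>q x - x\<bar> \<le> h"
    "\<And>x. x \<in> {0<..<1} \<Longrightarrow> Ge \<epsilon> x \<le> G0 x + \<delta> \<or> (\<forall>\<^sub>F x' in nhds x. q x' = q x)"
proof -
  have h0: "0 < h" using e L_pos by (simp add: h)
  \<comment> \<open>In cells that reach beyond 1, the jump is put beyond 1, outside the
    domain.\<close>
  have "\<exists>t\<in>{real i * h..(real i + 1) * h}. t > 1 \<or> Ge \<epsilon> t \<le> G0 t + \<delta>" for i
  proof (cases "(real i + 1) * h \<le> 1")
    case True
    have "real i * h + h = (real i + 1) * h" by (simp add: algebra_simps)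
    then show ?thesis using near_minimum_exists[OF e \<delta> h, of "real i * h"] True h0 by auto
  next
    case False
    then show ?thesis using h0 by (intro bexI[of _ "(real i + 1) * h"]) (auto simp: algebra_simps)
  qed
  then obtain t where t: "\<And>i. t i \<in> {real i * h..(real i + 1) * h}" "\<And>i. t i > 1 \<or> Ge \<epsilon> (t i) \<le> G0 (t i) + \<delta>"
    by metis
  obtain N :: nat where N: "real N > 1 / h" using reals_Archimedean2 by blast
  then have Nh: "1 < real N * h" using h0 by (simp add: field_simps)
  \<comment> \<open>There is one jump point in each cell of length \<open>h\<close>, so for x in
    cell j the count is j or j + 1, and h times the count differs from x by at most
    \<open>h\<close>. \<open>N\<close> is large enough for all cells that meet the unit interval;
    the clip at 1 keeps \<open>q\<close> in it.\<close>
  define c where "c x = (\<Sum>i<N. indicat_real {t i..} x)" for x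
  define q where "q x = min 1 (h * c x)" for x
  have c0: "0 \<le> c x" for x unfolding c_def by (intro sum_nonneg) simp
  show thesis
  proof (rule that[of q])
    show "q \<in> borel_measurable borel" unfolding q_def c_def by measurable
    show "q x \<in> {0..1}" for x using c0[of x] h0 by (simp add: q_def)
    fix x :: real assume x: "x \<in> {0<..<1}"
    define j where "j = nat \<lfloor>x / h\<rfloor>"
    have fl: "of_int \<lfloor>x / h\<rfloor> = real j" using x h0 by (simp add: j_def)
    have "real j \<le> x / h" "x / h < real j + 1" unfolding fl[symmetric] by linarith+
    then have j: "real j * h \<le> x" "x < (real j + 1) * h" using h0 by (auto simp: field_simps)
    have "real j * h < real N * h" using j(1) x Nh by simp
    then have jN: "j < N" using h0 by simp
    have low: "t i \<le> x" if "i < j" for i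
    proof -
      have "(real i + 1) * h \<le> real j * h" using that h0 by (intro mult_right_mono) auto
      then show ?thesis using t(1)[of i] j(1) by simp
    qed
    have high: "x < t i" if "j < i" for i
    proof -
      have "(real j + 1) * h \<le> real i * h" using that h0 by (intro mult_right_mono) auto
      then show ?thesis using t(1)[of i] j(2) by simp
    qed
    have "c x = (\<Sum>i<N. if i < j \<or> (i = j \<and> t j \<le> x) then 1 else 0)"
      unfolding c_def
    proof (rule sum.cong[OF refl])
      fix i
      consider "i < j" | "i = j" | "j < i" by linarith
      then show "indicat_real {t i..} x = (if i < j \<or> (i = j \<and> t j \<le> x) then 1 else 0)"
        by cases (use low[of i] high[of i] in \<open>auto simp: indicator_def\<close>)
    qed
    also have "\<dots> = real (card {i \<in> {..<N}. i < j \<or> (i = j \<and> t j \<le> x)})"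
      by (simp add: sum.If_cases Int_def)
    also have "{i \<in> {..<N}. i < j \<or> (i = j \<and> t j \<le> x)} = (if t j \<le> x then {..<Suc j} else {..<j})"
      using jN by auto
    finally have cx: "c x = real j \<or> c x = real j + 1" by (auto split: if_splits)
    have "\<bar>h * c x - x\<bar> \<le> h" using cx j by (auto simp: algebra_simps abs_le_iff)
    then show "\<bar>q x - x\<bar> \<le> h" using x by (auto simp: q_def min_def abs_le_iff)
    show "Ge \<epsilon> x \<le> G0 x + \<delta> \<or> (\<forall>\<^sub>F x' in nhds x. q x' = q x)"
    proof (cases "\<exists>i. t i = x")
      case True
      then obtain i where "t i = x" by blast
      then show ?thesis using t(2)[of i] x by auto
    next
      case False
      have "\<forall>\<^sub>F x' in nhds x. indicat_real {t i..} x' = indicat_real {t i..} x" for i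
      proof (cases "t i < x")
        case True
        then have "\<forall>\<^sub>F x' in nhds x. x' \<in> {t i<..}" by (intro eventually_nhds_in_open) auto
        then show ?thesis by eventually_elim (use True in \<open>auto simp: indicator_def\<close>)
      next
        case ge: False
        then have "t i > x" using False by (metis less_linear)
        then have "\<forall>\<^sub>F x' in nhds x. x' \<in> {..<t i}" by (intro eventually_nhds_in_open) auto
        then show ?thesis by eventually_elim (use ge \<open>t i > x\<close> in \<open>auto simp: indicator_def\<close>)
      qed
      then have "\<forall>\<^sub>F x' in nhds x. \<forall>i\<in>{..<N}. indicat_real {t i..} x' = indicat_real {t i..} x"
        by (intro eventually_ball_finite) auto
      then have "\<forall>\<^sub>F x' in nhds x. q x' = q x"
        by eventually_elim (simp add: q_def c_def)
      then show ?thesis ..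
    qed
  qed
qed

text \<open>By Fubini, since every slice meets the layer in length at most \<delta>.\<close>

lemma layer_norm:
  assumes e: "\<epsilon> \<in> {0<..<\<epsilon>\<^sub>0}" and f: "f \<in> borel_measurable (lebesgue_on (region b (Ge \<epsilon>)))" and "0 \<le> B" "0 \<le> \<delta>"
    and bd: "\<And>z. z \<in> region b (Ge \<epsilon>) \<Longrightarrow> \<bar>f z\<bar> \<le> (if G0 (fst z) \<le> snd z \<and> snd z \<le> G0 (fst z) + \<delta> then B else 0)"
  shows "f \<in> Lsq (region b (Ge \<epsilon>))" "Lsq_norm (region b (Ge \<epsilon>)) f \<le> B * sqrt \<delta>"
proof -
  interpret height_region b "Ge \<epsilon>" b\<^sub>0 H by (rule height_region_eps[OF e])
  have bdB: "\<bar>f z\<bar> \<le> B" if "z \<in> \<Omega>" for z using bd[OF that] \<open>0 \<le> B\<close> by (auto split: if_splits)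
  show fL: "f \<in> Lsq \<Omega>" by (rule Lsq_bounded(1)[OF region_lmeasurable(1) f bdB])
  have f2: "(\<lambda>z. (f z)\<^sup>2) \<in> Lsq \<Omega>"
  proof (rule Lsq_bounded(1)[OF region_lmeasurable(1), where B="B\<^sup>2"])
    show "\<bar>(f z)\<^sup>2\<bar> \<le> B\<^sup>2" if "z \<in> \<Omega>" for z
      using bdB[OF that] \<open>0 \<le> B\<close> by (simp add: abs_le_square_iff[symmetric])
  qed (use f in measurable)
  have one: "(\<lambda>x. 1) \<in> Lsq {0<..<1::real}" by (rule Lsq_bounded(1)) auto
  have "(Lsq_norm \<Omega> f)\<^sup>2 = (\<integral>z. (f z)\<^sup>2 * 1 \<partial>lebesgue_on \<Omega>)" by (simp add: Lsq_norm_power2)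
  also have "\<dots> = (\<integral>x. VI (\<lambda>z. (f z)\<^sup>2) x * 1 \<partial>lebesgue_on {0<..<1})"
    by (rule VI_integral[OF f2 one])
  also have "\<dots> \<le> (\<integral>x. B\<^sup>2 * \<delta> \<partial>lebesgue_on {0<..<1::real})"
  proof (rule integral_mono)
    have "VI (\<lambda>z. (f z)\<^sup>2) \<in> Lsq {0<..<1}" by (rule VI_Lsq(1)[OF f2])
    then show "integrable (lebesgue_on {0<..<1}) (\<lambda>x. VI (\<lambda>z. (f z)\<^sup>2) x * 1)"
      using Lsq_integrable(1)[of "{0<..<1::real}"] by simp
    show "integrable (lebesgue_on {0<..<1::real}) (\<lambda>x. B\<^sup>2 * \<delta>)" by (rule integrable_const_interval)
    fix x :: real assume "x \<in> space (lebesgue_on {0<..<1})"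
    then have x: "x \<in> {0<..<1}" by simp
    let ?J = "{- b x..Ge \<epsilon> x}" and ?K = "{G0 x..G0 x + \<delta>}"
    have "VI (\<lambda>z. (f z)\<^sup>2) x = (\<integral>y. (f (x, y))\<^sup>2 \<partial>lebesgue_on ?J)" by (simp add: vertical_integral_def)
    also have "\<dots> \<le> (\<integral>y. B\<^sup>2 * indicator ?K y \<partial>lebesgue_on ?J)"
    proof (rule integral_mono_AE')
      have "(\<lambda>y. B\<^sup>2 * indicat_real ?K y) \<in> Lsq ?J"
        by (rule Lsq_bounded(1)[where B="B\<^sup>2"]) (auto simp: indicator_def intro!: borel_imp_measurable_lebesgue_on)
      then show "integrable (lebesgue_on ?J) (\<lambda>y. B\<^sup>2 * indicat_real ?K y)" by (intro Lsq_integrable(1)) auto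
      have N: "AE y in lebesgue. y \<notin> {- b x, Ge \<epsilon> x}"
        by (intro AE_not_in) (simp add: negligible_iff_null_sets[symmetric])
      then have "AE y in lebesgue. y \<in> ?J \<longrightarrow> (f (x, y))\<^sup>2 \<le> B\<^sup>2 * indicat_real ?K y"
      proof eventually_elim
        case (elim y)
        show ?case
        proof
          assume "y \<in> ?J"
          then have "(x, y) \<in> \<Omega>" using elim x by (auto simp: mem_region)
          from bd[OF this] show "(f (x, y))\<^sup>2 \<le> B\<^sup>2 * indicat_real ?K y"
            using \<open>0 \<le> B\<close> by (auto simp: indicator_def abs_le_square_iff[symmetric] split: if_splits)
        qed
      qed
      then show "AE y in lebesgue_on ?J. (f (x, y))\<^sup>2 \<le> B\<^sup>2 * indicat_real ?K y"
        by (simp add: AE_restrict_space_iff)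
    qed simp
    also have "\<dots> = B\<^sup>2 * (\<integral>y. indicator ?K y \<partial>lebesgue_on ?J)" by simp
    also have "(\<integral>y. indicat_real ?K y \<partial>lebesgue_on ?J) \<le> (\<integral>y. indicator ?K y \<partial>lebesgue)"
    proof -
      have "(\<integral>y. indicat_real ?K y \<partial>lebesgue_on ?J) = (\<integral>y. indicat_real ?J y *\<^sub>R indicat_real ?K y \<partial>lebesgue)"
        by (rule integral_restrict_space) simp
      also have "\<dots> \<le> (\<integral>y. indicat_real ?K y \<partial>lebesgue)"
      proof (rule integral_mono_AE')
        show "integrable lebesgue (indicat_real ?K)" by (rule integrable_real_indicator) (auto simp: emeasure_lborel_Icc_eq)
      qed (auto simp: indicator_def)
      finally show ?thesis .
    qed
    also have "(\<integral>y. indicat_real ?K y \<partial>lebesgue) = \<delta>" using \<open>0 \<le> \<delta>\<close> by simp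
    finally show "VI (\<lambda>z. (f z)\<^sup>2) x * 1 \<le> B\<^sup>2 * \<delta>" by (simp add: mult_left_mono)
  qed
  also have "\<dots> = B\<^sup>2 * \<delta>" using integral_const_interval[of 0 1] by simp
  finally have "sqrt ((Lsq_norm \<Omega> f)\<^sup>2) \<le> sqrt (B\<^sup>2 * \<delta>)" by (rule real_sqrt_le_mono)
  then show "Lsq_norm \<Omega> f \<le> B * sqrt \<delta>" using \<open>0 \<le> B\<close> by (simp add: real_sqrt_mult)
qed

lemma powr_small:
  fixes \<beta> c K :: real
  assumes "\<beta> > 0" "c > 0"
  shows "\<forall>\<^sub>F \<epsilon> in at_right 0. K * \<epsilon> powr \<beta> < c"
proof -
  have "((\<lambda>\<epsilon>. \<epsilon> powr \<beta>) \<longlongrightarrow> 0 powr \<beta>) (at_right 0)"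
    by (rule tendsto_powr2) (use assms in \<open>auto simp: eventually_at_filter\<close>)
  from tendsto_mult[OF tendsto_const[of K] this]
  have "((\<lambda>\<epsilon>. K * \<epsilon> powr \<beta>) \<longlongrightarrow> 0) (at_right 0)" by simp
  then show ?thesis using assms by (intro order_tendstoD(2))
qed

text \<open>The recovery functions agree with a smooth approximation \<open>U\<close> of \<open>u\<close> below the level \<open>G0\<close> and with
  a step function, constant in each finger, above it. As the jumps of the step function lie where
  there are no fingers, the result is differentiable. The transition is possible at small cost because
  \<open>U - U \<circ> q = O(\<epsilon>\<^sup>\<alpha>)\<close> and \<open>\<alpha> > 1\<close>.\<close>

lemma recovery_construction:
  assumes e: "\<epsilon> \<in> {0<..<\<epsilon>\<^sub>0}" and \<delta>0: "\<delta> > 0"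
    and \<delta>: "\<forall>x\<in>{0..1}. \<forall>x'\<in>{0..1}. \<bar>x - x'\<bar> < \<delta>' \<longrightarrow> (\<forall>y. \<bar>G x y - G x' y\<bar> \<le> \<delta> / 2)"
    and h: "h = L * \<epsilon> powr \<alpha>" "h < \<delta>'"
    and U: "\<And>x. (U has_real_derivative w x) (at x)" "continuous_on UNIV w" "\<And>x. \<bar>w x\<bar> \<le> B"
    and R: "\<And>t. (R has_real_derivative \<rho> t) (at t)" "\<And>t. t \<le> 0 \<Longrightarrow> R t = 0" "\<And>t. t \<ge> 1 \<Longrightarrow> R t = 1"
      "\<And>t. 0 \<le> R t" "\<And>t. R t \<le> 1" "\<And>t. t \<le> 0 \<Longrightarrow> \<rho> t = 0" "\<And>t. \<bar>\<rho> t\<bar> \<le> P" "continuous_on UNIV \<rho>"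
  obtains v g1 g2 where "v \<in> Lsq (region b (Ge \<epsilon>))" "g1 \<in> Lsq (region b (Ge \<epsilon>))" "g2 \<in> Lsq (region b (Ge \<epsilon>))"
    "has_weak_partial (region b (Ge \<epsilon>)) (1, 0) v g1" "has_weak_partial (region b (Ge \<epsilon>)) (0, 1) v g2"
    "\<And>z. z \<in> region b (Ge \<epsilon>) \<Longrightarrow> \<bar>v z - U (fst z)\<bar> \<le> B * h"
    "\<And>z. z \<in> region b (Ge \<epsilon>) \<Longrightarrow> \<bar>g2 z\<bar> \<le> P / \<delta> * (B * h)"
    "\<And>z. z \<in> region b (Ge \<epsilon>) \<Longrightarrow> \<bar>g1 z - (if z \<in> region b G0 then w (fst z) else 0)\<bar>
       \<le> (if G0 (fst z) \<le> snd z \<and> snd z \<le> G0 (fst z) + 5 * \<delta> then B else 0)"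
proof -
  interpret height_region b "Ge \<epsilon>" b\<^sub>0 H by (rule height_region_eps[OF e])
  have B0: "0 \<le> B" using U(3)[of 0] by linarith
  have P0: "0 \<le> P" using R(7)[of 0] by linarith
  have h0: "0 < h" using e L_pos by (simp add: h)
  obtain q where q: "q \<in> borel_measurable borel" "\<And>x. q x \<in> {0..1}"
    "\<And>x. x \<in> {0<..<1} \<Longrightarrow> \<bar>q x - x\<bar> \<le> h"
    "\<And>x. x \<in> {0<..<1} \<Longrightarrow> Ge \<epsilon> x \<le> G0 x + \<delta> \<or> (\<forall>\<^sub>F x' in nhds x. q x' = q x)"
    using step_function_exists[OF e \<delta> h] by blast
  have G0q: "G0 x - G0 x' \<le> \<delta>" "G0 x' - G0 x \<le> \<delta>" if "x \<in> {0..1}" "x' \<in> {0..1}" "\<bar>x - x'\<bar> < \<delta>'" for x x'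
  proof -
    have "\<bar>G0 x - G0 x'\<bar> \<le> \<delta> / 2" by (rule G0_close) (use that \<delta> in auto)
    moreover have "\<delta> / 2 \<le> \<delta>" using \<delta>0 by simp
    ultimately have "\<bar>G0 x - G0 x'\<bar> \<le> \<delta>" by (rule order_trans)
    then show "G0 x - G0 x' \<le> \<delta>" "G0 x' - G0 x \<le> \<delta>" by (simp_all add: abs_le_iff)
  qed
  \<comment> \<open>\<open>G0\<close> is taken at q x so that \<gamma> is locally constant wherever
    \<open>q\<close> is. Of the 3 \<delta>, one covers the height of the domain above
    \<open>G0\<close> at a jump, one the change between G0 (q x) and G0 x, and one is slack. The
    transition from \<gamma> to \<gamma> + \<delta> thus ends at most 5 \<delta> above
    \<open>G0\<close>.\<close>
  define \<gamma> where "\<gamma> x = G0 (q x) + 3 * \<delta>" for x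
  have Uc: "continuous_on UNIV U" using U(1) by (auto intro!: continuous_at_imp_continuous_on DERIV_isCont)
  have Rc: "continuous_on UNIV R" using R(1) by (auto intro!: continuous_at_imp_continuous_on DERIV_isCont)
  have [measurable]: "U \<in> borel_measurable borel" "w \<in> borel_measurable borel" "R \<in> borel_measurable borel" "\<rho> \<in> borel_measurable borel"
    by (rule borel_measurable_continuous_onI Uc U(2) Rc R(8))+
  have Uq: "\<bar>U (q x) - U x\<bar> \<le> B * h" if "x \<in> {0<..<1}" for x
  proof -
    have "\<bar>U (q x) - U x\<bar> \<le> B * \<bar>q x - x\<bar>"
      using field_differentiable_bound[of UNIV U w B "q x" x] U by (simp add: has_field_derivative_at_within)
    also have "\<dots> \<le> B * h" using q(3)[OF that] B0 by (intro mult_left_mono)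
    finally show ?thesis .
  qed
  define v where "v z = U (fst z) + R ((snd z - \<gamma> (fst z)) / \<delta>) * (U (q (fst z)) - U (fst z))" for z
  define g1 where "g1 z = w (fst z) * (1 - R ((snd z - \<gamma> (fst z)) / \<delta>))" for z
  define g2 where "g2 z = \<rho> ((snd z - \<gamma> (fst z)) / \<delta>) / \<delta> * (U (q (fst z)) - U (fst z))" for z
  have [measurable]: "q \<in> borel_measurable borel" by (rule q(1))
  have fs[measurable]: "(fst :: real \<times> real \<Rightarrow> real) \<in> borel_measurable borel" "(snd :: real \<times> real \<Rightarrow> real) \<in> borel_measurable borel"
    by (intro borel_measurable_continuous_onI continuous_intros)+
  have \<gamma>m[measurable]: "\<gamma> \<in> borel_measurable borel"
  proof -
    have "(\<lambda>x. if x \<in> {0..1} then G0 x else 0) \<in> borel_measurable borel"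
      by (rule borel_measurable_continuous_on_if[OF _ G0_continuous]) auto
    from measurable_compose[OF q(1) this]
    have "(\<lambda>x. G0 (q x)) \<in> borel_measurable borel" using q(2) by simp
    then show ?thesis unfolding \<gamma>_def by simp
  qed
  have cm: "(\<lambda>z::real \<times> real. f (fst z)) \<in> borel_measurable borel" if "f \<in> borel_measurable borel" for f :: "real \<Rightarrow> real"
    by (rule borel_measurable_fst_compose[OF that])
  have qm: "(\<lambda>x. U (q x)) \<in> borel_measurable borel" by measurable
  have am: "(\<lambda>z::real \<times> real. (snd z - \<gamma> (fst z)) / \<delta>) \<in> borel_measurable borel"
    using cm[OF \<gamma>m] fs(2) by simp
  have Rm: "(\<lambda>z::real \<times> real. f ((snd z - \<gamma> (fst z)) / \<delta>)) \<in> borel_measurable borel" if "f \<in> borel_measurable borel" for f :: "real \<Rightarrow> real"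
    by (rule measurable_compose[OF am that])
  have vm: "v \<in> borel_measurable borel" and g1m: "g1 \<in> borel_measurable borel" and g2m: "g2 \<in> borel_measurable borel"
    unfolding v_def g1_def g2_def using cm[of U] cm[OF qm] cm[of w] Rm[of R] Rm[of \<rho>] by simp_all
  have vU: "\<bar>v z - U (fst z)\<bar> \<le> B * h" if "z \<in> \<Omega>" for z
  proof -
    have "\<bar>v z - U (fst z)\<bar> = R ((snd z - \<gamma> (fst z)) / \<delta>) * \<bar>U (q (fst z)) - U (fst z)\<bar>"
      using R(4) by (simp add: v_def abs_mult)
    also have "\<dots> \<le> 1 * (B * h)" using R(4,5) Uq[OF fst_region[OF that]] by (intro mult_mono) auto
    finally show ?thesis by simp
  qed
  have g2b: "\<bar>g2 z\<bar> \<le> P / \<delta> * (B * h)" if "z \<in> \<Omega>" for z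
  proof -
    have "\<bar>g2 z\<bar> = \<bar>\<rho> ((snd z - \<gamma> (fst z)) / \<delta>)\<bar> / \<delta> * \<bar>U (q (fst z)) - U (fst z)\<bar>"
      using \<delta>0 by (simp add: g2_def abs_mult)
    also have "\<dots> \<le> P / \<delta> * (B * h)"
      using R(7) P0 \<delta>0 Uq[OF fst_region[OF that]] by (intro mult_mono divide_right_mono) auto
    finally show ?thesis .
  qed
  have g1b: "\<bar>g1 z\<bar> \<le> B" for z
  proof -
    have "\<bar>g1 z\<bar> = \<bar>w (fst z)\<bar> * (1 - R ((snd z - \<gamma> (fst z)) / \<delta>))" using R(5) by (simp add: g1_def abs_mult)
    also have "\<dots> \<le> B * 1" using U(3) R(4,5) B0 by (intro mult_mono) auto
    finally show ?thesis by simp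
  qed
  obtain BU where BU: "\<And>x. x \<in> {0<..<1} \<Longrightarrow> \<bar>U x\<bar> \<le> BU"
  proof -
    have "compact (U ` {0..1})" by (intro compact_continuous_image continuous_on_subset[OF Uc]) auto
    then obtain B' where "\<And>y. y \<in> U ` {0..1} \<Longrightarrow> norm y \<le> B'" by (meson compact_imp_bounded bounded_iff)
    then show ?thesis by (intro that[of B']) auto
  qed
  have vb: "\<bar>v z\<bar> \<le> BU + B * h" if "z \<in> \<Omega>" for z
    using vU[OF that] BU[OF fst_region[OF that]] by linarith
  \<comment> \<open>Near each point of the domain \<open>v\<close> agrees with a formula in which U
    (q x) and \<gamma> are frozen to constants a and c. Away from jumps this holds because
    \<open>q\<close> is locally constant. Where the boundary is low, the transition has not begun
    and \<open>R\<close> vanishes in both formulas; c is then just some level that is high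
    enough.\<close>
  have near: "\<forall>\<^sub>F z' in nhds z. v z' = U (fst z') + R ((snd z' - c) / \<delta>) * (a - U (fst z')) \<and> R ((snd z - \<gamma> (fst z)) / \<delta>) = R ((snd z - c) / \<delta>)
      \<and> \<rho> ((snd z - \<gamma> (fst z)) / \<delta>) = \<rho> ((snd z - c) / \<delta>)"
    if z: "z \<in> \<Omega>" and ac: "a = U (q (fst z))" "c = (if Ge \<epsilon> (fst z) \<le> G0 (fst z) + \<delta> then G0 (fst z) + 2 * \<delta> else \<gamma> (fst z))" for z a c
  proof (cases "Ge \<epsilon> (fst z) \<le> G0 (fst z) + \<delta>")
    case False
    have f: "((\<lambda>z'. fst z') \<longlongrightarrow> fst z) (nhds z)" by (intro tendsto_intros filterlim_ident)
    have "\<forall>\<^sub>F x' in nhds (fst z). q x' = q (fst z)" using q(4)[OF fst_region[OF z]] False by blast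
    from eventually_compose_filterlim[OF this f] show ?thesis
      by eventually_elim (use False ac in \<open>simp add: v_def \<gamma>_def\<close>)
  next
    case True
    have x: "fst z \<in> {0<..<1}" by (rule fst_region[OF z])
    have sz: "snd z < G0 (fst z) + \<delta>" using z True by (cases z) (auto simp: mem_region)
    have low: "snd z' - \<gamma> (fst z') \<le> 0 \<and> snd z' - c \<le> 0" if z': "fst z' \<in> {0<..<1} \<inter> {fst z - (\<delta>' - h)<..<fst z + (\<delta>' - h)}" "snd z' < G0 (fst z) + \<delta>" for z'
    proof -
      have "\<bar>q (fst z') - fst z'\<bar> \<le> h" using q(3) z'(1) by blast
      moreover have "\<bar>fst z' - fst z\<bar> < \<delta>' - h" using z'(1) by auto
      ultimately have "\<bar>q (fst z') - fst z\<bar> < \<delta>'" by linarith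
      then have "G0 (fst z) - G0 (q (fst z')) \<le> \<delta>" using G0q(2)[of "q (fst z')" "fst z"] q(2) x by auto
      then have "snd z' - (G0 (q (fst z')) + 3 * \<delta>) \<le> 0" "snd z' - (G0 (fst z) + 2 * \<delta>) \<le> 0"
        using z'(2) \<delta>0 by linarith+
      then show ?thesis using True by (simp add: \<gamma>_def ac)
    qed
    have "open (({0<..<1} \<inter> {fst z - (\<delta>' - h)<..<fst z + (\<delta>' - h)}) \<times> {..<G0 (fst z) + \<delta>})"
      by (intro open_Times open_Int) auto
    moreover have zin: "z \<in> ({0<..<1} \<inter> {fst z - (\<delta>' - h)<..<fst z + (\<delta>' - h)}) \<times> {..<G0 (fst z) + \<delta>}"
      using x sz h(2) by (cases z) auto
    ultimately have "\<forall>\<^sub>F z' in nhds z. z' \<in> ({0<..<1} \<inter> {fst z - (\<delta>' - h)<..<fst z + (\<delta>' - h)}) \<times> {..<G0 (fst z) + \<delta>}"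
      by (rule eventually_nhds_in_open)
    then show ?thesis
    proof eventually_elim
      case (elim z')
      have l: "snd z' - \<gamma> (fst z') \<le> 0 \<and> snd z' - c \<le> 0" using elim by (intro low) auto
      have l2: "snd z - \<gamma> (fst z) \<le> 0 \<and> snd z - c \<le> 0" using zin by (intro low) auto
      have "R ((snd z' - \<gamma> (fst z')) / \<delta>) = 0" "R ((snd z' - c) / \<delta>) = 0" "R ((snd z - \<gamma> (fst z)) / \<delta>) = 0" "R ((snd z - c) / \<delta>) = 0"
        "\<rho> ((snd z - \<gamma> (fst z)) / \<delta>) = 0" "\<rho> ((snd z - c) / \<delta>) = 0"
        using l l2 \<delta>0 by (auto intro!: R(2,6) simp: divide_le_0_iff)
      then show ?case by (simp add: v_def)
    qed
  qed
  have lim: "((\<lambda>t. z + t *\<^sub>R i) \<longlongrightarrow> z) (nhds 0)" for z i :: "real \<times> real"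
  proof -
    have "((\<lambda>t. z + t *\<^sub>R i) \<longlongrightarrow> z + 0 *\<^sub>R i) (nhds 0)" by (intro tendsto_intros filterlim_ident)
    then show ?thesis by simp
  qed
  have w1: "has_weak_partial \<Omega> (1, 0) v g1"
  proof (rule has_weak_partial_if_directional_derivative[OF open_region bounded_region _ vm g1m vb g1b])
    show "(1, 0) \<in> (Basis :: (real \<times> real) set)" by (simp add: Basis_prod_def)
    fix z assume z: "z \<in> \<Omega>"
    define a where "a = U (q (fst z))"
    define c where "c = (if Ge \<epsilon> (fst z) \<le> G0 (fst z) + \<delta> then G0 (fst z) + 2 * \<delta> else \<gamma> (fst z))"
    note nr = near[OF z a_def c_def]
    from eventually_nhds_x_imp_x[OF nr] have Rz: "R ((snd z - \<gamma> (fst z)) / \<delta>) = R ((snd z - c) / \<delta>)" by blast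
    from eventually_compose_filterlim[OF nr lim[of z "(1, 0)"]]
    have ev: "\<forall>\<^sub>F t in nhds 0. v (z + t *\<^sub>R (1, 0)) = U (fst z + t) + R ((snd z - c) / \<delta>) * (a - U (fst z + t))"
      by eventually_elim simp
    have "((\<lambda>t. U (fst z + t)) has_real_derivative w (fst z)) (at 0)"
      using U(1)[of "fst z"] DERIV_shift[of U "w (fst z)" 0 "fst z"] by (simp add: add.commute)
    then have "((\<lambda>t. U (fst z + t) + R ((snd z - c) / \<delta>) * (a - U (fst z + t))) has_real_derivative g1 z) (at 0)"
      by (auto intro!: derivative_eq_intros simp: g1_def Rz algebra_simps)
    then show "((\<lambda>t. v (z + t *\<^sub>R (1, 0))) has_real_derivative g1 z) (at 0)"
      by (subst DERIV_cong_ev[OF refl ev refl])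
  qed
  have w2: "has_weak_partial \<Omega> (0, 1) v g2"
  proof (rule has_weak_partial_if_directional_derivative[OF open_region bounded_region _ vm g2m vb g2b])
    show "(0, 1) \<in> (Basis :: (real \<times> real) set)" by (simp add: Basis_prod_def)
    fix z assume z: "z \<in> \<Omega>"
    define a where "a = U (q (fst z))"
    define c where "c = (if Ge \<epsilon> (fst z) \<le> G0 (fst z) + \<delta> then G0 (fst z) + 2 * \<delta> else \<gamma> (fst z))"
    note nr = near[OF z a_def c_def]
    from eventually_nhds_x_imp_x[OF nr] have \<rho>z: "\<rho> ((snd z - \<gamma> (fst z)) / \<delta>) = \<rho> ((snd z - c) / \<delta>)" by blast
    from eventually_compose_filterlim[OF nr lim[of z "(0, 1)"]]
    have ev: "\<forall>\<^sub>F t in nhds 0. v (z + t *\<^sub>R (0, 1)) = U (fst z) + R ((snd z + t - c) / \<delta>) * (a - U (fst z))"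
      by eventually_elim simp
    have "((\<lambda>t. (snd z + t - c) / \<delta>) has_real_derivative 1 / \<delta>) (at 0)"
      using \<delta>0 by (auto intro!: derivative_eq_intros)
    from DERIV_chain'[OF this, of R] R(1)
    have "((\<lambda>t. R ((snd z + t - c) / \<delta>)) has_real_derivative \<rho> ((snd z - c) / \<delta>) / \<delta>) (at 0)" by force
    then have "((\<lambda>t. U (fst z) + R ((snd z + t - c) / \<delta>) * (a - U (fst z))) has_real_derivative g2 z) (at 0)"
      using \<delta>0 by (auto intro!: derivative_eq_intros simp: g2_def \<rho>z a_def)
    then show "((\<lambda>t. v (z + t *\<^sub>R (0, 1))) has_real_derivative g2 z) (at 0)"
      by (subst DERIV_cong_ev[OF refl ev refl])
  qed
  show thesis
  proof (rule that[OF _ _ _ w1 w2 vU g2b])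
    show "v \<in> Lsq \<Omega>" by (rule Lsq_bounded(1)[OF region_lmeasurable(1) borel_imp_measurable_lebesgue_on[OF vm] vb])
    show "g1 \<in> Lsq \<Omega>" by (rule Lsq_bounded(1)[OF region_lmeasurable(1) borel_imp_measurable_lebesgue_on[OF g1m] g1b])
    show "g2 \<in> Lsq \<Omega>" by (rule Lsq_bounded(1)[OF region_lmeasurable(1) borel_imp_measurable_lebesgue_on[OF g2m] g2b])
    fix z assume z: "z \<in> \<Omega>"
    have x: "fst z \<in> {0<..<1}" by (rule fst_region[OF z])
    have "\<bar>q (fst z) - fst z\<bar> < \<delta>'" using q(3)[OF x] h(2) by linarith
    then have c: "G0 (q (fst z)) - G0 (fst z) \<le> \<delta>" "G0 (fst z) - G0 (q (fst z)) \<le> \<delta>"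
      using G0q[of "q (fst z)" "fst z"] q(2) x by auto
    show "\<bar>g1 z - (if z \<in> region b G0 then w (fst z) else 0)\<bar>
       \<le> (if G0 (fst z) \<le> snd z \<and> snd z \<le> G0 (fst z) + 5 * \<delta> then B else 0)"
    proof (cases "snd z < G0 (fst z)")
      case True
      then have "z \<in> region b G0" using z by (cases z) (auto simp: region_def)
      moreover have "(snd z - \<gamma> (fst z)) / \<delta> \<le> 0"
      proof (rule divide_nonpos_pos[OF _ \<delta>0])
        show "snd z - \<gamma> (fst z) \<le> 0" unfolding \<gamma>_def using True c \<delta>0 by linarith
      qed
      ultimately show ?thesis using R(2) True B0 by (simp add: g1_def)
    next
      case False
      then have "z \<notin> region b G0" by (cases z) (auto simp: region_def)
      moreover have "g1 z = 0" if "\<not> snd z \<le> G0 (fst z) + 5 * \<delta>"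
      proof -
        have "1 \<le> (snd z - \<gamma> (fst z)) / \<delta>"
        proof -
          have "\<delta> \<le> snd z - \<gamma> (fst z)" unfolding \<gamma>_def using that c \<delta>0 by linarith
          then show ?thesis using \<delta>0 by (simp add: le_divide_eq)
        qed
        then show ?thesis using R(3) by (simp add: g1_def)
      qed
      ultimately show ?thesis using False g1b[of z] B0 by auto
    qed
  qed
qed

end

section \<open>The energy estimate\<close>

lemma Lsq_restrict:
  assumes f: "f \<in> Lsq S" and T: "T \<in> sets borel"
  shows "(\<lambda>z. if z \<in> T then f z else 0) \<in> Lsq S" "Lsq_norm S (\<lambda>z. if z \<in> T then f z else 0) \<le> Lsq_norm S f"
proof -
  have eq: "(\<lambda>z. if z \<in> T then f z else 0) = (\<lambda>z. indicat_real T z * f z)" by (auto simp: indicator_def)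
  have m: "indicat_real T \<in> borel_measurable (lebesgue_on S)"
    by (rule borel_imp_measurable_lebesgue_on) (use T in simp)
  show "(\<lambda>z. if z \<in> T then f z else 0) \<in> Lsq S" "Lsq_norm S (\<lambda>z. if z \<in> T then f z else 0) \<le> Lsq_norm S f"
    unfolding eq using Lsq_mult_bounded[OF f m, of 1] by (auto simp: indicator_def)
qed

lemma (in height_region) Lsq_norm_region_bounded:
  assumes f: "f \<in> Lsq \<Omega>" and c: "\<And>z. z \<in> \<Omega> \<Longrightarrow> \<bar>f z\<bar> \<le> c" "0 \<le> c"
  shows "Lsq_norm \<Omega> f \<le> sqrt H * c"
proof -
  have cL: "(\<lambda>x. c) \<in> Lsq {0<..<1::real}" "Lsq_norm {0<..<1::real} (\<lambda>x. c) \<le> c"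
    using Lsq_bounded[of "{0<..<1::real}" "\<lambda>x. c" c] c(2) by auto
  have "Lsq_norm \<Omega> f \<le> Lsq_norm \<Omega> (\<lambda>z. c)"
    by (rule Lsq_AE_bound(2)[OF Lsq_fst(1)[OF cL(1)] LsqD(1)[OF f]], rule AE_I2) (use c in auto)
  also have "\<dots> \<le> sqrt H * Lsq_norm {0<..<1::real} (\<lambda>x. c)" by (rule Lsq_fst(2)[OF cL(1)])
  also have "\<dots> \<le> sqrt H * c" using cL(2) H_pos by (intro mult_left_mono) auto
  finally show ?thesis .
qed

text \<open>Testing the equation with v and splitting u = v + w turns its left side into the energy
  of v plus cross terms with w. The chosen weak derivatives of v are exchanged a.e. for
  \<open>h1\<close> and \<open>h2\<close>.\<close>

lemma energy_identity:
  assumes S: "open S" "bounded S" and "0 < \<epsilon>" and sol: "weak_solution_eps \<epsilon> S f u"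
    and w: "w \<in> Lsq S" "g1 \<in> Lsq S" "g2 \<in> Lsq S" "has_weak_partial S (1, 0) w g1" "has_weak_partial S (0, 1) w g2"
  defines "v \<equiv> \<lambda>z. u z - w z"
    and "h1 \<equiv> \<lambda>z. weak_partial S (1, 0) u z - g1 z" and "h2 \<equiv> \<lambda>z. weak_partial S (0, 1) u z - g2 z"
  shows "v \<in> Lsq S" "h1 \<in> Lsq S" "h2 \<in> Lsq S" "has_weak_partial S (1, 0) v h1" "has_weak_partial S (0, 1) v h2"
    "(Lsq_norm S h1)\<^sup>2 + 1 / \<epsilon>\<^sup>2 * (Lsq_norm S h2)\<^sup>2 + (Lsq_norm S v)\<^sup>2 =
      (\<integral>z. f z * v z \<partial>lebesgue_on S) - (\<integral>z. g1 z * h1 z \<partial>lebesgue_on S)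
      - 1 / \<epsilon>\<^sup>2 * (\<integral>z. g2 z * h2 z \<partial>lebesgue_on S) - (\<integral>z. w z * v z \<partial>lebesgue_on S)"
proof -
  have Sm: "S \<in> lmeasurable" using S by (auto intro: lmeasurable_open)
  have bas: "(1, 0) \<in> (Basis :: (real \<times> real) set)" "(0, 1) \<in> (Basis :: (real \<times> real) set)"
    "(Basis :: (real \<times> real) set) = {(1, 0), (0, 1)}" by (auto simp: Basis_prod_def)
  have uH: "u \<in> H1 S" using sol by (simp add: weak_solution_eps_def)
  have uL: "u \<in> Lsq S" using uH by (simp add: H1_def)
  note p1 = weak_partial_H1[OF uH bas(1)] and p2 = weak_partial_H1[OF uH bas(2)]
  show vL: "v \<in> Lsq S" and h1L: "h1 \<in> Lsq S" and h2L: "h2 \<in> Lsq S"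
    unfolding v_def h1_def h2_def by (rule Lsq_diff uL w p1(1) p2(1))+
  show wv1: "has_weak_partial S (1, 0) v h1" unfolding v_def h1_def
    by (rule has_weak_partial_diff[OF Sm uL w(1) p1(1) w(2) bas(1) p1(2) w(4)])
  show wv2: "has_weak_partial S (0, 1) v h2" unfolding v_def h2_def
    by (rule has_weak_partial_diff[OF Sm uL w(1) p2(1) w(3) bas(2) p2(2) w(5)])
  have vH: "v \<in> H1 S" unfolding H1_def bas(3) using vL h1L h2L wv1 wv2 by auto
  note a1 = weak_partial_eq_AE[OF S h1L wv1] and a2 = weak_partial_eq_AE[OF S h2L wv2]
  let ?M = "lebesgue_on S"
  have "(\<integral>z. weak_partial S (1, 0) u z * weak_partial S (1, 0) v z
            + 1 / \<epsilon>\<^sup>2 * (weak_partial S (0, 1) u z * weak_partial S (0, 1) v z) + u z * v z \<partial>?M)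
    = (\<integral>z. f z * v z \<partial>?M)" using sol vH by (simp add: weak_solution_eps_def)
  moreover have "(\<integral>z. weak_partial S (1, 0) u z * weak_partial S (1, 0) v z
            + 1 / \<epsilon>\<^sup>2 * (weak_partial S (0, 1) u z * weak_partial S (0, 1) v z) + u z * v z \<partial>?M)
    = (\<integral>z. (h1 z * h1 z + g1 z * h1 z) + 1 / \<epsilon>\<^sup>2 * (h2 z * h2 z + g2 z * h2 z) + (v z * v z + w z * v z) \<partial>?M)"
  proof (rule integral_cong_AE)
    note [measurable] = LsqD(1)[OF uL] LsqD(1)[OF vL] LsqD(1)[OF h1L] LsqD(1)[OF h2L] LsqD(1)[OF w(1)] LsqD(1)[OF w(2)] LsqD(1)[OF w(3)]
      LsqD(1)[OF p1(1)] LsqD(1)[OF p2(1)] LsqD(1)[OF a1(1)] LsqD(1)[OF a2(1)]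
    show "(\<lambda>z. weak_partial S (1, 0) u z * weak_partial S (1, 0) v z
            + 1 / \<epsilon>\<^sup>2 * (weak_partial S (0, 1) u z * weak_partial S (0, 1) v z) + u z * v z) \<in> borel_measurable ?M"
      by measurable
    show "(\<lambda>z. (h1 z * h1 z + g1 z * h1 z) + 1 / \<epsilon>\<^sup>2 * (h2 z * h2 z + g2 z * h2 z) + (v z * v z + w z * v z)) \<in> borel_measurable ?M"
      by measurable
    show "AE z in ?M. weak_partial S (1, 0) u z * weak_partial S (1, 0) v z
            + 1 / \<epsilon>\<^sup>2 * (weak_partial S (0, 1) u z * weak_partial S (0, 1) v z) + u z * v z
      = (h1 z * h1 z + g1 z * h1 z) + 1 / \<epsilon>\<^sup>2 * (h2 z * h2 z + g2 z * h2 z) + (v z * v z + w z * v z)"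
      using a1(2) a2(2)
    proof eventually_elim
      case (elim z)
      have "weak_partial S (1, 0) u z = h1 z + g1 z" "weak_partial S (0, 1) u z = h2 z + g2 z" "u z = v z + w z"
        by (simp_all add: h1_def h2_def v_def)
      then show ?case unfolding elim by (simp only: distrib_right)
    qed
  qed
  moreover have "\<dots> = ((Lsq_norm S h1)\<^sup>2 + (\<integral>z. g1 z * h1 z \<partial>?M)) + 1 / \<epsilon>\<^sup>2 * ((Lsq_norm S h2)\<^sup>2 + (\<integral>z. g2 z * h2 z \<partial>?M))
      + ((Lsq_norm S v)\<^sup>2 + (\<integral>z. w z * v z \<partial>?M))"
    unfolding Lsq_norm_power2 power2_eq_square[of "h1 _"] power2_eq_square[of "h2 _"] power2_eq_square[of "v _"]
    using Lsq_integrable_mult[OF h1L h1L] Lsq_integrable_mult[OF w(2) h1L] Lsq_integrable_mult[OF h2L h2L]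
      Lsq_integrable_mult[OF w(3) h2L] Lsq_integrable_mult[OF vL vL] Lsq_integrable_mult[OF w(1) vL] by simp
  ultimately show "(Lsq_norm S h1)\<^sup>2 + 1 / \<epsilon>\<^sup>2 * (Lsq_norm S h2)\<^sup>2 + (Lsq_norm S v)\<^sup>2 =
      (\<integral>z. f z * v z \<partial>?M) - (\<integral>z. g1 z * h1 z \<partial>?M) - 1 / \<epsilon>\<^sup>2 * (\<integral>z. g2 z * h2 z \<partial>?M) - (\<integral>z. w z * v z \<partial>?M)"
    by (simp add: distrib_left)
qed

context thin_domain
begin

abbreviation \<Omega>e :: "real \<Rightarrow> (real \<times> real) set" where "\<Omega>e \<epsilon> \<equiv> region b (Ge \<epsilon>)"
abbreviation \<Omega>0 :: "(real \<times> real) set" where "\<Omega>0 \<equiv> region b G0"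

text \<open>The constants are fixed in the order \<open>U\<close>, and with it \<open>B\<close>,
  then the layer thickness \<delta>, then \<epsilon>: the vertical derivative contains the factor P
  / \<delta>, which has to be constant while \<epsilon> tends to 0.\<close>

proposition recovery:
  assumes u: "u \<in> Lsq {0<..<1}" "d \<in> Lsq {0<..<1}" "has_weak_partial {0<..<1} 1 u d" and "e > 0"
  shows "\<forall>\<^sub>F \<epsilon> in at_right 0. \<exists>v g1 g2. v \<in> Lsq (\<Omega>e \<epsilon>) \<and> g1 \<in> Lsq (\<Omega>e \<epsilon>) \<and> g2 \<in> Lsq (\<Omega>e \<epsilon>) \<and>
    has_weak_partial (\<Omega>e \<epsilon>) (1, 0) v g1 \<and> has_weak_partial (\<Omega>e \<epsilon>) (0, 1) v g2 \<and>
    Lsq_norm (\<Omega>e \<epsilon>) (\<lambda>z. v z - u (fst z)) \<le> e \<and>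
    Lsq_norm (\<Omega>e \<epsilon>) (\<lambda>z. g1 z - (if z \<in> \<Omega>0 then d (fst z) else 0)) \<le> e \<and>
    Lsq_norm (\<Omega>e \<epsilon>) g2 \<le> e * \<epsilon>"
proof -
  have Hp: "0 < H" using height_region.H_pos[OF height_region_G0] .
  define s where "s = sqrt H + 1"
  have s: "s \<ge> 1" "sqrt H \<le> s" "0 < s" using Hp by (auto simp: s_def add_pos_pos)
  define e1 where "e1 = e / (2 * s)"
  have e1: "e1 > 0" "sqrt H * e1 \<le> e / 2"
  proof -
    show "e1 > 0" using \<open>e > 0\<close> s by (simp add: e1_def)
    then have "sqrt H * e1 \<le> s * e1" using s by (intro mult_right_mono) auto
    then show "sqrt H * e1 \<le> e / 2" using s by (simp add: e1_def)
  qed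
  obtain U w B where U: "\<And>x. (U has_real_derivative w x) (at x)" "continuous_on UNIV w" "\<And>x. \<bar>w x\<bar> \<le> B"
    "AE x in lebesgue_on {0<..<1}. \<bar>u x - U x\<bar> \<le> e1" "Lsq_norm {0<..<1} (\<lambda>x. d x - w x) \<le> e1"
    using H1_unit_interval_smooth_approximation[OF u e1(1)] by blast
  have B0: "0 \<le> B" using U(3)[of 0] by linarith
  \<comment> \<open>Chosen so that B sqrt (5 \<delta>) <= e / 2, the cost of the layer of thickness
    5 \<delta> in which \<open>g1\<close> may be off by \<open>B\<close>; \<open>B + 1\<close>
    avoids a zero denominator.\<close>
  define \<delta> where "\<delta> = (e / (2 * (B + 1)))\<^sup>2 / 5"
  have \<delta>0: "\<delta> > 0" using \<open>e > 0\<close> B0 by (simp add: \<delta>_def)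
  have B\<delta>: "B * sqrt (5 * \<delta>) \<le> e / 2"
  proof -
    have "sqrt (5 * \<delta>) = e / (2 * (B + 1))" using \<open>e > 0\<close> B0 by (simp add: \<delta>_def)
    then have "B * sqrt (5 * \<delta>) = e / 2 * (B / (B + 1))" by simp
    also have "\<dots> \<le> e / 2 * 1" using \<open>e > 0\<close> B0 by (intro mult_left_mono) auto
    finally show ?thesis by simp
  qed
  obtain \<delta>' where \<delta>': "\<delta>' > 0" "\<forall>x\<in>{0..1}. \<forall>x'\<in>{0..1}. \<bar>x - x'\<bar> < \<delta>' \<longrightarrow> (\<forall>y. \<bar>G x y - G x' y\<bar> \<le> \<delta> / 2)"
    using G_cont[of "\<delta> / 2"] \<delta>0 by auto
  obtain \<rho> where \<rho>: "unit_bump 0 1 \<rho>" using unit_bump_exists[of 0 1] by auto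
  have \<rho>t: "\<rho> \<in> test_functions UNIV" by (rule unit_bump_test_function[OF \<rho>]) simp
  obtain R where R: "antideriv_from \<rho> 0 1 R 1" using \<rho> by (auto simp: unit_bump_def)
  have \<rho>nn: "0 \<le> \<rho> y" for y using \<rho> by (simp add: unit_bump_def)
  obtain P where P: "\<And>x. \<bar>\<rho> x\<bar> \<le> P" using test_function_bounded[OF \<rho>t] by blast
  \<comment> \<open>\<open>unit_bump\<close> gives zero only outside the closed interval; the value
    at 0 itself follows by continuity.\<close>
  have \<rho>0: "\<rho> t = 0" if "t \<le> 0" for t
  proof (cases "t = 0")
    case True
    have "((\<lambda>t. \<rho> t) \<longlongrightarrow> \<rho> 0) (at_left 0)"
      using test_function_continuous[OF \<rho>t] by (simp add: continuous_on_eq_continuous_at isCont_def filterlim_at_split)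
    moreover have "((\<lambda>t. \<rho> t) \<longlongrightarrow> 0) (at_left 0)"
      by (rule Lim_transform_eventually[OF tendsto_const]) (use \<rho> in \<open>auto simp: unit_bump_def eventually_at_filter\<close>)
    ultimately show ?thesis using True tendsto_unique[OF trivial_limit_at_left_real] by blast
  qed (use \<rho> that in \<open>auto simp: unit_bump_def\<close>)
  have "\<forall>\<^sub>F \<epsilon> in at_right 0. L * \<epsilon> powr \<alpha> < \<delta>'" by (rule powr_small) (use alpha \<delta>' in auto)
  moreover have "\<forall>\<^sub>F \<epsilon> in at_right 0. (sqrt H * B * L) * \<epsilon> powr \<alpha> < e / 2" by (rule powr_small) (use alpha \<open>e > 0\<close> in auto)
  moreover have "\<forall>\<^sub>F \<epsilon> in at_right 0. (sqrt H * (P / \<delta>) * B * L) * \<epsilon> powr (\<alpha> - 1) < e" by (rule powr_small) (use alpha \<open>e > 0\<close> in auto)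
  ultimately show ?thesis using eventually_eps
  proof eventually_elim
    case (elim \<epsilon>)
    interpret height_region b "Ge \<epsilon>" b\<^sub>0 H by (rule height_region_eps[OF elim(4)])
    have e0: "0 < \<epsilon>" using elim(4) by simp
    obtain v g1 g2 where v: "v \<in> Lsq \<Omega>" "g1 \<in> Lsq \<Omega>" "g2 \<in> Lsq \<Omega>"
      "has_weak_partial \<Omega> (1, 0) v g1" "has_weak_partial \<Omega> (0, 1) v g2"
      "\<And>z. z \<in> \<Omega> \<Longrightarrow> \<bar>v z - U (fst z)\<bar> \<le> B * (L * \<epsilon> powr \<alpha>)"
      "\<And>z. z \<in> \<Omega> \<Longrightarrow> \<bar>g2 z\<bar> \<le> P / \<delta> * (B * (L * \<epsilon> powr \<alpha>))"
      "\<And>z. z \<in> \<Omega> \<Longrightarrow> \<bar>g1 z - (if z \<in> \<Omega>0 then w (fst z) else 0)\<bar>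
         \<le> (if G0 (fst z) \<le> snd z \<and> snd z \<le> G0 (fst z) + 5 * \<delta> then B else 0)"
    proof (rule recovery_construction[OF elim(4) \<delta>0 \<delta>'(2) refl elim(1) U(1,2,3), of R \<rho> P])
      show "(R has_real_derivative \<rho> t) (at t)" "t \<le> 0 \<Longrightarrow> R t = 0" "t \<ge> 1 \<Longrightarrow> R t = 1" for t
        using R by (auto simp: antideriv_from_def)
      show "0 \<le> R t" "R t \<le> 1" for t using antideriv_from_bounds[OF R \<rho>nn] by auto
      show "t \<le> 0 \<Longrightarrow> \<rho> t = 0" "\<bar>\<rho> t\<bar> \<le> P" for t using \<rho>0 P by auto
      show "continuous_on UNIV \<rho>" by (rule test_function_continuous[OF \<rho>t])
    qed (rule that)
    have Uc: "continuous_on UNIV U" using U(1) by (auto intro!: continuous_at_imp_continuous_on DERIV_isCont)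
    have UL: "U \<in> Lsq {0<..<1}"
    proof -
      have "compact (U ` {0..1})" by (intro compact_continuous_image continuous_on_subset[OF Uc]) auto
      then obtain B' where "\<And>y. y \<in> U ` {0..1} \<Longrightarrow> norm y \<le> B'" by (meson compact_imp_bounded bounded_iff)
      then show ?thesis by (intro Lsq_bounded(1)[of _ _ B'] continuous_on_imp_measurable_lebesgue_on Uc) auto
    qed
    have wL: "w \<in> Lsq {0<..<1}"
      by (rule Lsq_bounded(1)[OF _ continuous_on_imp_measurable_lebesgue_on[OF U(2)] U(3)]) simp
    have n0: "0 \<le> B * (L * \<epsilon> powr \<alpha>)" "0 \<le> P" using B0 L_pos P[of 0] by auto
    have "Lsq_norm \<Omega> (\<lambda>z. v z - u (fst z)) = Lsq_norm \<Omega> (\<lambda>z. (v z - U (fst z)) + (U (fst z) - u (fst z)))" by simp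
    also have "\<dots> \<le> Lsq_norm \<Omega> (\<lambda>z. v z - U (fst z)) + Lsq_norm \<Omega> (\<lambda>z. U (fst z) - u (fst z))"
      by (intro Lsq_norm_triangle Lsq_diff v Lsq_fst(1)[OF UL] Lsq_fst(1)[OF u(1)])
    also have "Lsq_norm \<Omega> (\<lambda>z. v z - U (fst z)) \<le> sqrt H * (B * (L * \<epsilon> powr \<alpha>))"
      by (rule Lsq_norm_region_bounded[OF Lsq_diff[OF v(1) Lsq_fst(1)[OF UL]] v(6) n0(1)])
    also have "\<dots> \<le> e / 2" using elim(2) by (simp add: mult_ac)
    also have "Lsq_norm \<Omega> (\<lambda>z. U (fst z) - u (fst z)) \<le> sqrt H * Lsq_norm {0<..<1} (\<lambda>x. U x - u x)"
      by (rule Lsq_fst(2)[OF Lsq_diff[OF UL u(1)]])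
    also have "Lsq_norm {0<..<1} (\<lambda>x. U x - u x) \<le> e1"
    proof -
      have cL: "(\<lambda>x. e1) \<in> Lsq {0<..<1::real}" "Lsq_norm {0<..<1::real} (\<lambda>x. e1) \<le> e1"
        using Lsq_bounded[of "{0<..<1::real}" "\<lambda>x. e1" e1] e1 by auto
      have "Lsq_norm {0<..<1} (\<lambda>x. U x - u x) \<le> Lsq_norm {0<..<1::real} (\<lambda>x. e1)"
        by (rule Lsq_AE_bound(2)[OF cL(1) LsqD(1)[OF Lsq_diff[OF UL u(1)]]])
          (use U(4) in \<open>eventually_elim, simp add: abs_minus_commute\<close>)
      then show ?thesis using cL(2) by linarith
    qed
    finally have b1: "Lsq_norm \<Omega> (\<lambda>z. v z - u (fst z)) \<le> e" using e1 Hp by (simp add: mult_left_mono)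
    have \<Omega>0b: "\<Omega>0 \<in> sets borel" using open_region_G0 by simp
    note dF = Lsq_fst(1)[OF u(2)] and wF = Lsq_fst(1)[OF wL]
    note rd = Lsq_restrict(1)[OF dF \<Omega>0b] and rw = Lsq_restrict(1)[OF wF \<Omega>0b]
    have "Lsq_norm \<Omega> (\<lambda>z. g1 z - (if z \<in> \<Omega>0 then d (fst z) else 0))
      = Lsq_norm \<Omega> (\<lambda>z. (g1 z - (if z \<in> \<Omega>0 then w (fst z) else 0)) + (if z \<in> \<Omega>0 then w (fst z) - d (fst z) else 0))"
      by (rule arg_cong[where f="Lsq_norm \<Omega>"]) auto
    also have "\<dots> \<le> Lsq_norm \<Omega> (\<lambda>z. g1 z - (if z \<in> \<Omega>0 then w (fst z) else 0)) + Lsq_norm \<Omega> (\<lambda>z. if z \<in> \<Omega>0 then w (fst z) - d (fst z) else 0)"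
      by (intro Lsq_norm_triangle Lsq_diff v(2) rw Lsq_restrict(1)[OF _ \<Omega>0b] wF dF)
    also have "Lsq_norm \<Omega> (\<lambda>z. g1 z - (if z \<in> \<Omega>0 then w (fst z) else 0)) \<le> B * sqrt (5 * \<delta>)"
      by (rule layer_norm(2)[OF elim(4) LsqD(1)[OF Lsq_diff[OF v(2) rw]] B0 _ v(8)]) (use \<delta>0 in simp)
    also have "\<dots> \<le> e / 2" by (rule B\<delta>)
    also have "Lsq_norm \<Omega> (\<lambda>z. if z \<in> \<Omega>0 then w (fst z) - d (fst z) else 0) \<le> Lsq_norm \<Omega> (\<lambda>z. w (fst z) - d (fst z))"
      by (rule Lsq_restrict(2)[OF Lsq_diff[OF wF dF] \<Omega>0b])
    also have "\<dots> \<le> sqrt H * Lsq_norm {0<..<1} (\<lambda>x. w x - d x)" by (rule Lsq_fst(2)[OF Lsq_diff[OF wL u(2)]])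
    also have "Lsq_norm {0<..<1} (\<lambda>x. w x - d x) = Lsq_norm {0<..<1} (\<lambda>x. d x - w x)"
      using Lsq_norm_minus[of "{0<..<1}" "\<lambda>x. d x - w x"] by simp
    also have "sqrt H * Lsq_norm {0<..<1} (\<lambda>x. d x - w x) \<le> sqrt H * e1"
      using Hp by (intro mult_left_mono U(5)) simp
    also note e1(2)
    finally have b2: "Lsq_norm \<Omega> (\<lambda>z. g1 z - (if z \<in> \<Omega>0 then d (fst z) else 0)) \<le> e" by simp
    have "Lsq_norm \<Omega> g2 \<le> sqrt H * (P / \<delta> * (B * (L * \<epsilon> powr \<alpha>)))"
      by (rule Lsq_norm_region_bounded[OF v(3,7)]) (use n0 \<delta>0 in auto)
    \<comment> \<open>One factor \<epsilon> is split off to compensate the weight 1 / \<epsilon>^2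
      of the energy; the remaining \<epsilon>^(\<alpha> - 1) tends to 0 because \<alpha> >
      1.\<close>
    also have "\<epsilon> powr \<alpha> = \<epsilon> powr (\<alpha> - 1) * \<epsilon>" using e0 powr_add[of \<epsilon> "\<alpha> - 1" 1] by simp
    also have "sqrt H * (P / \<delta> * (B * (L * (\<epsilon> powr (\<alpha> - 1) * \<epsilon>)))) = ((sqrt H * (P / \<delta>) * B * L) * \<epsilon> powr (\<alpha> - 1)) * \<epsilon>" by simp
    also have "\<dots> \<le> e * \<epsilon>" using elim(3) e0 by (intro mult_right_mono) auto
    finally have b3: "Lsq_norm \<Omega> g2 \<le> e * \<epsilon>" .
    show ?case using v(1-5) b1 b2 b3 by blast
  qed
qed

end

lemma (in height_region) integral_fst_mult:
  assumes q: "q \<in> Lsq {0<..<1}" and r: "r \<in> Lsq {0<..<1}"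
  shows "(\<integral>z. q (fst z) * r (fst z) \<partial>lebesgue_on \<Omega>) = (\<integral>x. (b x + g x) * q x * r x \<partial>lebesgue_on {0<..<1})"
proof -
  have "VI (\<lambda>z. q (fst z)) x = (b x + g x) * q x" if "x \<in> {0<..<1}" for x
    using b_ge[OF that] g_nonneg[OF that] b0_pos by (simp add: vertical_integral_def measure_restrict_space)
  then show ?thesis
    unfolding VI_integral[OF Lsq_fst(1)[OF q] r] by (intro Bochner_Integration.integral_cong) auto
qed

section \<open>Energy of the difference between solution and recovery function\<close>

context thin_domain
begin

text \<open>Each integral on the right of \<open>energy_identity\<close> is compared with its
  counterpart for \<open>V\<close> and \<open>V'\<close> on the unit interval. The counterparts
  cancel by the limit equation up to the null terms. Remainders with \<eta> stem from the recovery
  functions and from \<psi>, those with \<epsilon> from the error of the strip average.\<close>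

lemma energy_estimate:
  assumes e: "\<epsilon> \<in> {0<..<\<epsilon>\<^sub>0}" and f: "f \<in> Lsq (\<Omega>e \<epsilon>)" "Lsq_norm (\<Omega>e \<epsilon>) f \<le> C"
    and sol: "weak_solution_eps \<epsilon> (\<Omega>e \<epsilon>) f u"
    and fh: "f_hat \<in> Lsq {0<..<1}"
    and u0: "u0 \<in> Lsq {0<..<1}" "d \<in> Lsq {0<..<1}" "has_weak_partial {0<..<1} 1 u0 d"
    and lim: "\<And>V V'. V \<in> Lsq {0<..<1} \<Longrightarrow> V' \<in> Lsq {0<..<1} \<Longrightarrow> has_weak_partial {0<..<1} 1 V V' \<Longrightarrow>
      (\<integral>x. (b x + G0 x) * d x * V' x \<partial>lebesgue_on {0<..<1}) + (\<integral>x. (b x + G_mean x) * u0 x * V x \<partial>lebesgue_on {0<..<1})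
      = (\<integral>x. f_hat x * V x \<partial>lebesgue_on {0<..<1})"
    and \<rho>: "unit_bump p q \<rho>" "{p..q} \<subseteq> {- b\<^sub>0<..<0}" "\<And>y. \<bar>\<rho> y\<bar> \<le> P"
    and \<psi>: "\<psi> \<in> test_functions \<Omega>0" "Lsq_norm \<Omega>0 (\<lambda>z. d (fst z) - \<psi> z) \<le> \<eta>"
    and \<eta>: "0 < \<eta>" "\<eta> \<le> 1"
    and w: "w \<in> Lsq (\<Omega>e \<epsilon>)" "g1 \<in> Lsq (\<Omega>e \<epsilon>)" "g2 \<in> Lsq (\<Omega>e \<epsilon>)"
      "has_weak_partial (\<Omega>e \<epsilon>) (1, 0) w g1" "has_weak_partial (\<Omega>e \<epsilon>) (0, 1) w g2"
      "Lsq_norm (\<Omega>e \<epsilon>) (\<lambda>z. w z - u0 (fst z)) \<le> \<eta>"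
      "Lsq_norm (\<Omega>e \<epsilon>) (\<lambda>z. g1 z - (if z \<in> \<Omega>0 then d (fst z) else 0)) \<le> \<eta>"
      "Lsq_norm (\<Omega>e \<epsilon>) g2 \<le> \<eta> * \<epsilon>"
    and K: "K = C + sqrt H * Lsq_norm {0<..<1} d + sqrt H * Lsq_norm {0<..<1} u0 + 3" and R: "R = sqrt H * (P * K)"
    and null: "\<And>V V'. V \<in> Lsq {0<..<1} \<Longrightarrow> V' \<in> Lsq {0<..<1} \<Longrightarrow> has_weak_partial {0<..<1} 1 V V' \<Longrightarrow>
      Lsq_norm {0<..<1} V \<le> R \<Longrightarrow> Lsq_norm {0<..<1} V' \<le> R \<Longrightarrow>
      \<bar>(\<integral>x. (vertical_integral b (Ge \<epsilon>) f x - f_hat x) * V x \<partial>lebesgue_on {0<..<1})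
        - (\<integral>x. (Ge \<epsilon> x - G_mean x) * u0 x * V x \<partial>lebesgue_on {0<..<1})\<bar> \<le> 2 * \<eta>"
  defines "v \<equiv> \<lambda>z. u z - w z"
    and "h1 \<equiv> \<lambda>z. weak_partial (\<Omega>e \<epsilon>) (1, 0) u z - g1 z" and "h2 \<equiv> \<lambda>z. weak_partial (\<Omega>e \<epsilon>) (0, 1) u z - g2 z"
  shows "v \<in> Lsq (\<Omega>e \<epsilon>)" "h1 \<in> Lsq (\<Omega>e \<epsilon>)" "h2 \<in> Lsq (\<Omega>e \<epsilon>)"
    "(Lsq_norm (\<Omega>e \<epsilon>) h1)\<^sup>2 + (Lsq_norm (\<Omega>e \<epsilon>) h2 / \<epsilon>)\<^sup>2 + (Lsq_norm (\<Omega>e \<epsilon>) v)\<^sup>2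
      \<le> \<eta> * (2 + 4 * K + sqrt H * R)
        + \<epsilon> * (H * K * (C + sqrt H * Lsq_norm {0<..<1} u0 + Lsq_norm \<Omega>0 (\<lambda>z. frechet_derivative \<psi> (at z) (1, 0))))"
proof -
  interpret E: height_region b "Ge \<epsilon>" b\<^sub>0 H by (rule height_region_eps[OF e])
  interpret Z: height_region b G0 b\<^sub>0 H by (rule height_region_G0)
  have e0: "0 < \<epsilon>" using e by simp
  let ?S = "\<Omega>e \<epsilon>" and ?I = "{0<..<1::real}"
  let ?M = "lebesgue_on ?S" and ?N = "lebesgue_on ?I" and ?W = "lebesgue_on \<Omega>0"
  define s where "s = sqrt H"
  define A Dn where "A = Lsq_norm ?I u0" and "Dn = Lsq_norm ?I d"
  have s0: "0 \<le> s" "0 < H" using E.H_pos by (auto simp: s_def)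
  have AD: "0 \<le> A" "0 \<le> Dn" by (auto simp: A_def Dn_def)
  have C0: "0 \<le> C" using f(2) Lsq_norm_nonneg[of ?S f] by linarith
  have K': "K = C + s * Dn + s * A + 3" by (simp add: K s_def A_def Dn_def)
  have K0: "0 \<le> K" using C0 s0 AD by (simp add: K')
  have P0: "0 \<le> P" using \<rho>(3)[of 0] by linarith
  note EI = energy_identity[OF E.open_region E.bounded_region e0 sol w(1-5), folded v_def h1_def h2_def]
  note vL = EI(1) and h1L = EI(2) and h2L = EI(3)
  show "v \<in> Lsq ?S" "h1 \<in> Lsq ?S" "h2 \<in> Lsq ?S" by (rule vL h1L h2L)+
  define a b2 c where "a = Lsq_norm ?S h1" and "b2 = Lsq_norm ?S h2" and "c = Lsq_norm ?S v"
  have abc: "0 \<le> a" "0 \<le> b2" "0 \<le> c" by (auto simp: a_def b2_def c_def)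
  define En where "En = a\<^sup>2 + (b2 / \<epsilon>)\<^sup>2 + c\<^sup>2"
  define X where "X = sqrt En"
  have X2: "X * X = En" by (simp add: X_def En_def)
  have aX: "a \<le> X" and bX: "b2 / \<epsilon> \<le> X" and cX: "c \<le> X"
    unfolding X_def En_def by (auto intro!: real_le_rsqrt)
  have X0: "0 \<le> X" using aX abc by linarith
  have I: "En = (\<integral>z. f z * v z \<partial>?M) - (\<integral>z. g1 z * h1 z \<partial>?M) - 1 / \<epsilon>\<^sup>2 * (\<integral>z. g2 z * h2 z \<partial>?M) - (\<integral>z. w z * v z \<partial>?M)"
    using EI(6) unfolding En_def a_def b2_def c_def v_def h1_def h2_def power_divide by simp
  have \<Omega>0b: "\<Omega>0 \<in> sets borel" using open_region_G0 by simp
  note dF = E.Lsq_fst(1)[OF u0(2)] and uF = E.Lsq_fst(1)[OF u0(1)]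
  note rd = Lsq_restrict[OF dF \<Omega>0b]
  define k where "k z = (if z \<in> \<Omega>0 then d (fst z) else 0)" for z
  have kL: "k \<in> Lsq ?S" unfolding k_def[abs_def] by (rule rd(1))
  have kn: "Lsq_norm ?S k \<le> s * Dn"
    unfolding k_def[abs_def] s_def Dn_def by (rule order_trans[OF rd(2) E.Lsq_fst(2)[OF u0(2)]])
  have g1k: "Lsq_norm ?S (\<lambda>z. g1 z - k z) \<le> \<eta>" using w(7) by (simp add: k_def)
  have g1n: "Lsq_norm ?S g1 \<le> \<eta> + s * Dn"
    using Lsq_norm_triangle[OF Lsq_diff[OF w(2) kL] kL] g1k kn by simp
  have uFn: "Lsq_norm ?S (\<lambda>z. u0 (fst z)) \<le> s * A" unfolding s_def A_def by (rule E.Lsq_fst(2)[OF u0(1)])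
  have wn: "Lsq_norm ?S w \<le> \<eta> + s * A"
    using Lsq_norm_triangle[OF Lsq_diff[OF w(1) uF] uF] w(6) uFn by simp
  have cs: "\<bar>\<integral>z. r z * t z \<partial>?M\<bar> \<le> x * y" if "r \<in> Lsq ?S" "t \<in> Lsq ?S" "Lsq_norm ?S r \<le> x" "Lsq_norm ?S t \<le> y" for r t x y
  proof -
    have "0 \<le> x" using that(3) Lsq_norm_nonneg[of ?S r] by linarith
    then show ?thesis
      by (intro order_trans[OF Lsq_Cauchy_Schwarz[OF that(1,2)] mult_mono]) (use that in auto)
  qed
  have g2h: "\<bar>1 / \<epsilon>\<^sup>2 * (\<integral>z. g2 z * h2 z \<partial>?M)\<bar> \<le> \<eta> * X"
  proof -
    have "\<bar>\<integral>z. g2 z * h2 z \<partial>?M\<bar> \<le> (\<eta> * \<epsilon>) * b2" by (rule cs[OF w(3) h2L w(8)]) (simp add: b2_def)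
    then have "1 / \<epsilon>\<^sup>2 * \<bar>\<integral>z. g2 z * h2 z \<partial>?M\<bar> \<le> 1 / \<epsilon>\<^sup>2 * ((\<eta> * \<epsilon>) * b2)" by (intro mult_left_mono) auto
    also have "\<dots> = \<eta> * (b2 / \<epsilon>)" using e0 by (simp add: power2_eq_square)
    also have "\<dots> \<le> \<eta> * X" using bX \<eta> by (intro mult_left_mono) auto
    finally show ?thesis by (simp add: abs_mult)
  qed
  \<comment> \<open>The right side of the identity is at most (C + s Dn + s A + 3 \<eta>) X. The
    three \<eta> are the errors of \<open>g1\<close>, of \<open>w\<close> and of \<open>g2\<close>,
    which explains the 3 in \<open>K\<close>.\<close>
  have XK: "X \<le> K"
  proof -
    have "\<bar>\<integral>z. f z * v z \<partial>?M\<bar> \<le> C * X" by (rule cs[OF f(1) vL f(2)]) (use cX in \<open>simp add: c_def\<close>)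
    moreover have "\<bar>\<integral>z. g1 z * h1 z \<partial>?M\<bar> \<le> (\<eta> + s * Dn) * X" by (rule cs[OF w(2) h1L g1n]) (use aX in \<open>simp add: a_def\<close>)
    moreover have "\<bar>\<integral>z. w z * v z \<partial>?M\<bar> \<le> (\<eta> + s * A) * X" by (rule cs[OF w(1) vL wn]) (use cX in \<open>simp add: c_def\<close>)
    ultimately have "X * X \<le> C * X + (\<eta> + s * Dn) * X + (\<eta> + s * A) * X + \<eta> * X"
      unfolding X2 I using g2h by linarith
    also have "\<dots> = (C + s * Dn + s * A + 3 * \<eta>) * X" by (simp add: algebra_simps)
    also have "\<dots> \<le> K * X" unfolding K' using \<eta> X0 by (intro mult_right_mono) auto
    finally have "X * X \<le> K * X" .
    show ?thesis
    proof (rule ccontr)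
      assume "\<not> X \<le> K"
      then have "K * X < X * X" using K0 by (intro mult_strict_right_mono) auto
      then show False using \<open>X * X \<le> K * X\<close> by linarith
    qed
  qed
  have cK: "c \<le> K" "a \<le> K" using cX aX XK by linarith+
  have b2K: "b2 \<le> \<epsilon> * K"
  proof -
    have "b2 / \<epsilon> \<le> K" using bX XK by linarith
    then show ?thesis using e0 by (simp add: divide_le_eq mult.commute)
  qed
  have \<rho>t: "\<rho> \<in> test_functions UNIV" by (rule unit_bump_test_function[OF \<rho>(1)]) simp
  define V V' where "V = vertical_integral b (Ge \<epsilon>) (\<lambda>z. v z * \<rho> (snd z))"
    and "V' = vertical_integral b (Ge \<epsilon>) (\<lambda>z. h1 z * \<rho> (snd z))"
  note v\<rho> = Lsq_mult_test_snd[OF vL \<rho>t] and h\<rho> = Lsq_mult_test_snd[OF h1L \<rho>t]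
  have VL: "V \<in> Lsq ?I" and V'L: "V' \<in> Lsq ?I"
    unfolding V_def V'_def by (rule E.VI_Lsq(1)[OF v\<rho>(1)] E.VI_Lsq(1)[OF h\<rho>(1)])+
  have VV': "has_weak_partial ?I 1 V V'"
    unfolding V_def V'_def by (rule E.strip_average_has_weak_derivative[OF vL h1L EI(4) \<rho>(1,2)])
  have VR: "Lsq_norm ?I V \<le> R"
  proof -
    have "Lsq_norm ?I V \<le> sqrt H * Lsq_norm ?S (\<lambda>z. v z * \<rho> (snd z))"
      unfolding V_def by (rule E.VI_Lsq(2)[OF v\<rho>(1)])
    also have "\<dots> \<le> sqrt H * (\<bar>P\<bar> * c)" unfolding c_def using s0 by (intro mult_left_mono v\<rho>(2) \<rho>(3)) auto
    also have "\<dots> \<le> R" unfolding R using abc cK P0 s0 by (intro mult_left_mono mult_mono) auto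
    finally show ?thesis .
  qed
  have V'R: "Lsq_norm ?I V' \<le> R"
  proof -
    have "Lsq_norm ?I V' \<le> sqrt H * Lsq_norm ?S (\<lambda>z. h1 z * \<rho> (snd z))"
      unfolding V'_def by (rule E.VI_Lsq(2)[OF h\<rho>(1)])
    also have "\<dots> \<le> sqrt H * (\<bar>P\<bar> * a)" unfolding a_def using s0 by (intro mult_left_mono h\<rho>(2) \<rho>(3)) auto
    also have "\<dots> \<le> R" unfolding R using abc cK P0 s0 by (intro mult_left_mono mult_mono) auto
    finally show ?thesis .
  qed
  note VF = E.Lsq_fst(1)[OF VL] and V'F = E.Lsq_fst(1)[OF V'L]
  note VF0 = Z.Lsq_fst(1)[OF VL] and V'F0 = Z.Lsq_fst(1)[OF V'L]
  \<comment> \<open>The Poincare remainder, of order \<epsilon> because the vertical derivative of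
    \<open>v\<close> has norm at most \<epsilon> K.\<close>
  define y where "y z = v z - V (fst z)" for z
  have yL: "y \<in> Lsq ?S" unfolding y_def[abs_def] by (rule Lsq_diff[OF vL VF])
  have yn: "Lsq_norm ?S y \<le> H * (\<epsilon> * K)"
  proof -
    have "Lsq_norm ?S y \<le> H * b2"
      unfolding y_def[abs_def] V_def b2_def by (rule E.strip_average_error[OF vL h2L EI(5) \<rho>(1,2)])
    also have "\<dots> \<le> H * (\<epsilon> * K)" using b2K s0 by (intro mult_left_mono) auto
    finally show ?thesis .
  qed
  have fV: "(\<integral>z. f z * v z \<partial>?M) = (\<integral>x. vertical_integral b (Ge \<epsilon>) f x * V x \<partial>?N) + (\<integral>z. f z * y z \<partial>?M)"
  proof -
    have "(\<integral>z. f z * v z \<partial>?M) = (\<integral>z. f z * V (fst z) + f z * y z \<partial>?M)" by (simp add: y_def algebra_simps)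
    also have "\<dots> = (\<integral>z. f z * V (fst z) \<partial>?M) + (\<integral>z. f z * y z \<partial>?M)"
      by (rule Bochner_Integration.integral_add[OF Lsq_integrable_mult[OF f(1) VF] Lsq_integrable_mult[OF f(1) yL]])
    finally show ?thesis by (simp add: E.VI_integral[OF f(1) VL])
  qed
  have r1: "\<bar>\<integral>z. f z * y z \<partial>?M\<bar> \<le> C * (H * (\<epsilon> * K))" by (rule cs[OF f(1) yL f(2) yn])
  have wV: "(\<integral>z. w z * v z \<partial>?M) = (\<integral>x. (b x + Ge \<epsilon> x) * u0 x * V x \<partial>?N)
      + (\<integral>z. (w z - u0 (fst z)) * v z \<partial>?M) + (\<integral>z. u0 (fst z) * y z \<partial>?M)"
  proof -
    have "(\<integral>z. w z * v z \<partial>?M) = (\<integral>z. u0 (fst z) * V (fst z) + (w z - u0 (fst z)) * v z + u0 (fst z) * y z \<partial>?M)"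
      by (simp add: y_def algebra_simps)
    also have "\<dots> = (\<integral>z. u0 (fst z) * V (fst z) \<partial>?M) + (\<integral>z. (w z - u0 (fst z)) * v z \<partial>?M) + (\<integral>z. u0 (fst z) * y z \<partial>?M)"
      using Lsq_integrable_mult[OF uF VF] Lsq_integrable_mult[OF Lsq_diff[OF w(1) uF] vL] Lsq_integrable_mult[OF uF yL] by simp
    finally show ?thesis by (simp add: E.integral_fst_mult[OF u0(1) VL])
  qed
  have r2: "\<bar>\<integral>z. (w z - u0 (fst z)) * v z \<partial>?M\<bar> \<le> \<eta> * K"
    by (rule cs[OF Lsq_diff[OF w(1) uF] vL w(6)]) (use cK in \<open>simp add: c_def\<close>)
  have r3: "\<bar>\<integral>z. u0 (fst z) * y z \<partial>?M\<bar> \<le> (s * A) * (H * (\<epsilon> * K))" by (rule cs[OF uF yL uFn yn])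
  have sub: "\<Omega>0 \<subseteq> ?S" by (rule region_G0_subset)
  note ss = sub Z.region_lmeasurable(2) E.region_lmeasurable(2)
  note h10 = Lsq_subset[OF h1L ss] and y0 = Lsq_subset[OF yL ss] and v0 = Lsq_subset[OF vL ss]
  note dF0 = Z.Lsq_fst(1)[OF u0(2)] and \<psi>L = test_function_in_Lsq[OF \<psi>(1) Z.region_lmeasurable(1)]
  have bas: "(1, 0) \<in> (Basis :: (real \<times> real) set)" by (simp add: Basis_prod_def)
  \<comment> \<open>\<open>t\<close> need not be small in norm. It is the weak derivative of the
    small \<open>y\<close>, hence small against the test function \<psi>; against the rest, d -
    \<psi>, its boundedness is enough.\<close>
  define t where "t z = h1 z - V' (fst z)" for z
  have tL: "t \<in> Lsq \<Omega>0" unfolding t_def[abs_def] by (rule Lsq_diff[OF h10(1) V'F0])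
  have tn: "Lsq_norm \<Omega>0 t \<le> K + s * R"
  proof -
    have "Lsq_norm \<Omega>0 t \<le> Lsq_norm \<Omega>0 h1 + Lsq_norm \<Omega>0 (\<lambda>z. V' (fst z))"
      unfolding t_def[abs_def] by (rule Lsq_norm_triangle_diff[OF h10(1) V'F0])
    moreover have "Lsq_norm \<Omega>0 h1 \<le> K" using h10(2) cK(2) by (simp add: a_def)
    moreover have "Lsq_norm \<Omega>0 (\<lambda>z. V' (fst z)) \<le> s * R"
      unfolding s_def by (rule order_trans[OF Z.Lsq_fst(2)[OF V'L] mult_left_mono[OF V'R]]) (use s0 in simp)
    ultimately show ?thesis by linarith
  qed
  have gh: "(\<integral>z. g1 z * h1 z \<partial>?M) = (\<integral>x. (b x + G0 x) * d x * V' x \<partial>?N)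
      + (\<integral>z. (g1 z - k z) * h1 z \<partial>?M) + (\<integral>z. (d (fst z) - \<psi> z) * t z \<partial>?W) + (\<integral>z. \<psi> z * t z \<partial>?W)"
  proof -
    have "(\<integral>z. g1 z * h1 z \<partial>?M) = (\<integral>z. k z * h1 z + (g1 z - k z) * h1 z \<partial>?M)" by (simp add: algebra_simps)
    also have "\<dots> = (\<integral>z. k z * h1 z \<partial>?M) + (\<integral>z. (g1 z - k z) * h1 z \<partial>?M)"
      by (rule Bochner_Integration.integral_add[OF Lsq_integrable_mult[OF kL h1L] Lsq_integrable_mult[OF Lsq_diff[OF w(2) kL] h1L]])
    also have "(\<integral>z. k z * h1 z \<partial>?M) = (\<integral>z. k z * h1 z \<partial>?W)"
      by (rule integral_eq_on_subset[OF ss]) (simp add: k_def)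
    also have "\<dots> = (\<integral>z. d (fst z) * V' (fst z) + (d (fst z) - \<psi> z) * t z + \<psi> z * t z \<partial>?W)"
      by (rule Bochner_Integration.integral_cong) (auto simp: k_def t_def algebra_simps)
    also have "\<dots> = (\<integral>z. d (fst z) * V' (fst z) \<partial>?W) + (\<integral>z. (d (fst z) - \<psi> z) * t z \<partial>?W) + (\<integral>z. \<psi> z * t z \<partial>?W)"
      using Lsq_integrable_mult[OF dF0 V'F0] Lsq_integrable_mult[OF Lsq_diff[OF dF0 \<psi>L] tL] Lsq_integrable_mult[OF \<psi>L tL] by simp
    finally show ?thesis by (simp add: Z.integral_fst_mult[OF u0(2) V'L])
  qed
  have r4: "\<bar>\<integral>z. (g1 z - k z) * h1 z \<partial>?M\<bar> \<le> \<eta> * K"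
    by (rule cs[OF Lsq_diff[OF w(2) kL] h1L g1k]) (use cK in \<open>simp add: a_def\<close>)
  have r5: "\<bar>\<integral>z. (d (fst z) - \<psi> z) * t z \<partial>?W\<bar> \<le> \<eta> * (K + s * R)"
    by (intro order_trans[OF Lsq_Cauchy_Schwarz[OF Lsq_diff[OF dF0 \<psi>L] tL] mult_mono]) (use \<psi>(2) tn \<eta> in auto)
  define \<Psi> where "\<Psi> = Lsq_norm \<Omega>0 (\<lambda>z. frechet_derivative \<psi> (at z) (1, 0))"
  have r6: "\<bar>\<integral>z. \<psi> z * t z \<partial>?W\<bar> \<le> \<Psi> * (H * (\<epsilon> * K))"
  proof -
    have "has_weak_partial \<Omega>0 (1, 0) y t"
      unfolding y_def[abs_def] t_def[abs_def]
      by (rule has_weak_partial_diff[OF Z.region_lmeasurable(1) v0(1) VF0 h10(1) V'F0 bas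
            has_weak_partial_subset[OF EI(4) ss bas] Z.has_weak_partial_compose_fst(1)[OF VL V'L VV']])
    from bspec[OF this[unfolded has_weak_partial_def] \<psi>(1)]
    have "(\<integral>z. \<psi> z * t z \<partial>?W) = - (\<integral>z. frechet_derivative \<psi> (at z) (1, 0) * y z \<partial>?W)"
      by (simp add: mult.commute)
    then have "\<bar>\<integral>z. \<psi> z * t z \<partial>?W\<bar> = \<bar>\<integral>z. frechet_derivative \<psi> (at z) (1, 0) * y z \<partial>?W\<bar>" by simp
    also have "\<dots> \<le> \<Psi> * Lsq_norm \<Omega>0 y"
      unfolding \<Psi>_def by (rule Lsq_Cauchy_Schwarz[OF test_function_in_Lsq[OF test_function_partial[OF \<psi>(1) bas] Z.region_lmeasurable(1)] y0(1)])
    also have "\<dots> \<le> \<Psi> * (H * (\<epsilon> * K))" using y0(2) yn by (intro mult_left_mono) (auto simp: \<Psi>_def)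
    finally show ?thesis .
  qed
  have bnd: "(\<lambda>x. (b x + Ge \<epsilon> x) * u0 x) \<in> Lsq ?I" "(\<lambda>x. (b x + G_mean x) * u0 x) \<in> Lsq ?I" "(\<lambda>x. (Ge \<epsilon> x - G_mean x) * u0 x) \<in> Lsq ?I"
  proof -
    note m = LsqD(1)[OF Lsq_b] LsqD(1)[OF Lsq_Ge[OF e]] LsqD(1)[OF Lsq_G_mean]
    have Hx: "b x + Ge \<epsilon> x \<le> H" "0 \<le> Ge \<epsilon> x" "b x \<le> b\<^sub>1" "0 < b x" "0 \<le> G_mean x" "G_mean x \<le> M" if "x \<in> ?I" for x
      using E.height_le[OF that] E.g_nonneg[OF that] b_bounds[OF that] b0 G_mean_bounds[OF that] by auto
    show "(\<lambda>x. (b x + Ge \<epsilon> x) * u0 x) \<in> Lsq ?I"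
    proof (rule Lsq_mult_bounded(1)[OF u0(1)])
      show "\<bar>b x + Ge \<epsilon> x\<bar> \<le> H" if "x \<in> ?I" for x using Hx[OF that] by linarith
    qed (use m in simp)
    show "(\<lambda>x. (b x + G_mean x) * u0 x) \<in> Lsq ?I"
    proof (rule Lsq_mult_bounded(1)[OF u0(1)])
      show "\<bar>b x + G_mean x\<bar> \<le> b\<^sub>1 + M" if "x \<in> ?I" for x using Hx[OF that] by linarith
    qed (use m in simp)
    show "(\<lambda>x. (Ge \<epsilon> x - G_mean x) * u0 x) \<in> Lsq ?I"
    proof (rule Lsq_mult_bounded(1)[OF u0(1)])
      show "\<bar>Ge \<epsilon> x - G_mean x\<bar> \<le> H + M" if "x \<in> ?I" for x using Hx[OF that] by linarith
    qed (use m in simp)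
  qed
  have n1: "(\<integral>x. (vertical_integral b (Ge \<epsilon>) f x - f_hat x) * V x \<partial>?N)
      = (\<integral>x. vertical_integral b (Ge \<epsilon>) f x * V x \<partial>?N) - (\<integral>x. f_hat x * V x \<partial>?N)"
    using Lsq_integrable_mult[OF E.VI_Lsq(1)[OF f(1)] VL] Lsq_integrable_mult[OF fh VL] by (simp add: left_diff_distrib)
  have n2: "(\<integral>x. (Ge \<epsilon> x - G_mean x) * u0 x * V x \<partial>?N)
      = (\<integral>x. (b x + Ge \<epsilon> x) * u0 x * V x \<partial>?N) - (\<integral>x. (b x + G_mean x) * u0 x * V x \<partial>?N)"
  proof -
    have "(\<integral>x. (Ge \<epsilon> x - G_mean x) * u0 x * V x \<partial>?N)
      = (\<integral>x. (b x + Ge \<epsilon> x) * u0 x * V x - (b x + G_mean x) * u0 x * V x \<partial>?N)" by (simp add: algebra_simps)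
    also have "\<dots> = (\<integral>x. (b x + Ge \<epsilon> x) * u0 x * V x \<partial>?N) - (\<integral>x. (b x + G_mean x) * u0 x * V x \<partial>?N)"
      by (rule Bochner_Integration.integral_diff[OF Lsq_integrable_mult[OF bnd(1) VL] Lsq_integrable_mult[OF bnd(2) VL]])
    finally show ?thesis .
  qed
  have g2K: "\<bar>1 / \<epsilon>\<^sup>2 * (\<integral>z. g2 z * h2 z \<partial>?M)\<bar> \<le> \<eta> * K"
    using g2h mult_left_mono[OF XK, of \<eta>] \<eta> by linarith
  have lower: "- x \<le> y" if "\<bar>x\<bar> \<le> y" for x y :: real using that by simp
  have nl: "(\<integral>x. vertical_integral b (Ge \<epsilon>) f x * V x \<partial>?N) - (\<integral>x. f_hat x * V x \<partial>?N)
      - ((\<integral>x. (b x + Ge \<epsilon> x) * u0 x * V x \<partial>?N) - (\<integral>x. (b x + G_mean x) * u0 x * V x \<partial>?N)) \<le> 2 * \<eta>"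
    using abs_le_D1[OF null[OF VL V'L VV' VR V'R]] unfolding n1 n2 .
  have "En \<le> 2 * \<eta> + C * (H * (\<epsilon> * K)) + \<eta> * K + (s * A) * (H * (\<epsilon> * K)) + \<eta> * K + \<eta> * (K + s * R) + \<Psi> * (H * (\<epsilon> * K)) + \<eta> * K"
    unfolding I fV wV gh
    using nl lim[OF VL V'L VV'] abs_le_D1[OF r1] lower[OF r2] lower[OF r3] lower[OF r4] lower[OF r5] lower[OF r6] lower[OF g2K]
    by linarith
  also have "\<dots> = \<eta> * (2 + 4 * K + s * R) + \<epsilon> * (H * K * (C + s * A + \<Psi>))" by (simp add: algebra_simps)
  finally show "(Lsq_norm ?S h1)\<^sup>2 + (Lsq_norm ?S h2 / \<epsilon>)\<^sup>2 + (Lsq_norm ?S v)\<^sup>2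
      \<le> \<eta> * (2 + 4 * K + sqrt H * R)
        + \<epsilon> * (H * K * (C + sqrt H * Lsq_norm {0<..<1} u0 + Lsq_norm \<Omega>0 (\<lambda>z. frechet_derivative \<psi> (at z) (1, 0))))"
    unfolding En_def a_def b2_def c_def s_def A_def \<Psi>_def .
qed

section \<open>Convergence\<close>

lemma abs_Ge_diff_mean_le: "x \<in> {0<..<1} \<Longrightarrow> \<bar>Ge \<epsilon> x - G_mean x\<bar> \<le> M"
  using G_nonneg[of x "x / \<epsilon> powr \<alpha>"] G_le[of x "x / \<epsilon> powr \<alpha>"] G_mean_bounds[of x]
  by (auto simp: G_eps_def)

text \<open>\<open>corrector_convergence\<close> needs interval averages of the product with
  \<open>u0\<close>. The cutoff to the interval is put into the oscillating factor, because cutting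
  off \<open>u0\<close> could lead out of H1.\<close>

lemma G_eps_averages_H1:
  assumes u0: "u0 \<in> Lsq {0<..<1}" "d \<in> Lsq {0<..<1}" "has_weak_partial {0<..<1} 1 u0 d"
    and ac: "0 \<le> a" "c \<le> 1"
  shows "((\<lambda>\<epsilon>. \<integral>x. (Ge \<epsilon> x - G_mean x) * u0 x \<partial>lebesgue_on {a<..<c}) \<longlongrightarrow> 0) (at_right 0)"
proof (rule tendstoI)
  fix e :: real assume "e > 0"
  define D where "D \<epsilon> x = (if x \<in> {a<..<c} then Ge \<epsilon> x - G_mean x else 0)" for \<epsilon> x
  have sub: "{a<..<c} \<subseteq> {0<..<1}" using ac by auto
  define R where "R = max (Lsq_norm {0<..<1} u0) (Lsq_norm {0<..<1} d)"
  have DL: "D \<epsilon> \<in> Lsq {0<..<1}" "Lsq_norm {0<..<1} (D \<epsilon>) \<le> M" if "\<epsilon> \<in> {0<..<\<epsilon>\<^sub>0}" for \<epsilon>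
  proof -
    note L = Lsq_diff[OF Lsq_Ge[OF that] Lsq_G_mean]
    show "D \<epsilon> \<in> Lsq {0<..<1}" unfolding D_def[abs_def] by (rule Lsq_restrict(1)[OF L]) simp
    have "Lsq_norm {0<..<1} (D \<epsilon>) \<le> Lsq_norm {0<..<1} (\<lambda>x. Ge \<epsilon> x - G_mean x)"
      unfolding D_def[abs_def] by (rule Lsq_restrict(2)[OF L]) simp
    also have "\<dots> \<le> \<bar>M\<bar> * sqrt (measure lebesgue {0<..<1::real})"
      by (rule Lsq_bounded(2)[OF _ LsqD(1)[OF L] abs_Ge_diff_mean_le]) auto
    finally show "Lsq_norm {0<..<1} (D \<epsilon>) \<le> M" using M_nonneg by simp
  qed
  have "\<forall>\<^sub>F \<epsilon> in at_right 0. \<forall>V V'. V \<in> Lsq {0<..<1} \<longrightarrow> V' \<in> Lsq {0<..<1} \<longrightarrow> has_weak_partial {0<..<1} 1 V V' \<longrightarrow>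
    Lsq_norm {0<..<1} V \<le> R \<longrightarrow> Lsq_norm {0<..<1} V' \<le> R \<longrightarrow> \<bar>\<integral>x. D \<epsilon> x * V x \<partial>lebesgue_on {0<..<1}\<bar> \<le> e / 2"
  proof (rule weak_null_uniform_on_bounded_H1)
    show "\<forall>\<^sub>F \<epsilon> in at_right 0. D \<epsilon> \<in> Lsq {0<..<1} \<and> Lsq_norm {0<..<1} (D \<epsilon>) \<le> M"
      using eventually_eps by eventually_elim (use DL in auto)
    fix a' c' :: real assume "0 \<le> a'" "c' \<le> 1"
    have eq: "{a<..<c} \<inter> {a'<..<c'} = {max a a'<..<min c c'}" by auto
    have "(\<integral>x. D \<epsilon> x \<partial>lebesgue_on {a'<..<c'}) = (\<integral>x. Ge \<epsilon> x - G_mean x \<partial>lebesgue_on {max a a'<..<min c c'})" for \<epsilon>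
      unfolding D_def eq[symmetric] by (rule Lebesgue_Measure.integral_restrict_Int) auto
    then show "((\<lambda>\<epsilon>. \<integral>x. D \<epsilon> x \<partial>lebesgue_on {a'<..<c'}) \<longlongrightarrow> 0) (at_right 0)"
      using G_eps_averages[of "max a a'" "min c c'"] ac by simp
  qed (use \<open>e > 0\<close> in simp)
  then show "\<forall>\<^sub>F \<epsilon> in at_right 0. dist (\<integral>x. (Ge \<epsilon> x - G_mean x) * u0 x \<partial>lebesgue_on {a<..<c}) 0 < e"
  proof eventually_elim
    case (elim \<epsilon>)
    have "\<bar>\<integral>x. D \<epsilon> x * u0 x \<partial>lebesgue_on {0<..<1}\<bar> \<le> e / 2"
      using elim u0 by (simp add: R_def)
    also have "(\<integral>x. D \<epsilon> x * u0 x \<partial>lebesgue_on {0<..<1}) = (\<integral>x. D \<epsilon> x * u0 x \<partial>lebesgue_on {a<..<c})"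
      by (rule integral_eq_on_subset[OF sub]) (auto simp: D_def)
    also have "\<dots> = (\<integral>x. (Ge \<epsilon> x - G_mean x) * u0 x \<partial>lebesgue_on {a<..<c})"
      by (rule Bochner_Integration.integral_cong) (auto simp: D_def)
    finally show ?case using \<open>e > 0\<close> by (simp add: dist_real_def)
  qed
qed

text \<open>The averages V come with an explicit derivative V', whereas the limit problem is written
  with chosen representatives; the two agree a.e.\<close>

lemma limit_equation:
  assumes sol: "weak_solution_limit (\<lambda>x. b x + G0 x) (mean_height b G l) f_hat u0"
    and V: "V \<in> Lsq {0<..<1}" "V' \<in> Lsq {0<..<1}" "has_weak_partial {0<..<1} 1 V V'"
  shows "(\<integral>x. (b x + G0 x) * weak_partial {0<..<1} 1 u0 x * V' x \<partial>lebesgue_on {0<..<1})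
      + (\<integral>x. (b x + G_mean x) * u0 x * V x \<partial>lebesgue_on {0<..<1})
      = (\<integral>x. f_hat x * V x \<partial>lebesgue_on {0<..<1})"
proof -
  let ?I = "{0<..<1::real}"
  let ?N = "lebesgue_on ?I"
  define d where "d = weak_partial ?I 1 u0"
  have uH: "u0 \<in> H1 ?I" using sol by (simp add: weak_solution_limit_def)
  have uL: "u0 \<in> Lsq ?I" using uH by (simp add: H1_def)
  have dL: "d \<in> Lsq ?I" unfolding d_def by (rule weak_partial_H1(1)[OF uH]) simp
  have VH: "V \<in> H1 ?I" using V by (auto simp: H1_def)
  have wV: "weak_partial ?I 1 V \<in> Lsq ?I" "AE x in ?N. weak_partial ?I 1 V x = V' x"
    by (rule weak_partial_eq_AE[OF _ _ V(2,3)]; simp)+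
  note m = LsqD(1)[OF Lsq_b] LsqD(1)[OF Lsq_G0] LsqD(1)[OF Lsq_G_mean]
  have bd: "b x + G0 x \<le> H" "0 \<le> G0 x" "0 < b x" "b x \<le> b\<^sub>1" "0 \<le> G_mean x" "G_mean x \<le> M" if "x \<in> ?I" for x
    using height_region.height_le[OF height_region_G0 that] height_region.g_nonneg[OF height_region_G0 that]
      b_bounds[OF that] b0 G_mean_bounds[OF that] by auto
  have i1: "(\<lambda>x. (b x + G0 x) * d x) \<in> Lsq ?I"
  proof (rule Lsq_mult_bounded(1)[OF dL])
    show "\<bar>b x + G0 x\<bar> \<le> H" if "x \<in> ?I" for x using bd[OF that] by linarith
  qed (use m in simp)
  have i2: "(\<lambda>x. (b x + G_mean x) * u0 x) \<in> Lsq ?I"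
  proof (rule Lsq_mult_bounded(1)[OF uL])
    show "\<bar>b x + G_mean x\<bar> \<le> b\<^sub>1 + M" if "x \<in> ?I" for x using bd[OF that] by linarith
  qed (use m in simp)
  have "(\<integral>x. f_hat x * V x \<partial>?N) = (\<integral>x. (b x + G0 x) * d x * weak_partial ?I 1 V x + mean_height b G l x * u0 x * V x \<partial>?N)"
    using sol VH by (simp add: weak_solution_limit_def d_def)
  also have "\<dots> = (\<integral>x. (b x + G0 x) * d x * weak_partial ?I 1 V x + (b x + G_mean x) * u0 x * V x \<partial>?N)"
    by (rule Bochner_Integration.integral_cong) (auto simp: mean_height_eq)
  also have "\<dots> = (\<integral>x. (b x + G0 x) * d x * weak_partial ?I 1 V x \<partial>?N) + (\<integral>x. (b x + G_mean x) * u0 x * V x \<partial>?N)"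
    by (rule Bochner_Integration.integral_add[OF Lsq_integrable_mult[OF i1 wV(1)] Lsq_integrable_mult[OF i2 V(1)]])
  also have "(\<integral>x. (b x + G0 x) * d x * weak_partial ?I 1 V x \<partial>?N) = (\<integral>x. (b x + G0 x) * d x * V' x \<partial>?N)"
  proof (rule integral_cong_AE)
    show "(\<lambda>x. (b x + G0 x) * d x * weak_partial ?I 1 V x) \<in> borel_measurable ?N"
      by (rule borel_measurable_times[OF LsqD(1)[OF i1] LsqD(1)[OF wV(1)]])
    show "(\<lambda>x. (b x + G0 x) * d x * V' x) \<in> borel_measurable ?N"
      by (rule borel_measurable_times[OF LsqD(1)[OF i1] LsqD(1)[OF V(2)]])
    show "AE x in ?N. (b x + G0 x) * d x * weak_partial ?I 1 V x = (b x + G0 x) * d x * V' x"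
      using wV(2) by eventually_elim simp
  qed
  finally show ?thesis by (simp add: d_def)
qed

text \<open>Stated on the oscillating domains with \<open>d\<close> cut off at the level
  \<open>G0\<close>, because the horizontal derivative tends to 0 in the fingers. Restriction to
  \<Omega>0 then yields the convergence in H1.\<close>

proposition corrector_convergence:
  assumes f: "\<And>\<epsilon>. \<epsilon> \<in> {0<..<\<epsilon>\<^sub>0} \<Longrightarrow> f \<epsilon> \<in> Lsq (\<Omega>e \<epsilon>) \<and> Lsq_norm (\<Omega>e \<epsilon>) (f \<epsilon>) \<le> C"
    and fh: "Lsq_weak_tendsto {0<..<1} (\<lambda>\<epsilon>. vertical_integral b (Ge \<epsilon>) (f \<epsilon>)) f_hat (at_right 0)"
    and u: "\<And>\<epsilon>. \<epsilon> \<in> {0<..<\<epsilon>\<^sub>0} \<Longrightarrow> weak_solution_eps \<epsilon> (\<Omega>e \<epsilon>) (f \<epsilon>) (u \<epsilon>)"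
    and sol: "weak_solution_limit (\<lambda>x. b x + G0 x) (mean_height b G l) f_hat u0"
    and "e > 0"
  defines "d \<equiv> weak_partial {0<..<1} 1 u0"
  shows "\<forall>\<^sub>F \<epsilon> in at_right 0. Lsq_norm (\<Omega>e \<epsilon>) (\<lambda>z. u \<epsilon> z - u0 (fst z)) \<le> e \<and>
    Lsq_norm (\<Omega>e \<epsilon>) (\<lambda>z. weak_partial (\<Omega>e \<epsilon>) (1, 0) (u \<epsilon>) z - (if z \<in> \<Omega>0 then d (fst z) else 0)) \<le> e \<and>
    Lsq_norm (\<Omega>e \<epsilon>) (weak_partial (\<Omega>e \<epsilon>) (0, 1) (u \<epsilon>)) \<le> e"
proof -
  let ?I = "{0<..<1::real}"
  interpret Z: height_region b G0 b\<^sub>0 H by (rule height_region_G0)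
  have uH: "u0 \<in> H1 ?I" using sol by (simp add: weak_solution_limit_def)
  have uL: "u0 \<in> Lsq ?I" using uH by (simp add: H1_def)
  have dL: "d \<in> Lsq ?I" and ud: "has_weak_partial ?I 1 u0 d"
    unfolding d_def by (rule weak_partial_H1[OF uH]; simp)+
  have fhL: "f_hat \<in> Lsq ?I" using fh by (simp add: Lsq_weak_tendsto_def)
  have C0: "0 \<le> C" using f[OF eps_half] Lsq_norm_nonneg order_trans by blast
  \<comment> \<open>The weight of the average lives in the middle half of the strip that all domains
    share.\<close>
  define p q where "p = - (3 / 4) * b\<^sub>0" and "q = - (1 / 4) * b\<^sub>0"
  have "p < q" using b0 by (simp add: p_def q_def)
  then obtain \<rho> where \<rho>: "unit_bump p q \<rho>" using unit_bump_exists by blast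
  have pq: "{p..q} \<subseteq> {- b\<^sub>0<..<0}"
  proof
    fix x assume "x \<in> {p..q}"
    then show "x \<in> {- b\<^sub>0<..<0}" using b0 by (simp add: p_def q_def)
  qed
  obtain P where P: "0 < P" "\<And>y. \<bar>\<rho> y\<bar> \<le> P" using test_function_bounded[OF unit_bump_test_function[OF \<rho> pq]] by blast
  define K where "K = C + sqrt H * Lsq_norm ?I d + sqrt H * Lsq_norm ?I u0 + 3"
  define R where "R = sqrt H * (P * K)"
  have K0: "0 \<le> K" using C0 Z.H_pos by (simp add: K_def)
  have R0: "0 \<le> R" using K0 P Z.H_pos by (simp add: R_def)
  define X where "X = 2 + 4 * K + sqrt H * R"
  have X0: "X > 0" using K0 R0 Z.H_pos by (auto simp: X_def intro!: add_pos_nonneg)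
  \<comment> \<open>\<eta> X, and later \<epsilon> Y, are each kept at most e^2 / 8, so that the
    energy of the difference is at most (e / 2)^2. The other half of e pays for the recovery error
    \<eta>.\<close>
  define \<eta> where "\<eta> = min (min 1 (e / 2)) (e\<^sup>2 / (8 * X))"
  have \<eta>: "0 < \<eta>" "\<eta> \<le> 1" "\<eta> \<le> e / 2" using \<open>e > 0\<close> X0 by (auto simp: \<eta>_def)
  have \<eta>X: "\<eta> * X \<le> e\<^sup>2 / 8"
  proof -
    have "\<eta> * X \<le> e\<^sup>2 / (8 * X) * X" using X0 by (intro mult_right_mono) (auto simp: \<eta>_def)
    then show ?thesis using X0 by simp
  qed
  note dF0 = Z.Lsq_fst(1)[OF dL]
  obtain \<psi> where \<psi>: "\<psi> \<in> test_functions \<Omega>0" "Lsq_norm \<Omega>0 (\<lambda>z. d (fst z) - \<psi> z) < \<eta>"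
    using test_functions_dense[OF Z.open_region Z.bounded_region dF0 \<eta>(1)] by blast
  define Y where "Y = H * K * (C + sqrt H * Lsq_norm ?I u0 + Lsq_norm \<Omega>0 (\<lambda>z. frechet_derivative \<psi> (at z) (1, 0)))"
  have Y0: "0 \<le> Y" unfolding Y_def using K0 C0 Z.H_pos by (intro mult_nonneg_nonneg add_nonneg_nonneg) auto
  \<comment> \<open>\<open>Y\<close> depends on \<psi>, hence on \<eta>, but not on \<epsilon>, so
    \<epsilon> can be chosen last.\<close>
  define e2 where "e2 = min 1 (e\<^sup>2 / (8 * (Y + 1)))"
  have e2: "e2 > 0" using \<open>e > 0\<close> Y0 by (simp add: e2_def)
  \<comment> \<open>The two differences between the oscillating data and the data of the limit
    equation. Both are bounded in L2 with vanishing interval averages, which makes them small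
    uniformly over all admissible V.\<close>
  define D1 D2 where "D1 \<epsilon> x = vertical_integral b (Ge \<epsilon>) (f \<epsilon>) x - f_hat x"
    and "D2 \<epsilon> x = (Ge \<epsilon> x - G_mean x) * u0 x" for \<epsilon> x
  have null1: "\<forall>\<^sub>F \<epsilon> in at_right 0. \<forall>V V'. V \<in> Lsq ?I \<longrightarrow> V' \<in> Lsq ?I \<longrightarrow> has_weak_partial ?I 1 V V' \<longrightarrow>
    Lsq_norm ?I V \<le> R \<longrightarrow> Lsq_norm ?I V' \<le> R \<longrightarrow> \<bar>\<integral>x. D1 \<epsilon> x * V x \<partial>lebesgue_on ?I\<bar> \<le> \<eta>"
  proof (rule weak_null_uniform_on_bounded_H1[OF _ _ \<eta>(1)])
    show "\<forall>\<^sub>F \<epsilon> in at_right 0. D1 \<epsilon> \<in> Lsq ?I \<and> Lsq_norm ?I (D1 \<epsilon>) \<le> sqrt H * C + Lsq_norm ?I f_hat"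
      using eventually_eps
    proof eventually_elim
      case (elim \<epsilon>)
      interpret E: height_region b "Ge \<epsilon>" b\<^sub>0 H by (rule height_region_eps[OF elim])
      note V = E.VI_Lsq[OF conjunct1[OF f[OF elim]]]
      have "Lsq_norm ?I (vertical_integral b (Ge \<epsilon>) (f \<epsilon>)) \<le> sqrt H * C"
        by (rule order_trans[OF V(2) mult_left_mono]) (use f[OF elim] Z.H_pos in auto)
      then show ?case unfolding D1_def[abs_def] using Lsq_diff[OF V(1) fhL] Lsq_norm_triangle_diff[OF V(1) fhL] by auto
    qed
    fix a c :: real assume ac: "0 \<le> a" "c \<le> 1"
    have sub: "{a<..<c} \<subseteq> ?I" using ac by auto
    have ind: "(\<lambda>x. indicat_real {a<..<c} x) \<in> Lsq ?I"
      by (rule Lsq_bounded(1)[where B=1]) (auto simp: indicator_def intro!: borel_imp_measurable_lebesgue_on)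
    have cut: "(\<integral>x. h x * indicat_real {a<..<c} x \<partial>lebesgue_on ?I) = (\<integral>x. h x \<partial>lebesgue_on {a<..<c})" for h :: "real \<Rightarrow> real"
    proof -
      have "(\<integral>x. h x * indicat_real {a<..<c} x \<partial>lebesgue_on ?I) = (\<integral>x. h x * indicat_real {a<..<c} x \<partial>lebesgue_on {a<..<c})"
        by (rule integral_eq_on_subset[OF sub]) auto
      also have "\<dots> = (\<integral>x. h x \<partial>lebesgue_on {a<..<c})" by (rule Bochner_Integration.integral_cong) auto
      finally show ?thesis .
    qed
    have "((\<lambda>\<epsilon>. \<integral>x. vertical_integral b (Ge \<epsilon>) (f \<epsilon>) x * indicat_real {a<..<c} x \<partial>lebesgue_on ?I) \<longlongrightarrow>
        (\<integral>x. f_hat x * indicat_real {a<..<c} x \<partial>lebesgue_on ?I)) (at_right 0)"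
      using fh ind by (simp add: Lsq_weak_tendsto_def)
    then have "((\<lambda>\<epsilon>. (\<integral>x. vertical_integral b (Ge \<epsilon>) (f \<epsilon>) x \<partial>lebesgue_on {a<..<c}) - (\<integral>x. f_hat x \<partial>lebesgue_on {a<..<c})) \<longlongrightarrow> 0) (at_right 0)"
      unfolding cut by (simp add: LIM_zero_iff)
    moreover have "\<forall>\<^sub>F \<epsilon> in at_right 0. (\<integral>x. vertical_integral b (Ge \<epsilon>) (f \<epsilon>) x \<partial>lebesgue_on {a<..<c}) - (\<integral>x. f_hat x \<partial>lebesgue_on {a<..<c})
      = (\<integral>x. D1 \<epsilon> x \<partial>lebesgue_on {a<..<c})"
      using eventually_eps
    proof eventually_elim
      case (elim \<epsilon>)
      interpret E: height_region b "Ge \<epsilon>" b\<^sub>0 H by (rule height_region_eps[OF elim])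
      have i: "integrable (lebesgue_on {a<..<c}) h" if "h \<in> Lsq ?I" for h
        by (rule Lsq_integrable(1)[OF _ Lsq_subset(1)[OF that sub]]) auto
      show ?case unfolding D1_def
        by (rule Bochner_Integration.integral_diff[symmetric, OF i[OF E.VI_Lsq(1)[OF conjunct1[OF f[OF elim]]]] i[OF fhL]])
    qed
    ultimately show "((\<lambda>\<epsilon>. \<integral>x. D1 \<epsilon> x \<partial>lebesgue_on {a<..<c}) \<longlongrightarrow> 0) (at_right 0)"
      by (rule Lim_transform_eventually)
  qed
  have null2: "\<forall>\<^sub>F \<epsilon> in at_right 0. \<forall>V V'. V \<in> Lsq ?I \<longrightarrow> V' \<in> Lsq ?I \<longrightarrow> has_weak_partial ?I 1 V V' \<longrightarrow>
    Lsq_norm ?I V \<le> R \<longrightarrow> Lsq_norm ?I V' \<le> R \<longrightarrow> \<bar>\<integral>x. D2 \<epsilon> x * V x \<partial>lebesgue_on ?I\<bar> \<le> \<eta>"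
  proof (rule weak_null_uniform_on_bounded_H1[OF _ _ \<eta>(1)])
    show "\<forall>\<^sub>F \<epsilon> in at_right 0. D2 \<epsilon> \<in> Lsq ?I \<and> Lsq_norm ?I (D2 \<epsilon>) \<le> \<bar>M\<bar> * Lsq_norm ?I u0"
      using eventually_eps
    proof eventually_elim
      case (elim \<epsilon>)
      note m = LsqD(1)[OF Lsq_diff[OF Lsq_Ge[OF elim] Lsq_G_mean]]
      show ?case unfolding D2_def[abs_def]
        using Lsq_mult_bounded[OF uL m abs_Ge_diff_mean_le] by blast
    qed
    show "((\<lambda>\<epsilon>. \<integral>x. D2 \<epsilon> x \<partial>lebesgue_on {a<..<c}) \<longlongrightarrow> 0) (at_right 0)" if "0 \<le> a" "c \<le> 1" for a c
      unfolding D2_def by (rule G_eps_averages_H1[OF uL dL ud that])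
  qed
  have small: "\<forall>\<^sub>F \<epsilon> in at_right 0. \<epsilon> \<in> {0<..<e2}"
    using e2 by (rule eventually_at_rightI[rotated]) simp
  from recovery[OF uL dL ud \<eta>(1)] null1 null2 small eventually_eps show ?thesis
  proof eventually_elim
    case (elim \<epsilon>)
    interpret E: height_region b "Ge \<epsilon>" b\<^sub>0 H by (rule height_region_eps[OF elim(5)])
    have e0: "0 < \<epsilon>" "\<epsilon> \<le> 1" "\<epsilon> \<le> e\<^sup>2 / (8 * (Y + 1))" using elim(4) by (auto simp: e2_def)
    let ?S = "\<Omega>e \<epsilon>"
    obtain w g1 g2 where w: "w \<in> Lsq ?S" "g1 \<in> Lsq ?S" "g2 \<in> Lsq ?S"
      "has_weak_partial ?S (1, 0) w g1" "has_weak_partial ?S (0, 1) w g2"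
      "Lsq_norm ?S (\<lambda>z. w z - u0 (fst z)) \<le> \<eta>"
      "Lsq_norm ?S (\<lambda>z. g1 z - (if z \<in> \<Omega>0 then d (fst z) else 0)) \<le> \<eta>"
      "Lsq_norm ?S g2 \<le> \<eta> * \<epsilon>"
      using elim(1) by blast
    define v h1 h2 where "v z = u \<epsilon> z - w z" and "h1 z = weak_partial ?S (1, 0) (u \<epsilon>) z - g1 z"
      and "h2 z = weak_partial ?S (0, 1) (u \<epsilon>) z - g2 z" for z
    have null: "\<bar>(\<integral>x. (vertical_integral b (Ge \<epsilon>) (f \<epsilon>) x - f_hat x) * V x \<partial>lebesgue_on ?I)
        - (\<integral>x. (Ge \<epsilon> x - G_mean x) * u0 x * V x \<partial>lebesgue_on ?I)\<bar> \<le> 2 * \<eta>"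
      if V: "V \<in> Lsq ?I" "V' \<in> Lsq ?I" "has_weak_partial ?I 1 V V'" "Lsq_norm ?I V \<le> R" "Lsq_norm ?I V' \<le> R" for V V'
    proof -
      have "\<bar>\<integral>x. D1 \<epsilon> x * V x \<partial>lebesgue_on ?I\<bar> \<le> \<eta>" "\<bar>\<integral>x. D2 \<epsilon> x * V x \<partial>lebesgue_on ?I\<bar> \<le> \<eta>"
        using elim(2,3) V by blast+
      then have "\<bar>(\<integral>x. D1 \<epsilon> x * V x \<partial>lebesgue_on ?I) - (\<integral>x. D2 \<epsilon> x * V x \<partial>lebesgue_on ?I)\<bar> \<le> 2 * \<eta>" by linarith
      then show ?thesis unfolding D1_def D2_def .
    qed
    note EE = energy_estimate[OF elim(5) conjunct1[OF f[OF elim(5)]] conjunct2[OF f[OF elim(5)]] u[OF elim(5)] fhL uL dL ud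
        _ \<rho> pq P(2) \<psi>(1) less_imp_le[OF \<psi>(2)] \<eta>(1,2) w K_def R_def]
    have vL: "v \<in> Lsq ?S" and h1L: "h1 \<in> Lsq ?S" and h2L: "h2 \<in> Lsq ?S"
      and En: "(Lsq_norm ?S h1)\<^sup>2 + (Lsq_norm ?S h2 / \<epsilon>)\<^sup>2 + (Lsq_norm ?S v)\<^sup>2 \<le> \<eta> * X + \<epsilon> * Y"
      unfolding v_def[abs_def] h1_def[abs_def] h2_def[abs_def] X_def Y_def
      by (rule EE, erule (2) limit_equation[OF sol, folded d_def], erule (4) null)+
    have "\<epsilon> * Y \<le> e\<^sup>2 / (8 * (Y + 1)) * (Y + 1)" using e0 Y0 by (intro mult_mono) auto
    also have "\<dots> = e\<^sup>2 / 8"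
    proof -
      have "r / (8 * t) * t = r / 8" if "0 < t" for r t :: real using that by simp
      note c = this
      show ?thesis by (rule c) (use Y0 in simp)
    qed
    finally have "\<eta> * X + \<epsilon> * Y \<le> (e / 2)\<^sup>2" using \<eta>X by (simp add: power_divide)
    with En have En': "(Lsq_norm ?S h1)\<^sup>2 + (Lsq_norm ?S h2 / \<epsilon>)\<^sup>2 + (Lsq_norm ?S v)\<^sup>2 \<le> (e / 2)\<^sup>2" by linarith
    have sq: "x \<le> e / 2" if "x\<^sup>2 \<le> (e / 2)\<^sup>2" for x
      by (rule power2_le_imp_le[OF that]) (use \<open>e > 0\<close> in simp)
    have n: "Lsq_norm ?S h1 \<le> e / 2" "Lsq_norm ?S h2 / \<epsilon> \<le> e / 2" "Lsq_norm ?S v \<le> e / 2"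
      by (rule sq, rule order_trans[OF _ En'], simp)+
    have "Lsq_norm ?S h2 \<le> e / 2 * \<epsilon>" using n(2) e0 by (simp add: divide_le_eq)
    also have "\<dots> \<le> e / 2 * 1" using e0 \<open>e > 0\<close> by (intro mult_left_mono) auto
    finally have n2: "Lsq_norm ?S h2 \<le> e / 2" by simp
    have "\<eta> * \<epsilon> \<le> \<eta> * 1" using e0 \<eta> by (intro mult_left_mono) auto
    then have ng2: "Lsq_norm ?S g2 \<le> e / 2" using w(8) \<eta>(3) by linarith
    note uF = E.Lsq_fst(1)[OF uL] and dF = E.Lsq_fst(1)[OF dL]
    have \<Omega>0b: "\<Omega>0 \<in> sets borel" using open_region_G0 by simp
    note rd = Lsq_restrict(1)[OF dF \<Omega>0b]
    have "Lsq_norm ?S (\<lambda>z. u \<epsilon> z - u0 (fst z)) = Lsq_norm ?S (\<lambda>z. v z + (w z - u0 (fst z)))" by (simp add: v_def)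
    also have "\<dots> \<le> Lsq_norm ?S v + Lsq_norm ?S (\<lambda>z. w z - u0 (fst z))"
      by (rule Lsq_norm_triangle[OF vL Lsq_diff[OF w(1) uF]])
    also have "\<dots> \<le> e / 2 + e / 2" using n(3) w(6) \<eta>(3) by (intro add_mono) auto
    finally have c1: "Lsq_norm ?S (\<lambda>z. u \<epsilon> z - u0 (fst z)) \<le> e" by simp
    have "Lsq_norm ?S (\<lambda>z. weak_partial ?S (1, 0) (u \<epsilon>) z - (if z \<in> \<Omega>0 then d (fst z) else 0))
      = Lsq_norm ?S (\<lambda>z. h1 z + (g1 z - (if z \<in> \<Omega>0 then d (fst z) else 0)))" by (simp add: h1_def)
    also have "\<dots> \<le> Lsq_norm ?S h1 + Lsq_norm ?S (\<lambda>z. g1 z - (if z \<in> \<Omega>0 then d (fst z) else 0))"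
      by (rule Lsq_norm_triangle[OF h1L Lsq_diff[OF w(2) rd]])
    also have "\<dots> \<le> e / 2 + e / 2" using n(1) w(7) \<eta>(3) by (intro add_mono) auto
    finally have c2: "Lsq_norm ?S (\<lambda>z. weak_partial ?S (1, 0) (u \<epsilon>) z - (if z \<in> \<Omega>0 then d (fst z) else 0)) \<le> e" by simp
    have "Lsq_norm ?S (weak_partial ?S (0, 1) (u \<epsilon>)) = Lsq_norm ?S (\<lambda>z. h2 z + g2 z)" by (simp add: h2_def)
    also have "\<dots> \<le> Lsq_norm ?S h2 + Lsq_norm ?S g2" by (rule Lsq_norm_triangle[OF h2L w(3)])
    also have "\<dots> \<le> e / 2 + e / 2" using n2 ng2 by (intro add_mono)
    finally have c3: "Lsq_norm ?S (weak_partial ?S (0, 1) (u \<epsilon>)) \<le> e" by simp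
    show ?case using c1 c2 c3 by blast
  qed
qed

text \<open>The representatives chosen by \<open>weak_partial\<close> on \<Omega>0 and on the larger
  domain are independent choices; uniqueness matches them a.e. On \<Omega>0 the cut off corrector is
  \<open>d\<close> itself.\<close>

lemma H1_norm_on_region_G0_le:
  assumes e: "\<epsilon> \<in> {0<..<\<epsilon>\<^sub>0}" and u: "u \<in> H1 (\<Omega>e \<epsilon>)" and u0: "u0 \<in> H1 {0<..<1}"
  defines "d \<equiv> weak_partial {0<..<1} 1 u0"
  shows "u \<in> H1 \<Omega>0" "(\<lambda>z. u0 (fst z)) \<in> H1 \<Omega>0"
    "H1_norm \<Omega>0 (\<lambda>z. u z - u0 (fst z)) \<le> Lsq_norm (\<Omega>e \<epsilon>) (\<lambda>z. u z - u0 (fst z))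
      + Lsq_norm (\<Omega>e \<epsilon>) (\<lambda>z. weak_partial (\<Omega>e \<epsilon>) (1, 0) u z - (if z \<in> \<Omega>0 then d (fst z) else 0))
      + Lsq_norm (\<Omega>e \<epsilon>) (weak_partial (\<Omega>e \<epsilon>) (0, 1) u)"
proof -
  interpret E: height_region b "Ge \<epsilon>" b\<^sub>0 H by (rule height_region_eps[OF e])
  interpret Z: height_region b G0 b\<^sub>0 H by (rule height_region_G0)
  let ?S = "\<Omega>e \<epsilon>" and ?W = "\<Omega>0"
  have bas: "(1, 0) \<in> (Basis :: (real \<times> real) set)" "(0, 1) \<in> (Basis :: (real \<times> real) set)"
    "(Basis :: (real \<times> real) set) = {(1, 0), (0, 1)}" by (auto simp: Basis_prod_def)
  have uL: "u0 \<in> Lsq {0<..<1}" using u0 by (simp add: H1_def)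
  have dL: "d \<in> Lsq {0<..<1}" and ud: "has_weak_partial {0<..<1} 1 u0 d"
    unfolding d_def by (rule weak_partial_H1[OF u0]; simp)+
  have uS: "u \<in> Lsq ?S" using u by (simp add: H1_def)
  note p1 = weak_partial_H1[OF u bas(1)] and p2 = weak_partial_H1[OF u bas(2)]
  note ss = region_G0_subset[of \<epsilon>] Z.region_lmeasurable(2) E.region_lmeasurable(2)
  note q1 = Lsq_subset[OF p1(1) ss] has_weak_partial_subset[OF p1(2) ss bas(1)]
    and q2 = Lsq_subset[OF p2(1) ss] has_weak_partial_subset[OF p2(2) ss bas(2)]
    and q0 = Lsq_subset[OF uS ss]
  note uF = Z.Lsq_fst(1)[OF uL] and dF = Z.Lsq_fst(1)[OF dL] and wF = Z.has_weak_partial_compose_fst[OF uL dL ud]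
  have zL: "(\<lambda>z. 0) \<in> Lsq ?W" by (rule Lsq_bounded(1)[OF Z.region_lmeasurable(1)]) auto
  show "u \<in> H1 ?W" unfolding H1_def bas(3) using q0(1) q1(1,3) q2(1,3) by auto
  show "(\<lambda>z. u0 (fst z)) \<in> H1 ?W" unfolding H1_def bas(3) using uF dF zL wF by auto
  let ?y = "\<lambda>z. u z - u0 (fst z)"
  have w1: "has_weak_partial ?W (1, 0) ?y (\<lambda>z. weak_partial ?S (1, 0) u z - d (fst z))"
    by (rule has_weak_partial_diff[OF Z.region_lmeasurable(1) q0(1) uF q1(1) dF bas(1) q1(3) wF(1)])
  have w2: "has_weak_partial ?W (0, 1) ?y (\<lambda>z. weak_partial ?S (0, 1) u z - 0)"
    by (rule has_weak_partial_diff[OF Z.region_lmeasurable(1) q0(1) uF q2(1) zL bas(2) q2(3) wF(2)])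
  note a1 = weak_partial_eq_AE[OF Z.open_region Z.bounded_region Lsq_diff[OF q1(1) dF] w1]
    and a2 = weak_partial_eq_AE[OF Z.open_region Z.bounded_region Lsq_diff[OF q2(1) zL] w2]
  have n0: "Lsq_norm ?W ?y \<le> Lsq_norm ?S ?y"
    by (rule Lsq_subset(2)[OF Lsq_diff[OF uS E.Lsq_fst(1)[OF uL]] ss])
  have \<Omega>0b: "?W \<in> sets borel" using open_region_G0 by simp
  let ?t = "\<lambda>z. weak_partial ?S (1, 0) u z - (if z \<in> ?W then d (fst z) else 0)"
  have tL: "?t \<in> Lsq ?S" by (rule Lsq_diff[OF p1(1) Lsq_restrict(1)[OF E.Lsq_fst(1)[OF dL] \<Omega>0b]])
  have n1: "Lsq_norm ?W (weak_partial ?W (1, 0) ?y) \<le> Lsq_norm ?S ?t"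
  proof -
    have "Lsq_norm ?W (weak_partial ?W (1, 0) ?y) = Lsq_norm ?W (\<lambda>z. weak_partial ?S (1, 0) u z - d (fst z))"
      by (rule Lsq_norm_cong_AE[OF a1(1) Lsq_diff[OF q1(1) dF] a1(2)])
    also have "\<dots> = Lsq_norm ?W ?t"
      unfolding Lsq_norm_def by (intro arg_cong[where f=sqrt] Bochner_Integration.integral_cong) auto
    also have "\<dots> \<le> Lsq_norm ?S ?t" by (rule Lsq_subset(2)[OF tL ss])
    finally show ?thesis .
  qed
  have n2: "Lsq_norm ?W (weak_partial ?W (0, 1) ?y) \<le> Lsq_norm ?S (weak_partial ?S (0, 1) u)"
  proof -
    have "Lsq_norm ?W (weak_partial ?W (0, 1) ?y) = Lsq_norm ?W (\<lambda>z. weak_partial ?S (0, 1) u z - 0)"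
      by (rule Lsq_norm_cong_AE[OF a2(1) Lsq_diff[OF q2(1) zL] a2(2)])
    then show ?thesis using q2(2) by simp
  qed
  have "H1_norm ?W ?y = sqrt ((Lsq_norm ?W ?y)\<^sup>2 + ((Lsq_norm ?W (weak_partial ?W (1, 0) ?y))\<^sup>2 + (Lsq_norm ?W (weak_partial ?W (0, 1) ?y))\<^sup>2))"
    by (simp add: H1_norm_def bas(3))
  also have "\<dots> \<le> Lsq_norm ?W ?y + sqrt ((Lsq_norm ?W (weak_partial ?W (1, 0) ?y))\<^sup>2 + (Lsq_norm ?W (weak_partial ?W (0, 1) ?y))\<^sup>2)"
    using sqrt_add_le_add_sqrt[of "(Lsq_norm ?W ?y)\<^sup>2" "(Lsq_norm ?W (weak_partial ?W (1, 0) ?y))\<^sup>2 + (Lsq_norm ?W (weak_partial ?W (0, 1) ?y))\<^sup>2"] by simp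
  also have "\<dots> \<le> Lsq_norm ?W ?y + (Lsq_norm ?W (weak_partial ?W (1, 0) ?y) + Lsq_norm ?W (weak_partial ?W (0, 1) ?y))"
    using sqrt_add_le_add_sqrt[of "(Lsq_norm ?W (weak_partial ?W (1, 0) ?y))\<^sup>2" "(Lsq_norm ?W (weak_partial ?W (0, 1) ?y))\<^sup>2"] by simp
  finally show "H1_norm ?W ?y \<le> Lsq_norm ?S ?y + Lsq_norm ?S ?t + Lsq_norm ?S (weak_partial ?S (0, 1) u)"
    using n0 n1 n2 by linarith
qed

end

theorem theorem2p1:
  fixes \<alpha> \<epsilon>\<^sub>0 b\<^sub>0 b\<^sub>1 L' L C :: real
    and b l f_hat u\<^sub>0 :: "real \<Rightarrow> real"
    and G :: "real \<Rightarrow> real \<Rightarrow> real"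
    and f u :: "real \<Rightarrow> real \<times> real \<Rightarrow> real"
    and \<Omega> :: "real \<Rightarrow> (real \<times> real) set"
    and \<Omega>\<^sub>0 :: "(real \<times> real) set"
  defines "\<Omega> \<equiv> \<lambda>\<epsilon>. region b (G_eps G \<alpha> \<epsilon>)"
    and "\<Omega>\<^sub>0 \<equiv> region b (G_min G)"
  assumes "\<alpha> > 1" and "\<epsilon>\<^sub>0 > 0"
    and b_pw_C1: "pw_C1 b"
    and b_bounds: "0 < b\<^sub>0" "\<forall>x\<in>{0<..<1}. b\<^sub>0 \<le> b x \<and> b x \<le> b\<^sub>1"
    and G_nonneg: "\<forall>x\<in>{0..1}. \<forall>y. 0 \<le> G x y"
    and G_cont: "\<forall>\<eta>>0. \<exists>\<delta>>0. \<forall>x\<in>{0..1}. \<forall>x'\<in>{0..1}. \<bar>x - x'\<bar> < \<delta> \<longrightarrow>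
                   (\<forall>y. \<bar>G x y - G x' y\<bar> \<le> \<eta>)"
    and G_bounded: "\<exists>M. \<forall>x\<in>{0..1}. \<forall>y. G x y \<le> M"
    and G_periodic: "\<forall>x\<in>{0..1}. \<forall>y. G x (y + l x) = G x y"
    and l_cont: "continuous_on {0..1} l"
    and l_bounds: "0 < L'" "\<forall>x\<in>{0..1}. L' \<le> l x \<and> l x \<le> L"
    and domain: "\<forall>\<epsilon>\<in>{0<..<\<epsilon>\<^sub>0}. open (\<Omega> \<epsilon>) \<and> connected (\<Omega> \<epsilon>)"
    and min_exists: "\<forall>x\<in>{0..1}. \<exists>y. \<forall>z. G x y \<le> G x z"
    and f_L2: "\<forall>\<epsilon>\<in>{0<..<\<epsilon>\<^sub>0}. f \<epsilon> \<in> Lsq (\<Omega> \<epsilon>) \<and> Lsq_norm (\<Omega> \<epsilon>) (f \<epsilon>) \<le> C"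
    and "C > 0"
    and f_hat: "Lsq_weak_tendsto {0<..<1}
                  (\<lambda>\<epsilon>. vertical_integral b (G_eps G \<alpha> \<epsilon>) (f \<epsilon>)) f_hat (at_right 0)"
    and u: "\<forall>\<epsilon>\<in>{0<..<\<epsilon>\<^sub>0}. weak_solution_eps \<epsilon> (\<Omega> \<epsilon>) (f \<epsilon>) (u \<epsilon>)"
    and u0: "weak_solution_limit (\<lambda>x. b x + G_min G x) (mean_height b G l) f_hat u\<^sub>0"
  shows "(\<forall>\<epsilon>\<in>{0<..<\<epsilon>\<^sub>0}. (\<lambda>z. u \<epsilon> z - u\<^sub>0 (fst z)) \<in> Lsq (\<Omega> \<epsilon>))
       \<and> ((\<lambda>\<epsilon>. Lsq_norm (\<Omega> \<epsilon>) (\<lambda>z. u \<epsilon> z - u\<^sub>0 (fst z))) \<longlongrightarrow> 0) (at_right 0)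
       \<and> (\<forall>\<epsilon>\<in>{0<..<\<epsilon>\<^sub>0}. \<Omega>\<^sub>0 \<subseteq> \<Omega> \<epsilon>)
       \<and> H1_tendsto \<Omega>\<^sub>0 u (\<lambda>z. u\<^sub>0 (fst z)) (at_right 0)"
proof -
  obtain M where M: "\<forall>x\<in>{0..1}. \<forall>y. G x y \<le> M" using G_bounded by blast
  interpret thin_domain \<alpha> \<epsilon>\<^sub>0 b\<^sub>0 b\<^sub>1 L' L M b l G
  proof
    show "open (region b (G_eps G \<alpha> \<epsilon>))" if "\<epsilon> \<in> {0<..<\<epsilon>\<^sub>0}" for \<epsilon>
      using domain that by (simp add: \<Omega>_def)
    show "\<exists>\<delta>>0. \<forall>x\<in>{0..1}. \<forall>x'\<in>{0..1}. \<bar>x - x'\<bar> < \<delta> \<longrightarrow> (\<forall>y. \<bar>G x y - G x' y\<bar> \<le> \<eta>)" if "\<eta> > 0" for \<eta>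
      using G_cont that by blast
    show "\<exists>y. \<forall>z. G x y \<le> G x z" if "x \<in> {0..1}" for x using min_exists that by blast
  qed (use assms M in auto)
  have fA: "f \<epsilon> \<in> Lsq (\<Omega>e \<epsilon>) \<and> Lsq_norm (\<Omega>e \<epsilon>) (f \<epsilon>) \<le> C" if "\<epsilon> \<in> {0<..<\<epsilon>\<^sub>0}" for \<epsilon>
    using f_L2 that by (simp add: \<Omega>_def)
  have uA: "weak_solution_eps \<epsilon> (\<Omega>e \<epsilon>) (f \<epsilon>) (u \<epsilon>)" if "\<epsilon> \<in> {0<..<\<epsilon>\<^sub>0}" for \<epsilon>
    using u that by (simp add: \<Omega>_def)
  have uH: "u \<epsilon> \<in> H1 (\<Omega>e \<epsilon>)" if "\<epsilon> \<in> {0<..<\<epsilon>\<^sub>0}" for \<epsilon>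
    using uA[OF that] by (simp add: weak_solution_eps_def)
  have u0H: "u\<^sub>0 \<in> H1 {0<..<1}" using u0 by (simp add: weak_solution_limit_def)
  have u0L: "u\<^sub>0 \<in> Lsq {0<..<1}" using u0H by (simp add: H1_def)
  have conv: "\<forall>\<^sub>F \<epsilon> in at_right 0. Lsq_norm (\<Omega>e \<epsilon>) (\<lambda>z. u \<epsilon> z - u\<^sub>0 (fst z)) \<le> e \<and>
    Lsq_norm (\<Omega>e \<epsilon>) (\<lambda>z. weak_partial (\<Omega>e \<epsilon>) (1, 0) (u \<epsilon>) z - (if z \<in> \<Omega>0 then weak_partial {0<..<1} 1 u\<^sub>0 (fst z) else 0)) \<le> e \<and>
    Lsq_norm (\<Omega>e \<epsilon>) (weak_partial (\<Omega>e \<epsilon>) (0, 1) (u \<epsilon>)) \<le> e" if "e > 0" for e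
    by (rule corrector_convergence[OF _ f_hat _ u0 that]) (erule fA | erule uA)+
  have "(\<lambda>z. u \<epsilon> z - u\<^sub>0 (fst z)) \<in> Lsq (\<Omega>e \<epsilon>)" if e: "\<epsilon> \<in> {0<..<\<epsilon>\<^sub>0}" for \<epsilon>
  proof -
    interpret E: height_region b "Ge \<epsilon>" b\<^sub>0 H by (rule height_region_eps[OF e])
    have "u \<epsilon> \<in> Lsq (\<Omega>e \<epsilon>)" using uH[OF e] by (simp add: H1_def)
    then show ?thesis by (rule Lsq_diff[OF _ E.Lsq_fst(1)[OF u0L]])
  qed
  moreover have "((\<lambda>\<epsilon>. Lsq_norm (\<Omega>e \<epsilon>) (\<lambda>z. u \<epsilon> z - u\<^sub>0 (fst z))) \<longlongrightarrow> 0) (at_right 0)"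
  proof (rule tendstoI)
    fix e :: real assume "e > 0"
    then have "e / 2 > 0" by simp
    from conv[OF this] show "\<forall>\<^sub>F \<epsilon> in at_right 0. dist (Lsq_norm (\<Omega>e \<epsilon>) (\<lambda>z. u \<epsilon> z - u\<^sub>0 (fst z))) 0 < e"
      by eventually_elim (use \<open>e > 0\<close> in \<open>auto simp: dist_real_def\<close>)
  qed
  moreover have "H1_tendsto \<Omega>0 u (\<lambda>z. u\<^sub>0 (fst z)) (at_right 0)"
    unfolding H1_tendsto_def
  proof (intro conjI)
    show "\<forall>\<^sub>F \<epsilon> in at_right 0. u \<epsilon> \<in> H1 \<Omega>0"
      using eventually_eps by eventually_elim (rule H1_norm_on_region_G0_le(1)[OF _ uH u0H])
    show "(\<lambda>z. u\<^sub>0 (fst z)) \<in> H1 \<Omega>0" by (rule H1_norm_on_region_G0_le(2)[OF eps_half uH[OF eps_half] u0H])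
    show "((\<lambda>\<epsilon>. H1_norm \<Omega>0 (\<lambda>z. u \<epsilon> z - u\<^sub>0 (fst z))) \<longlongrightarrow> 0) (at_right 0)"
    proof (rule tendstoI)
      fix e :: real assume "e > 0"
      \<comment> \<open>The H1 norm is bounded by three terms of size at most e / 4, whose sum stays
        strictly below e.\<close>
      then have "e / 4 > 0" by simp
      from conv[OF this] eventually_eps show "\<forall>\<^sub>F \<epsilon> in at_right 0. dist (H1_norm \<Omega>0 (\<lambda>z. u \<epsilon> z - u\<^sub>0 (fst z))) 0 < e"
      proof eventually_elim
        case (elim \<epsilon>)
        have "0 \<le> H1_norm \<Omega>0 (\<lambda>z. u \<epsilon> z - u\<^sub>0 (fst z))"
          unfolding H1_norm_def by (intro real_sqrt_ge_zero add_nonneg_nonneg sum_nonneg) auto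
        then show ?case
          using H1_norm_on_region_G0_le(3)[OF elim(2) uH[OF elim(2)] u0H] elim(1) \<open>e > 0\<close> by (simp add: dist_real_def)
      qed
    qed
  qed
  ultimately show ?thesis unfolding \<Omega>_def \<Omega>\<^sub>0_def using region_G0_subset by blast
qed

end
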